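(* Let $\gamma\ge6$, $p(\rho)=\rho^\gamma$, and let $G\in D_0^{1,\frac{6\gamma}{5\gamma-6}}(\mathbb{R}^3)$. Let $(\rho,\mathbf{u})$ be a weak solution in $\mathbb{R}^3$ of the steady barotropic Navier--Stokes system with pressure $p$ and force potential $G$. If $$\int_{\mathbb{R}^3}\left(\frac12\rho|\mathbf{u}|^2+\frac{1}{\gamma-1}\rho^\gamma\right)dx<\infty,$$ then $\mathbf{u}=0$ a.e. in $\mathbb{R}^3$.
   Context: The system is $\operatorname{div}(\rho\mathbf{u})=0$, $\operatorname{div}(\rho\mathbf{u}\otimes\mathbf{u})+\nabla p(\rho)-\operatorname{div}\mathbb{S}(\nabla\mathbf{u})=\rho\nabla G$ in $\mathbb{R}^3$, where $\mathbb{S}(\nabla\mathbf{u})=\mu\left(\nabla\mathbf{u}+\nabla^t\mathbf{u}-\frac23\operatorname{div}\mathbf{u}\,\mathbb{I}\right)+\eta\operatorname{div}\mathbf{u}\,\mathbb{I}$ with constants $\mu>0$, $\eta\ge0$. Function space: for $1\le q<\infty$, $D_0^{1,q}(\mathbb{R}^3)$ is the completion of $C_c^\infty(\mathbb{R}^3)$ in the norm $\left(\int_{\mathbb{R}^3}|\nabla v|^q\,dx\right)^{1/q}$; $D_0^{1,q}(\mathbb{R}^3;\mathbb{R}^3)$ is the vector-valued version. For matrices, $F:G=\sum_{i,j}F_{ij}G_{ij}$. Weak solution: $(\rho,\mathbf{u})$ is a weak solution if (1) $\rho,\mathbf{u}$ are measurable in $\mathbb{R}^3$ and $\rho\ge0$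 a.e.; (2) $\rho\mathbf{u}\in L^1_{\rm loc}(\mathbb{R}^3;\mathbb{R}^3)$ and $\int_{\mathbb{R}^3}\rho\mathbf{u}\cdot\nabla\phi\,dx=0$ for all $\phi\in C_c^\infty(\mathbb{R}^3)$; (3) $\rho,\ \rho|\mathbf{u}|^2,\ p(\rho),\ \rho\nabla G$ are in $L^1_{\rm loc}(\mathbb{R}^3)$, $\mathbf{u}\in D_0^{1,2}(\mathbb{R}^3;\mathbb{R}^3)$, and $$\int_{\mathbb{R}^3}[\rho\mathbf{u}\otimes\mathbf{u}:\nabla\boldsymbol{\varphi}+p(\rho)\operatorname{div}\boldsymbol{\varphi}]\,dx=\int_{\mathbb{R}^3}\mathbb{S}(\nabla\mathbf{u}):\nabla\boldsymbol{\varphi}\,dx-\int_{\mathbb{R}^3}\rho\nabla G\cdot\boldsymbol{\varphi}\,dx$$ for all $\boldsymbol{\varphi}\in C_c^1(\mathbb{R}^3;\mathbb{R}^3)$. *)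

theory Defs
  imports "HOL-Analysis.Analysis"
begin

primrec Ck_fun :: "nat \<Rightarrow> ('a::euclidean_space \<Rightarrow> 'b::real_normed_vector) \<Rightarrow> bool" where
  "Ck_fun 0 f \<longleftrightarrow> continuous_on UNIV f"
| "Ck_fun (Suc k) f \<longleftrightarrow>
     (\<forall>x. f differentiable at x) \<and> (\<forall>v. Ck_fun k (\<lambda>x. frechet_derivative f (at x) v))"

definition compactly_supported :: "('a::euclidean_space \<Rightarrow> 'b::real_normed_vector) \<Rightarrow> bool" where
  "compactly_supported f \<longleftrightarrow> compact (closure {x. f x \<noteq> 0})"

definition Cc :: "nat \<Rightarrow> ('a::euclidean_space \<Rightarrow> 'b::real_normed_vector) set" where
  "Cc k = {f. Ck_fun k f \<and> compactly_supported f}"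

definition Cc_inf :: "('a::euclidean_space \<Rightarrow> 'b::real_normed_vector) set" where
  "Cc_inf = (\<Inter>k. Cc k)"

definition L1_loc :: "('a::euclidean_space \<Rightarrow> 'b::euclidean_space) set" where
  "L1_loc = {f. \<forall>K. compact K \<longrightarrow> set_integrable lebesgue K f}"

definition grad :: "(real^3 \<Rightarrow> real) \<Rightarrow> real^3 \<Rightarrow> real^3" where
  "grad f x = (\<chi> i. frechet_derivative f (at x) (axis i 1))"

definition divg :: "(real^3 \<Rightarrow> real^3) \<Rightarrow> real^3 \<Rightarrow> real" where
  "divg f x = trace (jacobian f (at x))"

definition has_weak_grad :: "(real^3 \<Rightarrow> real) \<Rightarrow> (real^3 \<Rightarrow> real^3) \<Rightarrow> bool" where
  "has_weak_grad v V \<longleftrightarrow> v \<in> L1_loc \<and> V \<in> L1_loc \<and>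
     (\<forall>\<phi>\<in>Cc_inf. (\<integral>x. v x *\<^sub>R grad \<phi> x \<partial>lebesgue) = - (\<integral>x. \<phi> x *\<^sub>R V x \<partial>lebesgue))"

text \<open>
  A weak gradient is unique up to a null set, so the choice below is immaterial under integrals.
  It is unspecified if there is no weak gradient; this does not occur on the spaces
  \<open>D0 q\<close> below.
\<close>

definition weak_grad :: "(real^3 \<Rightarrow> real) \<Rightarrow> real^3 \<Rightarrow> real^3" where
  "weak_grad v = (SOME V. has_weak_grad v V)"

text \<open>Row \<open>i\<close> is the weak gradient of \<open>u\<^sub>i\<close>, the same index convention as \<^const>\<open>jacobian\<close>.\<close>

definition weak_jacobian :: "(real^3 \<Rightarrow> real^3) \<Rightarrow> real^3 \<Rightarrow> real^3^3" where
  "weak_jacobian u x = (\<chi> i. weak_grad (\<lambda>y. u y $ i) x)"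

text \<open>
  The completion of \<open>C\<^sub>c\<^sup>\<infinity>\<close> in the norm \<open>\<parallel>\<nabla>v\<parallel>\<close> of \<open>L\<^sup>q\<close>, realised as a space of functions:
  for \<open>q < 3\<close> the Sobolev inequality shows that a Cauchy sequence in this norm converges
  in \<open>L\<^sup>s\<close>, \<open>s = 3q/(3 - q)\<close>, hence locally in \<open>L\<^sup>1\<close>, and that an element of the
  completion is determined by its limit.  (For \<open>q \<ge> 3\<close> elements of the completion are only
  determined up to constants.)
\<close>

definition D0 :: "real \<Rightarrow> (real^3 \<Rightarrow> real) set" where
  "D0 q = {v \<in> borel_measurable lebesgue. \<exists>\<phi>. (\<forall>n. \<phi> n \<in> Cc_inf) \<and>
     (\<forall>e>0. \<exists>N::nat. \<forall>m\<ge>N. \<forall>n\<ge>N.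
        (\<integral>\<^sup>+x. ennreal (norm (grad (\<phi> m) x - grad (\<phi> n) x) powr q) \<partial>lebesgue) < ennreal e) \<and>
     (\<forall>K. compact K \<longrightarrow>
        (\<lambda>n. \<integral>\<^sup>+x\<in>K. ennreal \<bar>\<phi> n x - v x\<bar> \<partial>lebesgue) \<longlonglongrightarrow> 0)}"

definition D0_vec :: "real \<Rightarrow> (real^3 \<Rightarrow> real^3) set" where
  "D0_vec q = {u. \<forall>i. (\<lambda>x. u x $ i) \<in> D0 q}"

definition tensor :: "real^3 \<Rightarrow> real^3 \<Rightarrow> real^3^3" where
  "tensor a b = (\<chi> i j. a $ i * b $ j)"

definition stress :: "real \<Rightarrow> real \<Rightarrow> real^3^3 \<Rightarrow> real^3^3" where
  "stress \<mu> \<eta> A = \<mu> *\<^sub>R (A + transpose A - (2 / 3 * trace A) *\<^sub>R mat 1) + (\<eta> * trace A) *\<^sub>R mat 1"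

text \<open>
  On \<^typ>\<open>real^3^3\<close> the inner product is the sum of the products of all entries, so
  \<open>F \<bullet> H\<close> is the contraction \<open>F : H\<close>.
\<close>

definition weak_solution ::
  "real \<Rightarrow> real \<Rightarrow> (real \<Rightarrow> real) \<Rightarrow> (real^3 \<Rightarrow> real) \<Rightarrow> (real^3 \<Rightarrow> real) \<Rightarrow> (real^3 \<Rightarrow> real^3) \<Rightarrow> bool"
where
  "weak_solution \<mu> \<eta> p G \<rho> u \<longleftrightarrow>
     \<rho> \<in> borel_measurable lebesgue \<and> u \<in> borel_measurable lebesgue \<and> (AE x in lebesgue. 0 \<le> \<rho> x) \<and>
     (\<lambda>x. \<rho> x *\<^sub>R u x) \<in> L1_loc \<and>
     (\<forall>\<phi>\<in>Cc_inf. (\<integral>x. (\<rho> x *\<^sub>R u x) \<bullet> grad \<phi> x \<partial>lebesgue) = 0) \<and>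
     \<rho> \<in> L1_loc \<and> (\<lambda>x. \<rho> x * (norm (u x))\<^sup>2) \<in> L1_loc \<and> (\<lambda>x. p (\<rho> x)) \<in> L1_loc \<and>
     (\<lambda>x. \<rho> x *\<^sub>R weak_grad G x) \<in> L1_loc \<and>
     u \<in> D0_vec 2 \<and>
     (\<forall>\<phi>\<in>Cc 1.
        (\<integral>x. (\<rho> x *\<^sub>R tensor (u x) (u x)) \<bullet> jacobian \<phi> (at x) + p (\<rho> x) * divg \<phi> x \<partial>lebesgue)
        = (\<integral>x. stress \<mu> \<eta> (weak_jacobian u x) \<bullet> jacobian \<phi> (at x) \<partial>lebesgue)
          - (\<integral>x. (\<rho> x *\<^sub>R weak_grad G x) \<bullet> \<phi> x \<partial>lebesgue))"

end

theory Submission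
  imports Defs
begin

text \<open>
  The finite energy gives \<open>\<rho> \<in> L\<^sup>\<gamma>\<close> and \<open>\<rho>|u|\<^sup>2 \<in> L\<^sup>1\<close>, and the Sobolev inequality gives \<open>u \<in> L\<^sup>6\<close>; since
  \<open>\<gamma> \<ge> 6\<close>, interpolation puts \<open>\<rho> u \<otimes> u\<close> into \<open>L\<^sup>2\<close> and \<open>\<rho> \<nabla>G\<close> into \<open>L\<close> with exponent \<open>6/5\<close>.  Testing the momentum
  equation with gradients of smoothed Newton potentials of the pressure gives \<open>\<rho>\<^sup>\<gamma> \<in> L\<^sup>2\<close>.  Hence every term of the
  momentum equation is continuous in the test field with respect to the norm of \<open>D\<^sub>0\<^sup>1\<^sup>,\<^sup>2\<close>, and the equation may be
  tested with \<open>u\<close> itself.  There the convective term and the work of the force vanish by the continuity equation, and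
  \<open>\<integral>\<rho>\<^sup>\<gamma> div u = 0\<close> by its renormalized form in the sense of DiPerna and Lions, for which \<open>\<rho> \<in> L\<^sup>4\<close> locally and
  \<open>\<nabla>u \<in> L\<^sup>2\<close> suffice in the commutator estimate.  What remains is \<open>\<mu> \<parallel>\<nabla>u\<parallel>\<^sup>2 + (\<mu>/3 + \<eta>) \<parallel>div u\<parallel>\<^sup>2 = 0\<close>, so \<open>\<nabla>u = 0\<close> and, by
  the Sobolev inequality, \<open>u = 0\<close>.
\<close>

text \<open>The obstacle is integrability. The energy places the pressure only in L^1, while div u
  lies in L^2, so u cannot be a test field before the pressure is known to be square integrable.
  That estimate rests on a Hilbert space identity: for compactly supported fields with symmetric
  gradient the L^2 norms of gradient and divergence agree, so a bound of the integral of p div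
  \<phi> by the norm of grad \<phi>, tested with suitable potentials, is an L^2 bound of p. The
  exponents come from pairing with u in L^6. The bound \<gamma> \<ge> 6 gives \<rho>^6 \<le>
  \<rho>^\<gamma> where \<rho> > 1, and the exponent q = 6\<gamma>/(5\<gamma> - 6) of the force
  satisfies 1/\<gamma> + 1/q = 5/6, the dual exponent of L^6. At infinity only \<rho>|u|^2 and
  \<rho>^\<gamma> are controlled, not \<rho>|u|; this dictates how the renormalizing functions are
  truncated and why a constant is subtracted from them. Elements of \<open>D0\<close> are limits of
  test functions, so identities involving u are proved for approximations and passed to the limit.
  The analysis is carried out for Borel representatives.\<close>

abbreviation nn_lborel :: "('a::euclidean_space \<Rightarrow> real) \<Rightarrow> ennreal" (binder "NNINT " 10) where
  "nn_lborel f \<equiv> \<integral>\<^sup>+x. ennreal (f x) \<partial>lborel"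

section \<open>Differentiable functions of bounded support\<close>

text \<open>The gradient is an explicit second argument, so the rules below compute it and no choice
  of a derivative has to be unfolded.\<close>

definition C1 :: "('a::euclidean_space \<Rightarrow> real) \<Rightarrow> ('a \<Rightarrow> 'a) \<Rightarrow> bool" where
  "C1 f g \<longleftrightarrow> (\<forall>x. (f has_derivative (\<lambda>h. g x \<bullet> h)) (at x)) \<and> continuous_on UNIV g"

text \<open>In a Euclidean space this is compact support (\<open>compactly_supported_iff\<close>),
  in a form that hands out a radius. The polymorphic zero lets one predicate serve functions,
  gradients and kernels.\<close>

definition bsupp :: "('a::real_normed_vector \<Rightarrow> 'b::zero) \<Rightarrow> bool" where
  "bsupp f \<longleftrightarrow> (\<exists>R. \<forall>x. norm x > R \<longrightarrow> f x = 0)"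

definition C1c :: "('a::euclidean_space \<Rightarrow> real) \<Rightarrow> ('a \<Rightarrow> 'a) \<Rightarrow> bool" where
  "C1c f g \<longleftrightarrow> C1 f g \<and> bsupp f"

lemma C1D:
  assumes "C1 f g"
  shows "(f has_derivative (\<lambda>h. g x \<bullet> h)) (at x)" "continuous_on UNIV g" "continuous_on UNIV f"
  using assms unfolding C1_def
  by (auto intro: continuous_at_imp_continuous_on has_derivative_continuous)

lemma C1c_C1: "C1c f g \<Longrightarrow> C1 f g"
  by (simp add: C1c_def)

lemma has_derivative_inner_unique:
  assumes "(f has_derivative (\<lambda>h. g \<bullet> h)) (at x)" "(f has_derivative (\<lambda>h. g' \<bullet> h)) (at x)"
  shows "g = (g' :: 'a::euclidean_space)"
proof -
  have "g \<bullet> h = g' \<bullet> h" for h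
    using has_derivative_unique[OF assms] by metis
  then show ?thesis by (metis inner_commute vector_eq_rdot)
qed

text \<open>The complement of the closed ball is open, so near x the function agrees with 0 and
  derivatives are unique.\<close>

lemma C1_grad_zero_outside:
  fixes f :: "'a::euclidean_space \<Rightarrow> real"
  assumes f: "C1 f g" and z: "\<And>x. norm x > R \<Longrightarrow> f x = 0" and x: "norm x > R"
  shows "g x = 0"
proof -
  have "open {x::'a. norm x > R}" by (intro open_Collect_less continuous_intros)
  moreover have "((\<lambda>_. 0 :: real) has_derivative (\<lambda>h. 0)) (at x)" by simp
  ultimately have "(f has_derivative (\<lambda>h. 0)) (at x)"
    using z x by (elim has_derivative_transform_within_open) auto
  then have "(f has_derivative (\<lambda>h. 0 \<bullet> h)) (at x)" by simp
  then show ?thesis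
    using has_derivative_inner_unique C1D(1)[OF f] by blast
qed

lemma C1c_supp:
  assumes "C1c f g"
  obtains R where "R > 0" "\<And>x. norm x > R \<Longrightarrow> f x = 0" "\<And>x. norm x > R \<Longrightarrow> g x = 0"
proof -
  obtain R where R: "\<And>x. norm x > R \<Longrightarrow> f x = 0"
    using assms by (auto simp: C1c_def bsupp_def)
  have "g x = 0" if "norm x > R" for x
    using C1_grad_zero_outside[OF C1c_C1[OF assms] R that] .
  then show ?thesis using R by (intro that[of "max R 1"]) auto
qed

lemma C1_mult:
  assumes "C1 f g" "C1 f' g'"
  shows "C1 (\<lambda>x. f x * f' x) (\<lambda>x. f x *\<^sub>R g' x + f' x *\<^sub>R g x)"
  unfolding C1_def
proof (intro conjI allI)
  show "((\<lambda>x. f x * f' x) has_derivative (\<bullet>) (f x *\<^sub>R g' x + f' x *\<^sub>R g x)) (at x)" for x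
    by (rule has_derivative_eq_rhs[OF has_derivative_mult[OF C1D(1)[OF assms(1)] C1D(1)[OF assms(2)]]])
      (auto simp: inner_add_left algebra_simps)
  show "continuous_on UNIV (\<lambda>x. f x *\<^sub>R g' x + f' x *\<^sub>R g x)"
    by (intro continuous_intros C1D(2)[OF assms(1)] C1D(2)[OF assms(2)] C1D(3)[OF assms(1)] C1D(3)[OF assms(2)])
qed

lemma C1_add:
  assumes "C1 f g" "C1 f' g'"
  shows "C1 (\<lambda>x. f x + f' x) (\<lambda>x. g x + g' x)"
  unfolding C1_def
  by (auto intro!: continuous_intros C1D(2)[OF assms(1)] C1D(2)[OF assms(2)] has_derivative_eq_rhs[OF has_derivative_add[OF C1D(1)[OF assms(1)] C1D(1)[OF assms(2)]]]
    simp: inner_add_left)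

lemma C1_const: "C1 (\<lambda>x. c) (\<lambda>x. 0)"
  unfolding C1_def by (auto simp: inner_zero_left[abs_def])

lemma C1_scale: "C1 f g \<Longrightarrow> C1 (\<lambda>x. c * f x) (\<lambda>x. c *\<^sub>R g x)"
  using C1_mult[OF C1_const[of c]] by fastforce

lemma C1_compose_real:
  assumes "C1 f g" "\<And>t. (b has_real_derivative b' t) (at t)" "continuous_on UNIV b'"
  shows "C1 (\<lambda>x. b (f x)) (\<lambda>x. b' (f x) *\<^sub>R g x)"
  unfolding C1_def
proof (intro conjI allI)
  show "((\<lambda>x. b (f x)) has_derivative (\<bullet>) (b' (f x) *\<^sub>R g x)) (at x)" for x
    by (rule has_derivative_eq_rhs[OF has_derivative_compose[OF C1D(1)[OF assms(1)]
         assms(2)[unfolded has_field_derivative_def]]]) auto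
  have "continuous_on UNIV (\<lambda>x. b' (f x))"
    by (rule continuous_on_compose2[OF assms(3) C1D(3)[OF assms(1)]]) auto
  then show "continuous_on UNIV (\<lambda>x. b' (f x) *\<^sub>R g x)"
    by (intro continuous_intros C1D(2)[OF assms(1)])
qed

lemma C1_affine:
  assumes "C1 f g"
  shows "C1 (\<lambda>y. f (a + c *\<^sub>R y)) (\<lambda>y. c *\<^sub>R g (a + c *\<^sub>R y))"
  unfolding C1_def
proof (intro conjI allI)
  show "((\<lambda>x. f (a + c *\<^sub>R x)) has_derivative (\<bullet>) (c *\<^sub>R g (a + c *\<^sub>R x))) (at x)" for x
  proof -
    have "((\<lambda>x. a + c *\<^sub>R x) has_derivative (\<lambda>h. c *\<^sub>R h)) (at x)"
      by (auto intro!: derivative_eq_intros)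
    from has_derivative_compose[OF this C1D(1)[OF assms]] show ?thesis
      by (rule has_derivative_eq_rhs) auto
  qed
  show "continuous_on UNIV (\<lambda>x. c *\<^sub>R g (a + c *\<^sub>R x))"
    by (intro continuous_intros continuous_on_compose2[OF C1D(2)[OF assms]]) auto
qed

lemma bsupp_affine:
  assumes "bsupp (f :: 'a::real_normed_vector \<Rightarrow> 'b::zero)" "c \<noteq> 0"
  shows "bsupp (\<lambda>y. f (a + c *\<^sub>R y))"
proof -
  obtain R where R: "\<And>x. norm x > R \<Longrightarrow> f x = 0" using assms(1) by (auto simp: bsupp_def)
  have "f (a + c *\<^sub>R y) = 0" if "norm y > (R + norm a) / \<bar>c\<bar>" for y
  proof (rule R)
    have "norm (c *\<^sub>R y) > R + norm a" using that assms(2) by (simp add: field_simps)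
    moreover have "norm (c *\<^sub>R y) \<le> norm (a + c *\<^sub>R y) + norm a"
      by (metis add.commute add_diff_cancel_left' norm_triangle_ineq4)
    ultimately show "norm (a + c *\<^sub>R y) > R" by linarith
  qed
  then show ?thesis unfolding bsupp_def by blast
qed

lemma C1c_affine: "C1c f g \<Longrightarrow> c \<noteq> 0 \<Longrightarrow> C1c (\<lambda>y. f (a + c *\<^sub>R y)) (\<lambda>y. c *\<^sub>R g (a + c *\<^sub>R y))"
  by (simp add: C1c_def C1_affine bsupp_affine)

lemma C1c_mult_left: "C1c f g \<Longrightarrow> C1 f' g' \<Longrightarrow> C1c (\<lambda>x. f x * f' x) (\<lambda>x. f x *\<^sub>R g' x + f' x *\<^sub>R g x)"
  unfolding C1c_def bsupp_def using C1_mult[of f g f' g'] by (metis mult_zero_left)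

lemma C1c_add: "C1c f g \<Longrightarrow> C1c f' g' \<Longrightarrow> C1c (\<lambda>x. f x + f' x) (\<lambda>x. g x + g' x)"
  using C1_add[of f g f' g'] unfolding C1c_def bsupp_def
  by (metis add_0 max_less_iff_conj)

lemma C1c_scale: "C1c f g \<Longrightarrow> C1c (\<lambda>x. c * f x) (\<lambda>x. c *\<^sub>R g x)"
  using C1_scale unfolding C1c_def bsupp_def by (metis mult_zero_right)

lemma C1c_sum: "finite A \<Longrightarrow> (\<And>i. i \<in> A \<Longrightarrow> C1c (f i) (g i)) \<Longrightarrow> C1c (\<lambda>x. \<Sum>i\<in>A. f i x) (\<lambda>x. \<Sum>i\<in>A. g i x)"
proof (induction A rule: finite_induct)
  case empty
  then show ?case using C1_const[of 0] by (auto simp: C1c_def bsupp_def)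
next
  case (insert x F)
  then show ?case using C1c_add[of "f x" "g x"] by simp
qed

text \<open>Bound and support are packed into one integrable majorant, the shape that dominated
  convergence asks for.\<close>

lemma bsupp_bound:
  fixes f :: "'a::euclidean_space \<Rightarrow> 'b::real_normed_vector"
  assumes "continuous_on UNIV f" "bsupp f"
  obtains B R where "B > 0" "R > 0" "\<And>x. norm (f x) \<le> B * indicator (cball 0 R) x"
proof -
  obtain R where R: "\<And>x. norm x > R \<Longrightarrow> f x = 0" using assms(2) by (auto simp: bsupp_def)
  define R' where "R' = max R 1"
  have "compact (f ` cball 0 R')"
    by (intro compact_continuous_image continuous_on_subset[OF assms(1)]) auto
  then have "bounded (f ` cball 0 R')" by (rule compact_imp_bounded)
  then obtain B where B: "B > 0" "\<And>x. x \<in> cball 0 R' \<Longrightarrow> norm (f x) \<le> B"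
    unfolding bounded_pos by blast
  have "norm (f x) \<le> B * indicator (cball 0 R') x" for x
    using B R[of x] by (cases "x \<in> cball 0 R'") (auto simp: R'_def)
  then show ?thesis using B(1) by (intro that[of B R']) (auto simp: R'_def)
qed

lemma bsupp_C1c:
  assumes a: "C1c f g"
  shows "bsupp f" "bsupp g"
proof -
  obtain R where "\<And>x. norm x > R \<Longrightarrow> f x = 0" "\<And>x. norm x > R \<Longrightarrow> g x = 0"
    using C1c_supp[OF a] by metis
  then show "bsupp f" "bsupp g" unfolding bsupp_def by blast+
qed

lemma integrable_indicator_cball: "integrable lborel (\<lambda>x. c * indicator (cball a R) x :: real)" for a :: "'a::euclidean_space"
  by (intro integrable_mult_right integrable_real_indicator)
     (use emeasure_lborel_cball_finite[of a R] in auto)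

lemma integrable_bsupp:
  fixes f :: "'a::euclidean_space \<Rightarrow> 'b::euclidean_space"
  assumes "continuous_on UNIV f" "bsupp f"
  shows "integrable lborel f"
proof -
  obtain B R where B: "B > 0" "R > 0" "\<And>x. norm (f x) \<le> B * indicator (cball 0 R) x"
    using bsupp_bound[OF assms] by metis
  show ?thesis
    by (rule Bochner_Integration.integrable_bound[OF integrable_indicator_cball[of B 0 R]])
      (use B assms(1) in \<open>auto intro!: borel_measurable_continuous_onI\<close>)
qed

text \<open>Compactness handles the ball of radius R + 1. If two points closer than 1 are not both
  in it, both lie outside the ball of radius R, where f is 0. The bound \<open>d \<le> 1\<close>
  lets \<open>C1_conv\<close> work in one fixed ball.\<close>

lemma uniformly_continuous_bsupp:
  fixes f :: "'a::euclidean_space \<Rightarrow> 'b::real_normed_vector"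
  assumes "continuous_on UNIV f" "bsupp f" "e > 0"
  obtains d where "d > 0" "d \<le> 1" "\<And>x y. norm (x - y) < d \<Longrightarrow> norm (f x - f y) < e"
proof -
  obtain R where R: "\<And>x. norm x > R \<Longrightarrow> f x = 0" using assms(2) by (auto simp: bsupp_def)
  have "uniformly_continuous_on (cball 0 (R + 1)) f"
    by (intro compact_uniformly_continuous continuous_on_subset[OF assms(1)]) auto
  then obtain d where d: "d > 0" "\<And>x y. x \<in> cball 0 (R+1) \<Longrightarrow> y \<in> cball 0 (R+1) \<Longrightarrow> dist x y < d \<Longrightarrow> dist (f x) (f y) < e"
    using \<open>e > 0\<close> unfolding uniformly_continuous_on_def by (metis dist_commute)
  have "norm (f x - f y) < e" if "norm (x - y) < min d 1" for x y
  proof (cases "x \<in> cball 0 (R+1) \<and> y \<in> cball 0 (R+1)")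
    case True
    then show ?thesis using d(2)[of x y] that by (auto simp: dist_norm)
  next
    case False
    then have "norm x > R + 1 \<or> norm y > R + 1" by auto
    moreover have "norm x \<le> norm y + norm (x - y)" "norm y \<le> norm x + norm (x - y)"
      by (metis norm_triangle_sub add.commute, metis norm_triangle_sub norm_minus_commute add.commute)
    ultimately have "norm x > R" "norm y > R" using that by auto
    then show ?thesis using R assms(3) by simp
  qed
  then show ?thesis using d(1) by (intro that[of "min d 1"]) auto
qed

lemma C1c_lipschitz:
  assumes "C1c f g"
  obtains L where "L > 0" "\<And>x y. \<bar>f x - f y\<bar> \<le> L * norm (x - y)"
proof -
  obtain B R where B: "B > 0" "\<And>x. norm (g x) \<le> B * indicator (cball 0 R) x"
    using bsupp_bound[OF C1D(2)[OF C1c_C1[OF assms]] bsupp_C1c(2)[OF assms]] by metis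
  have gB: "norm (g x) \<le> B" for x using B(2)[of x] B(1) by (cases "norm x \<le> R") auto
  have "norm (f x - f y) \<le> B * norm (x - y)" for x y
  proof (rule differentiable_bound[of UNIV f "\<lambda>x h. g x \<bullet> h"])
    show "(f has_derivative (\<bullet>) (g x)) (at x within UNIV)" for x
      using C1D(1)[OF C1c_C1[OF assms]] by simp
    show "onorm ((\<bullet>) (g x)) \<le> B" for x
    proof (rule onorm_bound)
      show "norm (g x \<bullet> h) \<le> B * norm h" for h
        by (metis Cauchy_Schwarz_ineq2 gB dual_order.trans mult_right_mono norm_ge_zero real_norm_def)
    qed (use B(1) in auto)
  qed auto
  then show ?thesis using B(1) that by (metis real_norm_def)
qed

section \<open>Affine changes of variables and integration by parts\<close>

lemma lborel_nn_integral_translate: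
  fixes f :: "'a::euclidean_space \<Rightarrow> ennreal"
  assumes [measurable]: "f \<in> borel_measurable borel"
  shows "(\<integral>\<^sup>+x. f (x + c) \<partial>lborel) = (\<integral>\<^sup>+x. f x \<partial>lborel)"
proof -
  have "(\<integral>\<^sup>+x. f x \<partial>lborel) = (\<integral>\<^sup>+x. f x \<partial>distr lborel borel ((+) c))"
    by (simp add: lborel_distr_plus)
  also have "\<dots> = (\<integral>\<^sup>+x. f (c + x) \<partial>lborel)"
    by (subst nn_integral_distr) auto
  finally show ?thesis by (simp add: add.commute)
qed

lemma lborel_nn_integral_affine:
  fixes f :: "'a::euclidean_space \<Rightarrow> ennreal"
  assumes [measurable]: "f \<in> borel_measurable borel" and "c \<noteq> 0"
  shows "(\<integral>\<^sup>+x. f x \<partial>lborel) = ennreal (\<bar>c\<bar> ^ DIM('a)) * (\<integral>\<^sup>+x. f (t + c *\<^sub>R x) \<partial>lborel)"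
  by (subst lborel_affine[OF assms(2), of t])
     (simp add: nn_integral_density nn_integral_distr nn_integral_cmult)

lemma lborel_nn_integral_reflect:
  fixes f :: "'a::euclidean_space \<Rightarrow> ennreal"
  assumes [measurable]: "f \<in> borel_measurable borel"
  shows "(\<integral>\<^sup>+x. f (t - x) \<partial>lborel) = (\<integral>\<^sup>+x. f x \<partial>lborel)"
  using lborel_nn_integral_affine[OF assms, of "-1" t] by simp

lemma lborel_integral_affine:
  fixes f :: "'a::euclidean_space \<Rightarrow> 'b::{banach, second_countable_topology}"
  assumes [measurable]: "f \<in> borel_measurable borel" and "c \<noteq> 0"
  shows "(LBINT x. f x) = \<bar>c\<bar> ^ DIM('a) *\<^sub>R (LBINT x. f (t + c *\<^sub>R x))"
  by (subst lborel_affine[OF assms(2), of t])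
     (simp add: integral_density integral_distr)

lemma lborel_integrable_affine:
  fixes f :: "'a::euclidean_space \<Rightarrow> 'b::{banach, second_countable_topology}"
  assumes "integrable lborel f" and "c \<noteq> 0"
  shows "integrable lborel (\<lambda>x. f (t + c *\<^sub>R x))"
proof -
  have [measurable]: "f \<in> borel_measurable borel" using assms(1) by auto
  have "integrable (density (distr lborel borel (\<lambda>x. t + c *\<^sub>R x)) (\<lambda>_. ennreal (\<bar>c\<bar> ^ DIM('a)))) f"
    using assms(1) lborel_affine[OF assms(2), of t] by simp
  then have "integrable lborel (\<lambda>x. \<bar>c\<bar> ^ DIM('a) *\<^sub>R f (t + c *\<^sub>R x))"
    by (simp add: integrable_density integrable_distr_eq)
  then have "integrable lborel (\<lambda>x. inverse (\<bar>c\<bar> ^ DIM('a)) *\<^sub>R (\<bar>c\<bar> ^ DIM('a) *\<^sub>R f (t + c *\<^sub>R x)))"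
    by (rule integrable_scaleR_right)
  then show ?thesis using assms(2) by simp
qed

lemma lborel_integral_reflect:
  fixes f :: "'a::euclidean_space \<Rightarrow> 'b::{banach, second_countable_topology}"
  assumes [measurable]: "f \<in> borel_measurable borel"
  shows "(LBINT x. f (t - x)) = (LBINT x. f x)"
  using lborel_integral_affine[OF assms, of "-1" t] by simp

lemma lborel_integral_translate:
  fixes f :: "'a::euclidean_space \<Rightarrow> 'b::{banach, second_countable_topology}"
  assumes [measurable]: "f \<in> borel_measurable borel"
  shows "(LBINT x. f (x + t)) = (LBINT x. f x)"
  using lborel_integral_affine[OF assms, of "1" t] by (simp add: add.commute)

text \<open>Differentiating the translation invariance of the integral of \<open>f\<close>.\<close>

lemma integral_C1c_grad:
  assumes "C1c f g"
  shows "(LBINT x. g x) = 0"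
proof -
  have fc: "continuous_on UNIV f" and gc: "continuous_on UNIV g" using C1D[OF C1c_C1[OF assms]] by auto
  have intf: "integrable lborel f" and intg: "integrable lborel g"
    using integrable_bsupp[OF fc bsupp_C1c(1)[OF assms]] integrable_bsupp[OF gc bsupp_C1c(2)[OF assms]] by simp_all
  obtain L where L: "L > 0" "\<And>x y. \<bar>f x - f y\<bar> \<le> L * norm (x - y)" using C1c_lipschitz[OF assms] by metis
  obtain R where R: "R > 0" "\<And>x. norm x > R \<Longrightarrow> f x = 0" using C1c_supp[OF assms] by metis
  have [measurable]: "f \<in> borel_measurable borel" "g \<in> borel_measurable borel"
    using fc gc by (auto intro!: borel_measurable_continuous_onI)
  have "(LBINT x. g x \<bullet> b) = 0" if b: "b \<in> Basis" for b
  proof -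
    define t where "t n = 1 / real (Suc n)" for n
    define q where "q n x = (f (x + t n *\<^sub>R b) - f x) / t n" for n x
    have tpos: "t n > 0" "t n \<le> 1" for n by (auto simp: t_def)
    have int0: "(LBINT x. q n x) = 0" for n
    proof -
      have i2: "integrable lborel (\<lambda>x. f (x + t n *\<^sub>R b))"
        using lborel_integrable_affine[OF intf, of 1 "t n *\<^sub>R b"] by (simp add: add.commute)
      show ?thesis unfolding q_def using i2 intf
        by (simp add: lborel_integral_translate)
    qed
    \<comment> \<open>Since \<open>t n\<close> is at most 1, all difference quotients vanish outside
      the ball of radius R + 1, and the Lipschitz constant bounds them inside.\<close>
    have "(\<lambda>n. LBINT x. q n x) \<longlonglongrightarrow> (LBINT x. g x \<bullet> b)"
    proof (rule integral_dominated_convergence[where w="\<lambda>x. L * indicator (cball 0 (R+1)) x"])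
      show "AE x in lborel. (\<lambda>n. q n x) \<longlonglongrightarrow> g x \<bullet> b"
      proof (rule AE_I2)
        fix x
        have "((\<lambda>s. x + s *\<^sub>R b) has_derivative (\<lambda>s. s *\<^sub>R b)) (at 0)"
          by (auto intro!: derivative_eq_intros)
        from has_derivative_compose[OF this, of f "\<lambda>h. g x \<bullet> h"]
        have "((\<lambda>s. f (x + s *\<^sub>R b)) has_derivative (\<lambda>s. s * (g x \<bullet> b))) (at 0)"
          using C1D(1)[OF C1c_C1[OF assms], of x] by simp
        then have "((\<lambda>s. f (x + s *\<^sub>R b)) has_real_derivative (g x \<bullet> b)) (at 0)"
          by (simp add: has_field_derivative_def mult_commute_abs)
        then have "((\<lambda>s. (f (x + s *\<^sub>R b) - f x) / s) \<longlongrightarrow> g x \<bullet> b) (at 0)"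
          by (simp add: DERIV_def)
        moreover have "filterlim t (at 0) sequentially"
        proof -
          have "t \<longlonglongrightarrow> 0" using LIMSEQ_inverse_real_of_nat by (simp add: t_def[abs_def] inverse_eq_divide)
          moreover have "t n \<noteq> 0" for n using tpos(1)[of n] by simp
          ultimately show ?thesis unfolding filterlim_at by simp
        qed
        ultimately show "(\<lambda>n. q n x) \<longlonglongrightarrow> g x \<bullet> b"
          unfolding q_def by (rule filterlim_compose)
      qed
      show "AE x in lborel. norm (q n x) \<le> L * indicator (cball 0 (R+1)) x" for n
      proof (rule AE_I2)
        fix x
        show "norm (q n x) \<le> L * indicator (cball 0 (R+1)) x"
        proof (cases "x \<in> cball 0 (R+1)")
          case True
          have "\<bar>f (x + t n *\<^sub>R b) - f x\<bar> \<le> L * t n"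
            using L(2)[of "x + t n *\<^sub>R b" x] b tpos[of n] by simp
          then show ?thesis using True tpos[of n] by (simp add: q_def field_simps)
        next
          case False
          then have "norm x > R + 1" by auto
          moreover have "norm x \<le> norm (x + t n *\<^sub>R b) + t n"
            using norm_triangle_ineq4[of "x + t n *\<^sub>R b" "t n *\<^sub>R b"] b tpos[of n] by simp
          ultimately have "norm (x + t n *\<^sub>R b) > R" "norm x > R" using tpos[of n] by auto
          then show ?thesis using R(2) False by (simp add: q_def)
        qed
      qed
    qed (use integrable_indicator_cball[of L 0 "R+1"] in \<open>simp_all add: q_def\<close>)
    with int0 show ?thesis by (simp add: LIMSEQ_const_iff)
  qed
  moreover have "(LBINT x. g x) \<bullet> b = (LBINT x. g x \<bullet> b)" for b
    using integral_inner_left[of b, OF intg] by simp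
  ultimately show ?thesis by (intro euclidean_eqI[where 'a='a]) simp
qed

lemma integral_by_parts:
  assumes "C1c f g" "C1 f' g'"
  shows "(LBINT x. f x *\<^sub>R g' x) = - (LBINT x. f' x *\<^sub>R g x)"
proof -
  have c: "continuous_on UNIV f" "continuous_on UNIV g" "continuous_on UNIV f'" "continuous_on UNIV g'"
    using C1D[OF C1c_C1[OF assms(1)]] C1D[OF assms(2)] by simp_all
  have b: "bsupp (\<lambda>x. f x *\<^sub>R g' x)" "bsupp (\<lambda>x. f' x *\<^sub>R g x)"
    using bsupp_C1c[OF assms(1)] unfolding bsupp_def by auto
  have "integrable lborel (\<lambda>x. f x *\<^sub>R g' x)" "integrable lborel (\<lambda>x. f' x *\<^sub>R g x)"
    using integrable_bsupp[OF continuous_on_scaleR[OF c(1,4)] b(1)]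
      integrable_bsupp[OF continuous_on_scaleR[OF c(3,2)] b(2)] by simp_all
  then show ?thesis
    using integral_C1c_grad[OF C1c_mult_left[OF assms]] by (simp add: eq_neg_iff_add_eq_0)
qed

section \<open>Convolution\<close>

lemma ennreal_tendsto_0I:
  fixes f :: "'a \<Rightarrow> ennreal"
  assumes "\<And>e::real. e > 0 \<Longrightarrow> eventually (\<lambda>x. f x \<le> ennreal e) F"
  shows "(f \<longlongrightarrow> 0) F"
proof (rule order_tendstoI)
  fix a :: ennreal
  assume "0 < a"
  then obtain r where r: "0 < r" "r < a" using dense by blast
  then obtain e where e: "r = ennreal e" "e > 0" by (cases r) auto
  show "eventually (\<lambda>x. f x < a) F"
    using assms[OF e(2)] by eventually_elim (use r e in auto)
qed auto

lemma ennreal_tendsto_0D: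
  fixes f :: "'a \<Rightarrow> ennreal"
  assumes "(f \<longlongrightarrow> 0) F" "e > 0"
  shows "eventually (\<lambda>x. f x \<le> ennreal e) F"
  using order_tendstoD(2)[OF assms(1), of "ennreal e"] assms(2)
  by (auto elim!: eventually_mono)

text \<open>The Borel counterpart of \<open>L1_loc\<close>: Borel functions and
  \<open>lborel\<close> are what Tonelli's theorem and the measurability prover work with.
  \<open>L1_loc_locint\<close> and \<open>locint_L1_loc\<close> translate between the two.\<close>

definition locint :: "('a::euclidean_space \<Rightarrow> 'b::euclidean_space) \<Rightarrow> bool" where
  "locint f \<longleftrightarrow> f \<in> borel_measurable borel \<and> (\<forall>R. integrable lborel (\<lambda>x. indicator (cball 0 R) x *\<^sub>R f x))"

text \<open>The kernel may be vector valued, so the same notion covers the gradient of a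
  convolution, which is the convolution with the gradient of the kernel
  (\<open>C1_conv\<close>).\<close>

definition conv :: "('a::euclidean_space \<Rightarrow> 'b::euclidean_space) \<Rightarrow> ('a \<Rightarrow> real) \<Rightarrow> 'a \<Rightarrow> 'b" where
  "conv \<kappa> f x = (LBINT y. f y *\<^sub>R \<kappa> (x - y))"

lemma locint_measurable[measurable_dest]: "locint f \<Longrightarrow> f \<in> borel_measurable borel"
  by (simp add: locint_def)

lemma integrable_imp_locint:
  assumes "integrable lborel f" shows "locint f"
  unfolding locint_def using assms
  by (auto intro!: Bochner_Integration.integrable_bound[OF assms] simp: indicator_def)

lemma locint_inner:
  assumes "locint f" shows "locint (\<lambda>x. f x \<bullet> b)"
proof -
  have [measurable]: "f \<in> borel_measurable borel" using assms by (rule locint_measurable)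
  have "integrable lborel (\<lambda>x. (indicat_real (cball 0 R) x *\<^sub>R f x) \<bullet> b)" for R
    using assms unfolding locint_def by (intro integrable_inner_left) auto
  then show ?thesis unfolding locint_def by auto
qed

lemma locint_truncate:
  assumes "locint f"
  shows "integrable lborel (\<lambda>x. indicator (cball 0 R) x *\<^sub>R f x)"
  using assms by (simp add: locint_def)

lemma locint_mult_bounded:
  fixes f :: "'a::euclidean_space \<Rightarrow> 'b::euclidean_space" and g :: "'a \<Rightarrow> real"
  assumes "locint f" "g \<in> borel_measurable borel" "\<And>x. \<bar>g x\<bar> \<le> B * indicator (cball 0 R) x"
  shows "integrable lborel (\<lambda>x. g x *\<^sub>R f x)"
proof (rule Bochner_Integration.integrable_bound)
  show "integrable lborel (\<lambda>x. B *\<^sub>R (indicator (cball 0 R) x *\<^sub>R f x))"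
    using locint_truncate[OF assms(1)] by (intro integrable_scaleR_right)
  show "(\<lambda>x. g x *\<^sub>R f x) \<in> borel_measurable lborel"
    using assms(1,2) by (auto dest: locint_measurable)
  show "AE x in lborel. norm (g x *\<^sub>R f x) \<le> norm (B *\<^sub>R indicat_real (cball 0 R) x *\<^sub>R f x)"
  proof (rule AE_I2)
    fix x
    have "norm (g x *\<^sub>R f x) = \<bar>g x\<bar> * norm (f x)" by simp
    also have "\<dots> \<le> (B * indicator (cball 0 R) x) * norm (f x)"
      by (intro mult_right_mono assms) auto
    also have "\<dots> \<le> \<bar>B * indicator (cball 0 R) x\<bar> * norm (f x)"
      by (intro mult_right_mono) auto
    finally show "norm (g x *\<^sub>R f x) \<le> norm (B *\<^sub>R indicat_real (cball 0 R) x *\<^sub>R f x)"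
      by (simp add: abs_mult)
  qed
qed

lemma locint_mult_bsupp:
  fixes f :: "'a::euclidean_space \<Rightarrow> 'b::euclidean_space" and g :: "'a \<Rightarrow> real"
  assumes "locint f" "continuous_on UNIV g" "bsupp g"
  shows "integrable lborel (\<lambda>x. g x *\<^sub>R f x)"
proof -
  obtain B R where "B > 0" "R > 0" "\<And>x. norm (g x) \<le> B * indicator (cball 0 R) x"
    using bsupp_bound[OF assms(2,3)] by metis
  then show ?thesis
    using locint_mult_bounded[OF assms(1), of g B R] assms(2)
    by (auto intro: borel_measurable_continuous_onI)
qed

text \<open>A majorant in y that is uniform for x in a ball of radius r. It dominates the
  convolution integrals in \<open>conv_integrable\<close> and
  \<open>conv_continuous\<close>.\<close>

lemma kernel_bound:
  fixes \<kappa> :: "'a::euclidean_space \<Rightarrow> 'b::euclidean_space"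
  assumes "\<And>x. norm (\<kappa> x) \<le> B * indicator (cball 0 R) x" "B > 0" "norm x \<le> r"
  shows "norm (\<kappa> (x - y)) \<le> B * indicator (cball 0 (R + r)) y"
proof (cases "y \<in> cball 0 (R + r)")
  case True
  have "norm (\<kappa> (x - y)) \<le> B * indicator (cball 0 R) (x - y)" by (rule assms)
  also have "\<dots> \<le> B" using assms(2) by (auto simp: indicator_def)
  finally show ?thesis using True by simp
next
  case False
  have "norm y \<le> norm x + norm (x - y)" by (metis norm_minus_commute norm_triangle_sub)
  then have "norm (x - y) > R" using False assms(3) by auto
  then show ?thesis using assms(1)[of "x - y"] False by simp
qed

lemma conv_integrable:
  fixes \<kappa> :: "'a::euclidean_space \<Rightarrow> 'b::euclidean_space"
  assumes "continuous_on UNIV \<kappa>" "bsupp \<kappa>" "locint f"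
  shows "integrable lborel (\<lambda>y. f y *\<^sub>R \<kappa> (x - y))"
proof -
  obtain B R where B: "B > 0" "R > 0" "\<And>x. norm (\<kappa> x) \<le> B * indicator (cball 0 R) x"
    using bsupp_bound[OF assms(1,2)] by metis
  have m: "\<kappa> \<in> borel_measurable borel" using assms(1) by (rule borel_measurable_continuous_onI)
  have [measurable]: "f \<in> borel_measurable borel" using assms(3) by (rule locint_measurable)
  show ?thesis
  proof (rule Bochner_Integration.integrable_bound)
    show "integrable lborel (\<lambda>y. B * (indicator (cball 0 (R + norm x)) y *\<^sub>R f y))"
      using locint_truncate[OF assms(3)] by (rule integrable_mult_right)
    show "(\<lambda>y. f y *\<^sub>R \<kappa> (x - y)) \<in> borel_measurable lborel" using m by measurable
    show "AE y in lborel. norm (f y *\<^sub>R \<kappa> (x - y)) \<le> norm (B * (indicator (cball 0 (R + norm x)) y *\<^sub>R f y))"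
    proof (rule AE_I2)
      fix y
      have "norm (f y *\<^sub>R \<kappa> (x - y)) = \<bar>f y\<bar> * norm (\<kappa> (x - y))" by simp
      also have "\<dots> \<le> \<bar>f y\<bar> * (B * indicator (cball 0 (R + norm x)) y)"
        by (intro mult_left_mono kernel_bound[OF B(3,1)]) auto
      finally show "norm (f y *\<^sub>R \<kappa> (x - y)) \<le> norm (B * (indicator (cball 0 (R + norm x)) y *\<^sub>R f y))"
        using B(1) by (simp add: abs_mult mult_ac)
    qed
  qed
qed

lemma conv_inner:
  fixes \<kappa> :: "'a::euclidean_space \<Rightarrow> 'b::euclidean_space"
  assumes "continuous_on UNIV \<kappa>" "bsupp \<kappa>" "locint f"
  shows "conv \<kappa> f x \<bullet> b = conv (\<lambda>z. \<kappa> z \<bullet> b) f x"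
  unfolding conv_def
  using integral_inner_left[OF conv_integrable[OF assms, of x]] by simp

lemma conv_reflect:
  assumes "\<kappa> \<in> borel_measurable borel" "f \<in> borel_measurable borel"
  shows "conv \<kappa> f x = (LBINT h. f (x - h) *\<^sub>R \<kappa> h)"
proof -
  have [measurable]: "\<kappa> \<in> borel_measurable borel" "f \<in> borel_measurable borel" using assms by auto
  show ?thesis unfolding conv_def
    by (subst lborel_integral_reflect[of _ x, symmetric]) auto
qed

lemma conv_bsupp:
  assumes "bsupp \<kappa>" "bsupp f"
  shows "bsupp (conv \<kappa> f)"
proof -
  obtain R R' where R: "\<And>x. norm x > R \<Longrightarrow> \<kappa> x = 0" "\<And>x. norm x > R' \<Longrightarrow> f x = 0"
    using assms by (auto simp: bsupp_def)
  have "conv \<kappa> f x = 0" if "norm x > R + R'" for x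
  proof -
    have "f y *\<^sub>R \<kappa> (x - y) = 0" for y
    proof (cases "norm y > R'")
      case False
      have "norm x \<le> norm y + norm (x - y)" by (rule norm_triangle_sub)
      then show ?thesis using False that R(1)[of "x - y"] by auto
    qed (use R in auto)
    then have "(\<lambda>y. f y *\<^sub>R \<kappa> (x - y)) = (\<lambda>_. 0)" by (rule ext)
    then show ?thesis by (simp add: conv_def)
  qed
  then show ?thesis unfolding bsupp_def by blast
qed

lemma conv_continuous:
  fixes \<kappa> :: "'a::euclidean_space \<Rightarrow> 'b::euclidean_space"
  assumes "continuous_on UNIV \<kappa>" "bsupp \<kappa>" "locint f"
  shows "continuous_on UNIV (conv \<kappa> f)"
proof -
  obtain B R where B: "B > 0" "R > 0" "\<And>x. norm (\<kappa> x) \<le> B * indicator (cball 0 R) x"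
    using bsupp_bound[OF assms(1,2)] by metis
  have m[measurable]: "\<kappa> \<in> borel_measurable borel" using assms(1) by (rule borel_measurable_continuous_onI)
  have [measurable]: "f \<in> borel_measurable borel" using assms(3) by (rule locint_measurable)
  show ?thesis unfolding continuous_on_sequentially
  proof (intro ballI allI impI, elim conjE)
    fix X :: "nat \<Rightarrow> 'a" and a assume X: "X \<longlonglongrightarrow> a"
    obtain r where r: "\<And>n. norm (X n) \<le> r"
      using convergent_imp_Bseq[of X] X by (auto simp: convergent_def Bseq_def)
    have "(\<lambda>n. conv \<kappa> f (X n)) \<longlonglongrightarrow> conv \<kappa> f a"
      unfolding conv_def
    proof (rule integral_dominated_convergence[where w="\<lambda>y. norm (B * (indicator (cball 0 (R + r)) y *\<^sub>R f y))"])
      show "integrable lborel (\<lambda>y. norm (B * (indicator (cball 0 (R + r)) y *\<^sub>R f y)))"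
        using locint_truncate[OF assms(3), of "R + r"] by (intro integrable_norm integrable_mult_right)
      show "AE y in lborel. (\<lambda>n. f y *\<^sub>R \<kappa> (X n - y)) \<longlonglongrightarrow> f y *\<^sub>R \<kappa> (a - y)"
      proof (rule AE_I2)
        fix y
        have "(\<lambda>n. X n - y) \<longlonglongrightarrow> a - y" by (intro tendsto_intros X)
        then have "(\<lambda>n. \<kappa> (X n - y)) \<longlonglongrightarrow> \<kappa> (a - y)"
          by (rule continuous_on_tendsto_compose[OF assms(1)]) auto
        then show "(\<lambda>n. f y *\<^sub>R \<kappa> (X n - y)) \<longlonglongrightarrow> f y *\<^sub>R \<kappa> (a - y)" by (intro tendsto_intros)
      qed
      show "AE y in lborel. norm (f y *\<^sub>R \<kappa> (X n - y)) \<le> norm (B * (indicator (cball 0 (R + r)) y *\<^sub>R f y))" for n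
      proof (rule AE_I2)
        fix y
        have "norm (f y *\<^sub>R \<kappa> (X n - y)) = \<bar>f y\<bar> * norm (\<kappa> (X n - y))" by simp
        also have "\<dots> \<le> \<bar>f y\<bar> * (B * indicator (cball 0 (R + r)) y)"
          by (intro mult_left_mono kernel_bound[OF B(3,1) r]) auto
        finally show "norm (f y *\<^sub>R \<kappa> (X n - y)) \<le> norm (B * (indicator (cball 0 (R + r)) y *\<^sub>R f y))"
          using B(1) by (simp add: abs_mult mult_ac)
      qed
    qed (use m in \<open>measurable\<close>)
    then show "(conv \<kappa> f \<circ> X) \<longlonglongrightarrow> conv \<kappa> f a" by (simp add: o_def)
  qed
qed

lemma integral_abs_le_integral:
  fixes f g :: "'a \<Rightarrow> real"
  assumes "integrable M g" "\<And>x. \<bar>f x\<bar> \<le> g x"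
  shows "\<bar>\<integral>x. f x \<partial>M\<bar> \<le> (\<integral>x. g x \<partial>M)"
proof -
  have g: "0 \<le> g x" for x using assms(2)[of x] by linarith
  \<comment> \<open>The Bochner integral of a function that is not integrable is 0, which settles
    the second case.\<close>
  show ?thesis
  proof (cases "integrable M f")
    case True
    have "\<bar>\<integral>x. f x \<partial>M\<bar> \<le> (\<integral>x. \<bar>f x\<bar> \<partial>M)" by (rule integral_abs_bound)
    also have "\<dots> \<le> (\<integral>x. g x \<partial>M)" using True assms by (intro integral_mono) auto
    finally show ?thesis .
  qed (simp add: not_integrable_integral_eq g integral_nonneg_AE)
qed

text \<open>A direct epsilon argument for differentiation under the integral. By the mean value
  inequality and the uniform continuity of \<open>d\<kappa>\<close>, the linearization error of
  \<kappa> is at most e/N times the length of the increment, uniformly in y, and it vanishes for y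
  outside a fixed ball, on which the integral of |f| is less than N.\<close>

lemma C1_conv:
  fixes \<kappa> :: "'a::euclidean_space \<Rightarrow> real"
  assumes \<kappa>: "C1c \<kappa> d\<kappa>" and f: "locint f"
  shows "C1 (conv \<kappa> f) (conv d\<kappa> f)"
  unfolding C1_def
proof (intro conjI allI)
  have c: "continuous_on UNIV \<kappa>" "continuous_on UNIV d\<kappa>"
    using C1D[OF C1c_C1[OF \<kappa>]] by simp_all
  note b = bsupp_C1c[OF \<kappa>]
  show "continuous_on UNIV (conv d\<kappa> f)" by (rule conv_continuous[OF c(2) b(2) f])
  obtain R where R: "R > 0" "\<And>x. norm x > R \<Longrightarrow> \<kappa> x = 0" "\<And>x. norm x > R \<Longrightarrow> d\<kappa> x = 0"
    using C1c_supp[OF \<kappa>] by metis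
  fix x
  show "(conv \<kappa> f has_derivative (\<bullet>) (conv d\<kappa> f x)) (at x)"
    unfolding has_derivative_at_alt
  proof (intro conjI allI impI)
    show "bounded_linear ((\<bullet>) (conv d\<kappa> f x))" by (rule bounded_linear_inner_right)
    fix e :: real assume e: "e > 0"
    define F where "F y = indicator (cball 0 (R + norm x + 1)) y *\<^sub>R f y" for y
    have Fi: "integrable lborel F" unfolding F_def by (rule locint_truncate[OF f])
    \<comment> \<open>The summand 1 keeps N positive when f vanishes on the ball.\<close>
    define N where "N = (LBINT y. \<bar>F y\<bar>) + 1"
    have N: "N > 0" unfolding N_def by (smt (verit) integral_nonneg_AE AE_I2 abs_ge_zero)
    have eN: "e / N > 0" using e N by simp
    obtain d where d: "d > 0" "d \<le> 1" "\<And>z z'. norm (z - z') < d \<Longrightarrow> norm (d\<kappa> z - d\<kappa> z') < e / N"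
      using uniformly_continuous_bsupp[OF c(2) b(2) eN] by metis
    have main: "norm (conv \<kappa> f z - conv \<kappa> f x - conv d\<kappa> f x \<bullet> (z - x)) \<le> e * norm (z - x)"
      if z: "norm (z - x) < d" for z
    proof -
      define D where "D y = \<kappa> (z - y) - \<kappa> (x - y) - d\<kappa> (x - y) \<bullet> (z - x)" for y
      have D: "\<bar>D y\<bar> \<le> e / N * norm (z - x)" for y
      proof -
        have "norm (\<kappa> (z - y) - \<kappa> (x - y) - (\<lambda>h. d\<kappa> (x - y) \<bullet> h) ((z - y) - (x - y))) \<le> norm ((z - y) - (x - y)) * (e / N)"
        proof (rule differentiable_bound_linearization[where S="ball (x - y) d" and f'="\<lambda>t h. d\<kappa> t \<bullet> h"])
          show "x - y + t *\<^sub>R (z - y - (x - y)) \<in> ball (x - y) d" if "t \<in> {0..1}" for t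
          proof -
            have "norm (t *\<^sub>R (z - x)) \<le> norm (z - x)"
              using that by (simp add: mult_left_le_one_le)
            then have "norm (t *\<^sub>R (z - x)) < d" using z by linarith
            moreover have "z - y - (x - y) = z - x" by simp
            ultimately show ?thesis by (simp only: mem_ball dist_norm) (simp add: norm_minus_commute)
          qed
          show "(\<kappa> has_derivative (\<bullet>) (d\<kappa> t)) (at t within ball (x - y) d)" for t
            using C1D(1)[OF C1c_C1[OF \<kappa>]] by (rule has_derivative_at_withinI)
          show "onorm ((\<bullet>) (d\<kappa> t) - (\<bullet>) (d\<kappa> (x - y))) \<le> e / N" if "t \<in> ball (x - y) d" for t
          unfolding fun_diff_def proof (rule onorm_bound)
            show "norm (d\<kappa> t \<bullet> h - d\<kappa> (x - y) \<bullet> h) \<le> e / N * norm h" for h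
            proof -
              have "norm (d\<kappa> t \<bullet> h - d\<kappa> (x - y) \<bullet> h) = \<bar>(d\<kappa> t - d\<kappa> (x - y)) \<bullet> h\<bar>"
                by (simp add: inner_diff_left)
              also have "\<dots> \<le> norm (d\<kappa> t - d\<kappa> (x - y)) * norm h" by (rule Cauchy_Schwarz_ineq2)
              also have "\<dots> \<le> e / N * norm h"
                using d(3)[of t "x - y"] that by (intro mult_right_mono) (auto simp: dist_norm norm_minus_commute)
              finally show ?thesis .
            qed
          qed (use eN in auto)
        qed (use d in auto)
        then show ?thesis by (simp add: D_def mult.commute)
      qed
      have D0: "D y = 0" if y: "norm y > R + norm x + 1" for y
      proof -
        have "norm y \<le> norm x + norm (x - y)" by (metis norm_minus_commute norm_triangle_sub)
        moreover have "norm (x - y) \<le> norm (z - y) + norm (z - x)"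
          by (metis add.commute diff_diff_eq2 diff_add_cancel norm_minus_commute norm_triangle_ineq)
        ultimately have "norm (x - y) > R" "norm (z - y) > R" using y z d(2) by auto
        then show ?thesis using R by (simp add: D_def)
      qed
      have i: "integrable lborel (\<lambda>y. f y *\<^sub>R \<kappa> (z - y))" "integrable lborel (\<lambda>y. f y *\<^sub>R \<kappa> (x - y))"
        using conv_integrable[OF c(1) b(1) f] by auto
      have i3: "integrable lborel (\<lambda>y. f y *\<^sub>R d\<kappa> (x - y))" using conv_integrable[OF c(2) b(2) f] .
      have "conv \<kappa> f z - conv \<kappa> f x - conv d\<kappa> f x \<bullet> (z - x) = (LBINT y. f y * D y)"
      proof -
        have "conv d\<kappa> f x \<bullet> (z - x) = (LBINT y. (f y *\<^sub>R d\<kappa> (x - y)) \<bullet> (z - x))"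
          unfolding conv_def using integral_inner_left[of "z - x", OF i3] by simp
        moreover have "integrable lborel (\<lambda>y. (f y *\<^sub>R d\<kappa> (x - y)) \<bullet> (z - x))"
          using integrable_inner_left[OF i3] .
        moreover have "f y * D y = f y *\<^sub>R \<kappa> (z - y) - f y *\<^sub>R \<kappa> (x - y) - (f y *\<^sub>R d\<kappa> (x - y)) \<bullet> (z - x)" for y
          by (simp add: D_def right_diff_distrib del: inner_diff_right)
        ultimately show ?thesis unfolding conv_def using i
          by (simp del: inner_diff_right real_scaleR_def)
      qed
      also have "\<bar>\<dots>\<bar> \<le> (LBINT y. e / N * norm (z - x) * \<bar>F y\<bar>)"
      proof (rule integral_abs_le_integral)
        show "integrable lborel (\<lambda>y. e / N * norm (z - x) * \<bar>F y\<bar>)" using Fi by auto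
        show "\<bar>f y * D y\<bar> \<le> e / N * norm (z - x) * \<bar>F y\<bar>" for y
        proof (cases "norm y \<le> R + norm x + 1")
          case True
          then show ?thesis using mult_right_mono[OF D[of y], of "\<bar>f y\<bar>"]
            by (simp add: F_def abs_mult mult_ac)
        qed (use D0[of y] eN in \<open>auto simp: F_def\<close>)
      qed
      also have "\<dots> = e * norm (z - x) * ((LBINT y. \<bar>F y\<bar>) / N)" by simp
      also have "\<dots> \<le> e * norm (z - x) * 1"
        using e N by (intro mult_left_mono) (auto simp: N_def divide_simps)
      finally show ?thesis by simp
    qed
    then show "\<exists>d>0. \<forall>y. norm (y - x) < d \<longrightarrow> norm (conv \<kappa> f y - conv \<kappa> f x - conv d\<kappa> f x \<bullet> (y - x)) \<le> e * norm (y - x)"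
      using d(1) by blast
  qed
qed


section \<open>Continuity of translations in L^1\<close>

text \<open>The integral of the difference is twice the measure of U minus twice the measure of the
  overlap of U with its translate. A point of an open set stays in it under small shifts, so the
  overlap tends to the full measure by dominated convergence.\<close>

lemma translation_open:
  fixes U :: "'a::euclidean_space set"
  assumes U: "open U" "emeasure lborel U < \<infinity>" and h: "h \<longlonglongrightarrow> 0"
  shows "(\<lambda>n. NNINT x. \<bar>indicat_real U (x + h n) - indicat_real U x\<bar>) \<longlonglongrightarrow> 0"
proof -
  have [measurable]: "U \<in> sets borel" using U(1) by simp
  have iU: "integrable lborel (indicat_real U)" using U by (intro integrable_real_indicator) auto
  have iUh: "integrable lborel (\<lambda>x. indicat_real U (x + c))" for c
    using lborel_integrable_affine[OF iU, of 1 c] by (simp add: add.commute)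
  have iUU: "integrable lborel (\<lambda>x. indicat_real U (x + c) * indicat_real U x)" for c
    by (rule Bochner_Integration.integrable_bound[OF iU]) (auto simp: indicator_def)
  have *: "\<bar>indicat_real U a - indicat_real U b\<bar> = indicat_real U a + indicat_real U b - 2 * (indicat_real U a * indicat_real U b)" for a b
    by (auto simp: indicator_def)
  have eq: "(NNINT x. \<bar>indicat_real U (x + c) - indicat_real U x\<bar>)
      = ennreal (2 * measure lborel U - 2 * (LBINT x. indicat_real U (x + c) * indicat_real U x))" for c
  proof -
    have "(NNINT x. \<bar>indicat_real U (x + c) - indicat_real U x\<bar>)
      = ennreal (LBINT x. \<bar>indicat_real U (x + c) - indicat_real U x\<bar>)"
      using iU iUh by (intro nn_integral_eq_integral) auto
    also have "(LBINT x. \<bar>indicat_real U (x + c) - indicat_real U x\<bar>) =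
       (LBINT x. indicat_real U (x + c)) + (LBINT x. indicat_real U x) - 2 * (LBINT x. indicat_real U (x + c) * indicat_real U x)"
      unfolding * using iU iUh iUU by simp
    also have "(LBINT x. indicat_real U (x + c)) = (LBINT x. indicat_real U x)"
      by (rule lborel_integral_translate) auto
    finally show ?thesis by simp
  qed
  have "(\<lambda>n. LBINT x. indicat_real U (x + h n) * indicat_real U x) \<longlonglongrightarrow> (LBINT x. indicat_real U x)"
  proof (rule integral_dominated_convergence[where w="indicat_real U"])
    show "AE x in lborel. (\<lambda>n. indicat_real U (x + h n) * indicat_real U x) \<longlonglongrightarrow> indicat_real U x"
    proof (rule AE_I2)
      fix x
      show "(\<lambda>n. indicat_real U (x + h n) * indicat_real U x) \<longlonglongrightarrow> indicat_real U x"
      proof (cases "x \<in> U")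
        case True
        have "(\<lambda>n. x + h n) \<longlonglongrightarrow> x + 0" by (intro tendsto_intros h)
        then have "\<forall>\<^sub>F n in sequentially. x + h n \<in> U"
          using True U(1) by (metis add.right_neutral topological_tendstoD)
        then show ?thesis using True by (intro tendsto_eventually) (auto elim!: eventually_mono)
      qed simp
    qed
  qed (use iU in \<open>auto simp: indicator_def\<close>)
  then have "(\<lambda>n. ennreal (2 * measure lborel U - 2 * (LBINT x. indicat_real U (x + h n) * indicat_real U x)))
    \<longlonglongrightarrow> ennreal (2 * measure lborel U - 2 * measure lborel U)"
    by (intro tendsto_intros) auto
  then show ?thesis unfolding eq by simp
qed

text \<open>The property is closed under L^1 approximation: a three epsilon argument in which the
  shifted error has the same integral as the unshifted one.\<close>

lemma translation_approx:
  fixes f :: "'a::euclidean_space \<Rightarrow> real"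
  assumes f[measurable]: "f \<in> borel_measurable borel" and h: "h \<longlonglongrightarrow> 0"
    and ap: "\<And>e::real. e > 0 \<Longrightarrow> \<exists>g. g \<in> borel_measurable borel \<and> (NNINT x. \<bar>f x - g x\<bar>) \<le> ennreal e \<and>
      (\<lambda>n. NNINT x. \<bar>g (x + h n) - g x\<bar>) \<longlonglongrightarrow> 0"
  shows "(\<lambda>n. NNINT x. \<bar>f (x + h n) - f x\<bar>) \<longlonglongrightarrow> 0"
proof (rule ennreal_tendsto_0I)
  fix e :: real assume e: "e > 0"
  have "e/3 > 0" using e by simp
  from ap[OF this] obtain g where g[measurable]: "g \<in> borel_measurable borel"
    and fg: "(NNINT x. \<bar>f x - g x\<bar>) \<le> ennreal (e/3)"
    and gh: "(\<lambda>n. NNINT x. \<bar>g (x + h n) - g x\<bar>) \<longlonglongrightarrow> 0" by blast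
  have "\<forall>\<^sub>F n in sequentially. (NNINT x. \<bar>g (x + h n) - g x\<bar>) \<le> ennreal (e/3)"
    using ennreal_tendsto_0D[OF gh] e by simp
  then show "\<forall>\<^sub>F n in sequentially. (NNINT x. \<bar>f (x + h n) - f x\<bar>) \<le> ennreal e"
  proof eventually_elim
    case (elim n)
    have "(NNINT x. \<bar>f (x + h n) - f x\<bar>)
       \<le> (\<integral>\<^sup>+x. ennreal \<bar>f (x + h n) - g (x + h n)\<bar> + ennreal \<bar>g (x + h n) - g x\<bar> + ennreal \<bar>f x - g x\<bar> \<partial>lborel)"
      by (intro nn_integral_mono) (auto simp flip: ennreal_plus)
    also have "\<dots> = (NNINT x. \<bar>f (x + h n) - g (x + h n)\<bar>) + (NNINT x. \<bar>g (x + h n) - g x\<bar>) + (NNINT x. \<bar>f x - g x\<bar>)"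
      by (simp add: nn_integral_add)
    also have "(NNINT x. \<bar>f (x + h n) - g (x + h n)\<bar>) = (NNINT x. \<bar>f x - g x\<bar>)"
      by (rule lborel_nn_integral_translate[of "\<lambda>x. ennreal \<bar>f x - g x\<bar>"]) simp
    also have "(NNINT x. \<bar>f x - g x\<bar>) + (NNINT x. \<bar>g (x + h n) - g x\<bar>) + (NNINT x. \<bar>f x - g x\<bar>)
      \<le> ennreal (e/3) + ennreal (e/3) + ennreal (e/3)"
      by (intro add_mono fg elim)
    also have "\<dots> = ennreal e" using e by (simp flip: ennreal_plus)
    finally show ?case .
  qed
qed

text \<open>Induction over integrable functions. Only indicators need an idea: outer regularity
  replaces a measurable set by an open one, for which \<open>translation_open\<close>
  applies.\<close>

lemma translation_L1:
  fixes f :: "'a::euclidean_space \<Rightarrow> real"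
  assumes f: "integrable lborel f" and h: "h \<longlonglongrightarrow> 0"
  shows "(\<lambda>n. NNINT x. \<bar>f (x + h n) - f x\<bar>) \<longlonglongrightarrow> 0"
  using f
proof (induction f rule: integrable_induct)
  case (base A c)
  then have [measurable]: "A \<in> sets borel" by simp
  show ?case
  proof (rule translation_approx[OF _ h])
    fix e :: real assume e: "e > 0"
    \<comment> \<open>The measure by which the open set may exceed A: after scaling by c the error
      is at most e.\<close>
    define d where "d = min 1 (e / (\<bar>c\<bar> + 1))"
    have d: "d > 0" "d \<le> 1" "\<bar>c\<bar> * d \<le> e"
    proof -
      have "\<bar>c\<bar> * d \<le> \<bar>c\<bar> * (e / (\<bar>c\<bar> + 1))" unfolding d_def by (intro mult_left_mono) auto
      also have "\<dots> \<le> e" using e by (simp add: field_simps)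
      finally show "\<bar>c\<bar> * d \<le> e" .
    qed (use e in \<open>auto simp: d_def add_nonneg_pos\<close>)
    have "A \<in> sets lebesgue" using base by simp
    from sets_lebesgue_outer_open[OF this d(1)]
    obtain T where T: "open T" "A \<subseteq> T" "T - A \<in> lmeasurable" "emeasure lebesgue (T - A) < ennreal d" by metis
    have [measurable]: "T \<in> sets borel" using T(1) by simp
    have TA: "emeasure lborel (T - A) < ennreal d" using T(4) by simp
    have "emeasure lborel T \<le> emeasure lborel A + emeasure lborel (T - A)"
      using T(2) emeasure_subadditive[of A lborel "T - A"] by (simp add: Un_absorb1)
    also have "\<dots> < \<infinity>" using base(2) TA
      by (metis ennreal_add_less_top ennreal_less_top infinity_ennreal_def order_less_trans)
    finally have Tf: "emeasure lborel T < \<infinity>" .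
    have "(\<lambda>n. ennreal \<bar>c\<bar> * (NNINT x. \<bar>indicat_real T (x + h n) - indicat_real T x\<bar>)) \<longlonglongrightarrow> ennreal \<bar>c\<bar> * 0"
      by (intro ennreal_tendsto_cmult translation_open T(1) Tf h) auto
    moreover have "ennreal \<bar>c\<bar> * (NNINT x. \<bar>indicat_real T (x + h n) - indicat_real T x\<bar>)
      = (NNINT x. \<bar>indicat_real T (x + h n) *\<^sub>R c - indicat_real T x *\<^sub>R c\<bar>)" for n
      by (subst nn_integral_cmult[symmetric]) (auto simp: ennreal_mult[symmetric] abs_mult[symmetric] algebra_simps)
    moreover have "(NNINT x. \<bar>indicat_real A x *\<^sub>R c - indicat_real T x *\<^sub>R c\<bar>) \<le> ennreal e"
    proof -
      have "(NNINT x. \<bar>indicat_real A x *\<^sub>R c - indicat_real T x *\<^sub>R c\<bar>)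
        = (\<integral>\<^sup>+x. ennreal \<bar>c\<bar> * indicator (T - A) x \<partial>lborel)"
        using T(2) by (intro nn_integral_cong) (auto simp: indicator_def)
      also have "\<dots> = ennreal \<bar>c\<bar> * emeasure lborel (T - A)" by (rule nn_integral_cmult_indicator) simp
      also have "\<dots> \<le> ennreal \<bar>c\<bar> * ennreal d" using TA by (intro mult_left_mono) auto
      also have "\<dots> \<le> ennreal e" using d by (simp add: ennreal_mult[symmetric] ennreal_leI)
      finally show ?thesis .
    qed
    ultimately show "\<exists>g. g \<in> borel_measurable borel \<and> (NNINT x. \<bar>indicat_real A x *\<^sub>R c - g x\<bar>) \<le> ennreal e \<and>
      (\<lambda>n. NNINT x. \<bar>g (x + h n) - g x\<bar>) \<longlonglongrightarrow> 0"
      by (intro exI[of _ "\<lambda>x. indicat_real T x *\<^sub>R c"]) simp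
  qed simp
next
  case (add f g)
  have [measurable]: "f \<in> borel_measurable borel" "g \<in> borel_measurable borel" using add by auto
  show ?case
  proof (rule tendsto_sandwich[OF _ _ tendsto_const])
    show "\<forall>\<^sub>F n in sequentially. (NNINT x. \<bar>f (x + h n) + g (x + h n) - (f x + g x)\<bar>)
      \<le> (NNINT x. \<bar>f (x + h n) - f x\<bar>) + (NNINT x. \<bar>g (x + h n) - g x\<bar>)"
      by (intro always_eventually allI, subst nn_integral_add[symmetric])
        (auto intro!: nn_integral_mono simp flip: ennreal_plus)
    show "(\<lambda>n. (NNINT x. \<bar>f (x + h n) - f x\<bar>) + (NNINT x. \<bar>g (x + h n) - g x\<bar>)) \<longlonglongrightarrow> 0"
      using tendsto_add[OF add(3,4)] by simp
  qed auto
next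
  case (lim f s)
  have [measurable]: "f \<in> borel_measurable borel" "\<And>i. s i \<in> borel_measurable borel" using lim by auto
  show ?case
  proof (rule translation_approx[OF _ h])
    fix e :: real assume e: "e > 0"
    have "(\<lambda>i. NNINT x. norm (f x - s i x)) \<longlonglongrightarrow> 0"
    proof (rule nn_integral_dominated_convergence_norm[where w="\<lambda>x. 2 * \<bar>f x\<bar>"])
      show "(NNINT x. 2 * \<bar>f x\<bar>) < \<infinity>"
        using integrable_mult_right[OF integrable_abs[OF lim(4)], of 2] unfolding real_integrable_def
        by (simp add: less_top)
    qed (use lim in auto)
    from eventually_happens[OF ennreal_tendsto_0D[OF this e]]
    obtain i where "(NNINT x. norm (f x - s i x)) \<le> ennreal e" by auto
    then show "\<exists>g. g \<in> borel_measurable borel \<and> (NNINT x. \<bar>f x - g x\<bar>) \<le> ennreal e \<and>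
      (\<lambda>n. NNINT x. \<bar>g (x + h n) - g x\<bar>) \<longlonglongrightarrow> 0"
      using lim(5)[of i] by (intro exI[of _ "s i"]) simp
  qed simp
qed


text \<open>If no radius worked, shifts of norm below 1/(n + 1) would form a null sequence
  contradicting \<open>translation_L1\<close>.\<close>

lemma translation_L1_uniform:
  fixes f :: "'a::euclidean_space \<Rightarrow> real"
  assumes f: "integrable lborel f" and e: "e > 0"
  obtains d where "d > 0" "\<And>c. norm c < d \<Longrightarrow> (NNINT x. \<bar>f (x + c) - f x\<bar>) \<le> ennreal e"
proof -
  have "\<exists>d>0. \<forall>c. norm c < d \<longrightarrow> (NNINT x. \<bar>f (x + c) - f x\<bar>) \<le> ennreal e"
  proof (rule ccontr)
    assume "\<not> ?thesis"
    then have "\<forall>n. \<exists>c. norm c < inverse (real (Suc n)) \<and> \<not> (NNINT x. \<bar>f (x + c) - f x\<bar>) \<le> ennreal e"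
      by (metis inverse_positive_iff_positive of_nat_0_less_iff zero_less_Suc)
    then obtain c where c: "\<And>n. norm (c n) < inverse (real (Suc n))"
      "\<And>n. \<not> (NNINT x. \<bar>f (x + c n) - f x\<bar>) \<le> ennreal e" by metis
    have "c \<longlonglongrightarrow> 0"
      by (rule LIMSEQ_norm_0) (use c(1) in \<open>simp add: inverse_eq_divide\<close>)
    from ennreal_tendsto_0D[OF translation_L1[OF f this] e] c(2) show False by simp
  qed
  then show ?thesis using that by metis
qed

lemma translation_local_uniform:
  fixes f :: "'a::euclidean_space \<Rightarrow> real"
  assumes f: "locint f" and e: "e > 0"
  obtains d where "d > 0" "d \<le> 1"
    "\<And>c. norm c < d \<Longrightarrow> (NNINT x. indicator (cball 0 R) x * \<bar>f (x + c) - f x\<bar>) \<le> ennreal e"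
proof -
  define g where "g x = indicator (cball 0 (R + 1)) x *\<^sub>R f x" for x
  have g: "integrable lborel g" unfolding g_def by (rule locint_truncate[OF f])
  obtain d where d: "d > 0" "\<And>c. norm c < d \<Longrightarrow> (NNINT x. \<bar>g (x + c) - g x\<bar>) \<le> ennreal e"
    using translation_L1_uniform[OF g e] by metis
  have "(NNINT x. indicator (cball 0 R) x * \<bar>f (x + c) - f x\<bar>) \<le> ennreal e" if c: "norm c < min d 1" for c
  proof -
    have "(NNINT x. indicator (cball 0 R) x * \<bar>f (x + c) - f x\<bar>) \<le> (NNINT x. \<bar>g (x + c) - g x\<bar>)"
    proof (rule nn_integral_mono, rule ennreal_leI)
      fix x
      have "norm (x + c) \<le> norm x + norm c" by (rule norm_triangle_ineq)
      then show "indicator (cball 0 R) x * \<bar>f (x + c) - f x\<bar> \<le> \<bar>g (x + c) - g x\<bar>"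
        using c by (auto simp: g_def indicator_def)
    qed
    also have "\<dots> \<le> ennreal e" using d(2)[of c] c by simp
    finally show ?thesis .
  qed
  then show ?thesis using d(1) by (intro that[of "min d 1"]) auto
qed

lemma nn_integral_tendsto_0_AE_subseq:
  fixes u :: "nat \<Rightarrow> 'a \<Rightarrow> real"
  assumes [measurable]: "\<And>n. u n \<in> borel_measurable M"
    and lim: "(\<lambda>n. \<integral>\<^sup>+x. ennreal \<bar>u n x\<bar> \<partial>M) \<longlonglongrightarrow> 0"
  obtains r :: "nat \<Rightarrow> nat" where "strict_mono r" "AE x in M. (\<lambda>n. u (r n) x) \<longlonglongrightarrow> 0"
proof -
  \<comment> \<open>Finitely many of the integrals may be infinite; from N on the functions are
    integrable and L^1 convergence in the real sense applies.\<close>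
  obtain N where N: "\<And>n. n \<ge> N \<Longrightarrow> (\<integral>\<^sup>+x. ennreal \<bar>u n x\<bar> \<partial>M) \<le> ennreal 1"
    using ennreal_tendsto_0D[OF lim, of 1] by (auto simp: eventually_sequentially)
  have int: "integrable M (u (n + N))" for n
    unfolding integrable_iff_bounded using N[of "n + N"] by (auto simp: less_top[symmetric] top_unique)
  have "(\<lambda>n. ennreal (\<integral>x. norm (u (n + N) x) \<partial>M)) \<longlonglongrightarrow> ennreal 0"
    using LIMSEQ_ignore_initial_segment[OF lim, of N] nn_integral_eq_integral[OF integrable_norm[OF int]] by simp
  then have "(\<lambda>n. \<integral>x. norm (u (n + N) x) \<partial>M) \<longlonglongrightarrow> 0"
    by (subst (asm) tendsto_ennreal_iff) auto
  from tendsto_L1_AE_subseq[OF int this]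
  obtain r where r: "strict_mono r" "AE x in M. (\<lambda>n. u (r n + N) x) \<longlonglongrightarrow> 0" by blast
  then show ?thesis by (intro that[of "\<lambda>n. r n + N"]) (auto simp: strict_mono_def)
qed

section \<open>Approximate identities\<close>

definition approx_id :: "(nat \<Rightarrow> 'a::euclidean_space \<Rightarrow> real) \<Rightarrow> bool" where
  "approx_id \<kappa> \<longleftrightarrow> (\<forall>n. continuous_on UNIV (\<kappa> n) \<and> (\<forall>h. 0 \<le> \<kappa> n h) \<and> (LBINT h. \<kappa> n h) = 1) \<and>
     (\<exists>r. r \<longlonglongrightarrow> 0 \<and> (\<forall>n h. norm h > r n \<longrightarrow> \<kappa> n h = 0))"

lemma approx_idD:
  assumes "approx_id \<kappa>"
  shows "continuous_on UNIV (\<kappa> n)" "0 \<le> \<kappa> n h" "(LBINT h. \<kappa> n h) = 1" "bsupp (\<kappa> n)"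
    "\<kappa> n \<in> borel_measurable borel" "integrable lborel (\<kappa> n)" "(NNINT h. \<kappa> n h) = 1"
proof -
  show a: "continuous_on UNIV (\<kappa> n)" and b: "0 \<le> \<kappa> n h" and c: "(LBINT h. \<kappa> n h) = 1" for h
    using assms by (auto simp: approx_id_def)
  show d: "bsupp (\<kappa> n)"
    using assms unfolding approx_id_def bsupp_def by metis
  show "\<kappa> n \<in> borel_measurable borel" by (rule borel_measurable_continuous_onI[OF a])
  show i: "integrable lborel (\<kappa> n)" by (rule integrable_bsupp[OF a d])
  show "(NNINT h. \<kappa> n h) = 1" using nn_integral_eq_integral[OF i] b c by simp
qed

lemma conv_diff_bound:
  fixes \<kappa> f :: "'a::euclidean_space \<Rightarrow> real"
  assumes "continuous_on UNIV \<kappa>" "bsupp \<kappa>" "\<And>h. 0 \<le> \<kappa> h" "(LBINT h. \<kappa> h) = 1" "locint f"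
  shows "ennreal \<bar>conv \<kappa> f x - f x\<bar> \<le> (\<integral>\<^sup>+h. ennreal (\<kappa> h) * ennreal \<bar>f (x - h) - f x\<bar> \<partial>lborel)"
proof -
  have [measurable]: "f \<in> borel_measurable borel" "\<kappa> \<in> borel_measurable borel"
    using assms(1,5) by (auto intro: borel_measurable_continuous_onI locint_measurable)
  have i: "integrable lborel (\<lambda>h. f (x - h) * \<kappa> h)"
    using lborel_integrable_affine[OF conv_integrable[OF assms(1,2,5), of x], of "-1" x] by simp
  have "conv \<kappa> f x - f x = (LBINT h. f (x - h) * \<kappa> h) - f x * (LBINT h. \<kappa> h)"
    by (subst conv_reflect) (auto simp: assms(4))
  also have "\<dots> = (LBINT h. f (x - h) * \<kappa> h - f x * \<kappa> h)"
    using i integrable_bsupp[OF assms(1,2)] by simp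
  also have "ennreal (norm \<dots>) \<le> (NNINT h. norm (f (x - h) * \<kappa> h - f x * \<kappa> h))"
    using i integrable_bsupp[OF assms(1,2)] by (intro integral_norm_bound_ennreal) auto
  also have "\<dots> = (\<integral>\<^sup>+h. ennreal (\<kappa> h) * ennreal \<bar>f (x - h) - f x\<bar> \<partial>lborel)"
  proof (rule nn_integral_cong)
    fix h
    have "\<bar>f (x - h) * \<kappa> h - f x * \<kappa> h\<bar> = \<kappa> h * \<bar>f (x - h) - f x\<bar>"
      by (metis abs_mult abs_of_nonneg assms(3) left_diff_distrib mult.commute)
    then show "ennreal (norm (f (x - h) * \<kappa> h - f x * \<kappa> h)) = ennreal (\<kappa> h) * ennreal \<bar>f (x - h) - f x\<bar>"
      by (simp add: ennreal_mult[symmetric] assms(3))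
  qed
  finally show ?thesis by simp
qed

text \<open>As the kernel has mass 1, Tonelli's theorem turns the smoothing error into an average of
  translation errors with density \<kappa>. Taking for A a ball or the whole space yields
  \<open>mollify_local\<close> and \<open>mollify_L1\<close>.\<close>

lemma mollify_bound:
  fixes f :: "'a::euclidean_space \<Rightarrow> real"
  assumes [measurable]: "A \<in> sets borel" and \<kappa>: "continuous_on UNIV \<kappa>" "bsupp \<kappa>" "\<And>h. 0 \<le> \<kappa> h" "(LBINT h. \<kappa> h) = 1" and f: "locint f"
    and r: "\<And>h. norm h \<ge> d \<Longrightarrow> \<kappa> h = 0"
    and b: "\<And>c. norm c < d \<Longrightarrow> (NNINT x. indicator A x * \<bar>f (x + c) - f x\<bar>) \<le> ennreal e"
  shows "(NNINT x. indicator A x * \<bar>conv \<kappa> f x - f x\<bar>) \<le> ennreal e"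
proof -
  have [measurable]: "f \<in> borel_measurable borel" "\<kappa> \<in> borel_measurable borel"
    using \<kappa>(1) f by (auto intro: borel_measurable_continuous_onI locint_measurable)
  have \<kappa>1: "(NNINT h. \<kappa> h) = 1"
    using nn_integral_eq_integral[OF integrable_bsupp[OF \<kappa>(1,2)]] \<kappa>(3,4) by simp
  have "(NNINT x. indicator A x * \<bar>conv \<kappa> f x - f x\<bar>)
    \<le> (\<integral>\<^sup>+x. (\<integral>\<^sup>+h. indicator A x * (ennreal (\<kappa> h) * ennreal \<bar>f (x - h) - f x\<bar>) \<partial>lborel) \<partial>lborel)"
  proof (rule nn_integral_mono)
    fix x
    show "ennreal (indicator A x * \<bar>conv \<kappa> f x - f x\<bar>) \<le> (\<integral>\<^sup>+h. indicator A x * (ennreal (\<kappa> h) * ennreal \<bar>f (x - h) - f x\<bar>) \<partial>lborel)"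
      using conv_diff_bound[OF \<kappa> f, of x] by (simp add: indicator_def)
  qed
  also have "\<dots> = (\<integral>\<^sup>+h. (\<integral>\<^sup>+x. indicator A x * (ennreal (\<kappa> h) * ennreal \<bar>f (x - h) - f x\<bar>) \<partial>lborel) \<partial>lborel)"
    by (rule lborel_pair.Fubini') measurable
  also have "\<dots> = (\<integral>\<^sup>+h. ennreal (\<kappa> h) * (NNINT x. indicator A x * \<bar>f (x - h) - f x\<bar>) \<partial>lborel)"
    by (intro nn_integral_cong, subst nn_integral_cmult[symmetric])
      (auto intro!: nn_integral_cong simp: indicator_def)
  also have "\<dots> \<le> (\<integral>\<^sup>+h. ennreal (\<kappa> h) * ennreal e \<partial>lborel)"
  proof (rule nn_integral_mono)
    fix h
    show "ennreal (\<kappa> h) * (NNINT x. indicator A x * \<bar>f (x - h) - f x\<bar>) \<le> ennreal (\<kappa> h) * ennreal e"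
      using b[of "- h"] r[of h] by (cases "norm h < d") (auto intro!: mult_left_mono)
  qed
  also have "\<dots> = ennreal e" by (simp add: nn_integral_multc \<kappa>1)
  finally show ?thesis .
qed

lemma mollify_local:
  fixes f :: "'a::euclidean_space \<Rightarrow> real"
  assumes \<kappa>: "approx_id \<kappa>" and f: "locint f"
  shows "(\<lambda>n. NNINT x. indicator (cball 0 R) x * \<bar>conv (\<kappa> n) f x - f x\<bar>) \<longlonglongrightarrow> 0"
proof (rule ennreal_tendsto_0I)
  fix e :: real assume e: "e > 0"
  obtain d where d: "d > 0" "\<And>c. norm c < d \<Longrightarrow> (NNINT x. indicator (cball 0 R) x * \<bar>f (x + c) - f x\<bar>) \<le> ennreal e"
    using translation_local_uniform[OF f e] by metis
  obtain r where r: "r \<longlonglongrightarrow> 0" "\<And>n h. norm h > r n \<Longrightarrow> \<kappa> n h = 0" using \<kappa> by (auto simp: approx_id_def)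
  from order_tendstoD(2)[OF r(1) d(1)]
  show "\<forall>\<^sub>F n in sequentially. (NNINT x. indicator (cball 0 R) x * \<bar>conv (\<kappa> n) f x - f x\<bar>) \<le> ennreal e"
  proof eventually_elim
    case (elim n)
    show ?case
      by (rule mollify_bound[OF _ approx_idD(1)[OF \<kappa>] approx_idD(4)[OF \<kappa>] approx_idD(2)[OF \<kappa>] approx_idD(3)[OF \<kappa>] f _ d(2)])
        (use elim r(2) in auto)
  qed
qed

lemma mollify_L1:
  fixes f :: "'a::euclidean_space \<Rightarrow> real"
  assumes \<kappa>: "approx_id \<kappa>" and f: "integrable lborel f"
  shows "(\<lambda>n. NNINT x. \<bar>conv (\<kappa> n) f x - f x\<bar>) \<longlonglongrightarrow> 0"
proof (rule ennreal_tendsto_0I)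
  fix e :: real assume e: "e > 0"
  obtain d where d: "d > 0" "\<And>c. norm c < d \<Longrightarrow> (NNINT x. \<bar>f (x + c) - f x\<bar>) \<le> ennreal e"
    using translation_L1_uniform[OF f e] by metis
  obtain r where r: "r \<longlonglongrightarrow> 0" "\<And>n h. norm h > r n \<Longrightarrow> \<kappa> n h = 0" using \<kappa> by (auto simp: approx_id_def)
  from order_tendstoD(2)[OF r(1) d(1)]
  show "\<forall>\<^sub>F n in sequentially. (NNINT x. \<bar>conv (\<kappa> n) f x - f x\<bar>) \<le> ennreal e"
  proof eventually_elim
    case (elim n)
    have "(NNINT x. indicator UNIV x * \<bar>conv (\<kappa> n) f x - f x\<bar>) \<le> ennreal e"
      by (rule mollify_bound[OF _ approx_idD(1)[OF \<kappa>] approx_idD(4)[OF \<kappa>] approx_idD(2)[OF \<kappa>] approx_idD(3)[OF \<kappa>] integrable_imp_locint[OF f], of _ d])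
        (use elim r(2) d(2) in auto)
    then show ?case by simp
  qed
qed

section \<open>The Sobolev inequality\<close>

text \<open>The inequality of arithmetic and geometric means for p q' and p' q. It is stated in
  ennreal so that \<open>nn_integral_Cauchy_Schwarz\<close> covers infinite integrals; the zero and
  infinite cases are split off first.\<close>

lemma ennreal_mult_add_le_of_squares:
  fixes s s' p p' q q' :: ennreal
  assumes "s^2 \<le> p * q" "s'^2 \<le> p' * q'"
  shows "s * s' + s * s' \<le> p * q' + p' * q"
proof (cases "s = 0 \<or> s' = 0")
  case False
  then have nz: "p \<noteq> 0" "q \<noteq> 0" "p' \<noteq> 0" "q' \<noteq> 0" using assms by auto
  show ?thesis
  proof (cases "p = top \<or> q = top \<or> p' = top \<or> q' = top")
    case True
    then show ?thesis using nz by (auto simp: ennreal_top_mult ennreal_mult_top)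
  next
    case False
    obtain a where a: "p = ennreal a" "a \<ge> 0" using False by (cases p) auto
    obtain b where b: "q = ennreal b" "b \<ge> 0" using False by (cases q) auto
    obtain a' where a': "p' = ennreal a'" "a' \<ge> 0" using False by (cases p') auto
    obtain b' where b': "q' = ennreal b'" "b' \<ge> 0" using False by (cases q') auto
    have "s \<noteq> top" "s' \<noteq> top"
      using assms a b a' b' by (auto simp: ennreal_mult[symmetric] power2_eq_square top_unique)
    then obtain t t' where t: "s = ennreal t" "t \<ge> 0" "s' = ennreal t'" "t' \<ge> 0"
      by (cases s; cases s') auto
    have 1: "t^2 \<le> a * b" "t'^2 \<le> a' * b'"
      using assms a b a' b' t by (auto simp: ennreal_mult[symmetric] ennreal_power)
    have "(2 * (t * t'))^2 = 4 * (t^2 * t'^2)" by (simp add: power_mult_distrib)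
    also have "\<dots> \<le> 4 * ((a * b) * (a' * b'))" using 1 a b by (intro mult_left_mono mult_mono) auto
    also have "\<dots> = 4 * (a * b') * (a' * b)" by simp
    also have "\<dots> \<le> (a * b' + a' * b)^2"
      using sum_squares_bound[of "a * b'" "a' * b"] by (simp add: power2_sum mult_ac)
    finally have "2 * (t * t') \<le> a * b' + a' * b"
      by (rule power2_le_imp_le) (use a b a' b' in auto)
    then show ?thesis
      using t a b a' b' by (simp add: ennreal_mult[symmetric] ennreal_plus[symmetric] ennreal_leI mult.commute[of t'] del: ennreal_plus)
  qed
qed auto

lemma ennreal_double_le_cancel: "(a::ennreal) + a \<le> b + b \<Longrightarrow> a \<le> b"
  by (cases a; cases b) (auto simp: ennreal_plus[symmetric] top_unique simp del: ennreal_plus)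

text \<open>The square of the integral is a double integral of f(x) f(y), bounded pointwise after
  symmetrizing in x and y. No normalization is involved, hence no division by zero or infinite
  norms.\<close>

lemma nn_integral_Cauchy_Schwarz:
  fixes f p q :: "'a \<Rightarrow> ennreal"
  assumes [measurable]: "f \<in> borel_measurable M" "p \<in> borel_measurable M" "q \<in> borel_measurable M"
    and b: "\<And>x. (f x)^2 \<le> p x * q x"
  shows "(\<integral>\<^sup>+x. f x \<partial>M)^2 \<le> (\<integral>\<^sup>+x. p x \<partial>M) * (\<integral>\<^sup>+x. q x \<partial>M)"
proof (rule ennreal_double_le_cancel)
  have "(\<integral>\<^sup>+x. f x \<partial>M)^2 + (\<integral>\<^sup>+x. f x \<partial>M)^2 = (\<integral>\<^sup>+x. (\<integral>\<^sup>+y. f x * f y + f x * f y \<partial>M) \<partial>M)"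
    by (simp add: nn_integral_add nn_integral_cmult nn_integral_multc power2_eq_square)
  also have "\<dots> \<le> (\<integral>\<^sup>+x. (\<integral>\<^sup>+y. p x * q y + p y * q x \<partial>M) \<partial>M)"
    by (intro nn_integral_mono ennreal_mult_add_le_of_squares b)
  also have "\<dots> = (\<integral>\<^sup>+x. p x \<partial>M) * (\<integral>\<^sup>+x. q x \<partial>M) + (\<integral>\<^sup>+x. p x \<partial>M) * (\<integral>\<^sup>+x. q x \<partial>M)"
    by (simp add: nn_integral_add nn_integral_cmult nn_integral_multc)
  finally show "(\<integral>\<^sup>+x. f x \<partial>M)^2 + (\<integral>\<^sup>+x. f x \<partial>M)^2
    \<le> (\<integral>\<^sup>+x. p x \<partial>M) * (\<integral>\<^sup>+x. q x \<partial>M) + (\<integral>\<^sup>+x. p x \<partial>M) * (\<integral>\<^sup>+x. q x \<partial>M)" .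
qed

text \<open>Cauchy-Schwarz twice: for fixed z in the plane of x and y, separating A B from C, and
  then in z, separating A from B.\<close>

lemma Loomis_Whitney:
  fixes f :: "real \<Rightarrow> real \<Rightarrow> real \<Rightarrow> ennreal" and A B C :: "real \<Rightarrow> real \<Rightarrow> ennreal"
  assumes [measurable]: "(\<lambda>(x, y, z). f x y z) \<in> borel_measurable borel"
    "case_prod A \<in> borel_measurable borel" "case_prod B \<in> borel_measurable borel" "case_prod C \<in> borel_measurable borel"
    and b: "\<And>x y z. (f x y z)^2 \<le> A y z * B x z * C x y"
  shows "(\<integral>\<^sup>+z. (\<integral>\<^sup>+x. (\<integral>\<^sup>+y. f x y z \<partial>lborel) \<partial>lborel) \<partial>lborel)^2
    \<le> (\<integral>\<^sup>+z. (\<integral>\<^sup>+y. A y z \<partial>lborel) \<partial>lborel) * (\<integral>\<^sup>+z. (\<integral>\<^sup>+x. B x z \<partial>lborel) \<partial>lborel) * (\<integral>\<^sup>+x. (\<integral>\<^sup>+y. C x y \<partial>lborel) \<partial>lborel)"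
proof -
  have A[measurable]: "(\<lambda>x. A (u x) (v x)) \<in> borel_measurable M"
    if "u \<in> borel_measurable M" "v \<in> borel_measurable M" for u v and M :: "'m measure"
    using measurable_compose[OF borel_measurable_Pair[OF that] assms(2)] by simp
  have B[measurable]: "(\<lambda>x. B (u x) (v x)) \<in> borel_measurable M"
    if "u \<in> borel_measurable M" "v \<in> borel_measurable M" for u v and M :: "'m measure"
    using measurable_compose[OF borel_measurable_Pair[OF that] assms(3)] by simp
  have C[measurable]: "(\<lambda>x. C (u x) (v x)) \<in> borel_measurable M"
    if "u \<in> borel_measurable M" "v \<in> borel_measurable M" for u v and M :: "'m measure"
    using measurable_compose[OF borel_measurable_Pair[OF that] assms(4)] by simp
  have f[measurable]: "(\<lambda>x. f (u x) (v x) (w x)) \<in> borel_measurable M"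
    if "u \<in> borel_measurable M" "v \<in> borel_measurable M" "w \<in> borel_measurable M" for u v w and M :: "'m measure"
    using measurable_compose[OF borel_measurable_Pair[OF that(1) borel_measurable_Pair[OF that(2,3)]] assms(1)] by simp
  define K where "K = (\<integral>\<^sup>+x. (\<integral>\<^sup>+y. C x y \<partial>lborel) \<partial>lborel)"
  have inner: "(\<integral>\<^sup>+x. (\<integral>\<^sup>+y. f x y z \<partial>lborel) \<partial>lborel)^2
      \<le> (\<integral>\<^sup>+y. A y z \<partial>lborel) * ((\<integral>\<^sup>+x. B x z \<partial>lborel) * K)" for z
  proof -
    have "(\<integral>\<^sup>+x. (\<integral>\<^sup>+y. f x y z \<partial>lborel) \<partial>lborel) = (\<integral>\<^sup>+t. f (fst t) (snd t) z \<partial>(lborel \<Otimes>\<^sub>M lborel))"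
      by (subst lborel.nn_integral_fst[symmetric]) auto
    moreover have "(\<integral>\<^sup>+t. f (fst t) (snd t) z \<partial>(lborel \<Otimes>\<^sub>M lborel))^2
      \<le> (\<integral>\<^sup>+t. A (snd t) z * B (fst t) z \<partial>(lborel \<Otimes>\<^sub>M lborel)) * (\<integral>\<^sup>+t. C (fst t) (snd t) \<partial>(lborel \<Otimes>\<^sub>M lborel))"
      by (rule nn_integral_Cauchy_Schwarz) (use b in auto)
    moreover have "(\<integral>\<^sup>+t. A (snd t) z * B (fst t) z \<partial>(lborel \<Otimes>\<^sub>M lborel)) = (\<integral>\<^sup>+y. A y z \<partial>lborel) * (\<integral>\<^sup>+x. B x z \<partial>lborel)"
      by (subst lborel.nn_integral_fst[symmetric]) (auto simp: nn_integral_multc nn_integral_cmult)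
    moreover have "(\<integral>\<^sup>+t. C (fst t) (snd t) \<partial>(lborel \<Otimes>\<^sub>M lborel)) = K"
      unfolding K_def by (subst lborel.nn_integral_fst[symmetric]) auto
    ultimately show ?thesis by (simp add: mult.assoc)
  qed
  have "(\<integral>\<^sup>+z. (\<integral>\<^sup>+x. (\<integral>\<^sup>+y. f x y z \<partial>lborel) \<partial>lborel) \<partial>lborel)^2
    \<le> (\<integral>\<^sup>+z. (\<integral>\<^sup>+y. A y z \<partial>lborel) \<partial>lborel) * (\<integral>\<^sup>+z. (\<integral>\<^sup>+x. B x z \<partial>lborel) * K \<partial>lborel)"
    by (rule nn_integral_Cauchy_Schwarz[OF _ _ _ inner]) measurable
  also have "(\<integral>\<^sup>+z. (\<integral>\<^sup>+x. B x z \<partial>lborel) * K \<partial>lborel) = (\<integral>\<^sup>+z. (\<integral>\<^sup>+x. B x z \<partial>lborel) \<partial>lborel) * K"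
    by (rule nn_integral_multc) measurable
  finally show ?thesis by (simp add: K_def mult.assoc)
qed

lemma vector3_eq: "(vector [x, y, z] :: real^3) = x *\<^sub>R axis 1 1 + y *\<^sub>R axis 2 1 + z *\<^sub>R axis 3 1"
  by (auto simp: vec_eq_iff forall_3 axis_def)

lemma continuous_vector3[continuous_intros]:
  "continuous_on S f \<Longrightarrow> continuous_on S g \<Longrightarrow> continuous_on S h \<Longrightarrow> continuous_on S (\<lambda>x. vector [f x, g x, h x] :: real^3)"
  unfolding vector3_eq by (intro continuous_intros)

lemma measurable_vector3[measurable]:
  assumes [measurable]: "f \<in> borel_measurable M" "g \<in> borel_measurable M" "h \<in> borel_measurable M"
  shows "(\<lambda>x. vector [f x, g x, h x] :: real^3) \<in> borel_measurable M"
  unfolding vector3_eq by measurable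

lemma sigma_finite_lborel2: "sigma_finite_measure (lborel \<Otimes>\<^sub>M lborel :: (real \<times> real) measure)"
  unfolding lborel_prod by (rule lborel.sigma_finite_measure_axioms)

text \<open>The order z, x, y is that of the iterated integrals in \<open>Loomis_Whitney\<close>. A
  measure with the right value on boxes is Lebesgue measure.\<close>

lemma lborel_vec3: "(lborel :: (real^3) measure) = distr (lborel \<Otimes>\<^sub>M (lborel \<Otimes>\<^sub>M lborel)) borel (\<lambda>(z, x, y). vector [x, y, z])"
proof (rule lborel_eqI)
  have "continuous_on UNIV (\<lambda>(z, x, y). vector [x, y, z] :: real^3)"
    unfolding case_prod_beta by (intro continuous_intros)
  then have m: "(\<lambda>(z, x, y). vector [x, y, z] :: real^3) \<in> borel_measurable borel"
    by (rule borel_measurable_continuous_onI)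
  then have m'[measurable]: "(\<lambda>(z, x, y). vector [x, y, z] :: real^3) \<in> measurable (lborel \<Otimes>\<^sub>M (lborel \<Otimes>\<^sub>M lborel)) borel"
    by (simp add: lborel_prod)
  fix l u :: "real^3" assume lu: "\<And>b. b \<in> Basis \<Longrightarrow> l \<bullet> b \<le> u \<bullet> b"
  have le: "l $ i \<le> u $ i" for i
    using lu[of "axis i 1"] by (simp add: inner_axis axis_in_Basis_iff)
  have "emeasure (distr (lborel \<Otimes>\<^sub>M (lborel \<Otimes>\<^sub>M lborel)) borel (\<lambda>(z, x, y). vector [x, y, z] :: real^3)) (box l u)
    = emeasure (lborel \<Otimes>\<^sub>M (lborel \<Otimes>\<^sub>M lborel)) ({l$3<..<u$3} \<times> ({l$1<..<u$1} \<times> {l$2<..<u$2}))"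
    by (subst emeasure_distr) (auto simp: space_pair_measure mem_box_cart forall_3 intro!: arg_cong2[where f=emeasure])
  also have "\<dots> = ennreal (u$3 - l$3) * (ennreal (u$1 - l$1) * ennreal (u$2 - l$2))"
  proof -
    have "emeasure (lborel \<Otimes>\<^sub>M (lborel \<Otimes>\<^sub>M lborel)) ({l$3<..<u$3} \<times> ({l$1<..<u$1} \<times> {l$2<..<u$2}))
      = emeasure lborel {l$3<..<u$3} * emeasure (lborel \<Otimes>\<^sub>M lborel) ({l$1<..<u$1} \<times> {l$2<..<u$2})"
      by (rule sigma_finite_measure.emeasure_pair_measure_Times[OF sigma_finite_lborel2]) auto
    also have "emeasure (lborel \<Otimes>\<^sub>M lborel) ({l$1<..<u$1} \<times> {l$2<..<u$2}) = emeasure lborel {l$1<..<u$1} * emeasure lborel {l$2<..<u$2}"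
      by (rule lborel.emeasure_pair_measure_Times) auto
    finally show ?thesis using le by simp
  qed
  also have "\<dots> = ennreal (\<Prod>b\<in>Basis. (u - l) \<bullet> b)"
  proof -
    have "(\<Prod>b\<in>Basis. (u - l) \<bullet> b) = (\<Prod>i\<in>UNIV. (u - l) $ i)"
      unfolding Basis_vec_def
      by (rule prod.reindex_cong[of "\<lambda>i. axis i 1"]) (auto simp: inj_on_def axis_eq_axis inner_axis)
    also have "\<dots> = (u $ 1 - l $ 1) * (u $ 2 - l $ 2) * (u $ 3 - l $ 3)"
      unfolding UNIV_3 by (simp add: ac_simps)
    finally show ?thesis using le by (simp add: ennreal_mult[symmetric] mult_ac)
  qed
  finally show "emeasure (distr (lborel \<Otimes>\<^sub>M (lborel \<Otimes>\<^sub>M lborel)) borel (\<lambda>(z, x, y). vector [x, y, z] :: real^3)) (box l u)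
    = ennreal (\<Prod>b\<in>Basis. (u - l) \<bullet> b)" .
qed simp

lemma nn_integral_vec3:
  fixes f :: "real^3 \<Rightarrow> ennreal"
  assumes [measurable]: "f \<in> borel_measurable borel"
  shows "(\<integral>\<^sup>+x. f x \<partial>lborel) = (\<integral>\<^sup>+z. (\<integral>\<^sup>+x. (\<integral>\<^sup>+y. f (vector [x, y, z]) \<partial>lborel) \<partial>lborel) \<partial>lborel)"
proof -
  have "continuous_on UNIV (\<lambda>(z, x, y). vector [x, y, z] :: real^3)"
    unfolding case_prod_beta by (intro continuous_intros)
  then have m: "(\<lambda>(z, x, y). vector [x, y, z] :: real^3) \<in> borel_measurable borel"
    by (rule borel_measurable_continuous_onI)
  then have m': "(\<lambda>(z, x, y). vector [x, y, z] :: real^3) \<in> measurable (lborel \<Otimes>\<^sub>M (lborel \<Otimes>\<^sub>M lborel)) borel"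
    by (simp add: lborel_prod)
  have m2: "(\<lambda>(z, x, y). f (vector [x, y, z] :: real^3)) \<in> borel_measurable (lborel \<Otimes>\<^sub>M (lborel \<Otimes>\<^sub>M lborel))"
    using measurable_compose[OF m' assms] by (simp add: case_prod_beta')
  have "(\<integral>\<^sup>+x. f x \<partial>lborel) = (\<integral>\<^sup>+t. (case t of (z, x, y) \<Rightarrow> f (vector [x, y, z])) \<partial>(lborel \<Otimes>\<^sub>M (lborel \<Otimes>\<^sub>M lborel)))"
    by (subst lborel_vec3, subst nn_integral_distr) (use m' in \<open>auto simp: case_prod_beta'\<close>)
  also have "\<dots> = (\<integral>\<^sup>+z. (\<integral>\<^sup>+t. (case t of (x, y) \<Rightarrow> f (vector [x, y, z])) \<partial>(lborel \<Otimes>\<^sub>M lborel)) \<partial>lborel)"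
  proof -
    show ?thesis using sigma_finite_measure.nn_integral_fst[OF sigma_finite_lborel2 m2] by simp
  qed
  also have "\<dots> = (\<integral>\<^sup>+z. (\<integral>\<^sup>+x. (\<integral>\<^sup>+y. f (vector [x, y, z]) \<partial>lborel) \<partial>lborel) \<partial>lborel)"
  proof (rule nn_integral_cong)
    fix z :: real
    have "(\<lambda>(x, y). f (vector [x, y, z] :: real^3)) \<in> borel_measurable (lborel \<Otimes>\<^sub>M lborel)"
      using measurable_compose[OF measurable_Pair1'[of z lborel "lborel \<Otimes>\<^sub>M lborel"] m2] by simp
    from lborel.nn_integral_fst[OF this]
    show "(\<integral>\<^sup>+t. (case t of (x, y) \<Rightarrow> f (vector [x, y, z])) \<partial>(lborel \<Otimes>\<^sub>M lborel)) = (\<integral>\<^sup>+x. (\<integral>\<^sup>+y. f (vector [x, y, z]) \<partial>lborel) \<partial>lborel)"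
      by simp
  qed
  finally show ?thesis .
qed


lemma C1_line:
  assumes "C1 f g"
  shows "((\<lambda>s. f (a + s *\<^sub>R b)) has_real_derivative g (a + t *\<^sub>R b) \<bullet> b) (at t)"
proof -
  have "((\<lambda>s. a + s *\<^sub>R b) has_derivative (\<lambda>s. s *\<^sub>R b)) (at t)"
    by (auto intro!: derivative_eq_intros)
  from has_derivative_compose[OF this C1D(1)[OF assms]]
  show ?thesis by (simp add: has_field_derivative_def mult_commute_abs)
qed

lemma abs_le_nn_integral_deriv:
  fixes f :: "real \<Rightarrow> real"
  assumes d: "\<And>t. (f has_real_derivative f' t) (at t)" and c: "continuous_on UNIV f'" and z: "\<And>t. t < - R \<Longrightarrow> f t = 0"
  shows "ennreal \<bar>f x\<bar> \<le> (NNINT t. \<bar>f' t\<bar>)"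
proof -
  \<comment> \<open>A point to the left of the support that does not exceed x, so f x is the
    integral of the derivative from a to x.\<close>
  define a where "a = min x (- R - 1)"
  have [measurable]: "f' \<in> borel_measurable borel" using c by (rule borel_measurable_continuous_onI)
  have "has_bochner_integral lborel (\<lambda>t. f' t * indicator {a..x} t) (f x - f a)"
    by (rule has_bochner_integral_FTC_Icc_real) (use d c in \<open>auto simp: a_def continuous_on_eq_continuous_at\<close>)
  moreover have "f a = 0" by (rule z) (simp add: a_def)
  ultimately have i: "integrable lborel (\<lambda>t. f' t * indicator {a..x} t)" and e: "(LBINT t. f' t * indicator {a..x} t) = f x"
    by (auto simp: has_bochner_integral_iff)
  have "ennreal \<bar>f x\<bar> \<le> (NNINT t. norm (f' t * indicator {a..x} t))"
    using integral_norm_bound_ennreal[OF i] e by simp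
  also have "\<dots> \<le> (NNINT t. \<bar>f' t\<bar>)"
    by (intro nn_integral_mono ennreal_leI) (auto simp: indicator_def)
  finally show ?thesis .
qed

lemma nn_integral_real3_rotations:
  fixes h :: "real^3 \<Rightarrow> ennreal"
  assumes [measurable]: "h \<in> borel_measurable borel"
  shows "(\<integral>\<^sup>+z. (\<integral>\<^sup>+y. (\<integral>\<^sup>+x. h (vector [x, y, z]) \<partial>lborel) \<partial>lborel) \<partial>lborel) = (\<integral>\<^sup>+x. h x \<partial>lborel)"
    "(\<integral>\<^sup>+z. (\<integral>\<^sup>+x. (\<integral>\<^sup>+y. h (vector [x, y, z]) \<partial>lborel) \<partial>lborel) \<partial>lborel) = (\<integral>\<^sup>+x. h x \<partial>lborel)"
    "(\<integral>\<^sup>+x. (\<integral>\<^sup>+y. (\<integral>\<^sup>+z. h (vector [x, y, z]) \<partial>lborel) \<partial>lborel) \<partial>lborel) = (\<integral>\<^sup>+x. h x \<partial>lborel)"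
proof -
  show 2: "(\<integral>\<^sup>+z. (\<integral>\<^sup>+x. (\<integral>\<^sup>+y. h (vector [x, y, z]) \<partial>lborel) \<partial>lborel) \<partial>lborel) = (\<integral>\<^sup>+x. h x \<partial>lborel)"
    by (rule nn_integral_vec3[symmetric]) measurable
  have s1: "(\<integral>\<^sup>+y. (\<integral>\<^sup>+x. h (vector [x, y, z]) \<partial>lborel) \<partial>lborel) = (\<integral>\<^sup>+x. (\<integral>\<^sup>+y. h (vector [x, y, z]) \<partial>lborel) \<partial>lborel)" for z
    by (rule lborel_pair.Fubini') measurable
  show "(\<integral>\<^sup>+z. (\<integral>\<^sup>+y. (\<integral>\<^sup>+x. h (vector [x, y, z]) \<partial>lborel) \<partial>lborel) \<partial>lborel) = (\<integral>\<^sup>+x. h x \<partial>lborel)"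
    unfolding s1 by (rule 2)
  have s2: "(\<integral>\<^sup>+y. (\<integral>\<^sup>+z. h (vector [x, y, z]) \<partial>lborel) \<partial>lborel) = (\<integral>\<^sup>+z. (\<integral>\<^sup>+y. h (vector [x, y, z]) \<partial>lborel) \<partial>lborel)" for x
    by (rule lborel_pair.Fubini') measurable
  have "(\<integral>\<^sup>+x. (\<integral>\<^sup>+z. (\<integral>\<^sup>+y. h (vector [x, y, z]) \<partial>lborel) \<partial>lborel) \<partial>lborel) = (\<integral>\<^sup>+z. (\<integral>\<^sup>+x. (\<integral>\<^sup>+y. h (vector [x, y, z]) \<partial>lborel) \<partial>lborel) \<partial>lborel)"
    by (rule lborel_pair.Fubini') measurable
  then show "(\<integral>\<^sup>+x. (\<integral>\<^sup>+y. (\<integral>\<^sup>+z. h (vector [x, y, z]) \<partial>lborel) \<partial>lborel) \<partial>lborel) = (\<integral>\<^sup>+x. h x \<partial>lborel)"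
    unfolding s2 2 .
qed

lemma measurable_vec_component[measurable]:
  fixes f :: "'a \<Rightarrow> real^'n"
  assumes "f \<in> borel_measurable M"
  shows "(\<lambda>x. f x $ i) \<in> borel_measurable M"
proof -
  have "(\<lambda>x. f x $ i) = (\<lambda>x. f x \<bullet> axis i 1)" by (simp add: inner_axis)
  then show ?thesis using assms by simp
qed

text \<open>|v| is bounded by the integral of each partial derivative along the coordinate line
  through the point. The three bounds each omit one coordinate and their product dominates |v|^3,
  which is the situation of \<open>Loomis_Whitney\<close>.\<close>

lemma Gagliardo_Nirenberg:
  fixes v :: "real^3 \<Rightarrow> real"
  assumes v: "C1c v dv"
  shows "(NNINT x. \<bar>v x\<bar> powr (3/2))^2 \<le> (NNINT x. norm (dv x))^3"
proof -
  have c: "continuous_on UNIV v" "continuous_on UNIV dv" using C1D[OF C1c_C1[OF v]] by simp_all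
  have [measurable]: "v \<in> borel_measurable borel" "dv \<in> borel_measurable borel"
    using c by (auto intro: borel_measurable_continuous_onI)
  obtain R where R: "R > 0" "\<And>x. norm x > R \<Longrightarrow> v x = 0" using C1c_supp[OF v] by metis
  define h where "h i x = ennreal \<bar>dv x $ i\<bar>" for i x
  have hm[measurable]: "h i \<in> borel_measurable borel" for i
    unfolding h_def by measurable
  \<comment> \<open>The base point has i-th coordinate 0, so the parameter is that coordinate and v
    vanishes for parameters below -R.\<close>
  have line: "ennreal \<bar>v (a + t *\<^sub>R axis i 1)\<bar> \<le> (\<integral>\<^sup>+s. h i (a + s *\<^sub>R axis i 1) \<partial>lborel)" if a: "a $ i = 0" for a t i
  proof -
    have "ennreal \<bar>v (a + t *\<^sub>R axis i 1)\<bar> \<le> (NNINT s. \<bar>dv (a + s *\<^sub>R axis i 1) \<bullet> axis i 1\<bar>)"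
    proof (rule abs_le_nn_integral_deriv[where R=R and x=t and f="\<lambda>s. v (a + s *\<^sub>R axis i 1)"])
      show "((\<lambda>s. v (a + s *\<^sub>R axis i 1)) has_real_derivative dv (a + s *\<^sub>R axis i 1) \<bullet> axis i 1) (at s)" for s
        by (rule C1_line[OF C1c_C1[OF v]])
      show "continuous_on UNIV (\<lambda>s. dv (a + s *\<^sub>R axis i 1) \<bullet> axis i 1)"
        by (intro continuous_intros continuous_on_compose2[OF c(2)]) auto
      show "v (a + s *\<^sub>R axis i 1) = 0" if "s < - R" for s
      proof (rule R(2))
        have "\<bar>(a + s *\<^sub>R axis i 1) $ i\<bar> \<le> norm (a + s *\<^sub>R axis i 1)" by (rule component_le_norm_cart)
        then show "R < norm (a + s *\<^sub>R axis i 1)" using that a R(1) by (simp add: axis_def)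
      qed
    qed
    then show ?thesis by (simp add: h_def inner_axis)
  qed
  define A where "A y z = (\<integral>\<^sup>+x. h 1 (vector [x, y, z]) \<partial>lborel)" for y z
  define B where "B x z = (\<integral>\<^sup>+y. h 2 (vector [x, y, z]) \<partial>lborel)" for x z
  define C where "C x y = (\<integral>\<^sup>+z. h 3 (vector [x, y, z]) \<partial>lborel)" for x y
  have ax: "(axis j (1::real)) $ i = (if i = j then 1 else 0)" for i j :: 3
    by (simp add: axis_def)
  have vA: "ennreal \<bar>v (vector [x, y, z])\<bar> \<le> A y z" for x y z
    using line[of "vector [0, y, z]" 1 x] unfolding A_def by (simp add: vector3_eq algebra_simps ax)
  have vB: "ennreal \<bar>v (vector [x, y, z])\<bar> \<le> B x z" for x y z
    using line[of "vector [x, 0, z]" 2 y] unfolding B_def by (simp add: vector3_eq algebra_simps ax)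
  have vC: "ennreal \<bar>v (vector [x, y, z])\<bar> \<le> C x y" for x y z
    using line[of "vector [x, y, 0]" 3 z] unfolding C_def by (simp add: vector3_eq algebra_simps ax)
  have "(NNINT x. \<bar>v x\<bar> powr (3/2))^2
    = (\<integral>\<^sup>+z. (\<integral>\<^sup>+x. (NNINT y. \<bar>v (vector [x, y, z])\<bar> powr (3/2)) \<partial>lborel) \<partial>lborel)^2"
    by (subst nn_integral_vec3) auto
  also have "\<dots> \<le> (\<integral>\<^sup>+z. (\<integral>\<^sup>+y. A y z \<partial>lborel) \<partial>lborel) * (\<integral>\<^sup>+z. (\<integral>\<^sup>+x. B x z \<partial>lborel) \<partial>lborel) * (\<integral>\<^sup>+x. (\<integral>\<^sup>+y. C x y \<partial>lborel) \<partial>lborel)"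
  proof (rule Loomis_Whitney)
    fix x y z
    let ?v = "\<bar>v (vector [x, y, z])\<bar>"
    have "(?v powr (3/2))^2 = ?v ^ 3"
    proof (cases "?v = 0")
      case False
      then have "(?v powr (3/2))^2 = ?v powr 3"
        by (simp add: powr_powr[symmetric] powr_add[symmetric] power2_eq_square)
      then show ?thesis using False by simp
    qed simp
    then have "ennreal (?v powr (3/2))^2 = ennreal ?v * ennreal ?v * ennreal ?v"
      by (simp add: ennreal_power ennreal_mult[symmetric] power3_eq_cube)
    also have "\<dots> \<le> A y z * B x z * C x y"
      by (intro mult_mono vA vB vC) auto
    finally show "ennreal (?v powr (3/2))^2 \<le> A y z * B x z * C x y" .
  next
    show "(\<lambda>(x, y, z). ennreal (\<bar>v (vector [x, y, z])\<bar> powr (3/2))) \<in> borel_measurable borel"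
      unfolding borel_prod[symmetric] by measurable
    show "case_prod A \<in> borel_measurable borel" "case_prod B \<in> borel_measurable borel" "case_prod C \<in> borel_measurable borel"
      unfolding A_def B_def C_def borel_prod[symmetric] by measurable
  qed
  also have "\<dots> = (\<integral>\<^sup>+x. h 1 x \<partial>lborel) * (\<integral>\<^sup>+x. h 2 x \<partial>lborel) * (\<integral>\<^sup>+x. h 3 x \<partial>lborel)"
    unfolding A_def B_def C_def by (simp add: nn_integral_real3_rotations hm)
  also have "\<dots> \<le> (NNINT x. norm (dv x)) * (NNINT x. norm (dv x)) * (NNINT x. norm (dv x))"
    by (intro mult_mono nn_integral_mono) (auto simp: h_def component_le_norm_cart)
  finally show ?thesis by (simp add: power3_eq_cube mult.assoc)
qed

text \<open>The Gagliardo--Nirenberg inequality for \<open>\<phi>\<^sup>4\<close>, whose gradient is \<open>4 \<phi>\<^sup>3 \<nabla>\<phi>\<close>.\<close>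

lemma Sobolev_6_2:
  fixes \<phi> :: "real^3 \<Rightarrow> real"
  assumes \<phi>: "C1c \<phi> d\<phi>"
  shows "(NNINT x. \<bar>\<phi> x\<bar>^6) \<le> 4096 * (NNINT x. norm (d\<phi> x)^2)^3"
proof -
  have c: "continuous_on UNIV \<phi>" "continuous_on UNIV d\<phi>" using C1D[OF C1c_C1[OF \<phi>]] by simp_all
  have [measurable]: "\<phi> \<in> borel_measurable borel" "d\<phi> \<in> borel_measurable borel"
    using c by (auto intro: borel_measurable_continuous_onI)
  define v where "v x = (\<phi> x)^4" for x
  define dv where "dv x = (4 * (\<phi> x)^3) *\<^sub>R d\<phi> x" for x
  have "C1 v dv" unfolding v_def dv_def
    by (rule C1_compose_real[OF C1c_C1[OF \<phi>]]) (auto intro!: derivative_eq_intros continuous_intros)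
  moreover have "bsupp v" using bsupp_C1c(1)[OF \<phi>] by (auto simp: bsupp_def v_def)
  ultimately have v: "C1c v dv" by (simp add: C1c_def)
  define S where "S = (NNINT x. \<bar>\<phi> x\<bar>^6)"
  define D where "D = (NNINT x. norm (d\<phi> x)^2)"
  define J where "J = (NNINT x. norm (dv x))"
  have p: "\<bar>v x\<bar> powr (3/2) = \<bar>\<phi> x\<bar>^6" for x
  proof (cases "\<phi> x = 0")
    case False
    have "\<bar>v x\<bar> = \<bar>\<phi> x\<bar>^4" unfolding v_def by (rule power_abs)
    also have "\<dots> = \<bar>\<phi> x\<bar> powr 4" using powr_realpow[of "\<bar>\<phi> x\<bar>" 4] False by simp
    finally have "\<bar>v x\<bar> powr (3/2) = (\<bar>\<phi> x\<bar> powr 4) powr (3/2)" by simp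
    also have "\<dots> = \<bar>\<phi> x\<bar> powr 6" unfolding powr_powr by simp
    also have "\<dots> = \<bar>\<phi> x\<bar>^6" using powr_realpow[of "\<bar>\<phi> x\<bar>" 6] False by simp
    finally show ?thesis .
  qed (simp add: v_def)
  have SJ: "S^2 \<le> J^3" using Gagliardo_Nirenberg[OF v] unfolding S_def J_def p .
  \<comment> \<open>Cauchy-Schwarz for the gradient of \<phi>^4; the factor 16 is the square of the
    4 in it.\<close>
  have JSD: "J^2 \<le> 16 * S * D"
  proof -
    have "J^2 \<le> (\<integral>\<^sup>+x. 16 * ennreal (\<bar>\<phi> x\<bar>^6) \<partial>lborel) * D"
      unfolding J_def D_def
    proof (rule nn_integral_Cauchy_Schwarz)
      fix x
      have "(norm (dv x))^2 = 16 * \<bar>\<phi> x\<bar>^6 * (norm (d\<phi> x))^2"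
        by (simp add: dv_def power_mult_distrib power_mult[symmetric] abs_mult power_abs)
      then show "(ennreal (norm (dv x)))^2 \<le> 16 * ennreal (\<bar>\<phi> x\<bar>^6) * ennreal ((norm (d\<phi> x))^2)"
        by (simp add: ennreal_power ennreal_mult)
    qed (auto simp: dv_def)
    also have "(\<integral>\<^sup>+x. 16 * ennreal (\<bar>\<phi> x\<bar>^6) \<partial>lborel) = 16 * S"
      unfolding S_def by (rule nn_integral_cmult) measurable
    finally show ?thesis by (simp add: mult.assoc)
  qed
  have "bsupp (\<lambda>x. \<bar>\<phi> x\<bar>^6)" "bsupp (\<lambda>x. norm (d\<phi> x)^2)"
    using bsupp_C1c[OF \<phi>] unfolding bsupp_def by force+
  moreover have "continuous_on UNIV (\<lambda>x. \<bar>\<phi> x\<bar>^6)" "continuous_on UNIV (\<lambda>x. norm (d\<phi> x)^2)"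
    using c by (auto intro!: continuous_intros)
  ultimately have i: "integrable lborel (\<lambda>x. \<bar>\<phi> x\<bar>^6)" "integrable lborel (\<lambda>x. norm (d\<phi> x)^2)"
    using integrable_bsupp by blast+
  \<comment> \<open>S is finite because the support is bounded. Hence S^3 can be cancelled, in the
    reals, from S^4 \<le> J^6 \<le> (16 S D)^3, and 4096 is 16^3.\<close>
  define s where "s = (LBINT x. \<bar>\<phi> x\<bar>^6)"
  define d where "d = (LBINT x. norm (d\<phi> x)^2)"
  have sd: "S = ennreal s" "D = ennreal d" "s \<ge> 0" "d \<ge> 0"
    unfolding S_def D_def s_def d_def using i by (auto intro!: nn_integral_eq_integral)
  have "S^4 \<le> 4096 * S^3 * D^3"
  proof -
    have "S^4 = (S^2)^2" by (simp add: power_mult[symmetric])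
    also have "\<dots> \<le> (J^3)^2" using SJ by (rule power_mono) simp
    also have "\<dots> = (J^2)^3" by (simp add: power_mult[symmetric])
    also have "\<dots> \<le> (16 * S * D)^3" using JSD by (rule power_mono) simp
    finally show ?thesis by (simp add: power_mult_distrib)
  qed
  then have "ennreal (s^4) \<le> ennreal (4096 * s^3 * d^3)"
    using sd by (simp add: ennreal_power ennreal_mult)
  then have "s^4 \<le> 4096 * s^3 * d^3" using sd by (simp add: ennreal_le_iff)
  then have "s \<le> 4096 * d^3"
  proof (cases "s = 0")
    case False
    assume "s^4 \<le> 4096 * s^3 * d^3"
    then have "s^3 * s \<le> s^3 * (4096 * d^3)" by (simp add: power4_eq_xxxx power3_eq_cube mult_ac)
    then show ?thesis using False sd(3) by (simp add: mult_le_cancel_left_pos)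
  qed (use sd in simp)
  then have "ennreal s \<le> ennreal (4096 * d^3)" by (rule ennreal_leI)
  then show ?thesis using sd unfolding S_def[symmetric] D_def[symmetric]
    by (simp add: ennreal_mult ennreal_power)
qed

section \<open>Mollifiers and weak gradients\<close>

lemma sets_cball[measurable]: "cball (a::'a::euclidean_space) R \<in> sets borel"
  by simp

lemma ennreal_squeeze_0:
  fixes f g :: "'a \<Rightarrow> ennreal"
  assumes "\<And>n. f n \<le> g n" "(g \<longlongrightarrow> 0) F"
  shows "(f \<longlongrightarrow> 0) F"
  by (rule tendsto_sandwich[OF _ _ tendsto_const assms(2)]) (simp_all add: assms(1))

lemma real_tendsto_0_from_ennreal:
  fixes f :: "'a \<Rightarrow> 'b::real_normed_vector"
  assumes "((\<lambda>x. ennreal (norm (f x))) \<longlongrightarrow> 0) F"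
  shows "(f \<longlongrightarrow> 0) F"
proof (rule tendsto_norm_zero_cancel)
  have "((\<lambda>x. ennreal (norm (f x))) \<longlongrightarrow> ennreal 0) F" using assms by simp
  then show "((\<lambda>x. norm (f x)) \<longlongrightarrow> 0) F" by (subst (asm) tendsto_ennreal_iff) auto
qed

text \<open>Smoothness can be shown with a derivative in closed form, without evaluating
  \<open>frechet_derivative\<close>.\<close>

lemma Ck_SucI:
  assumes "\<And>x. (f has_derivative D x) (at x)" "\<And>v. Ck_fun k (\<lambda>x. D x v)"
  shows "Ck_fun (Suc k) f"
proof -
  have "frechet_derivative f (at x) = D x" for x
    using frechet_derivative_at[OF assms(1)] by simp
  then show ?thesis using assms by (auto simp: differentiable_def)
qed

lemma Ck_SucD:
  assumes "Ck_fun (Suc k) f"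
  shows "(f has_derivative frechet_derivative f (at x)) (at x)" "Ck_fun k (\<lambda>x. frechet_derivative f (at x) v)"
  using assms by (auto simp: frechet_derivative_works)

lemma Ck_const: "Ck_fun k (\<lambda>x. c)"
proof (induction k arbitrary: c)
  case (Suc k)
  show ?case by (rule Ck_SucI[of _ "\<lambda>_ _. 0"]) (use Suc in auto)
qed auto

lemma Ck_mono: "Ck_fun (Suc k) f \<Longrightarrow> Ck_fun k f"
proof (induction k arbitrary: f)
  case 0
  then have "\<And>x. isCont f x" using Ck_SucD(1)[OF 0] has_derivative_continuous by blast
  then show ?case by (simp add: continuous_at_imp_continuous_on)
next
  case (Suc k)
  show ?case
    by (rule Ck_SucI[OF Ck_SucD(1)[OF Suc.prems] Suc.IH[OF Ck_SucD(2)[OF Suc.prems]]])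
qed

lemma Ck_add: "Ck_fun k f \<Longrightarrow> Ck_fun k g \<Longrightarrow> Ck_fun k (\<lambda>x. f x + g x)"
proof (induction k arbitrary: f g)
  case (Suc k)
  show ?case
    by (rule Ck_SucI[OF has_derivative_add[OF Ck_SucD(1)[OF Suc.prems(1)] Ck_SucD(1)[OF Suc.prems(2)]]
        Suc.IH[OF Ck_SucD(2)[OF Suc.prems(1)] Ck_SucD(2)[OF Suc.prems(2)]]])
qed (auto intro: continuous_on_add)

lemma Ck_mult:
  fixes f g :: "'a::euclidean_space \<Rightarrow> real"
  shows "Ck_fun k f \<Longrightarrow> Ck_fun k g \<Longrightarrow> Ck_fun k (\<lambda>x. f x * g x)"
proof (induction k arbitrary: f g)
  case (Suc k)
  show ?case
    by (rule Ck_SucI[OF has_derivative_mult[OF Ck_SucD(1)[OF Suc.prems(1)] Ck_SucD(1)[OF Suc.prems(2)]]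
        Ck_add[OF Suc.IH[OF Ck_mono[OF Suc.prems(1)] Ck_SucD(2)[OF Suc.prems(2)]]
          Suc.IH[OF Ck_SucD(2)[OF Suc.prems(1)] Ck_mono[OF Suc.prems(2)]]]])
qed (auto intro: continuous_on_mult)

lemma Ck_inner: "Ck_fun k (\<lambda>y. (x - y) \<bullet> v)"
proof (cases k)
  case (Suc j)
  show ?thesis unfolding Suc
    by (rule Ck_SucI[of _ "\<lambda>_ h. - (h \<bullet> v)"]) (auto intro!: derivative_eq_intros Ck_const)
qed (auto intro!: continuous_intros)

text \<open>The functions P(1/t) exp(-1/t), continued by 0, are closed under differentiation: P is
  replaced by X^2 (P - P'). This makes the smoothness of the bump an induction over all P at
  once.\<close>

definition exp_poly :: "real poly \<Rightarrow> real \<Rightarrow> real" where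
  "exp_poly P t = (if t > 0 then poly P (1/t) * exp (- (1/t)) else 0)"

lemma poly_exp_tendsto_0: "((\<lambda>y::real. poly P y * exp (- y)) \<longlongrightarrow> 0) at_top"
proof -
  have "((\<lambda>y::real. \<Sum>i\<le>degree P. coeff P i * (y ^ i / exp y)) \<longlongrightarrow> (\<Sum>i\<le>degree P. coeff P i * 0)) at_top"
    by (intro tendsto_intros tendsto_power_div_exp_0)
  moreover have "poly P y * exp (- y) = (\<Sum>i\<le>degree P. coeff P i * (y ^ i / exp y))" for y
    by (simp add: poly_altdef sum_distrib_right exp_minus divide_inverse mult.assoc)
  ultimately show ?thesis by simp
qed

lemma exp_poly_deriv:
  "(exp_poly P has_real_derivative exp_poly (pCons 0 (pCons 0 (P - pderiv P))) t) (at t)"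
proof -
  consider "t > 0" | "t < 0" | "t = 0" by linarith
  then show ?thesis
  proof cases
    case 1
    have "((\<lambda>t. poly P (1/t) * exp (- (1/t))) has_real_derivative
       poly P (1/t) * (exp (- (1/t)) * (1/t^2)) + poly (pderiv P) (1/t) * (- (1/t^2)) * exp (- (1/t))) (at t)"
      using 1 by (auto intro!: derivative_eq_intros DERIV_chain2[OF poly_DERIV] simp: power2_eq_square)
    then have "((\<lambda>t. poly P (1/t) * exp (- (1/t))) has_real_derivative exp_poly (pCons 0 (pCons 0 (P - pderiv P))) t) (at t)"
      using 1 by (simp add: exp_poly_def field_simps power2_eq_square)
    then show ?thesis
      by (rule has_field_derivative_transform_within_open[where S="{0<..}"]) (use 1 in \<open>auto simp: exp_poly_def\<close>)
  next
    case 2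
    have "((\<lambda>t. 0) has_real_derivative exp_poly (pCons 0 (pCons 0 (P - pderiv P))) t) (at t)"
      using 2 by (simp add: exp_poly_def)
    then show ?thesis
      by (rule has_field_derivative_transform_within_open[where S="{..<0}"]) (use 2 in \<open>auto simp: exp_poly_def\<close>)
  next
    case 3
    \<comment> \<open>The difference quotient at 0. From the right, division by h multiplies P by
      its variable, so it is again of the same form and tends to 0; from the left it is 0.\<close>
    have "((\<lambda>h. exp_poly P h / h) \<longlongrightarrow> 0) (at 0)"
    proof (rule filterlim_split_at)
      have "((\<lambda>y. poly (pCons 0 P) y * exp (- y)) \<longlongrightarrow> 0) at_top" by (rule poly_exp_tendsto_0)
      from filterlim_compose[OF this filterlim_inverse_at_top_right]
      have "((\<lambda>h. poly (pCons 0 P) (inverse h) * exp (- inverse h)) \<longlongrightarrow> 0) (at_right 0)" .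
      moreover have "\<forall>\<^sub>F h in at_right 0. poly (pCons 0 P) (inverse h) * exp (- inverse h) = exp_poly P h / h"
        by (rule eventually_at_right_less[THEN eventually_mono]) (auto simp: exp_poly_def field_simps)
      ultimately show "((\<lambda>h. exp_poly P h / h) \<longlongrightarrow> 0) (at_right 0)"
        by (rule Lim_transform_eventually)
      have "\<forall>\<^sub>F h in at_left 0. (0::real) = exp_poly P h / h"
        using eventually_at_left_real[of "-1" 0] by (auto elim!: eventually_mono simp: exp_poly_def)
      then show "((\<lambda>h. exp_poly P h / h) \<longlongrightarrow> 0) (at_left 0)"
        by (rule Lim_transform_eventually[OF tendsto_const])
    qed
    then show ?thesis unfolding 3 by (simp add: DERIV_def exp_poly_def)
  qed
qed

text \<open>Stated for the reflected, shifted and scaled bump, because test functions of the form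
  \<open>mollifier n (x - y)\<close> in y are used throughout, and for every P, because the
  induction changes P.\<close>

lemma Ck_exp_poly: "Ck_fun k (\<lambda>y. exp_poly P (1 - c * ((x - y) \<bullet> (x - y))))"
proof (induction k arbitrary: P)
  case 0
  have "continuous_on UNIV (exp_poly P)"
    using exp_poly_deriv by (intro continuous_at_imp_continuous_on) (blast intro: DERIV_isCont)
  then show ?case unfolding Ck_fun.simps
    by (rule continuous_on_compose2) (auto intro!: continuous_intros)
next
  case (Suc k)
  let ?P' = "pCons 0 (pCons 0 (P - pderiv P))"
  show ?case
  proof (rule Ck_SucI)
    fix y
    have "((\<lambda>y. 1 - c * ((x - y) \<bullet> (x - y))) has_derivative (\<lambda>v. 2 * c * ((x - y) \<bullet> v))) (at y)"
      by (auto intro!: derivative_eq_intros simp: inner_commute algebra_simps)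
    from has_derivative_compose[OF this exp_poly_deriv[unfolded has_field_derivative_def]]
    show "((\<lambda>y. exp_poly P (1 - c * ((x - y) \<bullet> (x - y)))) has_derivative
       (\<lambda>v. exp_poly ?P' (1 - c * ((x - y) \<bullet> (x - y))) * (2 * c * ((x - y) \<bullet> v)))) (at y)" .
  next
    show "Ck_fun k (\<lambda>y. exp_poly ?P' (1 - c * ((x - y) \<bullet> (x - y))) * (2 * c * ((x - y) \<bullet> v)))" for v
      by (intro Ck_mult Suc.IH Ck_const Ck_inner)
  qed
qed

lemma compactly_supported_iff: "compactly_supported f \<longleftrightarrow> bsupp f"
proof
  assume "compactly_supported f"
  then have "bounded (closure {x. f x \<noteq> 0})" unfolding compactly_supported_def by (rule compact_imp_bounded)
  then have "bounded {x. f x \<noteq> 0}" by (rule bounded_subset) (rule closure_subset)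
  then obtain B where "\<forall>x\<in>{x. f x \<noteq> 0}. norm x \<le> B" by (auto simp: bounded_iff)
  then show "bsupp f" unfolding bsupp_def by (intro exI[of _ B]) force
next
  assume "bsupp f"
  then obtain R where "\<And>x. norm x > R \<Longrightarrow> f x = 0" by (auto simp: bsupp_def)
  then have "{x. f x \<noteq> 0} \<subseteq> cball 0 R" by (auto simp: not_less[symmetric])
  then have "bounded {x. f x \<noteq> 0}" by (rule bounded_subset[OF bounded_cball])
  then show "compactly_supported f" unfolding compactly_supported_def compact_closure .
qed

text \<open>The classical function exp(-1/(1 - |x|^2)) on the unit ball.\<close>

definition bump :: "'a::euclidean_space \<Rightarrow> real" where
  "bump x = exp_poly 1 (1 - x \<bullet> x)"

lemma bump_nonneg: "0 \<le> bump x"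
  by (simp add: bump_def exp_poly_def)

lemma bump_zero:
  assumes "norm x \<ge> 1" shows "bump x = 0"
proof -
  have "1 \<le> (norm x)^2" using assms by (rule one_le_power)
  then show ?thesis by (simp add: bump_def exp_poly_def dot_square_norm)
qed

lemma bump_pos: "norm x < 1 \<Longrightarrow> bump x > 0"
  by (simp add: bump_def exp_poly_def dot_square_norm power_less_one_iff abs_square_less_1)

lemma bump_continuous: "continuous_on UNIV (bump :: 'a::euclidean_space \<Rightarrow> real)"
  using Ck_exp_poly[of 0 1 1 "0::'a"] by (simp add: bump_def[abs_def])

definition bump_mass :: "'a::euclidean_space itself \<Rightarrow> real" where
  "bump_mass _ = (LBINT x. bump (x :: 'a))"

text \<open>The scale is 1/(n + 1), so that n = 0 is meaningful; \<open>mollifier 0\<close>, the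
  normalized bump on the unit ball, later serves as a cut-off as well.\<close>

definition mollifier :: "nat \<Rightarrow> 'a::euclidean_space \<Rightarrow> real" where
  "mollifier n x = real (Suc n) ^ DIM('a) / bump_mass TYPE('a) * bump (real (Suc n) *\<^sub>R x)"

lemma integrable_bump: "integrable lborel (bump :: 'a::euclidean_space \<Rightarrow> real)"
  by (rule integrable_bsupp[OF bump_continuous]) (auto simp: bsupp_def intro!: exI[of _ 1] bump_zero)

lemma bump_mass_pos: "bump_mass TYPE('a::euclidean_space) > 0"
proof (rule ccontr)
  assume "\<not> ?thesis"
  moreover have "bump_mass TYPE('a) \<ge> 0" unfolding bump_mass_def by (simp add: bump_nonneg)
  ultimately have "(LBINT x. bump (x :: 'a)) = 0" by (simp add: bump_mass_def)
  then have "AE x in lborel. bump (x::'a) = 0"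
    by (subst (asm) integral_nonneg_eq_0_iff_AE[OF integrable_bump]) (auto simp: bump_nonneg)
  then have "AE x in lborel. x \<notin> ball (0::'a) 1"
    by eventually_elim (metis bump_pos less_irrefl mem_ball_0)
  then have "emeasure lborel (ball (0::'a) 1) = 0"
    by (subst (asm) AE_iff_measurable[of "ball 0 1"]) auto
  moreover have "emeasure lborel (ball (0::'a) 1) \<noteq> 0"
    using open_ball[of "0::'a" 1] open_not_negligible[of "ball (0::'a) 1"]
    by (auto simp: negligible_iff_emeasure0)
  ultimately show False by simp
qed

lemma mollifier_zero:
  assumes "norm h > 1 / real (Suc n)" shows "mollifier n h = 0"
proof -
  have "norm (real (Suc n) *\<^sub>R h) = real (Suc n) * norm h" by simp
  also have "\<dots> \<ge> 1" using assms by (simp add: pos_divide_less_eq mult.commute)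
  finally have "bump (real (Suc n) *\<^sub>R h) = 0" by (rule bump_zero)
  then show ?thesis unfolding mollifier_def by (simp only: mult_zero_right)
qed

lemma approx_id_mollifier: "approx_id (mollifier :: nat \<Rightarrow> 'a::euclidean_space \<Rightarrow> real)"
  unfolding approx_id_def
proof (intro conjI allI)
  fix n
  show "continuous_on UNIV (mollifier n :: 'a \<Rightarrow> real)"
    unfolding mollifier_def[abs_def]
    by (intro continuous_intros continuous_on_compose2[OF bump_continuous]) auto
  show "0 \<le> mollifier n (h::'a)" for h
    using bump_mass_pos[where 'a='a] by (simp add: mollifier_def bump_nonneg)
  have "bump_mass TYPE('a) = real (Suc n) ^ DIM('a) * (LBINT x. bump (real (Suc n) *\<^sub>R (x::'a)))"
    unfolding bump_mass_def using lborel_integral_affine[of "bump :: 'a \<Rightarrow> real" "real (Suc n)" 0] integrable_bump[where 'a='a]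
    by simp
  then show "(LBINT h. mollifier n (h::'a)) = 1"
    using bump_mass_pos[where 'a='a] unfolding mollifier_def[abs_def] by (auto simp del: of_nat_Suc)
next
  show "\<exists>r. r \<longlonglongrightarrow> 0 \<and> (\<forall>n h. r n < norm h \<longrightarrow> mollifier n (h::'a) = 0)"
    using mollifier_zero LIMSEQ_inverse_real_of_nat
    by (intro exI[of _ "\<lambda>n. 1 / real (Suc n)"]) (auto simp: inverse_eq_divide)
qed

text \<open>As a function of y the shifted kernel is a test function, so evaluating a mollification
  at x is the same as testing.\<close>

lemma mollifier_Cc_inf: "(\<lambda>y. mollifier n ((x::'a::euclidean_space) - y)) \<in> Cc_inf"
proof -
  have "bsupp (\<lambda>y. mollifier n (x - y))"
    using bsupp_affine[OF approx_idD(4)[OF approx_id_mollifier, of n], of "-1" x] by simp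
  moreover have "mollifier n (x - y) = real (Suc n) ^ DIM('a) / bump_mass TYPE('a) * exp_poly 1 (1 - (real (Suc n))^2 * ((x - y) \<bullet> (x - y)))" for x y :: 'a
    by (simp add: mollifier_def bump_def power2_eq_square mult.assoc)
  then have "Ck_fun k (\<lambda>y. mollifier n (x - y))" for k
    by (simp only:) (intro Ck_mult Ck_const Ck_exp_poly)
  ultimately show ?thesis by (auto simp: Cc_inf_def Cc_def compactly_supported_iff)
qed


section \<open>Test functions as pairs of a function and its gradient\<close>

lemma frechet_eq_grad:
  assumes "(f has_derivative F) (at x)"
  shows "F h = grad f x \<bullet> h"
proof -
  have F: "frechet_derivative f (at x) = F" using frechet_derivative_at[OF assms] by simp
  interpret F: bounded_linear F using assms by (rule has_derivative_bounded_linear)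
  have "h = (\<Sum>i\<in>UNIV. h $ i *\<^sub>R axis i 1)"
    using basis_expansion[of h] by (simp add: scalar_mult_eq_scaleR)
  then have "F h = F (\<Sum>i\<in>UNIV. h $ i *\<^sub>R axis i 1)" by simp
  also have "\<dots> = (\<Sum>i\<in>UNIV. h $ i * F (axis i 1))" by (simp add: F.sum F.scaleR)
  also have "\<dots> = grad f x \<bullet> h" by (simp add: grad_def inner_vec_def F mult.commute)
  finally show ?thesis .
qed

lemma Cc1_C1c:
  assumes "f \<in> Cc 1"
  shows "C1c f (grad f)"
proof -
  have k: "Ck_fun (Suc 0) f" and b: "bsupp f" using assms by (auto simp: Cc_def compactly_supported_iff)
  have eq: "frechet_derivative f (at x) = (\<bullet>) (grad f x)" for x
    using frechet_eq_grad[OF Ck_SucD(1)[OF k]] by (rule ext)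
  have "continuous_on UNIV (\<lambda>x. grad f x)"
    unfolding grad_def using Ck_SucD(2)[OF k] by (intro continuous_on_vec_lambda) simp
  then show ?thesis using Ck_SucD(1)[OF k] b unfolding C1c_def C1_def eq by simp
qed

lemma C1c_Cc1:
  assumes "C1c f g"
  shows "f \<in> Cc 1" "grad f = g"
proof -
  have d: "(f has_derivative (\<bullet>) (g x)) (at x)" for x using C1D(1)[OF C1c_C1[OF assms]] .
  have "Ck_fun (Suc 0) f"
    by (rule Ck_SucI[OF d]) (use C1D(2)[OF C1c_C1[OF assms]] in \<open>auto intro!: continuous_intros\<close>)
  then show "f \<in> Cc 1" using bsupp_C1c(1)[OF assms] by (simp add: Cc_def compactly_supported_iff)
  show "grad f = g"
  proof (rule ext)
    fix x
    have "\<forall>h. g x \<bullet> h = grad f x \<bullet> h" using frechet_eq_grad[OF d] by blast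
    then show "grad f x = g x" by (metis inner_commute vector_eq_rdot)
  qed
qed

lemma Cc_inf_Cc: "f \<in> Cc_inf \<Longrightarrow> f \<in> Cc k"
  by (simp add: Cc_inf_def)

lemma Cc_inf_C1c: "f \<in> Cc_inf \<Longrightarrow> C1c f (grad f)"
  by (intro Cc1_C1c Cc_inf_Cc)

lemma Cc_inf_grad:
  assumes "f \<in> Cc_inf"
  shows "(\<lambda>x. grad f x $ i) \<in> Cc_inf"
proof -
  have "Ck_fun k (\<lambda>x. grad f x $ i)" for k
    using assms Ck_SucD(2)[of k f "axis i 1"] by (simp add: Cc_inf_def Cc_def grad_def del: Ck_fun.simps)
  moreover have "bsupp (\<lambda>x. grad f x $ i)"
    using bsupp_C1c(2)[OF Cc_inf_C1c[OF assms]] unfolding bsupp_def by (metis zero_index)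
  ultimately show ?thesis by (simp add: Cc_inf_def Cc_def compactly_supported_iff)
qed

section \<open>Borel representatives and the fundamental lemma of the calculus of variations\<close>

lemma lebesgue_ex_borel:
  fixes f :: "'a::euclidean_space \<Rightarrow> 'b::euclidean_space"
  assumes "f \<in> borel_measurable lebesgue"
  obtains g where "g \<in> borel_measurable borel" "AE x in lebesgue. f x = g x"
proof -
  have "\<exists>g. g \<in> borel_measurable lborel \<and> (AE x in lborel. f x \<bullet> b = g x)" for b
  proof -
    have "(\<lambda>x. f x \<bullet> b) \<in> borel_measurable lebesgue" using assms by simp
    from completion_ex_borel_measurable_real[OF this] show ?thesis by blast
  qed
  then obtain g where g: "\<And>b. g b \<in> borel_measurable lborel" "\<And>b. AE x in lborel. f x \<bullet> b = g b x"
    by metis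
  have [measurable]: "g b \<in> borel_measurable borel" for b using g(1)[of b] by simp
  have "AE x in lborel. \<forall>b\<in>Basis. f x \<bullet> b = g b x"
    using g(2) by (intro AE_finite_allI) auto
  then have "AE x in lborel. f x = (\<Sum>b\<in>Basis. g b x *\<^sub>R b)"
  proof eventually_elim
    case (elim x)
    have "f x = (\<Sum>b\<in>Basis. (f x \<bullet> b) *\<^sub>R b)" by (rule euclidean_representation[symmetric])
    also have "\<dots> = (\<Sum>b\<in>Basis. g b x *\<^sub>R b)" using elim by (intro sum.cong) auto
    finally show ?case .
  qed
  then show ?thesis
    by (intro that[of "\<lambda>x. \<Sum>b\<in>Basis. g b x *\<^sub>R b"]) (auto intro: AE_completion)
qed

lemma L1_loc_locint:
  assumes f: "f \<in> L1_loc" and g[measurable]: "g \<in> borel_measurable borel" and fg: "AE x in lebesgue. f x = g x"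
  shows "locint g"
  unfolding locint_def
proof (intro conjI allI)
  fix R
  have "integrable lebesgue (\<lambda>x. indicator (cball 0 R) x *\<^sub>R f x)"
    using f by (auto simp: L1_loc_def set_integrable_def)
  then have "integrable lebesgue (\<lambda>x. indicator (cball 0 R) x *\<^sub>R g x)"
  proof (rule integrable_cong_AE_imp)
    have "(\<lambda>x. indicat_real (cball 0 R) x *\<^sub>R g x) \<in> borel_measurable lborel" by measurable
    then show "(\<lambda>x. indicat_real (cball 0 R) x *\<^sub>R g x) \<in> borel_measurable lebesgue"
      by (rule measurable_completion)
    show "AE x in lebesgue. indicat_real (cball 0 R) x *\<^sub>R f x = indicat_real (cball 0 R) x *\<^sub>R g x"
      using fg by eventually_elim simp
  qed
  then show "integrable lborel (\<lambda>x. indicator (cball 0 R) x *\<^sub>R g x)"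
    by (subst (asm) integrable_completion) auto
qed (rule g)

lemma L1_loc_measurable:
  fixes f :: "'a::euclidean_space \<Rightarrow> 'b::euclidean_space"
  assumes "f \<in> L1_loc"
  shows "f \<in> borel_measurable lebesgue"
proof (rule borel_measurable_LIMSEQ_metric)
  show "(\<lambda>x. indicator (cball 0 (real n)) x *\<^sub>R f x) \<in> borel_measurable lebesgue" for n
    using assms unfolding L1_loc_def set_integrable_def by (intro borel_measurable_integrable) auto
  fix x :: 'a
  obtain N :: nat where N: "norm x \<le> N" using real_arch_simple by blast
  have "\<forall>\<^sub>F n in sequentially. indicator (cball 0 (real n)) x *\<^sub>R f x = f x"
    using eventually_ge_at_top[of N] by eventually_elim (use N in auto)
  then show "(\<lambda>n. indicator (cball 0 (real n)) x *\<^sub>R f x) \<longlonglongrightarrow> f x" by (rule tendsto_eventually)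
qed

lemma locint_L1_loc:
  assumes g: "locint g" and f: "f \<in> borel_measurable lebesgue" and fg: "AE x in lebesgue. f x = g x"
  shows "f \<in> L1_loc"
  unfolding L1_loc_def set_integrable_def
proof (intro CollectI allI impI)
  fix K :: "'a set" assume K: "compact K"
  have [measurable]: "g \<in> borel_measurable borel" "K \<in> sets borel" using g K by (auto dest: locint_measurable compact_imp_closed)
  from K obtain R where R: "K \<subseteq> cball 0 R"
    using compact_imp_bounded[OF K] by (auto simp: bounded_iff subset_eq)
  have "integrable lborel (\<lambda>x. indicator K x *\<^sub>R g x)"
    by (rule locint_mult_bounded[OF g, of _ 1 R]) (use R in \<open>auto simp: indicator_def\<close>)
  then have "integrable lebesgue (\<lambda>x. indicator K x *\<^sub>R g x)" by (subst integrable_completion) auto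
  then show "integrable lebesgue (\<lambda>x. indicator K x *\<^sub>R f x)"
  proof (rule integrable_cong_AE_imp)
    have "indicat_real K \<in> borel_measurable lebesgue" by (rule measurable_completion) simp
    then show "(\<lambda>x. indicat_real K x *\<^sub>R f x) \<in> borel_measurable lebesgue"
      using f by (intro borel_measurable_scaleR)
    show "AE x in lebesgue. indicat_real K x *\<^sub>R g x = indicat_real K x *\<^sub>R f x"
      using fg by eventually_elim simp
  qed
qed

text \<open>Testing with shifted mollifiers shows that all mollifications of the components vanish
  identically. They also converge to the components in L^1 on balls.\<close>

lemma locint_zero_if_orthogonal:
  fixes f :: "'a::euclidean_space \<Rightarrow> 'b::euclidean_space"
  assumes f: "locint f" and z: "\<And>\<phi>. \<phi> \<in> Cc_inf \<Longrightarrow> (LBINT x. \<phi> x *\<^sub>R f x) = 0"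
  shows "AE x in lborel. f x = 0"
proof -
  have [measurable]: "f \<in> borel_measurable borel" using f by (rule locint_measurable)
  have "AE x in lborel. f x \<bullet> b = 0" for b
  proof -
    have c0: "conv (mollifier n) (\<lambda>x. f x \<bullet> b) x = 0" for n x
    proof -
      note m = mollifier_Cc_inf[of n x]
      have k0: "Ck_fun 0 (\<lambda>y. mollifier n (x - y))" and b0: "bsupp (\<lambda>y. mollifier n (x - y))"
        using m[THEN Cc_inf_Cc, of 0] by (auto simp: Cc_def compactly_supported_iff)
      have i: "integrable lborel (\<lambda>y. mollifier n (x - y) *\<^sub>R f y)"
        using locint_mult_bsupp[OF f _ b0] k0 by simp
      have "conv (mollifier n) (\<lambda>x. f x \<bullet> b) x = (LBINT y. (mollifier n (x - y) *\<^sub>R f y) \<bullet> b)"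
        unfolding conv_def by (simp add: mult.commute)
      also have "\<dots> = (LBINT y. mollifier n (x - y) *\<^sub>R f y) \<bullet> b" by (rule integral_inner_left[OF i])
      finally show ?thesis using z[OF m] by simp
    qed
    have "AE x in lborel. norm x \<le> real k \<longrightarrow> f x \<bullet> b = 0" for k
    proof -
      have "(NNINT x. indicator (cball 0 (real k)) x * \<bar>f x \<bullet> b\<bar>) = 0"
        using mollify_local[OF approx_id_mollifier locint_inner[OF f], of "real k" b] unfolding c0
        by (simp add: LIMSEQ_const_iff)
      then have "AE x in lborel. ennreal (indicator (cball 0 (real k)) x * \<bar>f x \<bullet> b\<bar>) = 0"
        by (subst (asm) nn_integral_0_iff_AE) measurable
      then show ?thesis by eventually_elim (auto simp: indicator_def)
    qed
    then have "AE x in lborel. \<forall>k. norm x \<le> real k \<longrightarrow> f x \<bullet> b = 0" by (simp only: AE_all_countable) simp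
    then show ?thesis by eventually_elim (meson real_arch_simple)
  qed
  then have "AE x in lborel. \<forall>b\<in>Basis. f x \<bullet> b = 0" by (intro AE_finite_allI) auto
  then show ?thesis by eventually_elim (simp add: euclidean_all_zero_iff)
qed


section \<open>Convergence and completeness in L^q\<close>

text \<open>If d > l, then d = d^q d^(1-q) \<le> d^q l^(1-q). Integrated over a ball this does the
  work of Hoelder's inequality with the constant 1.\<close>

lemma powr_split_le:
  fixes d l q :: real
  assumes "d \<ge> 0" "l > 0" "q \<ge> 1"
  shows "d \<le> l + l powr (1 - q) * d powr q"
proof (cases "d \<le> l")
  case False
  then have "l powr (q - 1) \<le> d powr (q - 1)" using assms by (intro powr_mono2) auto
  then have "1 \<le> l powr (1 - q) * d powr (q - 1)"
    using assms mult_left_mono[of "l powr (q - 1)" "d powr (q - 1)" "l powr (1 - q)"]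
    by (simp add: powr_add[symmetric])
  then have "d * 1 \<le> d * (l powr (1 - q) * d powr (q - 1))" using assms by (intro mult_left_mono)
  also have "\<dots> = l powr (1 - q) * d powr q"
    using False assms powr_add[of d 1 "q - 1"] by simp
  finally show ?thesis using assms by linarith
qed (use assms in \<open>auto intro!: add_increasing2\<close>)

lemma Lq_imp_L1_local:
  fixes d :: "nat \<Rightarrow> 'a::euclidean_space \<Rightarrow> real"
  assumes [measurable]: "\<And>n. d n \<in> borel_measurable borel" and q: "q \<ge> 1" and d: "\<And>n x. d n x \<ge> 0"
    and lim: "(\<lambda>n. NNINT x. d n x powr q) \<longlonglongrightarrow> 0"
  shows "(\<lambda>n. NNINT x. indicator (cball 0 R) x * d n x) \<longlonglongrightarrow> 0"
proof (rule ennreal_tendsto_0I)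
  fix e :: real assume e: "e > 0"
  define m where "m = measure lborel (cball (0::'a) R)"
  have m: "m \<ge> 0" "emeasure lborel (cball (0::'a) R) = ennreal m"
    unfolding m_def using emeasure_lborel_cball_finite[of "0::'a" R] by (auto intro: emeasure_eq_ennreal_measure)
  \<comment> \<open>The constant term of the splitting costs l times the volume of the ball, at most
    e/2; the L^q term is then made at most e/2.\<close>
  define l where "l = e / (2 * (m + 1))"
  have l: "l > 0" "l * m \<le> e / 2" using e m by (auto simp: l_def field_simps)
  define c where "c = l powr (1 - q)"
  have c: "c > 0" using l by (simp add: c_def)
  from ennreal_tendsto_0D[OF lim, of "e / (2 * c)"]
  have "\<forall>\<^sub>F n in sequentially. (NNINT x. d n x powr q) \<le> ennreal (e / (2 * c))"
    using e c by simp
  then show "\<forall>\<^sub>F n in sequentially. (NNINT x. indicator (cball 0 R) x * d n x) \<le> ennreal e"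
  proof eventually_elim
    case (elim n)
    have "(NNINT x. indicator (cball 0 R) x * d n x)
      \<le> (\<integral>\<^sup>+x. ennreal l * indicator (cball 0 R) x + ennreal c * ennreal (d n x powr q) \<partial>lborel)"
    proof (rule nn_integral_mono)
      fix x
      show "ennreal (indicator (cball 0 R) x * d n x) \<le> ennreal l * indicator (cball 0 R) x + ennreal c * ennreal (d n x powr q)"
        using powr_split_le[OF d l(1) q, of n x] l c d[of n x]
        by (auto simp: indicator_def c_def ennreal_mult[symmetric] ennreal_plus[symmetric] simp del: ennreal_plus intro!: ennreal_leI)
    qed
    also have "\<dots> = ennreal l * ennreal m + ennreal c * (NNINT x. d n x powr q)"
      by (simp add: nn_integral_add nn_integral_cmult m(2))
    also have "\<dots> \<le> ennreal l * ennreal m + ennreal c * ennreal (e / (2 * c))"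
      by (intro add_left_mono mult_left_mono elim) auto
    also have "\<dots> = ennreal (l * m + e / 2)"
      using l m c e by (simp add: ennreal_mult[symmetric] ennreal_plus[symmetric] del: ennreal_plus)
    also have "\<dots> \<le> ennreal e" using l(2) by (intro ennreal_leI) simp
    finally show ?case .
  qed
qed

text \<open>Borel-Cantelli: along a fast subsequence the sets where consecutive members differ by at
  least 2^-k have summable measures, so almost everywhere the increments are eventually dominated by
  a geometric series.\<close>

lemma Lq_Cauchy_AE_limit:
  fixes g :: "nat \<Rightarrow> 'a \<Rightarrow> 'b::euclidean_space"
  assumes [measurable]: "\<And>n. g n \<in> borel_measurable M" and q: "q > 0"
    and cau: "\<And>e. e > 0 \<Longrightarrow> \<exists>N. \<forall>m\<ge>N. \<forall>n\<ge>N. (\<integral>\<^sup>+x. ennreal (norm (g m x - g n x) powr q) \<partial>M) < ennreal e"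
  obtains N :: "nat \<Rightarrow> nat" where "mono N" "\<And>k. N k \<ge> k" "AE x in M. convergent (\<lambda>k. g (N k) x)"
proof -
  \<comment> \<open>By Markov's inequality an L^q distance (to the power q) below 2^-k (2^-k)^q
    leaves measure at most 2^-k for differences of size 2^-k.\<close>
  define e where "e k = (1/2)^k * ((1/2)^k) powr q" for k :: nat
  have e: "e k > 0" for k by (simp add: e_def)
  obtain N0 where N0: "\<And>k m n. m \<ge> N0 k \<Longrightarrow> n \<ge> N0 k \<Longrightarrow> (\<integral>\<^sup>+x. ennreal (norm (g m x - g n x) powr q) \<partial>M) < ennreal (e k)"
    using cau[OF e] by metis
  \<comment> \<open>Adding up the thresholds makes the subsequence of indices monotone and keeps
    \<open>N j\<close> beyond every threshold \<open>N0 k\<close> with k \<le> j.\<close>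
  define N where "N k = k + (\<Sum>i\<le>k. N0 i)" for k
  have mono: "mono N" unfolding N_def by (intro monoI add_mono sum_mono2) auto
  have NN: "N j \<ge> N0 k" if "k \<le> j" for j k
    unfolding N_def using member_le_sum[of k "{..j}" N0] that by auto
  define A where "A k = {x\<in>space M. norm (g (N (Suc k)) x - g (N k) x) \<ge> (1/2)^k}" for k
  have A[measurable]: "A k \<in> sets M" for k unfolding A_def by measurable
  have em: "emeasure M (A k) \<le> ennreal ((1/2)^k)" for k
  proof -
    have "ennreal (((1/2)^k) powr q) * emeasure M (A k) = (\<integral>\<^sup>+x. ennreal (((1/2)^k) powr q) * indicator (A k) x \<partial>M)"
      by (rule nn_integral_cmult_indicator[symmetric]) (rule A)
    also have "\<dots> \<le> (\<integral>\<^sup>+x. ennreal (norm (g (N (Suc k)) x - g (N k) x) powr q) \<partial>M)"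
      by (intro nn_integral_mono) (use q in \<open>auto simp: A_def indicator_def intro!: ennreal_leI powr_mono2\<close>)
    also have "\<dots> \<le> ennreal (e k)" using N0[of k "N (Suc k)" "N k"] NN by (simp add: less_imp_le)
    also have "\<dots> = ennreal (((1/2)^k) powr q) * ennreal ((1/2)^k)"
      by (simp add: e_def ennreal_mult[symmetric] mult.commute)
    finally show ?thesis by (subst (asm) ennreal_mult_le_mult_iff) auto
  qed
  have "AE x in M. eventually (\<lambda>k. x \<in> space M - A k) sequentially"
  proof (rule borel_cantelli_AE1)
    show "emeasure M (A k) < \<infinity>" for k using em[of k] by (rule order_le_less_trans) simp
    have m: "measure M (A k) \<le> (1/2)^k" for k
      unfolding measure_def by (rule enn2real_leI[OF _ em[of k]]) simp
    show "summable (\<lambda>k. measure M (A k))"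
    proof (rule summable_comparison_test'[where N=0])
      show "summable (\<lambda>k. (1/2)^k :: real)" by (rule summable_geometric) simp
      show "norm (measure M (A k)) \<le> (1/2)^k" for k using m[of k] by simp
    qed
  qed simp
  then have "AE x in M. convergent (\<lambda>k. g (N k) x)"
  proof eventually_elim
    case (elim x)
    have "\<forall>\<^sub>F k in sequentially. norm (g (N (Suc k)) x - g (N k) x) \<le> (1/2)^k"
      using elim by eventually_elim (auto simp: A_def)
    then have "summable (\<lambda>k. g (N (Suc k)) x - g (N k) x)"
      by (rule summable_comparison_test_ev[OF _ summable_geometric]) simp
    then have "convergent (\<lambda>n. \<Sum>k<n. g (N (Suc k)) x - g (N k) x)" by (simp add: summable_iff_convergent)
    moreover have "(\<Sum>k<n. g (N (Suc k)) x - g (N k) x) = g (N n) x - g (N 0) x" for n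
      by (rule sum_lessThan_telescope)
    ultimately have "convergent (\<lambda>n. g (N n) x - g (N 0) x)" by simp
    from convergent_add[OF this convergent_const[of "g (N 0) x"]] show ?case by simp
  qed
  then show ?thesis using mono by (intro that[of N]) (auto simp: N_def)
qed

text \<open>Fatou's lemma along the almost everywhere convergent subsequence transfers the Cauchy
  estimate to the limit.\<close>

lemma Lq_complete:
  fixes g :: "nat \<Rightarrow> 'a \<Rightarrow> 'b::euclidean_space"
  assumes [measurable]: "\<And>n. g n \<in> borel_measurable M" and q: "q > 0"
    and cau: "\<And>e. e > 0 \<Longrightarrow> \<exists>N. \<forall>m\<ge>N. \<forall>n\<ge>N. (\<integral>\<^sup>+x. ennreal (norm (g m x - g n x) powr q) \<partial>M) < ennreal e"
  obtains V where "V \<in> borel_measurable M" "(\<lambda>n. \<integral>\<^sup>+x. ennreal (norm (g n x - V x) powr q) \<partial>M) \<longlonglongrightarrow> 0"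
proof -
  obtain N where N: "\<And>k. N k \<ge> k" "AE x in M. convergent (\<lambda>k. g (N k) x)"
    using Lq_Cauchy_AE_limit[OF assms] by metis
  define V where "V x = lim (\<lambda>k. g (N k) x)" for x
  have V[measurable]: "V \<in> borel_measurable M" unfolding V_def by (rule borel_measurable_lim_metric) simp
  have "(\<lambda>n. \<integral>\<^sup>+x. ennreal (norm (g n x - V x) powr q) \<partial>M) \<longlonglongrightarrow> 0"
  proof (rule ennreal_tendsto_0I)
    fix e :: real assume "e > 0"
    from cau[OF this] obtain K where K: "\<And>m n. m \<ge> K \<Longrightarrow> n \<ge> K \<Longrightarrow> (\<integral>\<^sup>+x. ennreal (norm (g m x - g n x) powr q) \<partial>M) < ennreal e" by metis
    have "(\<integral>\<^sup>+x. ennreal (norm (g m x - V x) powr q) \<partial>M) \<le> ennreal e" if m: "m \<ge> K" for m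
    proof -
      have "AE x in M. ennreal (norm (g m x - V x) powr q) = liminf (\<lambda>k. ennreal (norm (g m x - g (N k) x) powr q))"
        using N(2)
      proof eventually_elim
        case (elim x)
        then have "(\<lambda>k. g (N k) x) \<longlonglongrightarrow> V x" unfolding V_def by (simp add: convergent_LIMSEQ_iff)
        then have "(\<lambda>k. ennreal (norm (g m x - g (N k) x) powr q)) \<longlonglongrightarrow> ennreal (norm (g m x - V x) powr q)"
          using q by (intro tendsto_intros tendsto_ennrealI tendsto_powr') auto
        then show ?case by (intro lim_imp_Liminf[symmetric]) auto
      qed
      then have "(\<integral>\<^sup>+x. ennreal (norm (g m x - V x) powr q) \<partial>M) = (\<integral>\<^sup>+x. liminf (\<lambda>k. ennreal (norm (g m x - g (N k) x) powr q)) \<partial>M)"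
        by (rule nn_integral_cong_AE)
      also have "\<dots> \<le> liminf (\<lambda>k. \<integral>\<^sup>+x. ennreal (norm (g m x - g (N k) x) powr q) \<partial>M)"
        by (rule nn_integral_liminf) measurable
      also have "\<dots> \<le> ennreal e"
      proof (rule Liminf_le)
        show "\<forall>\<^sub>F k in sequentially. (\<integral>\<^sup>+x. ennreal (norm (g m x - g (N k) x) powr q) \<partial>M) \<le> ennreal e"
          using eventually_ge_at_top[of K]
        proof eventually_elim
          case (elim k)
          then show ?case using K[OF m, of "N k"] N(1)[of k] by (simp add: less_imp_le)
        qed
      qed simp
      finally show ?thesis .
    qed
    then show "\<forall>\<^sub>F n in sequentially. (\<integral>\<^sup>+x. ennreal (norm (g n x - V x) powr q) \<partial>M) \<le> ennreal e"
      unfolding eventually_sequentially by blast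
  qed
  then show ?thesis using that V by blast
qed


lemma local_L1_limit_locint:
  fixes g :: "nat \<Rightarrow> 'a::euclidean_space \<Rightarrow> 'b::euclidean_space"
  assumes g: "\<And>n. continuous_on UNIV (g n)" and f[measurable]: "f \<in> borel_measurable borel"
    and lim: "\<And>R. (\<lambda>n. NNINT x. indicator (cball 0 R) x * norm (g n x - f x)) \<longlonglongrightarrow> 0"
  shows "locint f"
  unfolding locint_def
proof (intro conjI allI)
  fix R
  have [measurable]: "g n \<in> borel_measurable borel" for n by (rule borel_measurable_continuous_onI[OF g])
  obtain n where n: "(NNINT x. indicator (cball 0 R) x * norm (g n x - f x)) \<le> ennreal 1"
    using eventually_happens[OF ennreal_tendsto_0D[OF lim[of R], of 1]] by auto
  have "integrable lborel (\<lambda>x. indicator (cball 0 R) x *\<^sub>R (g n x - f x))"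
    unfolding integrable_iff_bounded
  proof (intro conjI)
    have "(NNINT x. norm (indicat_real (cball 0 R) x *\<^sub>R (g n x - f x))) \<le> ennreal 1"
      using n by simp
    then show "(NNINT x. norm (indicat_real (cball 0 R) x *\<^sub>R (g n x - f x))) < \<infinity>"
      by (rule order_le_less_trans) simp
  qed measurable
  moreover have "integrable lborel (\<lambda>x. indicator (cball 0 R) x *\<^sub>R g n x)"
  proof -
    have "integrable lborel (\<lambda>x. indicator (cball 0 R) x *\<^sub>R g n x)"
      using borel_integrable_compact[of "cball 0 R" "g n"] continuous_on_subset[OF g] by auto
    then show ?thesis .
  qed
  ultimately have "integrable lborel (\<lambda>x. indicat_real (cball 0 R) x *\<^sub>R g n x - indicat_real (cball 0 R) x *\<^sub>R (g n x - f x))"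
    by (rule Bochner_Integration.integrable_diff[rotated])
  then show "integrable lborel (\<lambda>x. indicat_real (cball 0 R) x *\<^sub>R f x)" by (simp add: algebra_simps)
qed (rule f)

lemma local_L1_limit_integral:
  fixes g :: "nat \<Rightarrow> 'a::euclidean_space \<Rightarrow> 'b::euclidean_space" and \<zeta> :: "'a \<Rightarrow> real"
  assumes g: "\<And>n. locint (g n)" and f: "locint f"
    and lim: "\<And>R. (\<lambda>n. NNINT x. indicator (cball 0 R) x * norm (g n x - f x)) \<longlonglongrightarrow> 0"
    and \<zeta>: "continuous_on UNIV \<zeta>" "bsupp \<zeta>"
  shows "(\<lambda>n. LBINT x. \<zeta> x *\<^sub>R g n x) \<longlonglongrightarrow> (LBINT x. \<zeta> x *\<^sub>R f x)"
proof (rule Lim_null[THEN iffD2], rule real_tendsto_0_from_ennreal)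
  obtain B R where B: "B > 0" "\<And>x. norm (\<zeta> x) \<le> B * indicator (cball 0 R) x"
    using bsupp_bound[OF \<zeta>] by metis
  have [measurable]: "g n \<in> borel_measurable borel" "f \<in> borel_measurable borel" "\<zeta> \<in> borel_measurable borel" for n
    using g f \<zeta>(1) by (auto intro: locint_measurable borel_measurable_continuous_onI)
  have "ennreal (norm ((LBINT x. \<zeta> x *\<^sub>R g n x) - (LBINT x. \<zeta> x *\<^sub>R f x)))
    \<le> ennreal B * (NNINT x. indicator (cball 0 R) x * norm (g n x - f x))" for n
  proof -
    have i: "integrable lborel (\<lambda>x. \<zeta> x *\<^sub>R g n x)" "integrable lborel (\<lambda>x. \<zeta> x *\<^sub>R f x)"
      by (rule locint_mult_bsupp[OF g \<zeta>], rule locint_mult_bsupp[OF f \<zeta>])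
    have "ennreal (norm ((LBINT x. \<zeta> x *\<^sub>R g n x) - (LBINT x. \<zeta> x *\<^sub>R f x)))
      = ennreal (norm (LBINT x. \<zeta> x *\<^sub>R g n x - \<zeta> x *\<^sub>R f x))"
      using i by simp
    also have "\<dots> \<le> (NNINT x. norm (\<zeta> x *\<^sub>R g n x - \<zeta> x *\<^sub>R f x))"
      using i by (intro integral_norm_bound_ennreal) auto
    also have "\<dots> \<le> (\<integral>\<^sup>+x. ennreal B * ennreal (indicator (cball 0 R) x * norm (g n x - f x)) \<partial>lborel)"
    proof (rule nn_integral_mono)
      fix x
      have "norm (\<zeta> x *\<^sub>R g n x - \<zeta> x *\<^sub>R f x) = norm (\<zeta> x) * norm (g n x - f x)"
        by (simp add: scaleR_diff_right[symmetric])
      also have "\<dots> \<le> B * indicator (cball 0 R) x * norm (g n x - f x)" by (intro mult_right_mono B) auto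
      finally show "ennreal (norm (\<zeta> x *\<^sub>R g n x - \<zeta> x *\<^sub>R f x)) \<le> ennreal B * ennreal (indicator (cball 0 R) x * norm (g n x - f x))"
        using B(1) by (simp add: ennreal_mult[symmetric] ennreal_leI mult.assoc)
    qed
    also have "\<dots> = ennreal B * (NNINT x. indicator (cball 0 R) x * norm (g n x - f x))"
      by (rule nn_integral_cmult) measurable
    finally show ?thesis .
  qed
  moreover have "(\<lambda>n. ennreal B * (NNINT x. indicator (cball 0 R) x * norm (g n x - f x))) \<longlonglongrightarrow> 0"
    using ennreal_tendsto_cmult[OF _ lim, of "ennreal B" R] by simp
  ultimately show "(\<lambda>n. ennreal (norm ((LBINT x. \<zeta> x *\<^sub>R g n x) - (LBINT x. \<zeta> x *\<^sub>R f x)))) \<longlonglongrightarrow> 0"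
    by (rule ennreal_squeeze_0)
qed

section \<open>Weak gradients of elements of the completion\<close>

text \<open>The gradients of the approximating test functions have an L^q limit V. Integration by
  parts passes to the limit in L^1 on balls, so V is a weak gradient; weak gradients are unique
  almost everywhere, so the one selected by \<open>weak_grad\<close> is V. The lemma hands over the
  approximating sequence together with Borel representatives.\<close>

lemma D0_gradient:
  assumes v: "v \<in> D0 q" and q: "q \<ge> 1"
  obtains \<phi> V v' where "\<And>n. \<phi> n \<in> Cc_inf" "locint V" "locint v'" "AE x in lebesgue. v x = v' x" "AE x in lebesgue. weak_grad v x = V x"
    "(\<lambda>n. NNINT x. norm (grad (\<phi> n) x - V x) powr q) \<longlonglongrightarrow> 0"
    "\<And>R. (\<lambda>n. NNINT x. indicator (cball 0 R) x * \<bar>\<phi> n x - v' x\<bar>) \<longlonglongrightarrow> 0"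
proof -
  obtain \<phi> where vm: "v \<in> borel_measurable lebesgue" and \<phi>: "\<And>n. \<phi> n \<in> Cc_inf"
    and cau: "\<And>e. e > 0 \<Longrightarrow> \<exists>N. \<forall>m\<ge>N. \<forall>n\<ge>N. (NNINT x. norm (grad (\<phi> m) x - grad (\<phi> n) x) powr q) < ennreal e"
    and l1: "\<And>K. compact K \<Longrightarrow> (\<lambda>n. \<integral>\<^sup>+x\<in>K. ennreal \<bar>\<phi> n x - v x\<bar> \<partial>lborel) \<longlonglongrightarrow> 0"
    using v unfolding D0_def by (auto simp: nn_integral_completion)
  note C = Cc_inf_C1c[OF \<phi>]
  have c: "continuous_on UNIV (\<phi> n)" "continuous_on UNIV (grad (\<phi> n))" for n
    using C1D[OF C1c_C1[OF C]] by simp_all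
  have [measurable]: "\<phi> n \<in> borel_measurable borel" "grad (\<phi> n) \<in> borel_measurable borel" for n
    using c by (auto intro: borel_measurable_continuous_onI)
  obtain v' where v'[measurable]: "v' \<in> borel_measurable borel" and vv': "AE x in lebesgue. v x = v' x"
    using lebesgue_ex_borel[OF vm] by metis
  have vv'2: "AE x in lborel. v x = v' x" using vv' by (simp add: AE_completion_iff)
  have l2: "(\<lambda>n. NNINT x. indicator (cball 0 R) x * \<bar>\<phi> n x - v' x\<bar>) \<longlonglongrightarrow> 0" for R
  proof -
    have "(\<integral>\<^sup>+x\<in>cball 0 R. ennreal \<bar>\<phi> n x - v x\<bar> \<partial>lborel) = (NNINT x. indicator (cball 0 R) x * \<bar>\<phi> n x - v' x\<bar>)" for n
      by (rule nn_integral_cong_AE) (use vv'2 in \<open>eventually_elim, auto simp: indicator_def\<close>)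
    then show ?thesis using l1[of "cball 0 R"] by simp
  qed
  obtain V where V[measurable]: "V \<in> borel_measurable lborel"
    and VL: "(\<lambda>n. NNINT x. norm (grad (\<phi> n) x - V x) powr q) \<longlonglongrightarrow> 0"
    by (rule Lq_complete[of "\<lambda>n. grad (\<phi> n)" lborel q]) (use q cau in auto)
  have [measurable]: "V \<in> borel_measurable borel" using V by simp
  have VL1: "(\<lambda>n. NNINT x. indicator (cball 0 R) x * norm (grad (\<phi> n) x - V x)) \<longlonglongrightarrow> 0" for R
    by (rule Lq_imp_L1_local[OF _ q _ VL]) auto
  have lV: "locint V" by (rule local_L1_limit_locint[OF c(2) _ VL1]) simp
  have lv: "locint v'" by (rule local_L1_limit_locint[OF c(1) v']) (use l2 in simp)
  have lg: "locint (\<phi> n)" "locint (grad (\<phi> n))" for n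
    using integrable_bsupp[OF c(1) bsupp_C1c(1)[OF C]] integrable_bsupp[OF c(2) bsupp_C1c(2)[OF C]]
    by (auto intro: integrable_imp_locint)
  have wk: "(LBINT x. v' x *\<^sub>R grad \<zeta> x) = - (LBINT x. \<zeta> x *\<^sub>R V x)" if z: "\<zeta> \<in> Cc_inf" for \<zeta>
  proof -
    note zC = Cc_inf_C1c[OF z]
    have zc: "continuous_on UNIV \<zeta>" "continuous_on UNIV (grad \<zeta>)" using C1D[OF C1c_C1[OF zC]] by simp_all
    have "(\<lambda>n. LBINT x. \<zeta> x *\<^sub>R grad (\<phi> n) x) \<longlonglongrightarrow> (LBINT x. \<zeta> x *\<^sub>R V x)"
      by (rule local_L1_limit_integral[OF lg(2) lV VL1 zc(1) bsupp_C1c(1)[OF zC]])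
    moreover have "(LBINT x. \<zeta> x *\<^sub>R grad (\<phi> n) x) = - (LBINT x. \<phi> n x *\<^sub>R grad \<zeta> x)" for n
      by (rule integral_by_parts[OF zC C1c_C1[OF C]])
    ultimately have 1: "(\<lambda>n. - (LBINT x. \<phi> n x *\<^sub>R grad \<zeta> x)) \<longlonglongrightarrow> (LBINT x. \<zeta> x *\<^sub>R V x)" by simp
    \<comment> \<open>Component by component: \<open>local_L1_limit_integral\<close> takes a scalar
      weight, here the i-th component of the gradient of \<zeta>.\<close>
    have "(LBINT x. v' x *\<^sub>R grad \<zeta> x) $ i = - (LBINT x. \<zeta> x *\<^sub>R V x) $ i" for i
    proof -
      have i1: "integrable lborel (\<lambda>x. \<phi> n x *\<^sub>R grad \<zeta> x)" for n
        by (intro integrable_bsupp continuous_intros c zc) (use bsupp_C1c(2)[OF zC] in \<open>auto simp: bsupp_def\<close>)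
      have zci: "continuous_on UNIV (\<lambda>x. grad \<zeta> x $ i)" "bsupp (\<lambda>x. grad \<zeta> x $ i)"
        using C1D(3)[OF C1c_C1[OF Cc_inf_C1c[OF Cc_inf_grad[OF z]]]] bsupp_C1c(1)[OF Cc_inf_C1c[OF Cc_inf_grad[OF z]]] by simp_all
      have i2: "integrable lborel (\<lambda>x. v' x *\<^sub>R grad \<zeta> x)"
      proof -
        obtain B R where B: "\<And>x. norm (grad \<zeta> x) \<le> B * indicator (cball 0 R) x" "B > 0"
          using bsupp_bound[OF zc(2) bsupp_C1c(2)[OF zC]] by metis
        show ?thesis
        proof (rule Bochner_Integration.integrable_bound)
          show "integrable lborel (\<lambda>x. B * (indicator (cball 0 R) x *\<^sub>R v' x))"
            by (intro integrable_mult_right locint_truncate lv)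
          show "(\<lambda>x. v' x *\<^sub>R grad \<zeta> x) \<in> borel_measurable lborel"
            using borel_measurable_continuous_onI[OF zc(2)] by simp
          show "AE x in lborel. norm (v' x *\<^sub>R grad \<zeta> x) \<le> norm (B * (indicator (cball 0 R) x *\<^sub>R v' x))"
          proof (rule AE_I2)
            fix x
            have "norm (v' x *\<^sub>R grad \<zeta> x) \<le> \<bar>v' x\<bar> * (B * indicator (cball 0 R) x)"
              by (simp only: norm_scaleR) (intro mult_left_mono B, simp)
            then show "norm (v' x *\<^sub>R grad \<zeta> x) \<le> norm (B * (indicator (cball 0 R) x *\<^sub>R v' x))"
              using B(2) by (simp add: abs_mult mult_ac)
          qed
        qed
      qed
      have comp: "(LBINT x. w x *\<^sub>R grad \<zeta> x) $ i = (LBINT x. grad \<zeta> x $ i *\<^sub>R w x)"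
        if "integrable lborel (\<lambda>x. w x *\<^sub>R grad \<zeta> x)" for w
        using integral_inner_left[OF that, of "axis i 1"] by (simp add: inner_axis mult.commute)
      have "(\<lambda>n. LBINT x. grad \<zeta> x $ i *\<^sub>R \<phi> n x) \<longlonglongrightarrow> (LBINT x. grad \<zeta> x $ i *\<^sub>R v' x)"
        by (rule local_L1_limit_integral[OF lg(1) lv _ zci]) (use l2 in simp)
      then have "(\<lambda>n. (- (LBINT x. \<phi> n x *\<^sub>R grad \<zeta> x)) $ i) \<longlonglongrightarrow> - (LBINT x. v' x *\<^sub>R grad \<zeta> x) $ i"
        unfolding comp[OF i2] vector_uminus_component comp[OF i1] by (rule tendsto_minus)
      moreover have "(\<lambda>n. (- (LBINT x. \<phi> n x *\<^sub>R grad \<zeta> x)) $ i) \<longlonglongrightarrow> (LBINT x. \<zeta> x *\<^sub>R V x) $ i"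
        using 1 by (rule tendsto_vec_nth)
      ultimately have "- (LBINT x. v' x *\<^sub>R grad \<zeta> x) $ i = (LBINT x. \<zeta> x *\<^sub>R V x) $ i"
        by (rule LIMSEQ_unique)
      then show ?thesis by simp
    qed
    then show ?thesis by (simp add: vec_eq_iff)
  qed
  have leb: "(\<integral>x. v x *\<^sub>R grad \<zeta> x \<partial>lebesgue) = (LBINT x. v' x *\<^sub>R grad \<zeta> x)" if z: "\<zeta> \<in> Cc_inf" for \<zeta>
  proof -
    have m: "grad \<zeta> \<in> borel_measurable borel"
      using borel_measurable_continuous_onI[OF C1D(2)[OF C1c_C1[OF Cc_inf_C1c[OF z]]]] .
    have m2: "(\<lambda>x. v' x *\<^sub>R grad \<zeta> x) \<in> borel_measurable lborel" using m by simp
    have "(\<integral>x. v x *\<^sub>R grad \<zeta> x \<partial>lebesgue) = (\<integral>x. v' x *\<^sub>R grad \<zeta> x \<partial>lebesgue)"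
    proof (rule integral_cong_AE)
      show "(\<lambda>x. v x *\<^sub>R grad \<zeta> x) \<in> borel_measurable lebesgue"
        by (rule borel_measurable_scaleR[OF vm measurable_completion]) (use m in simp)
      show "(\<lambda>x. v' x *\<^sub>R grad \<zeta> x) \<in> borel_measurable lebesgue" using m2 by (rule measurable_completion)
      show "AE x in lebesgue. v x *\<^sub>R grad \<zeta> x = v' x *\<^sub>R grad \<zeta> x" using vv' by eventually_elim simp
    qed
    then show ?thesis by (simp add: integral_completion[OF m2])
  qed
  have leb2: "(\<integral>x. \<zeta> x *\<^sub>R W x \<partial>lebesgue) = (LBINT x. \<zeta> x *\<^sub>R W' x)"
    if z: "\<zeta> \<in> Cc_inf" and W: "W \<in> borel_measurable lebesgue" "W' \<in> borel_measurable borel" "AE x in lebesgue. W x = W' x"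
    for \<zeta> and W W' :: "real^3 \<Rightarrow> real^3"
  proof -
    have m: "\<zeta> \<in> borel_measurable borel"
      using borel_measurable_continuous_onI[OF C1D(3)[OF C1c_C1[OF Cc_inf_C1c[OF z]]]] .
    have m2: "(\<lambda>x. \<zeta> x *\<^sub>R W' x) \<in> borel_measurable lborel" using m W(2) by simp
    have "(\<integral>x. \<zeta> x *\<^sub>R W x \<partial>lebesgue) = (\<integral>x. \<zeta> x *\<^sub>R W' x \<partial>lebesgue)"
    proof (rule integral_cong_AE)
      show "(\<lambda>x. \<zeta> x *\<^sub>R W x) \<in> borel_measurable lebesgue"
        by (rule borel_measurable_scaleR[OF measurable_completion W(1)]) (use m in simp)
      show "(\<lambda>x. \<zeta> x *\<^sub>R W' x) \<in> borel_measurable lebesgue" using m2 by (rule measurable_completion)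
      show "AE x in lebesgue. \<zeta> x *\<^sub>R W x = \<zeta> x *\<^sub>R W' x" using W(3) by eventually_elim simp
    qed
    then show ?thesis by (simp add: integral_completion[OF m2])
  qed
  have mV: "V \<in> borel_measurable lebesgue" using V by (rule measurable_completion)
  have "has_weak_grad v V"
    unfolding has_weak_grad_def
  proof (intro conjI ballI)
    show "v \<in> L1_loc" by (rule locint_L1_loc[OF lv vm vv'])
    show "V \<in> L1_loc" by (rule locint_L1_loc[OF lV mV]) simp
    fix \<zeta> :: "real^3 \<Rightarrow> real" assume z: "\<zeta> \<in> Cc_inf"
    show "(\<integral>x. v x *\<^sub>R grad \<zeta> x \<partial>lebesgue) = - (\<integral>x. \<zeta> x *\<^sub>R V x \<partial>lebesgue)"
      using wk[OF z] leb[OF z] leb2[OF z mV, of V] by simp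
  qed
  \<comment> \<open>V witnesses existence, so the choice in \<open>weak_grad\<close> is a genuine
    weak gradient.\<close>
  then have hw: "has_weak_grad v (weak_grad v)" unfolding weak_grad_def by (rule someI[where P="has_weak_grad v"])
  define W where "W = weak_grad v"
  have W: "W \<in> L1_loc" "\<And>\<zeta>. \<zeta> \<in> Cc_inf \<Longrightarrow> (\<integral>x. v x *\<^sub>R grad \<zeta> x \<partial>lebesgue) = - (\<integral>x. \<zeta> x *\<^sub>R W x \<partial>lebesgue)"
    using hw unfolding has_weak_grad_def W_def by auto
  obtain W' where W': "W' \<in> borel_measurable borel" "AE x in lebesgue. W x = W' x"
    using lebesgue_ex_borel[OF L1_loc_measurable[OF W(1)]] by metis
  have lW: "locint W'" by (rule L1_loc_locint[OF W(1) W'])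
  have ld: "locint (\<lambda>x. W' x - V x)"
    using lW lV unfolding locint_def by (auto simp: scaleR_diff_right)
  \<comment> \<open>Two weak gradients have the same integrals against test functions, so their
    difference vanishes by the fundamental lemma.\<close>
  have "AE x in lborel. W' x - V x = 0"
  proof (rule locint_zero_if_orthogonal[OF ld])
    fix \<zeta> :: "real^3 \<Rightarrow> real" assume z: "\<zeta> \<in> Cc_inf"
    note zC = Cc_inf_C1c[OF z]
    note zc = C1D(3)[OF C1c_C1[OF zC]]
    have "(LBINT x. \<zeta> x *\<^sub>R W' x) = (LBINT x. \<zeta> x *\<^sub>R V x)"
      using wk[OF z] leb[OF z] W(2)[OF z] leb2[OF z L1_loc_measurable[OF W(1)] W'] by simp
    then show "(LBINT x. \<zeta> x *\<^sub>R (W' x - V x)) = 0"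
      using locint_mult_bsupp[OF lW zc bsupp_C1c(1)[OF zC]] locint_mult_bsupp[OF lV zc bsupp_C1c(1)[OF zC]]
      by (simp add: scaleR_diff_right)
  qed
  then have "AE x in lebesgue. W' x - V x = 0" by (simp add: AE_completion_iff)
  with W'(2) have "AE x in lebesgue. weak_grad v x = V x" unfolding W_def by eventually_elim simp
  then show ?thesis using that \<phi> lV lv vv' VL l2 by blast
qed

section \<open>Square integrability from a bound on the divergence\<close>

lemma bsupp_mono:
  assumes "bsupp f" "\<And>x. f x = 0 \<Longrightarrow> g x = 0"
  shows "bsupp g"
  using assms unfolding bsupp_def by metis

lemma difference_quotient_integral:
  fixes f :: "'a::euclidean_space \<Rightarrow> real"
  assumes f: "C1c f df" and g: "continuous_on UNIV g" "bsupp g" and t: "t \<longlonglongrightarrow> 0" "\<And>n::nat. t n \<noteq> 0"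
  shows "(\<lambda>n. LBINT x. (f (x + t n *\<^sub>R b) - f x) / t n * g x) \<longlonglongrightarrow> (LBINT x. (df x \<bullet> b) * g x)"
proof -
  have fc: "continuous_on UNIV f" and dfc: "continuous_on UNIV df" using C1D[OF C1c_C1[OF f]] by simp_all
  have [measurable]: "f \<in> borel_measurable borel" "g \<in> borel_measurable borel" "df \<in> borel_measurable borel"
    using fc g(1) dfc by (auto intro: borel_measurable_continuous_onI)
  obtain L where L: "L > 0" "\<And>x y. \<bar>f x - f y\<bar> \<le> L * norm (x - y)" using C1c_lipschitz[OF f] by metis
  show ?thesis
  proof (rule integral_dominated_convergence[where w="\<lambda>x. L * norm b * \<bar>g x\<bar>"])
    show "integrable lborel (\<lambda>x. L * norm b * \<bar>g x\<bar>)"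
      using integrable_abs[OF integrable_bsupp[OF g]] by (rule integrable_mult_right)
    show "AE x in lborel. (\<lambda>n. (f (x + t n *\<^sub>R b) - f x) / t n * g x) \<longlonglongrightarrow> (df x \<bullet> b) * g x"
    proof (rule AE_I2)
      fix x
      have "((\<lambda>s. (f (x + s *\<^sub>R b) - f x) / s) \<longlongrightarrow> df x \<bullet> b) (at 0)"
        using C1_line[OF C1c_C1[OF f], of x b 0] by (simp add: DERIV_def)
      moreover have "filterlim t (at 0) sequentially" using t by (simp add: filterlim_at)
      ultimately have "(\<lambda>n. (f (x + t n *\<^sub>R b) - f x) / t n) \<longlonglongrightarrow> df x \<bullet> b"
        by (rule filterlim_compose)
      then show "(\<lambda>n. (f (x + t n *\<^sub>R b) - f x) / t n * g x) \<longlonglongrightarrow> (df x \<bullet> b) * g x"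
        by (intro tendsto_mult tendsto_const)
    qed
    show "AE x in lborel. norm ((f (x + t n *\<^sub>R b) - f x) / t n * g x) \<le> L * norm b * \<bar>g x\<bar>" for n
    proof (rule AE_I2)
      fix x
      have "\<bar>f (x + t n *\<^sub>R b) - f x\<bar> \<le> L * norm b * \<bar>t n\<bar>"
        using L(2)[of "x + t n *\<^sub>R b" x] by (simp add: mult_ac)
      then have "\<bar>f (x + t n *\<^sub>R b) - f x\<bar> / \<bar>t n\<bar> \<le> L * norm b"
        using t(2)[of n] by (simp add: pos_divide_le_eq)
      then show "norm ((f (x + t n *\<^sub>R b) - f x) / t n * g x) \<le> L * norm b * \<bar>g x\<bar>"
        unfolding real_norm_def abs_mult abs_divide by (rule mult_right_mono) simp
    qed
  qed simp_all
qed

text \<open>Difference quotients in place of second derivatives, so that \<open>C\<^sup>1\<close> suffices.\<close>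

lemma integral_grad_swap:
  fixes f g :: "'a::euclidean_space \<Rightarrow> real"
  assumes f: "C1c f df" and g: "C1c g dg"
  shows "(LBINT x. (df x \<bullet> b) * (dg x \<bullet> c)) = (LBINT x. (df x \<bullet> c) * (dg x \<bullet> b))"
proof -
  have c: "continuous_on UNIV f" "continuous_on UNIV df" "continuous_on UNIV g" "continuous_on UNIV dg"
    using C1D[OF C1c_C1[OF f]] C1D[OF C1c_C1[OF g]] by simp_all
  have m[measurable]: "f \<in> borel_measurable borel" "df \<in> borel_measurable borel" "g \<in> borel_measurable borel" "dg \<in> borel_measurable borel"
    using c by (auto intro: borel_measurable_continuous_onI)
  have bs: "bsupp (\<lambda>x. dg x \<bullet> c)" "bsupp (\<lambda>x. df x \<bullet> c)"
    by (rule bsupp_mono[OF bsupp_C1c(2)[OF g]], simp, rule bsupp_mono[OF bsupp_C1c(2)[OF f]], simp)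
  have cc: "continuous_on UNIV (\<lambda>x. dg x \<bullet> c)" "continuous_on UNIV (\<lambda>x. df x \<bullet> c)"
    using c by (auto intro!: continuous_intros)
  define t where "t n = inverse (real (Suc n))" for n
  have t: "t \<longlonglongrightarrow> 0" "t n \<noteq> 0" for n
    unfolding t_def using LIMSEQ_inverse_real_of_nat by auto
  \<comment> \<open>The difference quotient moves from f to g: integrate by parts, take the
    component in direction c, and undo the shift by translation invariance. This reverses the sign
    of the step s.\<close>
  have eq: "(LBINT x. (f (x + s *\<^sub>R b) - f x) / s * (dg x \<bullet> c)) = (LBINT x. (g (x + (- s) *\<^sub>R b) - g x) / (- s) * (df x \<bullet> c))"
    if s: "s \<noteq> 0" for s
  proof -
    have F: "C1c (\<lambda>x. f (s *\<^sub>R b + 1 *\<^sub>R x)) (\<lambda>x. 1 *\<^sub>R df (s *\<^sub>R b + 1 *\<^sub>R x))" by (rule C1c_affine[OF f]) simp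
    have d: "C1c (\<lambda>x. f (x + s *\<^sub>R b) - f x) (\<lambda>x. df (x + s *\<^sub>R b) - df x)"
      using C1c_add[OF F C1c_scale[OF f, of "-1"]] by (simp add: add.commute)
    have i1: "integrable lborel (\<lambda>x. (f (x + s *\<^sub>R b) - f x) *\<^sub>R dg x)"
      by (intro integrable_bsupp continuous_intros C1D(3)[OF C1c_C1[OF d]] c) (rule bsupp_mono[OF bsupp_C1c(1)[OF d]], simp)
    have i2: "integrable lborel (\<lambda>x. g x *\<^sub>R (df (x + s *\<^sub>R b) - df x))"
      by (intro integrable_bsupp continuous_on_scaleR C1D(2)[OF C1c_C1[OF d]] c) (rule bsupp_mono[OF bsupp_C1c(1)[OF g]], simp)
    have i3: "integrable lborel (\<lambda>x. g x * (df (x + s *\<^sub>R b) \<bullet> c))" "integrable lborel (\<lambda>x. g x * (df x \<bullet> c))" "integrable lborel (\<lambda>x. g (x + (- s) *\<^sub>R b) * (df x \<bullet> c))"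
    proof -
      have c': "continuous_on UNIV (\<lambda>x. df (x + s *\<^sub>R b))" "continuous_on UNIV (\<lambda>x. g (x + (- s) *\<^sub>R b))"
        by (rule continuous_on_compose2[OF c(2)], auto intro!: continuous_intros)
          (rule continuous_on_compose2[OF c(3)], auto intro!: continuous_intros)
      show "integrable lborel (\<lambda>x. g x * (df (x + s *\<^sub>R b) \<bullet> c))" "integrable lborel (\<lambda>x. g x * (df x \<bullet> c))"
        "integrable lborel (\<lambda>x. g (x + (- s) *\<^sub>R b) * (df x \<bullet> c))"
        by (rule integrable_bsupp[OF continuous_on_mult[OF c(3) continuous_on_inner[OF c'(1) continuous_on_const]]],
            rule bsupp_mono[OF bsupp_C1c(1)[OF g]], simp)
          (rule integrable_bsupp[OF continuous_on_mult[OF c(3) cc(2)]], rule bsupp_mono[OF bs(2)], simp,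
           rule integrable_bsupp[OF continuous_on_mult[OF c'(2) cc(2)]], rule bsupp_mono[OF bs(2)], simp)
    qed
    have "(LBINT x. (f (x + s *\<^sub>R b) - f x) * (dg x \<bullet> c)) = (LBINT x. (f (x + s *\<^sub>R b) - f x) *\<^sub>R dg x) \<bullet> c"
      using integral_inner_left[OF i1, of c] by simp
    also have "\<dots> = - (LBINT x. g x *\<^sub>R (df (x + s *\<^sub>R b) - df x)) \<bullet> c"
      using integral_by_parts[OF d C1c_C1[OF g]] by simp
    also have "\<dots> = - (LBINT x. g x * (df (x + s *\<^sub>R b) \<bullet> c) - g x * (df x \<bullet> c))"
      using integral_inner_left[OF i2, of c] by (simp add: inner_diff_left right_diff_distrib)
    also have "\<dots> = - ((LBINT x. g x * (df (x + s *\<^sub>R b) \<bullet> c)) - (LBINT x. g x * (df x \<bullet> c)))"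
      using i3 by simp
    also have "(LBINT x. g x * (df (x + s *\<^sub>R b) \<bullet> c)) = (LBINT x. g (x + (- s) *\<^sub>R b) * (df x \<bullet> c))"
      using lborel_integral_translate[of "\<lambda>x. g x * (df (x + s *\<^sub>R b) \<bullet> c)" "(- s) *\<^sub>R b"] by simp
    also have "\<dots> - (LBINT x. g x * (df x \<bullet> c)) = (LBINT x. (g (x + (- s) *\<^sub>R b) - g x) * (df x \<bullet> c))"
      using i3 by (simp add: left_diff_distrib)
    finally show ?thesis by simp
  qed
  have "(\<lambda>n. LBINT x. (f (x + t n *\<^sub>R b) - f x) / t n * (dg x \<bullet> c)) \<longlonglongrightarrow> (LBINT x. (df x \<bullet> b) * (dg x \<bullet> c))"
    by (rule difference_quotient_integral[OF f cc(1) bs(1) t])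
  moreover have "(\<lambda>n. LBINT x. (g (x + (- t n) *\<^sub>R b) - g x) / (- t n) * (df x \<bullet> c)) \<longlonglongrightarrow> (LBINT x. (dg x \<bullet> b) * (df x \<bullet> c))"
    by (rule difference_quotient_integral[OF g cc(2) bs(2)]) (use tendsto_minus[OF t(1)] t(2) in auto)
  ultimately have "(LBINT x. (df x \<bullet> b) * (dg x \<bullet> c)) = (LBINT x. (dg x \<bullet> b) * (df x \<bullet> c))"
    unfolding eq[OF t(2)] by (rule LIMSEQ_unique)
  then show ?thesis by (simp add: mult.commute)
qed

lemma conv_adjoint:
  fixes \<kappa> p f :: "'a::euclidean_space \<Rightarrow> real"
  assumes \<kappa>: "continuous_on UNIV \<kappa>" "bsupp \<kappa>" "\<And>x. \<kappa> (- x) = \<kappa> x"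
    and p: "integrable lborel p" and f: "integrable lborel f"
  shows "(LBINT x. p x * conv \<kappa> f x) = (LBINT x. conv \<kappa> p x * f x)"
proof -
  obtain B R where B: "B > 0" "\<And>x. norm (\<kappa> x) \<le> B * indicator (cball 0 R) x"
    using bsupp_bound[OF \<kappa>(1,2)] by metis
  have B': "\<bar>\<kappa> x\<bar> \<le> B" for x using B(2)[of x] B(1) by (cases "norm x \<le> R") auto
  have [measurable]: "p \<in> borel_measurable borel" "f \<in> borel_measurable borel" "\<kappa> \<in> borel_measurable borel"
    using p f \<kappa>(1) by (auto intro: borel_measurable_continuous_onI)
  have "integrable (lborel \<Otimes>\<^sub>M lborel) (\<lambda>(x, y). p x * (f y * \<kappa> (x - y)))"
    unfolding integrable_iff_bounded
  proof
    have "(\<integral>\<^sup>+z. ennreal (norm (case z of (x, y) \<Rightarrow> p x * (f y * \<kappa> (x - y)))) \<partial>(lborel \<Otimes>\<^sub>M lborel))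
      = (\<integral>\<^sup>+x. (NNINT y. norm (p x * (f y * \<kappa> (x - y)))) \<partial>lborel)"
      by (subst lborel.nn_integral_fst[symmetric]) auto
    also have "\<dots> \<le> (\<integral>\<^sup>+x. (\<integral>\<^sup>+y. ennreal (B * \<bar>p x\<bar>) * ennreal \<bar>f y\<bar> \<partial>lborel) \<partial>lborel)"
    proof (intro nn_integral_mono)
      fix x y
      have "norm (p x * (f y * \<kappa> (x - y))) = \<bar>p x\<bar> * \<bar>f y\<bar> * \<bar>\<kappa> (x - y)\<bar>" by (simp add: abs_mult)
      also have "\<dots> \<le> \<bar>p x\<bar> * \<bar>f y\<bar> * B" by (intro mult_left_mono B') auto
      finally show "ennreal (norm (p x * (f y * \<kappa> (x - y)))) \<le> ennreal (B * \<bar>p x\<bar>) * ennreal \<bar>f y\<bar>"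
        using B(1) by (simp add: ennreal_mult[symmetric] ennreal_leI mult_ac)
    qed
    also have "\<dots> = (NNINT x. B * \<bar>p x\<bar>) * (NNINT y. \<bar>f y\<bar>)"
      by (simp add: nn_integral_cmult nn_integral_multc)
    also have "\<dots> < \<infinity>"
      using nn_integral_eq_integral[OF integrable_mult_right[OF integrable_abs[OF p], of B]] nn_integral_eq_integral[OF integrable_abs[OF f]] B(1)
      by (simp add: ennreal_mult_less_top)
    finally show "(\<integral>\<^sup>+z. ennreal (norm (case z of (x, y) \<Rightarrow> p x * (f y * \<kappa> (x - y)))) \<partial>(lborel \<Otimes>\<^sub>M lborel)) < \<infinity>" .
  qed measurable
  note Fub = lborel_pair.Fubini_integral[OF this]
  have "(LBINT x. p x * conv \<kappa> f x) = (LBINT x. (LBINT y. p x * (f y * \<kappa> (x - y))))"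
    by (simp add: conv_def)
  also have "\<dots> = (LBINT y. (LBINT x. f y * (p x * \<kappa> (x - y))))"
    unfolding Fub[symmetric] by (simp only: mult.left_commute)
  also have "\<dots> = (LBINT y. f y * conv \<kappa> p y)"
  proof -
    have "\<kappa> (x - y) = \<kappa> (y - x)" for x y using \<kappa>(3)[of "x - y"] by simp
    then show ?thesis by (simp add: conv_def)
  qed
  finally show ?thesis by (simp add: mult.commute)
qed

text \<open>Jensen's inequality in the form of Cauchy-Schwarz with the probability density \<kappa>,
  followed by Tonelli's theorem. The constant 1 matters for \<open>L2_bound_smoothed\<close>, where
  the bound must hold for all scales.\<close>

lemma conv_L2:
  fixes \<kappa> f :: "'a::euclidean_space \<Rightarrow> real"
  assumes \<kappa>: "continuous_on UNIV \<kappa>" "bsupp \<kappa>" "\<And>x. 0 \<le> \<kappa> x" "(LBINT x. \<kappa> x) = 1" and f: "locint f"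
  shows "(NNINT x. (conv \<kappa> f x)^2) \<le> (NNINT x. (f x)^2)"
proof -
  have [measurable]: "f \<in> borel_measurable borel" "\<kappa> \<in> borel_measurable borel"
    using f \<kappa>(1) by (auto intro: borel_measurable_continuous_onI locint_measurable)
  have \<kappa>1: "(NNINT h. \<kappa> h) = 1"
    using nn_integral_eq_integral[OF integrable_bsupp[OF \<kappa>(1,2)]] \<kappa>(3,4) by simp
  have \<kappa>x: "(NNINT y. \<kappa> (x - y)) = 1" for x
    using lborel_nn_integral_reflect[of "\<lambda>h. ennreal (\<kappa> h)" x] \<kappa>1 by simp
  have \<kappa>y: "(NNINT x. \<kappa> (x - y)) = 1" for y
    using lborel_nn_integral_translate[of "\<lambda>h. ennreal (\<kappa> h)" "- y"] \<kappa>1 by simp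
  have pt: "ennreal ((conv \<kappa> f x)^2) \<le> (\<integral>\<^sup>+y. ennreal (\<kappa> (x - y)) * ennreal ((f y)^2) \<partial>lborel)" for x
  proof -
    have "ennreal \<bar>conv \<kappa> f x\<bar> \<le> (NNINT y. \<bar>f y * \<kappa> (x - y)\<bar>)"
      using integral_norm_bound_ennreal[OF conv_integrable[OF \<kappa>(1,2) f, of x]] by (simp add: conv_def)
    then have "(ennreal \<bar>conv \<kappa> f x\<bar>)^2 \<le> (NNINT y. \<bar>f y * \<kappa> (x - y)\<bar>)^2" by (rule power_mono) simp
    also have "\<dots> \<le> (NNINT y. \<kappa> (x - y)) * (\<integral>\<^sup>+y. ennreal (\<kappa> (x - y)) * ennreal ((f y)^2) \<partial>lborel)"
    proof (rule nn_integral_Cauchy_Schwarz)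
      fix y
      have "\<bar>f y * \<kappa> (x - y)\<bar>^2 = \<kappa> (x - y) * (\<kappa> (x - y) * (f y)^2)"
        by (simp add: power_mult_distrib power2_eq_square mult_ac)
      then show "(ennreal \<bar>f y * \<kappa> (x - y)\<bar>)^2 \<le> ennreal (\<kappa> (x - y)) * (ennreal (\<kappa> (x - y)) * ennreal ((f y)^2))"
        using \<kappa>(3) by (simp add: ennreal_power ennreal_mult[symmetric])
    qed measurable
    finally show ?thesis unfolding \<kappa>x by (simp add: ennreal_power)
  qed
  have "(NNINT x. (conv \<kappa> f x)^2) \<le> (\<integral>\<^sup>+x. (\<integral>\<^sup>+y. ennreal (\<kappa> (x - y)) * ennreal ((f y)^2) \<partial>lborel) \<partial>lborel)"
    by (intro nn_integral_mono pt)
  also have "\<dots> = (\<integral>\<^sup>+y. (\<integral>\<^sup>+x. ennreal (\<kappa> (x - y)) * ennreal ((f y)^2) \<partial>lborel) \<partial>lborel)"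
    by (rule lborel_pair.Fubini') measurable
  also have "\<dots> = (NNINT y. (f y)^2)"
    by (simp add: nn_integral_multc \<kappa>y)
  finally show ?thesis .
qed

section \<open>The truncated Newton field\<close>

lemma DERIV_If_join:
  fixes a b :: "real \<Rightarrow> real"
  assumes "(a has_real_derivative m) (at c)" "(b has_real_derivative m) (at c)" "a c = b c"
  shows "((\<lambda>s. if s < c then a s else b s) has_real_derivative m) (at c)"
  unfolding DERIV_def
proof (rule filterlim_split_at)
  have a: "((\<lambda>h. (a (c + h) - a c) / h) \<longlongrightarrow> m) (at_left 0)" and b: "((\<lambda>h. (b (c + h) - b c) / h) \<longlongrightarrow> m) (at_right 0)"
    using assms(1,2) by (auto simp: DERIV_def filterlim_at_split)
  have "\<forall>\<^sub>F h in at_left 0. (a (c + h) - a c) / h = ((if c + h < c then a (c + h) else b (c + h)) - (if c < c then a c else b c)) / h"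
    using eventually_at_left_real[of "-1" 0] by (auto elim!: eventually_mono simp: assms(3))
  then show "((\<lambda>h. ((if c + h < c then a (c + h) else b (c + h)) - (if c < c then a c else b c)) / h) \<longlongrightarrow> m) (at_left 0)"
    by (rule Lim_transform_eventually[OF a])
  have "\<forall>\<^sub>F h in at_right 0. (b (c + h) - b c) / h = ((if c + h < c then a (c + h) else b (c + h)) - (if c < c then a c else b c)) / h"
    using eventually_at_right_real[of 0 1] by (auto elim!: eventually_mono)
  then show "((\<lambda>h. ((if c + h < c then a (c + h) else b (c + h)) - (if c < c then a c else b c)) / h) \<longlongrightarrow> m) (at_right 0)"
    by (rule Lim_transform_eventually[OF b])
qed

text \<open>The field \<open>newton_profile (x \<bullet> x) x\<close> is \<open>x / |x|\<^sup>3\<close> outside the unit ball, where it is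
  divergence free, continued to a \<open>C\<^sup>1\<close> field inside.\<close>

definition newton_profile :: "real \<Rightarrow> real" where
  "newton_profile s = (if s < 1 then 5/2 - 3/2 * s else s powr (-3/2))"

text \<open>For s < 1 the profile is the tangent line of \<open>s powr (-3/2)\<close> at s = 1, so
  its value 1 and slope -3/2 match at the junction.\<close>

definition newton_profile' :: "real \<Rightarrow> real" where
  "newton_profile' s = (if s < 1 then -3/2 else -3/2 * s powr (-5/2))"

lemma newton_profile_deriv: "(newton_profile has_real_derivative newton_profile' s) (at s)"
proof -
  have b: "((\<lambda>s. s powr (-3/2)) has_real_derivative -3/2 * s powr (-5/2)) (at s)" if "s > 0" for s :: real
    using that by (auto intro!: derivative_eq_intros)
  have a: "((\<lambda>s. 5/2 - 3/2 * s) has_real_derivative -3/2) (at s)" for s :: real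
    by (auto intro!: derivative_eq_intros)
  consider "s < 1" | "s > 1" | "s = 1" by linarith
  then show ?thesis
  proof cases
    case 1
    have "(newton_profile has_real_derivative -3/2) (at s)"
      by (rule has_field_derivative_transform_within_open[OF a, where S="{..<1}"])
        (use 1 in \<open>auto simp: newton_profile_def\<close>)
    then show ?thesis using 1 by (simp add: newton_profile'_def)
  next
    case 2
    have "s > 0" using 2 by simp
    have "(newton_profile has_real_derivative -3/2 * s powr (-5/2)) (at s)"
      by (rule has_field_derivative_transform_within_open[OF b[OF \<open>s > 0\<close>], where S="{1<..}"])
        (use 2 in \<open>auto simp: newton_profile_def\<close>)
    then show ?thesis using 2 by (simp add: newton_profile'_def)
  next
    case 3
    have b1: "((\<lambda>s. s powr (-3/2)) has_real_derivative -3/2) (at (1::real))" using b[of 1] by simp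
    have "((\<lambda>s. if s < 1 then 5/2 - 3/2 * s else s powr (-3/2)) has_real_derivative -3/2) (at (1::real))"
      by (rule DERIV_If_join[OF a b1]) simp
    then show ?thesis unfolding 3 newton_profile_def[abs_def] by (simp add: newton_profile'_def)
  qed
qed

lemma newton_profile'_continuous: "continuous_on UNIV newton_profile'"
proof -
  have "continuous_on ({..1} \<union> {1..}) newton_profile'"
    unfolding newton_profile'_def
  proof (rule continuous_on_cases)
    show "continuous_on {1..} (\<lambda>s::real. -3/2 * s powr (-5/2))" by (intro continuous_intros) auto
    show "\<forall>t::real. t \<in> {..1} \<and> \<not> t < 1 \<or> t \<in> {1..} \<and> t < 1 \<longrightarrow> -3/2 = -3/2 * t powr (-5/2)"
      by (metis atLeast_iff atMost_iff linorder_not_le mult.right_neutral nle_le not_less_iff_gr_or_eq powr_one_eq_one)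
  qed auto
  moreover have "{..1} \<union> {1..} = (UNIV :: real set)" by auto
  ultimately show ?thesis by simp
qed


lemma integral_pos_continuous:
  fixes f :: "'a::euclidean_space \<Rightarrow> real"
  assumes f: "continuous_on UNIV f" "integrable lborel f" "\<And>x. 0 \<le> f x" "f a > 0"
  shows "(LBINT x. f x) > 0"
proof (rule ccontr)
  assume "\<not> ?thesis"
  moreover have "(LBINT x. f x) \<ge> 0" by (simp add: f(3))
  ultimately have "(LBINT x. f x) = 0" by simp
  then have ae: "AE x in lborel. f x = 0"
    by (subst (asm) integral_nonneg_eq_0_iff_AE[OF f(2)]) (auto simp: f(3))
  define S where "S = {x. f x > 0}"
  have S: "open S" unfolding S_def by (intro open_Collect_less continuous_intros f(1))
  have "AE x in lborel. x \<notin> S" using ae by eventually_elim (simp add: S_def)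
  then have "emeasure lborel S = 0"
    using S by (subst (asm) AE_iff_measurable[of S]) auto
  then have "negligible S" using S by (simp add: negligible_iff_emeasure0)
  moreover have "S \<noteq> {}" using f(4) by (auto simp: S_def)
  ultimately show False using open_not_negligible[OF S] by simp
qed

definition newton :: "3 \<Rightarrow> real^3 \<Rightarrow> real" where
  "newton i x = x $ i * newton_profile (x \<bullet> x)"

definition newton_grad :: "3 \<Rightarrow> real^3 \<Rightarrow> real^3" where
  "newton_grad i x = (x $ i * newton_profile' (x \<bullet> x) * 2) *\<^sub>R x + newton_profile (x \<bullet> x) *\<^sub>R axis i 1"

lemma C1_newton: "C1 (newton i) (newton_grad i)"
proof -
  have 1: "C1 (\<lambda>x::real^3. x $ i) (\<lambda>x. axis i 1)"
  proof -
    have "(\<bullet>) (axis i 1) = (\<lambda>h::real^3. h $ i)" by (rule ext) (simp add: inner_axis')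
    then show ?thesis unfolding C1_def
      by (simp add: bounded_linear_imp_has_derivative bounded_linear_vec_nth)
  qed
  have 2: "C1 (\<lambda>x::real^3. x \<bullet> x) (\<lambda>x. 2 *\<^sub>R x)"
    unfolding C1_def by (auto intro!: continuous_intros derivative_eq_intros simp: inner_commute)
  have 3: "C1 (\<lambda>x::real^3. newton_profile (x \<bullet> x)) (\<lambda>x. newton_profile' (x \<bullet> x) *\<^sub>R (2 *\<^sub>R x))"
    by (rule C1_compose_real[OF 2 newton_profile_deriv newton_profile'_continuous])
  show ?thesis using C1_mult[OF 1 3] unfolding newton_def[abs_def] newton_grad_def[abs_def]
    by (simp add: mult_ac)
qed

text \<open>The factor r^2 leaves the exterior field x/|x|^3 unchanged, so two scales differ only in
  a bounded region (\<open>C1c_newton_diff\<close>). Only such differences have compact support and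
  can be used for testing.\<close>

definition newton_at :: "real \<Rightarrow> 3 \<Rightarrow> real^3 \<Rightarrow> real" where
  "newton_at r i x = r^2 * newton i (r *\<^sub>R x)"

definition newton_at_grad :: "real \<Rightarrow> 3 \<Rightarrow> real^3 \<Rightarrow> real^3" where
  "newton_at_grad r i x = r^3 *\<^sub>R newton_grad i (r *\<^sub>R x)"

lemma C1_newton_at: "C1 (newton_at r i) (newton_at_grad r i)"
  using C1_scale[OF C1_affine[OF C1_newton[of i], of 0 r], of "r^2"]
  by (simp add: newton_at_def[abs_def] newton_at_grad_def[abs_def] power3_eq_cube power2_eq_square)

lemma newton_at_far:
  assumes "r > 0" "r * norm x \<ge> 1"
  shows "newton_at r i x = x $ i * (x \<bullet> x) powr (-3/2)"
proof -
  have "1 \<le> (r * norm x)^2" using assms(2) by (rule one_le_power)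
  then have "\<not> r * (r * (x \<bullet> x)) < 1" by (simp add: power_mult_distrib power2_eq_square dot_square_norm mult_ac)
  then have "newton_at r i x = r^2 * (r * x $ i * (r * (r * (x \<bullet> x))) powr (-3/2))"
    by (simp add: newton_at_def newton_def newton_profile_def)
  also have "(r * (r * (x \<bullet> x))) powr (-3/2) = (r^2) powr (-3/2) * (x \<bullet> x) powr (-3/2)"
    using powr_mult[of "r^2" "x \<bullet> x" "-3/2"] by (simp add: power2_eq_square mult_ac)
  also have "(r^2) powr (-3/2) = 1 / r^3"
  proof -
    have "r^2 = r powr 2" using assms powr_realpow[of r 2] by simp
    then have "(r^2) powr (-3/2) = r powr (- 3)" by (simp only: powr_powr) simp
    also have "\<dots> = 1 / r powr 3" by (simp add: powr_minus_divide)
    also have "r powr 3 = r^3" using assms powr_realpow[of r 3] by simp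
    finally show ?thesis .
  qed
  finally show ?thesis using assms by (simp add: power2_eq_square power3_eq_cube)
qed

text \<open>The divergence of the truncated Newton field: with s = |x|^2 < 1 it is 3 (5/2 - 3/2 s) -
  3 s = 15/2 (1 - s), and 0 outside. Being continuous, nonnegative and supported in the unit ball,
  it is itself a mollifier up to normalization.\<close>

definition hat :: "real^3 \<Rightarrow> real" where
  "hat x = 15/2 * max 0 (1 - x \<bullet> x)"

text \<open>A radial field is a gradient. This symmetry lets the divergence control the full
  gradient in \<open>L2_bound_smoothed\<close>.\<close>

lemma newton_grad_sym: "newton_at_grad r i x $ j = newton_at_grad r j x $ i"
  by (simp add: newton_at_grad_def newton_grad_def axis_def mult_ac)

lemma newton_grad_trace: "(\<Sum>i\<in>UNIV. newton_at_grad r i x $ i) = r^3 * hat (r *\<^sub>R x)"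
proof -
  have "(\<Sum>i\<in>UNIV. newton_grad i y $ i) = hat y" for y
  proof -
    define s where "s = y \<bullet> y"
    have "(\<Sum>i\<in>UNIV. newton_grad i y $ i) = (\<Sum>i\<in>UNIV. 2 * newton_profile' s * (y $ i * y $ i) + newton_profile s)"
      by (simp add: newton_grad_def s_def mult_ac)
    also have "\<dots> = 2 * newton_profile' s * s + 3 * newton_profile s"
      by (simp add: sum.distrib sum_distrib_left[symmetric] s_def inner_vec_def)
    also have "\<dots> = hat y"
    proof (cases "s < 1")
      case False
      then have "s powr (-5/2) * s = s powr (-3/2)" using powr_mult_base[of s "-5/2"] by (simp add: mult.commute)
      then show ?thesis using False by (simp add: newton_profile_def newton_profile'_def hat_def s_def)
    qed (simp add: newton_profile_def newton_profile'_def hat_def s_def algebra_simps)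
    finally show ?thesis .
  qed
  then show ?thesis by (simp add: newton_at_grad_def sum_distrib_left[symmetric])
qed

lemma hat_continuous: "continuous_on UNIV hat"
  unfolding hat_def[abs_def] by (intro continuous_intros)

lemma hat_nonneg: "0 \<le> hat x"
  by (simp add: hat_def)

lemma hat_zero:
  assumes "norm x \<ge> 1" shows "hat x = 0"
proof -
  have "1 \<le> (norm x)^2" using assms by (rule one_le_power)
  then show ?thesis by (simp add: hat_def dot_square_norm)
qed

lemma hat_integrable: "integrable lborel hat"
  by (rule integrable_bsupp[OF hat_continuous]) (auto simp: bsupp_def intro!: exI[of _ 1] hat_zero)

text \<open>The flux of x/|x|^3 through a sphere, that is 4 \<pi>, kept symbolic.\<close>

definition hat_mass :: real where "hat_mass = (LBINT x. hat x)"

lemma hat_mass_pos: "hat_mass > 0"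
  unfolding hat_mass_def
  by (rule integral_pos_continuous[OF hat_continuous hat_integrable hat_nonneg, of 0]) (simp add: hat_def)

definition hat_at :: "real \<Rightarrow> real^3 \<Rightarrow> real" where
  "hat_at r x = r^3 / hat_mass * hat (r *\<^sub>R x)"

lemma hat_at_props:
  assumes "r > 0"
  shows "continuous_on UNIV (hat_at r)" "bsupp (hat_at r)" "0 \<le> hat_at r x" "(LBINT x. hat_at r x) = 1" "norm x > 1/r \<Longrightarrow> hat_at r x = 0"
    "hat_at r (- x) = hat_at r x" "hat_at r x \<le> 15/2 * r^3 / hat_mass"
proof -
  show "continuous_on UNIV (hat_at r)"
    unfolding hat_at_def[abs_def] by (intro continuous_intros continuous_on_compose2[OF hat_continuous]) auto
  show "0 \<le> hat_at r x" using assms hat_mass_pos by (simp add: hat_at_def hat_nonneg)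
  show z: "hat_at r x = 0" if "norm x > 1/r" for x
  proof -
    have "norm (r *\<^sub>R x) \<ge> 1" using that assms by (simp add: pos_divide_less_eq mult.commute)
    then show ?thesis unfolding hat_at_def by (simp only: hat_zero mult_zero_right)
  qed
  then show "bsupp (hat_at r)" unfolding bsupp_def by blast
  have "hat_mass = r^3 * (LBINT x. hat (r *\<^sub>R x))"
    unfolding hat_mass_def using lborel_integral_affine[of hat r 0] hat_integrable assms by simp
  then show "(LBINT x. hat_at r x) = 1" using hat_mass_pos unfolding hat_at_def[abs_def] by auto
  show "hat_at r (- x) = hat_at r x" by (simp add: hat_at_def hat_def)
  have "hat (r *\<^sub>R x) \<le> 15/2" using inner_ge_zero[of "r *\<^sub>R x"] by (simp add: hat_def)
  then have "r^3 / hat_mass * hat (r *\<^sub>R x) \<le> r^3 / hat_mass * (15/2)"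
    using assms hat_mass_pos by (intro mult_left_mono) auto
  then show "hat_at r x \<le> 15/2 * r^3 / hat_mass" by (simp add: hat_at_def)
qed

lemma C1c_newton_diff:
  assumes "r > 0" "r' > 0"
  shows "C1c (\<lambda>x. newton_at r i x - newton_at r' i x) (\<lambda>x. newton_at_grad r i x - newton_at_grad r' i x)"
  unfolding C1c_def
proof
  show "C1 (\<lambda>x. newton_at r i x - newton_at r' i x) (\<lambda>x. newton_at_grad r i x - newton_at_grad r' i x)"
    using C1_add[OF C1_newton_at C1_scale[OF C1_newton_at, of "-1"]] by simp
  have "newton_at r i x - newton_at r' i x = 0" if "norm x > max (1/r) (1/r')" for x
  proof -
    have "r * norm x \<ge> 1" "r' * norm x \<ge> 1" using that assms by (auto simp: pos_divide_less_eq mult.commute)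
    then show ?thesis using assms by (simp add: newton_at_far)
  qed
  then show "bsupp (\<lambda>x. newton_at r i x - newton_at r' i x)" unfolding bsupp_def by blast
qed


section \<open>The L^2 estimate by testing with potentials\<close>

lemma integrable_product_bsupp:
  fixes f g :: "'a::euclidean_space \<Rightarrow> real"
  assumes "continuous_on UNIV f" "continuous_on UNIV g" "bsupp f"
  shows "integrable lborel (\<lambda>x. f x * g x)"
  by (rule integrable_bsupp[OF continuous_on_mult[OF assms(1,2)]], rule bsupp_mono[OF assms(3)], simp)

text \<open>For compactly supported \<open>\<phi>\<close> with symmetric gradient, \<open>\<parallel>\<nabla>\<phi>\<parallel> = \<parallel>div \<phi>\<parallel>\<close> in \<open>L\<^sup>2\<close>.\<close>

lemma integral_grad_transpose:
  fixes \<phi> :: "3 \<Rightarrow> real^3 \<Rightarrow> real"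
  assumes \<phi>: "\<And>i. C1c (\<phi> i) (D i)"
  shows "(LBINT x. (\<Sum>i\<in>UNIV. \<Sum>j\<in>UNIV. D i x $ j * D j x $ i)) = (LBINT x. (\<Sum>i\<in>UNIV. D i x $ i)^2)"
proof -
  have c: "continuous_on UNIV (\<lambda>x. D i x $ j)" for i j
    using C1D(2)[OF C1c_C1[OF \<phi>]] by (intro continuous_intros)
  have b: "bsupp (\<lambda>x. D i x $ j)" for i j by (rule bsupp_mono[OF bsupp_C1c(2)[OF \<phi>[of i]]]) simp
  have i: "integrable lborel (\<lambda>x. D i x $ j * D k x $ l)" for i j k l
    by (rule integrable_product_bsupp[OF c c b])
  have sw: "(LBINT x. D i x $ j * D j x $ i) = (LBINT x. D i x $ i * D j x $ j)" for i j
    using integral_grad_swap[OF \<phi>[of i] \<phi>[of j], of "axis j 1" "axis i 1"] by (simp add: inner_axis)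
  have "(LBINT x. (\<Sum>i\<in>UNIV. \<Sum>j\<in>UNIV. D i x $ j * D j x $ i)) = (\<Sum>i\<in>UNIV. \<Sum>j\<in>UNIV. (LBINT x. D i x $ j * D j x $ i))"
    using i by (simp add: integral_sum integrable_sum)
  also have "\<dots> = (LBINT x. (\<Sum>i\<in>UNIV. \<Sum>j\<in>UNIV. D i x $ i * D j x $ j))"
    unfolding sw using i by (simp add: integral_sum integrable_sum)
  also have "\<dots> = (LBINT x. (\<Sum>i\<in>UNIV. D i x $ i)^2)"
    by (simp add: power2_eq_square sum_product)
  finally show ?thesis .
qed

lemma nn_integral_sq_diff:
  fixes a b :: "'a \<Rightarrow> real"
  assumes [measurable]: "a \<in> borel_measurable M" "b \<in> borel_measurable M"
  shows "(\<integral>\<^sup>+x. ennreal ((a x - b x)^2) \<partial>M) \<le> 2 * (\<integral>\<^sup>+x. ennreal ((a x)^2) \<partial>M) + 2 * (\<integral>\<^sup>+x. ennreal ((b x)^2) \<partial>M)"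
proof -
  have "(\<integral>\<^sup>+x. ennreal ((a x - b x)^2) \<partial>M) \<le> (\<integral>\<^sup>+x. 2 * ennreal ((a x)^2) + 2 * ennreal ((b x)^2) \<partial>M)"
  proof (rule nn_integral_mono)
    fix x
    have "0 \<le> (a x + b x)^2" by simp
    then have "(a x - b x)^2 \<le> 2 * (a x)^2 + 2 * (b x)^2" by (simp add: power2_eq_square algebra_simps)
    then have "ennreal ((a x - b x)^2) \<le> ennreal (2 * (a x)^2 + 2 * (b x)^2)" by (rule ennreal_leI)
    then show "ennreal ((a x - b x)^2) \<le> 2 * ennreal ((a x)^2) + 2 * ennreal ((b x)^2)" by (simp add: ennreal_mult)
  qed
  also have "\<dots> = 2 * (\<integral>\<^sup>+x. ennreal ((a x)^2) \<partial>M) + 2 * (\<integral>\<^sup>+x. ennreal ((b x)^2) \<partial>M)"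
    by (simp add: nn_integral_add nn_integral_cmult)
  finally show ?thesis .
qed

lemma conv_diff_kernel:
  fixes \<kappa> \<kappa>' :: "'a::euclidean_space \<Rightarrow> real"
  assumes "continuous_on UNIV \<kappa>" "bsupp \<kappa>" "continuous_on UNIV \<kappa>'" "bsupp \<kappa>'" "locint f"
  shows "conv (\<lambda>x. \<kappa> x - \<kappa>' x) f x = conv \<kappa> f x - conv \<kappa>' f x"
  using conv_integrable[OF assms(1,2,5), of x] conv_integrable[OF assms(3,4,5), of x]
  by (simp add: conv_def right_diff_distrib)

text \<open>Testing with the field whose divergence is \<open>f\<close> smoothed at scale \<open>1/r\<close> minus \<open>f\<close> smoothed at
  scale \<open>1/r'\<close>, where \<open>f\<close> is the same difference for \<open>p\<close>, cut off to a ball.\<close>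

lemma L2_bound_smoothed:
  fixes p :: "real^3 \<Rightarrow> real"
  assumes p: "integrable lborel p"
    and bd: "\<And>\<phi> D. (\<And>i. C1c (\<phi> i) (D i)) \<Longrightarrow> (\<Sum>i\<in>UNIV. NNINT x. norm (D i x)^2) \<le> 1 \<Longrightarrow>
      \<bar>LBINT x. p x * (\<Sum>i\<in>UNIV. D i x $ i)\<bar> \<le> C"
    and r: "r > 0" "r' > 0"
  shows "(NNINT x. (indicator (cball 0 R) x * (conv (hat_at r) p x - conv (hat_at r') p x))^2) \<le> ennreal (4 * C^2)"
proof -
  define F where "F x = conv (hat_at r) p x - conv (hat_at r') p x" for x
  define f where "f x = indicator (cball 0 R) x * F x" for x
  define g where "g x = hat_at r x - hat_at r' x" for x
  note h = hat_at_props[OF r(1)] and h' = hat_at_props[OF r(2)]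
  have lp: "locint p" by (rule integrable_imp_locint[OF p])
  have gc: "continuous_on UNIV g" unfolding g_def[abs_def] by (intro continuous_intros h(1) h'(1))
  have gb: "bsupp g"
  proof -
    have "g x = 0" if "norm x > max (1/r) (1/r')" for x using that h(5) h'(5) by (simp add: g_def)
    then show ?thesis unfolding bsupp_def by blast
  qed
  have Fg: "F x = conv g p x" for x
    unfolding F_def g_def[abs_def] by (rule conv_diff_kernel[OF h(1,2) h'(1,2) lp, symmetric])
  have Fc: "continuous_on UNIV F" unfolding Fg[abs_def] by (rule conv_continuous[OF gc gb lp])
  have [measurable]: "F \<in> borel_measurable borel" by (rule borel_measurable_continuous_onI[OF Fc])
  have fi: "integrable lborel f"
    using borel_integrable_compact[of "cball 0 R" F] continuous_on_subset[OF Fc] by (auto simp: f_def[abs_def])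
  have fm[measurable]: "f \<in> borel_measurable borel" using fi by simp
  have lf: "locint f" by (rule integrable_imp_locint[OF fi])
  have fb: "bsupp f" unfolding bsupp_def f_def by (intro exI[of _ R]) auto
  have f2i: "integrable lborel (\<lambda>x. (f x)^2)"
  proof -
    have "(f x)^2 = indicator (cball 0 R) x *\<^sub>R (F x)^2" for x by (auto simp: f_def indicator_def)
    then show ?thesis
      using borel_integrable_compact[of "cball 0 R" "\<lambda>x. (F x)^2"] continuous_on_subset[OF Fc] by (auto intro!: continuous_intros)
  qed
  define A where "A = (LBINT x. (f x)^2)"
  have A: "A \<ge> 0" "(NNINT x. (f x)^2) = ennreal A"
    unfolding A_def using nn_integral_eq_integral[OF f2i] by auto
  \<comment> \<open>The convolution of f with the difference of two Newton fields is a compactly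
    supported C^1 field: f is cut off to a ball and the exterior fields cancel. Its divergence is
    \<open>conv g f\<close>.\<close>
  define \<phi> where "\<phi> i = conv (\<lambda>x. (newton_at r i x - newton_at r' i x) / hat_mass) f" for i
  define D where "D i = conv (\<lambda>x. (1 / hat_mass) *\<^sub>R (newton_at_grad r i x - newton_at_grad r' i x)) f" for i
  have Nc: "C1c (\<lambda>x. (newton_at r i x - newton_at r' i x) / hat_mass) (\<lambda>x. (1 / hat_mass) *\<^sub>R (newton_at_grad r i x - newton_at_grad r' i x))" for i
    using C1c_scale[OF C1c_newton_diff[OF r, of i], of "1 / hat_mass"] by simp
  have \<phi>C: "C1c (\<phi> i) (D i)" for i
    unfolding C1c_def \<phi>_def D_def using C1_conv[OF Nc lf] conv_bsupp[OF bsupp_C1c(1)[OF Nc] fb] by blast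
  have Dcomp: "D i x $ j = conv (\<lambda>z. (newton_at_grad r i z $ j - newton_at_grad r' i z $ j) / hat_mass) f x" for i j x
    using conv_inner[OF C1D(2)[OF C1c_C1[OF Nc]] bsupp_C1c(2)[OF Nc] lf, where b="axis j 1" and x=x]
    unfolding D_def by (simp add: inner_axis)
  have sym: "D i x $ j = D j x $ i" for i j x
    unfolding Dcomp by (simp only: newton_grad_sym[of r i] newton_grad_sym[of r' i])
  have tr: "(\<Sum>i\<in>UNIV. D i x $ i) = conv g f x" for x
  proof -
    have i: "integrable lborel (\<lambda>y. f y * ((newton_at_grad r i (x - y) $ i - newton_at_grad r' i (x - y) $ i) / hat_mass))" for i
      using integrable_inner_left[OF conv_integrable[OF C1D(2)[OF C1c_C1[OF Nc]] bsupp_C1c(2)[OF Nc] lf, of i x], of "axis i 1"]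
      by (simp add: inner_axis)
    have "(\<Sum>i\<in>UNIV. D i x $ i) = (LBINT y. (\<Sum>i\<in>UNIV. f y * ((newton_at_grad r i (x - y) $ i - newton_at_grad r' i (x - y) $ i) / hat_mass)))"
      unfolding Dcomp conv_def using i by (simp add: integral_sum)
    also have "\<dots> = conv g f x"
      unfolding conv_def
    proof (rule Bochner_Integration.integral_cong)
      fix y
      have "(\<Sum>i\<in>UNIV. (newton_at_grad r i (x - y) $ i - newton_at_grad r' i (x - y) $ i) / hat_mass) = g (x - y)"
        unfolding sum_divide_distrib[symmetric] sum_subtractf newton_grad_trace g_def hat_at_def
        by (simp add: diff_divide_distrib)
      then show "(\<Sum>i\<in>UNIV. f y * ((newton_at_grad r i (x - y) $ i - newton_at_grad r' i (x - y) $ i) / hat_mass)) = f y *\<^sub>R g (x - y)"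
        by (simp only: sum_distrib_left[symmetric] real_scaleR_def)
    qed simp
    finally show ?thesis .
  qed
  \<comment> \<open>g is even, so the convolution moves to p, where it gives F. As f is F cut off, f
    F = f^2.\<close>
  have test: "(LBINT x. p x * (\<Sum>i\<in>UNIV. D i x $ i)) = A"
  proof -
    have "(LBINT x. p x * conv g f x) = (LBINT x. conv g p x * f x)"
      by (rule conv_adjoint[OF gc gb _ p fi]) (simp add: g_def h(6) h'(6))
    also have "\<dots> = A"
      unfolding A_def Fg[symmetric] by (rule Bochner_Integration.integral_cong) (auto simp: f_def indicator_def power2_eq_square)
    finally show ?thesis unfolding tr .
  qed
  \<comment> \<open>Symmetry of the gradient turns its norm into the norm of the divergence
    \<open>conv g f\<close>. Each of the two smoothings in g contracts L^2, and the square of a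
    difference costs a factor 2 for each, hence 4.\<close>
  have D2: "(\<Sum>i\<in>UNIV. NNINT x. norm (D i x)^2) \<le> ennreal (4 * A)"
  proof -
    have Dc: "continuous_on UNIV (D i)" for i using C1D(2)[OF C1c_C1[OF \<phi>C]] .
    have Dci: "continuous_on UNIV (\<lambda>x. D i x $ j)" for i j using Dc by (intro continuous_intros)
    have Db: "bsupp (\<lambda>x. D i x $ j)" for i j by (rule bsupp_mono[OF bsupp_C1c(2)[OF \<phi>C[of i]]]) simp
    have ii: "integrable lborel (\<lambda>x. D i x $ j * D k x $ l)" for i j k l
      by (rule integrable_product_bsupp[OF Dci Dci Db])
    have n2: "norm (D i x)^2 = (\<Sum>j\<in>UNIV. D i x $ j * D j x $ i)" for i x
      unfolding power2_norm_eq_inner inner_vec_def using sym by simp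
    have "(\<Sum>i\<in>UNIV. NNINT x. norm (D i x)^2) = (\<Sum>i\<in>UNIV. ennreal (LBINT x. norm (D i x)^2))"
    proof (intro sum.cong refl nn_integral_eq_integral)
      show "integrable lborel (\<lambda>x. norm (D i x)^2)" for i unfolding n2 by (rule Bochner_Integration.integrable_sum) (rule ii)
    qed simp
    also have "\<dots> = ennreal (\<Sum>i\<in>UNIV. (LBINT x. norm (D i x)^2))" by (rule sum_ennreal) simp
    also have "(\<Sum>i\<in>UNIV. (LBINT x. norm (D i x)^2)) = (LBINT x. (\<Sum>i\<in>UNIV. \<Sum>j\<in>UNIV. D i x $ j * D j x $ i))"
      unfolding n2 using ii by (simp add: integral_sum integrable_sum)
    also have "\<dots> = (LBINT x. (conv g f x)^2)"
      unfolding integral_grad_transpose[OF \<phi>C] tr ..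
    also have "ennreal \<dots> = (NNINT x. (conv g f x)^2)"
    proof (rule nn_integral_eq_integral[symmetric])
      show "integrable lborel (\<lambda>x. (conv g f x)^2)"
        unfolding power2_eq_square
        by (rule integrable_product_bsupp) (rule conv_continuous[OF gc gb lf] conv_bsupp[OF gb fb])+
    qed simp
    also have "\<dots> \<le> 2 * (NNINT x. (conv (hat_at r) f x)^2) + 2 * (NNINT x. (conv (hat_at r') f x)^2)"
      unfolding g_def[abs_def] conv_diff_kernel[OF h(1,2) h'(1,2) lf]
      by (rule nn_integral_sq_diff) (auto intro!: borel_measurable_continuous_onI conv_continuous h(1,2) h'(1,2) lf)
    also have "\<dots> \<le> 2 * ennreal A + 2 * ennreal A"
      unfolding A(2)[symmetric] by (intro add_mono mult_left_mono conv_L2 h(1-4) h'(1-4) lf) auto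
    also have "\<dots> = ennreal (4 * A)"
    proof -
      have "2 * ennreal A = ennreal (2 * A)" using A(1) by (simp add: ennreal_mult)
      then show ?thesis using A(1) by (simp add: ennreal_plus[symmetric] del: ennreal_plus)
    qed
    finally show ?thesis .
  qed
  have "A \<le> 4 * C^2"
  proof (cases "A = 0")
    case False
    then have Ap: "A > 0" using A(1) by simp
    \<comment> \<open>Scales the test field into the unit ball of the norm. The hypothesis then
      reads l A \<le> C, and l A is half the square root of A.\<close>
    define l where "l = 1 / (2 * sqrt A)"
    have l: "l > 0" "l^2 * (4 * A) = 1" using Ap by (auto simp: l_def power_divide power_mult_distrib)
    have "\<bar>LBINT x. p x * (\<Sum>i\<in>UNIV. (l *\<^sub>R D i x) $ i)\<bar> \<le> C"
    proof (rule bd)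
      show "C1c (\<lambda>x. l * \<phi> i x) (\<lambda>x. l *\<^sub>R D i x)" for i by (rule C1c_scale[OF \<phi>C])
      have m: "D i \<in> borel_measurable borel" for i
        by (rule borel_measurable_continuous_onI[OF C1D(2)[OF C1c_C1[OF \<phi>C]]])
      have "(NNINT x. norm (l *\<^sub>R D i x)^2) = ennreal (l^2) * (NNINT x. norm (D i x)^2)" for i
        using m by (subst nn_integral_cmult[symmetric]) (auto simp: power_mult_distrib ennreal_mult[symmetric])
      then have "(\<Sum>i\<in>UNIV. NNINT x. norm (l *\<^sub>R D i x)^2) = ennreal (l^2) * (\<Sum>i\<in>UNIV. NNINT x. norm (D i x)^2)"
        by (simp add: sum_distrib_left)
      also have "\<dots> \<le> ennreal (l^2) * ennreal (4 * A)" by (intro mult_left_mono D2) simp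
      also have "\<dots> = ennreal (l^2 * (4 * A))" by (rule ennreal_mult[symmetric]) (use A in auto)
      also have "\<dots> = 1" unfolding l(2) by simp
      finally show "(\<Sum>i\<in>UNIV. NNINT x. norm (l *\<^sub>R D i x)^2) \<le> 1" .
    qed
    moreover have "(LBINT x. p x * (\<Sum>i\<in>UNIV. (l *\<^sub>R D i x) $ i)) = l * A"
    proof -
      have e: "(\<Sum>i\<in>UNIV. (l *\<^sub>R D i x) $ i) = l * (\<Sum>i\<in>UNIV. D i x $ i)" for x
        by (simp add: sum_distrib_left)
      show ?thesis unfolding e mult.left_commute[of _ l] test[symmetric] by (rule integral_mult_right_zero)
    qed
    ultimately have "l * A \<le> C" by simp
    moreover have "l * A = sqrt A / 2"
      using Ap real_sqrt_mult_self[of A] unfolding l_def by (simp add: field_simps)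
    ultimately have "sqrt A \<le> 2 * C" by simp
    then have "(sqrt A)^2 \<le> (2 * C)^2" using Ap by (intro power_mono) auto
    then show ?thesis using Ap by (simp add: power_mult_distrib)
  qed simp
  then have "ennreal A \<le> ennreal (4 * C^2)" by (rule ennreal_leI)
  then show ?thesis using A(2) by (simp add: f_def F_def)
qed

text \<open>The fine scale converges to p in L^1, while the coarse smoothing tends to 0 uniformly,
  because its kernel is bounded by a multiple of the cube of the scale parameter and p is
  integrable. The bound of \<open>L2_bound_smoothed\<close> depends neither on the scales nor on the
  radius, so Fatou's lemma carries it to p.\<close>

lemma L2_from_div_bound:
  fixes p :: "real^3 \<Rightarrow> real"
  assumes p: "integrable lborel p"
    and bd: "\<And>\<phi> D. (\<And>i. C1c (\<phi> i) (D i)) \<Longrightarrow> (\<Sum>i\<in>UNIV. NNINT x. norm (D i x)^2) \<le> 1 \<Longrightarrow>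
      \<bar>LBINT x. p x * (\<Sum>i\<in>UNIV. D i x $ i)\<bar> \<le> C"
  shows "(NNINT x. (p x)^2) < \<infinity>"
proof -
  define R where "R n = real (Suc n)" for n
  have R: "R n > 0" "1 / R n > 0" for n by (auto simp: R_def)
  have lp: "locint p" by (rule integrable_imp_locint[OF p])
  have [measurable]: "p \<in> borel_measurable borel" using p by simp
  define a where "a n = conv (hat_at (R n)) p" for n
  define b where "b n = conv (hat_at (1 / R n)) p" for n
  have [measurable]: "a n \<in> borel_measurable borel" "b n \<in> borel_measurable borel" for n
    unfolding a_def b_def by (auto intro!: borel_measurable_continuous_onI conv_continuous hat_at_props R lp)
  have ai: "approx_id (\<lambda>n. hat_at (R n))"
    unfolding approx_id_def
  proof (intro conjI allI exI[of _ "\<lambda>n. 1 / R n"] impI)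
    show "(\<lambda>n. 1 / R n) \<longlonglongrightarrow> 0" unfolding R_def using LIMSEQ_inverse_real_of_nat by (simp add: inverse_eq_divide)
  qed (use hat_at_props[OF R(1)] in auto)
  have "(\<lambda>n. NNINT x. \<bar>a n x - p x\<bar>) \<longlonglongrightarrow> 0"
    unfolding a_def by (rule mollify_L1[OF ai p])
  then obtain s :: "nat \<Rightarrow> nat" where s: "strict_mono s" "AE x in lborel. (\<lambda>n. a (s n) x - p x) \<longlonglongrightarrow> 0"
    by (rule nn_integral_tendsto_0_AE_subseq[rotated]) auto
  define K where "K = 15/2 / hat_mass * (LBINT y. \<bar>p y\<bar>)"
  \<comment> \<open>The supremum of the kernel at scale parameter \<open>1 / R n\<close> times the
    L^1 norm of p.\<close>
  have bb: "\<bar>b n x\<bar> \<le> K * (1 / R n)^3" for n x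
  proof -
    have "\<bar>b n x\<bar> \<le> (LBINT y. 15/2 * (1 / R n)^3 / hat_mass * \<bar>p y\<bar>)"
      unfolding b_def conv_def
    proof (rule integral_abs_le_integral)
      show "integrable lborel (\<lambda>y. 15/2 * (1 / R n)^3 / hat_mass * \<bar>p y\<bar>)" using p by auto
      show "\<bar>p y *\<^sub>R hat_at (1 / R n) (x - y)\<bar> \<le> 15/2 * (1 / R n)^3 / hat_mass * \<bar>p y\<bar>" for y
        using mult_right_mono[OF hat_at_props(7)[OF R(2)[of n], of "x - y"], of "\<bar>p y\<bar>"] hat_at_props(3)[OF R(2)[of n], of "x - y"]
        by (simp add: abs_mult mult.commute)
    qed
    then show ?thesis by (simp add: K_def mult_ac)
  qed
  have b0: "(\<lambda>n. b n x) \<longlonglongrightarrow> 0" for x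
  proof (rule Lim_null_comparison)
    show "\<forall>\<^sub>F n in sequentially. norm (b n x) \<le> K * (1 / R n)^3" using bb by simp
    have "(\<lambda>n. 1 / R n) \<longlonglongrightarrow> 0" unfolding R_def using LIMSEQ_inverse_real_of_nat by (simp add: inverse_eq_divide)
    then have "(\<lambda>n. K * (1 / R n)^3) \<longlonglongrightarrow> K * 0^3" by (intro tendsto_intros)
    then show "(\<lambda>n. K * (1 / R n)^3) \<longlonglongrightarrow> 0" by simp
  qed
  define F where "F n x = (indicator (cball 0 (real n)) x * (a (s n) x - b (s n) x))^2" for n x
  have [measurable]: "F n \<in> borel_measurable borel" for n unfolding F_def by measurable
  have lim: "AE x in lborel. ennreal ((p x)^2) = liminf (\<lambda>n. ennreal (F n x))"
    using s(2)
  proof eventually_elim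
    case (elim x)
    then have "(\<lambda>n. a (s n) x) \<longlonglongrightarrow> p x" by (rule Lim_null[THEN iffD2])
    moreover have "(\<lambda>n. b (s n) x) \<longlonglongrightarrow> 0" using LIMSEQ_subseq_LIMSEQ[OF b0 s(1)] by (simp add: o_def)
    moreover have "(\<lambda>n. indicat_real (cball 0 (real n)) x) \<longlonglongrightarrow> 1"
    proof (rule tendsto_eventually)
      obtain N :: nat where N: "norm x \<le> N" using real_arch_simple by blast
      show "\<forall>\<^sub>F n in sequentially. indicat_real (cball 0 (real n)) x = 1"
        using eventually_ge_at_top[of N] by eventually_elim (use N in auto)
    qed
    ultimately have "(\<lambda>n. F n x) \<longlonglongrightarrow> (1 * (p x - 0))^2" unfolding F_def by (intro tendsto_intros)
    then have "(\<lambda>n. ennreal (F n x)) \<longlonglongrightarrow> ennreal ((p x)^2)" by (simp add: tendsto_ennrealI)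
    then show ?case by (intro lim_imp_Liminf[symmetric]) auto
  qed
  have "(NNINT x. (p x)^2) = (\<integral>\<^sup>+x. liminf (\<lambda>n. ennreal (F n x)) \<partial>lborel)"
    by (rule nn_integral_cong_AE[OF lim])
  also have "\<dots> \<le> liminf (\<lambda>n. NNINT x. F n x)" by (rule nn_integral_liminf) measurable
  also have "\<dots> \<le> ennreal (4 * C^2)"
  proof (rule Liminf_le)
    show "\<forall>\<^sub>F n in sequentially. (NNINT x. F n x) \<le> ennreal (4 * C^2)"
    proof (rule always_eventually, rule allI)
      fix n
      show "(NNINT x. F n x) \<le> ennreal (4 * C^2)"
        unfolding F_def a_def b_def
      proof (rule L2_bound_smoothed[OF p _ R])
        fix \<phi> :: "3 \<Rightarrow> real^3 \<Rightarrow> real" and D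
        assume "\<And>i. C1c (\<phi> i) (D i)" "(\<Sum>i\<in>UNIV. NNINT x. norm (D i x)^2) \<le> 1"
        then show "\<bar>LBINT x. p x * (\<Sum>i\<in>UNIV. D i x $ i)\<bar> \<le> C" by (rule bd)
      qed
    qed
  qed simp
  also have "\<dots> < \<infinity>" by simp
  finally show ?thesis .
qed

section \<open>The renormalized continuity equation\<close>

text \<open>Two weighted inequalities of arithmetic and geometric means, for the exponents 4, 2, 4.
  In the commutator estimate a is an increment of the velocity over a distance at most \<epsilon>
  and d an increment of the density. The first terms are bounded and carry the small factor
  \<theta>; the last one tends to 0 for fixed \<theta>.\<close>

lemma young_three:
  fixes f a d \<theta> \<epsilon> :: real
  assumes "f \<ge> 0" "a \<ge> 0" "d \<ge> 0" "\<theta> > 0" "\<epsilon> > 0"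
  shows "f * a * d \<le> \<epsilon> * (\<theta> * ((a / \<epsilon>)^2 + f^4) + d^4 / \<theta>^3)"
proof -
  define b where "b = a / \<epsilon>"
  have am: "x * y \<le> \<theta> * x^2 + y^2 / \<theta>" if "x \<ge> 0" "y \<ge> 0" for x y :: real
  proof -
    have "0 \<le> (\<theta> * x - y)^2" by simp
    moreover have "x * y * \<theta> \<ge> 0" using that assms by simp
    moreover have "(\<theta> * x - y)^2 = \<theta>^2 * x^2 + y^2 - 2 * (x * y * \<theta>)"
      by (simp add: power2_diff power_mult_distrib)
    ultimately have "x * y * \<theta> \<le> \<theta>^2 * x^2 + y^2" by linarith
    then have "x * y \<le> (\<theta>^2 * x^2 + y^2) / \<theta>" using assms by (simp add: pos_le_divide_eq)
    then show ?thesis using assms by (simp add: add_divide_distrib power2_eq_square)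
  qed
  have b: "b \<ge> 0" using assms by (simp add: b_def)
  have 1: "b * (f * d) \<le> \<theta> * b^2 + (f * d)^2 / \<theta>" using am[of b "f * d"] b assms by simp
  have am2: "f^2 * d^2 \<le> \<theta>^2 * f^4 + d^4 / \<theta>^2"
  proof -
    have "0 \<le> (\<theta>^2 * f^2 - d^2)^2" by simp
    moreover have "0 \<le> f^2 * d^2 * \<theta>^2" by simp
    moreover have "(\<theta>^2 * f^2 - d^2)^2 = \<theta>^4 * f^4 + d^4 - 2 * (f^2 * d^2 * \<theta>^2)"
      by (simp add: power2_diff power_mult_distrib power_mult[symmetric])
    ultimately have "f^2 * d^2 * \<theta>^2 \<le> \<theta>^4 * f^4 + d^4" by linarith
    then have "f^2 * d^2 \<le> (\<theta>^4 * f^4 + d^4) / \<theta>^2" using assms by (simp add: pos_le_divide_eq)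
    also have "\<dots> = \<theta>^2 * f^4 + d^4 / \<theta>^2"
      using assms by (simp add: add_divide_distrib power2_eq_square power4_eq_xxxx)
    finally show ?thesis .
  qed
  have "(f * d)^2 / \<theta> \<le> (\<theta>^2 * f^4 + d^4 / \<theta>^2) / \<theta>"
    using am2 assms by (intro divide_right_mono) (auto simp: power_mult_distrib)
  also have "\<dots> = \<theta> * f^4 + d^4 / \<theta>^3"
    using assms by (simp add: add_divide_distrib power2_eq_square power3_eq_cube)
  finally have "b * (f * d) \<le> \<theta> * (b^2 + f^4) + d^4 / \<theta>^3" using 1 by (simp add: distrib_left)
  then have "\<epsilon> * (b * (f * d)) \<le> \<epsilon> * (\<theta> * (b^2 + f^4) + d^4 / \<theta>^3)" using assms by (intro mult_left_mono) auto
  moreover have "\<epsilon> * (b * (f * d)) = f * a * d" using assms by (simp add: b_def)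
  ultimately show ?thesis by (simp add: b_def)
qed

text \<open>The fourth power is superadditive on nonnegative numbers. Thus the L^4 modulus of
  continuity of the density is controlled by the L^1 modulus of its fourth power.\<close>

lemma diff_power4_le:
  fixes a b :: real
  assumes "a \<ge> 0" "b \<ge> 0"
  shows "\<bar>a - b\<bar>^4 \<le> \<bar>a^4 - b^4\<bar>"
proof -
  have *: "(x - y)^4 + y^4 \<le> x^4" if "0 \<le> y" "y \<le> x" for x y :: real
  proof -
    have "(x - y)^4 + y^4 \<le> ((x - y) + y)^4"
    proof -
      define z where "z = x - y"
      have z: "z \<ge> 0" using that by (simp add: z_def)
      have "(z + y)^4 = z^4 + y^4 + (4 * z^3 * y + 6 * z^2 * y^2 + 4 * z * y^3)"
        by (simp add: power4_eq_xxxx power2_eq_square power3_eq_cube algebra_simps)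
      moreover have "4 * z^3 * y + 6 * z^2 * y^2 + 4 * z * y^3 \<ge> 0" using z that by simp
      ultimately show ?thesis by (simp add: z_def)
    qed
    then show ?thesis by simp
  qed
  show ?thesis
  proof (cases "b \<le> a")
    case True
    then show ?thesis using *[of b a] assms power_mono[of b a 4] by simp
  next
    case False
    have "\<bar>a - b\<bar>^4 = (b - a)^4" using False by (simp add: abs_if)
    then show ?thesis using False *[of a b] assms power_mono[of a b 4] by simp
  qed
qed

text \<open>A kernel of mean zero allows f(x) to be subtracted under the integral. Applied to the
  gradient of the mollifier, this trades the size of f for its increments.\<close>

lemma conv_zero_mean_bound:
  fixes \<kappa> :: "'a::euclidean_space \<Rightarrow> 'b::euclidean_space" and f :: "'a \<Rightarrow> real"
  assumes \<kappa>: "continuous_on UNIV \<kappa>" "bsupp \<kappa>" "(LBINT h. \<kappa> h) = 0" and f: "locint f"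
  shows "ennreal (norm (conv \<kappa> f x)) \<le> (NNINT k. norm (\<kappa> k) * \<bar>f (x - k) - f x\<bar>)"
proof -
  have [measurable]: "f \<in> borel_measurable borel" "\<kappa> \<in> borel_measurable borel"
    using \<kappa>(1) f by (auto intro: borel_measurable_continuous_onI locint_measurable)
  have i: "integrable lborel (\<lambda>h. f (x - h) *\<^sub>R \<kappa> h)"
    using lborel_integrable_affine[OF conv_integrable[OF \<kappa>(1,2) f, of x], of "-1" x] by simp
  have ik: "integrable lborel \<kappa>" by (rule integrable_bsupp[OF \<kappa>(1,2)])
  have "conv \<kappa> f x = (LBINT h. f (x - h) *\<^sub>R \<kappa> h) - f x *\<^sub>R (LBINT h. \<kappa> h)"
    by (subst conv_reflect) (auto simp: \<kappa>(3))
  also have "\<dots> = (LBINT h. f (x - h) *\<^sub>R \<kappa> h - f x *\<^sub>R \<kappa> h)"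
    using i ik by simp
  also have "ennreal (norm \<dots>) \<le> (NNINT h. norm (f (x - h) *\<^sub>R \<kappa> h - f x *\<^sub>R \<kappa> h))"
    using i ik by (intro integral_norm_bound_ennreal) auto
  also have "\<dots> = (NNINT k. norm (\<kappa> k) * \<bar>f (x - k) - f x\<bar>)"
    by (simp add: scaleR_diff_left[symmetric] mult.commute)
  finally show ?thesis .
qed

lemma conv_commutator_bound:
  fixes \<eta> f w :: "'a::euclidean_space \<Rightarrow> real"
  assumes \<eta>: "continuous_on UNIV \<eta>" "bsupp \<eta>" "\<And>h. 0 \<le> \<eta> h" and f: "locint f" "\<And>x. 0 \<le> f x" and fw: "locint (\<lambda>x. f x * w x)"
    and w: "w \<in> borel_measurable borel"
  shows "ennreal \<bar>conv \<eta> (\<lambda>x. f x * w x) x - conv \<eta> f x * w x\<bar> \<le> (NNINT h. \<eta> h * (f (x - h) * \<bar>w (x - h) - w x\<bar>))"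
proof -
  have [measurable]: "f \<in> borel_measurable borel" "\<eta> \<in> borel_measurable borel" "w \<in> borel_measurable borel"
    using \<eta>(1) f w by (auto intro: borel_measurable_continuous_onI locint_measurable)
  have i: "integrable lborel (\<lambda>h. f (x - h) * \<eta> h)" "integrable lborel (\<lambda>h. (f (x - h) * w (x - h)) * \<eta> h)"
    using lborel_integrable_affine[OF conv_integrable[OF \<eta>(1,2) f(1), of x], of "-1" x]
      lborel_integrable_affine[OF conv_integrable[OF \<eta>(1,2) fw, of x], of "-1" x] by simp_all
  have "conv \<eta> (\<lambda>x. f x * w x) x - conv \<eta> f x * w x
    = (LBINT h. (f (x - h) * w (x - h)) * \<eta> h) - (LBINT h. f (x - h) * \<eta> h) * w x"
    by (subst (1 2) conv_reflect) auto
  also have "\<dots> = (LBINT h. (f (x - h) * w (x - h)) * \<eta> h - f (x - h) * \<eta> h * w x)"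
    using i by simp
  also have "ennreal (norm \<dots>) \<le> (NNINT h. norm ((f (x - h) * w (x - h)) * \<eta> h - f (x - h) * \<eta> h * w x))"
    using i by (intro integral_norm_bound_ennreal) auto
  also have "\<dots> = (NNINT h. \<eta> h * (f (x - h) * \<bar>w (x - h) - w x\<bar>))"
  proof (rule nn_integral_cong)
    fix h
    have "(f (x - h) * w (x - h)) * \<eta> h - f (x - h) * \<eta> h * w x = \<eta> h * (f (x - h) * (w (x - h) - w x))"
      by (simp add: algebra_simps)
    then show "ennreal (norm ((f (x - h) * w (x - h)) * \<eta> h - f (x - h) * \<eta> h * w x)) = ennreal (\<eta> h * (f (x - h) * \<bar>w (x - h) - w x\<bar>))"
      using \<eta>(3) f(2) by (simp add: abs_mult)
  qed
  finally show ?thesis by simp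
qed

lemma weighted_average_bound:
  fixes c :: "'a::euclidean_space \<Rightarrow> real" and \<psi> :: "'a \<Rightarrow> 'a \<Rightarrow> ennreal"
  assumes [measurable]: "c \<in> borel_measurable borel" "A \<in> sets borel" "(\<lambda>(x, h). \<psi> x h) \<in> borel_measurable (borel \<Otimes>\<^sub>M borel)"
    and c: "\<And>h. 0 \<le> c h" "(NNINT h. c h) \<le> C" "\<And>h. norm h > \<epsilon> \<Longrightarrow> c h = 0"
    and b: "\<And>h. norm h \<le> \<epsilon> \<Longrightarrow> (\<integral>\<^sup>+x. indicator A x * \<psi> x h \<partial>lborel) \<le> B"
  shows "(\<integral>\<^sup>+x. indicator A x * (\<integral>\<^sup>+h. ennreal (c h) * \<psi> x h \<partial>lborel) \<partial>lborel) \<le> C * B"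
proof -
  have [measurable]: "\<psi> x \<in> borel_measurable borel" "(\<lambda>x. \<psi> x h) \<in> borel_measurable borel" for x h
    using measurable_compose[OF _ assms(3), of "\<lambda>h. (x, h)" borel] measurable_compose[OF _ assms(3), of "\<lambda>x. (x, h)" borel] by simp_all
  have "(\<integral>\<^sup>+x. indicator A x * (\<integral>\<^sup>+h. ennreal (c h) * \<psi> x h \<partial>lborel) \<partial>lborel)
    = (\<integral>\<^sup>+x. (\<integral>\<^sup>+h. indicator A x * (ennreal (c h) * \<psi> x h) \<partial>lborel) \<partial>lborel)"
    by (intro nn_integral_cong nn_integral_cmult[symmetric]) measurable
  also have "\<dots> = (\<integral>\<^sup>+h. (\<integral>\<^sup>+x. indicator A x * (ennreal (c h) * \<psi> x h) \<partial>lborel) \<partial>lborel)"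
    by (rule lborel_pair.Fubini') measurable
  also have "\<dots> = (\<integral>\<^sup>+h. ennreal (c h) * (\<integral>\<^sup>+x. indicator A x * \<psi> x h \<partial>lborel) \<partial>lborel)"
    by (intro nn_integral_cong, subst nn_integral_cmult[symmetric]) (auto simp: mult_ac)
  also have "\<dots> \<le> (\<integral>\<^sup>+h. ennreal (c h) * B \<partial>lborel)"
  proof (rule nn_integral_mono)
    show "ennreal (c h) * (\<integral>\<^sup>+x. indicator A x * \<psi> x h \<partial>lborel) \<le> ennreal (c h) * B" for h
      using b[of h] c(3)[of h] by (cases "norm h \<le> \<epsilon>") (auto intro: mult_left_mono)
  qed
  also have "\<dots> = (NNINT h. c h) * B" by (rule nn_integral_multc) measurable
  also have "\<dots> \<le> C * B" by (intro mult_right_mono c(2)) simp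
  finally show ?thesis .
qed

text \<open>The increments of w are of order \<epsilon> in L^2 while the kernel \<kappa> has L^1
  norm of order 1/\<epsilon>, so the product of the commutator with \<open>conv \<kappa> f\<close>
  is merely bounded by scaling. Smallness comes from s, the modulus of continuity of f^4, after
  \<theta> has been chosen. The second estimate has no factor 1/\<epsilon> and is of order
  \<epsilon>.\<close>

lemma commutator_estimate:
  fixes \<eta> f w :: "'a::euclidean_space \<Rightarrow> real" and \<kappa> :: "'a \<Rightarrow> 'a"
  assumes \<eta>: "continuous_on UNIV \<eta>" "bsupp \<eta>" "\<And>h. 0 \<le> \<eta> h" "(LBINT h. \<eta> h) = 1" "\<And>h. norm h > \<epsilon> \<Longrightarrow> \<eta> h = 0"
    and \<kappa>: "continuous_on UNIV \<kappa>" "bsupp \<kappa>" "(LBINT h. \<kappa> h) = 0" "\<And>h. norm h > \<epsilon> \<Longrightarrow> \<kappa> h = 0"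
      "(NNINT h. \<epsilon> * norm (\<kappa> h)) \<le> ennreal G" "G \<ge> 0"
    and \<epsilon>: "0 < \<epsilon>" "\<epsilon> \<le> 1" and \<theta>: "\<theta> > 0"
    and f: "locint f" "\<And>x. 0 \<le> f x" and fw: "locint (\<lambda>x. f x * w x)" and w: "w \<in> borel_measurable borel"
    and M: "\<And>h. (NNINT x. (w (x + h) - w x)^2) \<le> ennreal ((norm h)^2 * M)" "M \<ge> 0"
    and N: "(NNINT x. indicator (cball 0 (R + 1)) x * (f x)^4) \<le> ennreal N" "N \<ge> 0"
    and s: "\<And>k. norm k \<le> \<epsilon> \<Longrightarrow> (NNINT x. indicator (cball 0 R) x * \<bar>(f (x + k))^4 - (f x)^4\<bar>) \<le> ennreal s" "s \<ge> 0"
    and V: "emeasure lborel (cball (0::'a) R) \<le> ennreal V" "V \<ge> 0"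
  shows "(NNINT x. indicator (cball 0 R) x * (\<bar>conv \<eta> (\<lambda>x. f x * w x) x - conv \<eta> f x * w x\<bar> * norm (conv \<kappa> f x)))
      \<le> ennreal (G * (\<theta> * (M + N) + s / \<theta>^3))"
    and "(NNINT x. indicator (cball 0 R) x * \<bar>conv \<eta> (\<lambda>x. f x * w x) x - conv \<eta> f x * w x\<bar>)
      \<le> ennreal (\<epsilon> * (M + N + V))"
proof -
  have m[measurable]: "f \<in> borel_measurable borel" "\<eta> \<in> borel_measurable borel" "w \<in> borel_measurable borel" "\<kappa> \<in> borel_measurable borel"
    using \<eta>(1) \<kappa>(1) f w by (auto intro: borel_measurable_continuous_onI locint_measurable)
  have \<eta>1: "(NNINT h. \<eta> h) = 1"
    using nn_integral_eq_integral[OF integrable_bsupp[OF \<eta>(1,2)]] \<eta>(3,4) by simp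
  \<comment> \<open>Increments of w measured in units of \<epsilon>; their squares integrate to at
    most M for shifts of length at most \<epsilon>.\<close>
  define a where "a x h = \<bar>w (x - h) - w x\<bar> / \<epsilon>" for x h
  define d where "d x k = \<bar>f (x - k) - f x\<bar>" for x k
  define c where "c k = \<epsilon> * norm (\<kappa> k)" for k
  define Rr where "Rr x = \<bar>conv \<eta> (\<lambda>x. f x * w x) x - conv \<eta> f x * w x\<bar>" for x
  have cm[measurable]: "c \<in> borel_measurable borel" unfolding c_def by measurable
  have am[measurable]: "(\<lambda>z. a (p z) (q z)) \<in> borel_measurable K" if "p \<in> borel_measurable K" "q \<in> borel_measurable K" for p q and K :: "'k measure"
    using that unfolding a_def by measurable
  have dm[measurable]: "(\<lambda>z. d (p z) (q z)) \<in> borel_measurable K" if "p \<in> borel_measurable K" "q \<in> borel_measurable K" for p q and K :: "'k measure"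
    using that unfolding d_def by measurable
  have c0: "0 \<le> c k" for k using \<epsilon> by (simp add: c_def)
  have a0: "0 \<le> a x h" for x h using \<epsilon> by (simp add: a_def)
  have d0: "0 \<le> d x k" for x k by (simp add: d_def)
  define S where "S x = (\<integral>\<^sup>+h. ennreal (\<eta> h) * ennreal ((a x h)^2 + (f (x - h))^4) \<partial>lborel)" for x
  define T where "T x = (\<integral>\<^sup>+k. ennreal (c k) * ennreal ((d x k)^4) \<partial>lborel)" for x
  have a2: "(\<integral>\<^sup>+x. indicator (cball 0 R) x * ennreal ((a x h)^2) \<partial>lborel) \<le> ennreal M" if h: "norm h \<le> \<epsilon>" for h
  proof -
    have "(\<integral>\<^sup>+x. indicator (cball 0 R) x * ennreal ((a x h)^2) \<partial>lborel) \<le> (\<integral>\<^sup>+x. ennreal (1/\<epsilon>^2) * ennreal ((w (x + (- h)) - w x)^2) \<partial>lborel)"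
      by (intro nn_integral_mono) (auto simp: indicator_def a_def power_divide ennreal_mult[symmetric])
    also have "\<dots> = ennreal (1/\<epsilon>^2) * (NNINT x. (w (x + (- h)) - w x)^2)" by (rule nn_integral_cmult) measurable
    also have "\<dots> \<le> ennreal (1/\<epsilon>^2) * ennreal ((norm (- h))^2 * M)" by (intro mult_left_mono M(1)) simp
    also have "\<dots> \<le> ennreal M"
    proof -
      have "(norm h)^2 * M \<le> \<epsilon>^2 * M" using h M(2) by (intro mult_right_mono power_mono) auto
      then have "1/\<epsilon>^2 * ((norm h)^2 * M) \<le> M" using \<epsilon> by (simp add: field_simps)
      then show ?thesis using M(2) by (simp add: ennreal_mult[symmetric] ennreal_leI)
    qed
    finally show ?thesis .
  qed
  have f4: "(\<integral>\<^sup>+x. indicator (cball 0 R) x * ennreal ((f (x - h))^4) \<partial>lborel) \<le> ennreal N" if h: "norm h \<le> \<epsilon>" for h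
  proof -
    have "(\<integral>\<^sup>+x. indicator (cball 0 R) x * ennreal ((f (x - h))^4) \<partial>lborel)
      \<le> (NNINT x. indicator (cball 0 (R + 1)) (x + - h) * (f (x + - h))^4)"
    proof (rule nn_integral_mono)
      fix x
      have "norm (x - h) \<le> norm x + norm h" by (rule norm_triangle_ineq4)
      then show "indicator (cball 0 R) x * ennreal ((f (x - h))^4) \<le> ennreal (indicator (cball 0 (R + 1)) (x + - h) * (f (x + - h))^4)"
        using h \<epsilon> by (auto simp: indicator_def)
    qed
    also have "\<dots> = (NNINT x. indicator (cball 0 (R + 1)) x * (f x)^4)"
      by (rule lborel_nn_integral_translate[of "\<lambda>x. ennreal (indicator (cball 0 (R + 1)) x * (f x)^4)"]) measurable
    finally show ?thesis using N(1) by simp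
  qed
  have af: "(\<integral>\<^sup>+x. indicator (cball 0 R) x * ennreal ((a x h)^2 + (f (x - h))^4) \<partial>lborel) \<le> ennreal (M + N)" if h: "norm h \<le> \<epsilon>" for h
  proof -
    have "(\<integral>\<^sup>+x. indicator (cball 0 R) x * ennreal ((a x h)^2 + (f (x - h))^4) \<partial>lborel)
      = (\<integral>\<^sup>+x. indicator (cball 0 R) x * ennreal ((a x h)^2) \<partial>lborel) + (\<integral>\<^sup>+x. indicator (cball 0 R) x * ennreal ((f (x - h))^4) \<partial>lborel)"
      by (subst nn_integral_add[symmetric]) (auto simp: distrib_left)
    also have "\<dots> \<le> ennreal M + ennreal N" by (intro add_mono a2 f4 h)
    finally show ?thesis using M(2) N(2) by simp
  qed
  have Sint: "(\<integral>\<^sup>+x. indicator (cball 0 R) x * S x \<partial>lborel) \<le> ennreal (M + N)"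
    using weighted_average_bound[of \<eta> "cball 0 R" "\<lambda>x h. ennreal ((a x h)^2 + (f (x - h))^4)" 1 \<epsilon> "ennreal (M + N)"] \<eta>(3,5) \<eta>1 af
    unfolding S_def by simp
  have d4: "(\<integral>\<^sup>+x. indicator (cball 0 R) x * ennreal ((d x k)^4) \<partial>lborel) \<le> ennreal s" if k: "norm k \<le> \<epsilon>" for k
  proof -
    have "(\<integral>\<^sup>+x. indicator (cball 0 R) x * ennreal ((d x k)^4) \<partial>lborel) \<le> (NNINT x. indicator (cball 0 R) x * \<bar>(f (x + (- k)))^4 - (f x)^4\<bar>)"
      by (intro nn_integral_mono) (use diff_power4_le f(2) in \<open>auto simp: indicator_def d_def intro!: ennreal_leI\<close>)
    also have "\<dots> \<le> ennreal s" by (rule s(1)) (use k in simp)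
    finally show ?thesis .
  qed
  have Tint: "(\<integral>\<^sup>+x. indicator (cball 0 R) x * T x \<partial>lborel) \<le> ennreal G * ennreal s"
    unfolding T_def
    by (rule weighted_average_bound[where \<epsilon>=\<epsilon>]) (use c0 \<kappa>(4,5) d4 in \<open>auto simp: c_def\<close>)
  have Rb: "ennreal (Rr x) \<le> (NNINT h. \<eta> h * (f (x - h) * \<bar>w (x - h) - w x\<bar>))" for x
    unfolding Rr_def by (rule conv_commutator_bound[OF \<eta>(1-3) f fw w])
  have Kb: "ennreal (norm (conv \<kappa> f x)) \<le> (NNINT k. norm (\<kappa> k) * d x k)" for x
    unfolding d_def by (rule conv_zero_mean_bound[OF \<kappa>(1-3) f(1)])
  \<comment> \<open>The product of the bounds for the commutator and for
    \<open>conv \<kappa> f\<close> is a double integral over two independent shifts h and k, to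
    which \<open>young_three\<close> applies pointwise. S collects the terms in h, T those in
    k.\<close>
  have pt: "ennreal (Rr x * norm (conv \<kappa> f x)) \<le> ennreal (\<theta> * G) * S x + ennreal (1 / \<theta>^3) * T x" for x
  proof -
    have "ennreal (Rr x * norm (conv \<kappa> f x)) = ennreal (Rr x) * ennreal (norm (conv \<kappa> f x))"
      by (rule ennreal_mult) (auto simp: Rr_def)
    also have "\<dots> \<le> (NNINT h. \<eta> h * (f (x - h) * \<bar>w (x - h) - w x\<bar>)) * (NNINT k. norm (\<kappa> k) * d x k)"
      by (intro mult_mono Rb Kb) auto
    also have "\<dots> = (\<integral>\<^sup>+h. (\<integral>\<^sup>+k. ennreal (\<eta> h * (f (x - h) * \<bar>w (x - h) - w x\<bar>)) * ennreal (norm (\<kappa> k) * d x k) \<partial>lborel) \<partial>lborel)"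
      by (simp add: nn_integral_cmult nn_integral_multc)
    also have "\<dots> \<le> (\<integral>\<^sup>+h. (\<integral>\<^sup>+k. (ennreal \<theta> * (ennreal (\<eta> h) * ennreal ((a x h)^2 + (f (x - h))^4))) * ennreal (c k)
         + (ennreal (1 / \<theta>^3) * ennreal (\<eta> h)) * (ennreal (c k) * ennreal ((d x k)^4)) \<partial>lborel) \<partial>lborel)"
    proof (intro nn_integral_mono)
      fix h k
      have "f (x - h) * \<bar>w (x - h) - w x\<bar> * d x k \<le> \<epsilon> * (\<theta> * ((a x h)^2 + (f (x - h))^4) + (d x k)^4 / \<theta>^3)"
        unfolding a_def by (rule young_three) (use f(2) d0 \<theta> \<epsilon> in auto)
      then have "(\<eta> h * norm (\<kappa> k)) * (f (x - h) * \<bar>w (x - h) - w x\<bar> * d x k) \<le> (\<eta> h * norm (\<kappa> k)) * (\<epsilon> * (\<theta> * ((a x h)^2 + (f (x - h))^4) + (d x k)^4 / \<theta>^3))"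
        by (intro mult_left_mono) (use \<eta>(3) in auto)
      also have "\<dots> = \<theta> * (\<eta> h * ((a x h)^2 + (f (x - h))^4)) * c k + 1 / \<theta>^3 * \<eta> h * (c k * (d x k)^4)"
        by (simp add: c_def algebra_simps)
      finally have le: "(\<eta> h * (f (x - h) * \<bar>w (x - h) - w x\<bar>)) * (norm (\<kappa> k) * d x k)
        \<le> \<theta> * (\<eta> h * ((a x h)^2 + (f (x - h))^4)) * c k + 1 / \<theta>^3 * \<eta> h * (c k * (d x k)^4)" by (simp add: mult_ac)
      have nn: "0 \<le> (a x h)^2 + (f (x - h))^4" by simp
      have "ennreal (\<eta> h * (f (x - h) * \<bar>w (x - h) - w x\<bar>)) * ennreal (norm (\<kappa> k) * d x k)
        = ennreal ((\<eta> h * (f (x - h) * \<bar>w (x - h) - w x\<bar>)) * (norm (\<kappa> k) * d x k))"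
        by (rule ennreal_mult[symmetric]) (use \<eta>(3) f(2) d0 in auto)
      also have "\<dots> \<le> ennreal (\<theta> * (\<eta> h * ((a x h)^2 + (f (x - h))^4)) * c k + 1 / \<theta>^3 * \<eta> h * (c k * (d x k)^4))"
        by (rule ennreal_leI[OF le])
      also have "\<dots> = ennreal (\<theta> * (\<eta> h * ((a x h)^2 + (f (x - h))^4)) * c k) + ennreal (1 / \<theta>^3 * \<eta> h * (c k * (d x k)^4))"
        by (rule ennreal_plus) (use \<theta> \<eta>(3) c0 nn d0 in auto)
      also have "ennreal (\<theta> * (\<eta> h * ((a x h)^2 + (f (x - h))^4)) * c k) = (ennreal \<theta> * (ennreal (\<eta> h) * ennreal ((a x h)^2 + (f (x - h))^4))) * ennreal (c k)"
        using \<theta> \<eta>(3) c0 nn by (simp add: ennreal_mult del: ennreal_plus)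
      also have "ennreal (1 / \<theta>^3 * \<eta> h * (c k * (d x k)^4)) = (ennreal (1 / \<theta>^3) * ennreal (\<eta> h)) * (ennreal (c k) * ennreal ((d x k)^4))"
      proof -
        have "ennreal (1 / \<theta>^3 * \<eta> h * (c k * (d x k)^4)) = ennreal (1 / \<theta>^3 * \<eta> h) * ennreal (c k * (d x k)^4)"
          by (rule ennreal_mult) (use \<theta> \<eta>(3) c0 in auto)
        then show ?thesis using \<theta> \<eta>(3) c0 by (subst (asm) (1 2) ennreal_mult) auto
      qed
      finally show "ennreal (\<eta> h * (f (x - h) * \<bar>w (x - h) - w x\<bar>)) * ennreal (norm (\<kappa> k) * d x k)
        \<le> (ennreal \<theta> * (ennreal (\<eta> h) * ennreal ((a x h)^2 + (f (x - h))^4))) * ennreal (c k)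
         + (ennreal (1 / \<theta>^3) * ennreal (\<eta> h)) * (ennreal (c k) * ennreal ((d x k)^4))" .
    qed
    also have "\<dots> = (\<integral>\<^sup>+h. (ennreal \<theta> * (ennreal (\<eta> h) * ennreal ((a x h)^2 + (f (x - h))^4))) * (NNINT k. c k)
        + ennreal (1 / \<theta>^3) * ennreal (\<eta> h) * T x \<partial>lborel)"
      unfolding T_def by (simp add: nn_integral_add nn_integral_cmult del: ennreal_plus)
    also have "\<dots> = ennreal \<theta> * S x * (NNINT k. c k) + ennreal (1 / \<theta>^3) * 1 * T x"
      unfolding S_def by (simp add: nn_integral_add nn_integral_cmult nn_integral_multc \<eta>1 del: ennreal_plus)
    also have "\<dots> \<le> ennreal \<theta> * S x * ennreal G + ennreal (1 / \<theta>^3) * 1 * T x"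
      by (intro add_mono mult_left_mono) (use \<kappa>(5) in \<open>auto simp: c_def\<close>)
    also have "\<dots> = ennreal (\<theta> * G) * S x + ennreal (1 / \<theta>^3) * T x"
      using \<theta> \<kappa>(6) by (simp add: ennreal_mult mult_ac)
    finally show ?thesis .
  qed
  have Sm[measurable]: "S \<in> borel_measurable borel" and Tm[measurable]: "T \<in> borel_measurable borel"
    unfolding S_def T_def by measurable
  have "(NNINT x. indicator (cball 0 R) x * (Rr x * norm (conv \<kappa> f x)))
    \<le> (\<integral>\<^sup>+x. ennreal (\<theta> * G) * (indicator (cball 0 R) x * S x) + ennreal (1 / \<theta>^3) * (indicator (cball 0 R) x * T x) \<partial>lborel)"
    by (intro nn_integral_mono) (use pt in \<open>auto simp: indicator_def\<close>)
  also have "\<dots> = ennreal (\<theta> * G) * (\<integral>\<^sup>+x. indicator (cball 0 R) x * S x \<partial>lborel) + ennreal (1 / \<theta>^3) * (\<integral>\<^sup>+x. indicator (cball 0 R) x * T x \<partial>lborel)"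
    by (simp add: nn_integral_add nn_integral_cmult)
  also have "\<dots> \<le> ennreal (\<theta> * G) * ennreal (M + N) + ennreal (1 / \<theta>^3) * (ennreal G * ennreal s)"
    by (intro add_mono mult_left_mono Sint Tint) auto
  also have "\<dots> = ennreal (G * (\<theta> * (M + N) + s / \<theta>^3))"
  proof -
    have "ennreal (\<theta> * G) * ennreal (M + N) = ennreal (\<theta> * G * (M + N))"
      using \<theta> \<kappa>(6) M(2) N(2) by (simp add: ennreal_mult)
    moreover have "ennreal (1 / \<theta>^3) * (ennreal G * ennreal s) = ennreal (1 / \<theta>^3 * (G * s))"
      unfolding ennreal_mult[OF \<kappa>(6) s(2), symmetric]
      by (rule ennreal_mult[symmetric]) (use \<theta> \<kappa>(6) s(2) in auto)
    moreover have "ennreal (\<theta> * G * (M + N)) + ennreal (1 / \<theta>^3 * (G * s)) = ennreal (\<theta> * G * (M + N) + 1 / \<theta>^3 * (G * s))"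
      by (rule ennreal_plus[symmetric]) (use \<theta> \<kappa>(6) M(2) N(2) s(2) in auto)
    ultimately show ?thesis by (simp add: algebra_simps)
  qed
  finally show "(NNINT x. indicator (cball 0 R) x * (\<bar>conv \<eta> (\<lambda>x. f x * w x) x - conv \<eta> f x * w x\<bar> * norm (conv \<kappa> f x)))
      \<le> ennreal (G * (\<theta> * (M + N) + s / \<theta>^3))" unfolding Rr_def .
  have pt2: "ennreal (Rr x) \<le> ennreal \<epsilon> * (S x + 1)" for x
  proof -
    have "ennreal (Rr x) \<le> (NNINT h. \<eta> h * (f (x - h) * \<bar>w (x - h) - w x\<bar>))" by (rule Rb)
    also have "\<dots> \<le> (\<integral>\<^sup>+h. ennreal \<epsilon> * (ennreal (\<eta> h) * ennreal ((a x h)^2 + (f (x - h))^4) + ennreal (\<eta> h)) \<partial>lborel)"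
    proof (rule nn_integral_mono)
      fix h
      \<comment> \<open>From f a \<le> a^2 + f^2 and f^2 \<le> f^4 + 1; the constant 1 leads to the
        volume V of the ball.\<close>
      have le: "f (x - h) * a x h \<le> (a x h)^2 + (f (x - h))^4 + 1"
      proof -
        have "f (x - h) * a x h \<le> (a x h)^2 + (f (x - h))^2"
          using sum_squares_bound[of "f (x - h)" "a x h"] f(2)[of "x - h"] a0[of x h] mult_nonneg_nonneg[of "f (x - h)" "a x h"] by linarith
        moreover have "(f (x - h))^2 \<le> (f (x - h))^4 + 1"
        proof -
          have "0 \<le> ((f (x - h))^2 - 1)^2" by simp
          then have "2 * (f (x - h))^2 \<le> (f (x - h))^4 + 1" unfolding power2_diff by (simp add: power_mult[symmetric])
          moreover have "0 \<le> (f (x - h))^2" by simp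
          ultimately show ?thesis by linarith
        qed
        ultimately show ?thesis by linarith
      qed
      have "\<eta> h * (f (x - h) * \<bar>w (x - h) - w x\<bar>) = \<epsilon> * \<eta> h * (f (x - h) * a x h)" using \<epsilon> by (simp add: a_def)
      also have "\<dots> \<le> \<epsilon> * \<eta> h * ((a x h)^2 + (f (x - h))^4 + 1)" by (intro mult_left_mono le) (use \<epsilon> \<eta>(3) in auto)
      finally have "ennreal (\<eta> h * (f (x - h) * \<bar>w (x - h) - w x\<bar>)) \<le> ennreal (\<epsilon> * (\<eta> h * ((a x h)^2 + (f (x - h))^4) + \<eta> h))"
        by (intro ennreal_leI) (simp add: algebra_simps)
      also have "\<dots> = ennreal \<epsilon> * (ennreal (\<eta> h) * ennreal ((a x h)^2 + (f (x - h))^4) + ennreal (\<eta> h))"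
      proof -
        have nn: "0 \<le> (a x h)^2 + (f (x - h))^4" by simp
        have "ennreal (\<eta> h * ((a x h)^2 + (f (x - h))^4) + \<eta> h) = ennreal (\<eta> h * ((a x h)^2 + (f (x - h))^4)) + ennreal (\<eta> h)"
          by (rule ennreal_plus) (use \<eta>(3) nn in auto)
        moreover have "ennreal (\<eta> h * ((a x h)^2 + (f (x - h))^4)) = ennreal (\<eta> h) * ennreal ((a x h)^2 + (f (x - h))^4)"
          by (rule ennreal_mult) (use \<eta>(3) nn in auto)
        moreover have "ennreal (\<epsilon> * (\<eta> h * ((a x h)^2 + (f (x - h))^4) + \<eta> h)) = ennreal \<epsilon> * ennreal (\<eta> h * ((a x h)^2 + (f (x - h))^4) + \<eta> h)"
          by (rule ennreal_mult) (use \<epsilon> \<eta>(3) nn in auto)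
        ultimately show ?thesis by simp
      qed
      finally show "ennreal (\<eta> h * (f (x - h) * \<bar>w (x - h) - w x\<bar>)) \<le> ennreal \<epsilon> * (ennreal (\<eta> h) * ennreal ((a x h)^2 + (f (x - h))^4) + ennreal (\<eta> h))" .
    qed
    also have "\<dots> = ennreal \<epsilon> * (S x + 1)"
      unfolding S_def by (simp add: nn_integral_cmult nn_integral_add \<eta>1 del: ennreal_plus)
    finally show ?thesis .
  qed
  have "(NNINT x. indicator (cball 0 R) x * Rr x)
    \<le> (\<integral>\<^sup>+x. ennreal \<epsilon> * (indicator (cball 0 R) x * S x + indicator (cball 0 R) x) \<partial>lborel)"
    by (intro nn_integral_mono) (use pt2 in \<open>auto simp: indicator_def\<close>)
  also have "\<dots> = ennreal \<epsilon> * ((\<integral>\<^sup>+x. indicator (cball 0 R) x * S x \<partial>lborel) + emeasure lborel (cball (0::'a) R))"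
    by (simp add: nn_integral_cmult nn_integral_add)
  also have "\<dots> \<le> ennreal \<epsilon> * (ennreal (M + N) + ennreal V)"
    by (intro mult_left_mono add_mono Sint V(1)) auto
  also have "\<dots> = ennreal (\<epsilon> * (M + N + V))"
    using \<epsilon> M(2) N(2) V(2) by (simp add: ennreal_mult)
  finally show "(NNINT x. indicator (cball 0 R) x * \<bar>conv \<eta> (\<lambda>x. f x * w x) x - conv \<eta> f x * w x\<bar>)
      \<le> ennreal (\<epsilon> * (M + N + V))" unfolding Rr_def .
qed


section \<open>Vanishing of the commutator for the mollifiers\<close>

definition mgrad :: "nat \<Rightarrow> real^3 \<Rightarrow> real^3" where
  "mgrad n = grad (mollifier n)"

lemma mollifier_even: "mollifier n (- x) = mollifier n x"
  by (simp add: mollifier_def bump_def)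

lemma C1c_mollifier: "C1c (mollifier n) (mgrad n)"
proof -
  have "(mollifier n :: real^3 \<Rightarrow> real) = (\<lambda>y. mollifier n (0 - y))" by (simp add: mollifier_even)
  then have "(mollifier n :: real^3 \<Rightarrow> real) \<in> Cc_inf" using mollifier_Cc_inf[of n 0] by metis
  then show ?thesis unfolding mgrad_def by (rule Cc_inf_C1c)
qed

lemma mgrad_props:
  shows "continuous_on UNIV (mgrad n)" "bsupp (mgrad n)" "(LBINT h. mgrad n h) = 0" "norm h > 1 / real (Suc n) \<Longrightarrow> mgrad n h = 0"
proof -
  show "continuous_on UNIV (mgrad n)" by (rule C1D(2)[OF C1c_C1[OF C1c_mollifier]])
  show "bsupp (mgrad n)" by (rule bsupp_C1c(2)[OF C1c_mollifier])
  show "(LBINT h. mgrad n h) = 0" by (rule integral_C1c_grad[OF C1c_mollifier])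
  show "mgrad n h = 0" if "norm h > 1 / real (Suc n)"
    by (rule C1_grad_zero_outside[OF C1c_C1[OF C1c_mollifier] mollifier_zero that])
qed

text \<open>The exponent 4 is the dimension plus one: 3 from normalizing the mass, 1 from
  differentiating.\<close>

lemma mgrad_scale: "mgrad n x = real (Suc n)^4 *\<^sub>R mgrad 0 (real (Suc n) *\<^sub>R x)"
proof -
  have "C1c (\<lambda>x. real (Suc n)^3 * mollifier 0 (0 + real (Suc n) *\<^sub>R x))
    (\<lambda>x. real (Suc n)^3 *\<^sub>R (real (Suc n) *\<^sub>R mgrad 0 (0 + real (Suc n) *\<^sub>R x)))"
    by (rule C1c_scale[OF C1c_affine[OF C1c_mollifier]]) simp
  moreover have "real (Suc n)^3 * mollifier 0 (0 + real (Suc n) *\<^sub>R x) = mollifier n x" for x :: "real^3"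
    by (simp add: mollifier_def)
  ultimately have "C1c (mollifier n) (\<lambda>x. real (Suc n)^3 *\<^sub>R (real (Suc n) *\<^sub>R mgrad 0 (0 + real (Suc n) *\<^sub>R x)))"
    by simp
  from C1c_Cc1(2)[OF this] have "mgrad n x = real (Suc n)^3 *\<^sub>R (real (Suc n) *\<^sub>R mgrad 0 (0 + real (Suc n) *\<^sub>R x))"
    unfolding mgrad_def[of n] by simp
  moreover have "real (Suc n)^4 = real (Suc n)^3 * real (Suc n)" by (simp add: power4_eq_xxxx power3_eq_cube del: of_nat_Suc)
  ultimately show ?thesis by (simp only: scaleR_scaleR add_0)
qed

text \<open>By scaling, the quantity does not depend on n: the L^1 norm of the gradient grows
  exactly like the inverse of the scale.\<close>

lemma mgrad_mass:
  obtains G where "G \<ge> 0" "\<And>n. (NNINT h. 1 / real (Suc n) * norm (mgrad n h)) \<le> ennreal G"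
proof -
  define G where "G = (LBINT h. norm (mgrad 0 h))"
  have i: "integrable lborel (\<lambda>h. norm (mgrad 0 h))"
    by (intro integrable_norm integrable_bsupp mgrad_props)
  have [measurable]: "mgrad n \<in> borel_measurable borel" for n by (rule borel_measurable_continuous_onI[OF mgrad_props(1)])
  have "(NNINT h. 1 / real (Suc n) * norm (mgrad n h)) = ennreal G" for n
  proof -
    let ?r = "real (Suc n)"
    have "ennreal G = (NNINT h. norm (mgrad 0 h))"
      unfolding G_def using nn_integral_eq_integral[OF i] by simp
    also have "\<dots> = ennreal (?r^3) * (NNINT x. norm (mgrad 0 (0 + ?r *\<^sub>R x)))"
      using lborel_nn_integral_affine[of "\<lambda>h. ennreal (norm (mgrad 0 h))" ?r 0] by simp
    also have "\<dots> = (\<integral>\<^sup>+x. ennreal (?r^3) * ennreal (norm (mgrad 0 (0 + ?r *\<^sub>R x))) \<partial>lborel)"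
      by (rule nn_integral_cmult[symmetric]) measurable
    also have "\<dots> = (NNINT x. 1 / ?r * norm (mgrad n x))"
    proof (rule nn_integral_cong)
      fix x
      have "1 / ?r * norm (mgrad n x) = ?r^3 * norm (mgrad 0 (0 + ?r *\<^sub>R x))"
        unfolding mgrad_scale[of n x] by (simp add: power4_eq_xxxx power3_eq_cube del: of_nat_Suc)
      then show "ennreal (?r^3) * ennreal (norm (mgrad 0 (0 + ?r *\<^sub>R x))) = ennreal (1 / ?r * norm (mgrad n x))"
        by (simp only: ennreal_mult[symmetric] norm_ge_zero zero_le_power of_nat_0_le_iff)
    qed
    finally show ?thesis by simp
  qed
  then show ?thesis by (intro that[of G]) (auto simp: G_def)
qed

text \<open>The weight with summand 1 covers both terms of the gradient of the test function in
  \<open>renormalized_continuity\<close>, the one containing the gradient of the mollified density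
  and the one without it. The constants are fixed in the order \<theta>, s, n.\<close>

lemma commutator_tendsto_0:
  fixes f w :: "real^3 \<Rightarrow> real"
  assumes f: "locint f" "\<And>x. 0 \<le> f x" and fw: "locint (\<lambda>x. f x * w x)" and w: "w \<in> borel_measurable borel"
    and f4: "locint (\<lambda>x. (f x)^4)" and M: "\<And>h. (NNINT x. (w (x + h) - w x)^2) \<le> ennreal ((norm h)^2 * M)" "M \<ge> 0"
  shows "(\<lambda>n. NNINT x. indicator (cball 0 R) x *
     (\<bar>conv (mollifier n) (\<lambda>x. f x * w x) x - conv (mollifier n) f x * w x\<bar> * (norm (conv (mgrad n) f x) + 1))) \<longlonglongrightarrow> 0"
proof (rule ennreal_tendsto_0I)
  fix e :: real assume e: "e > 0"
  obtain G where G: "G \<ge> 0" "\<And>n. (NNINT h. 1 / real (Suc n) * norm (mgrad n h)) \<le> ennreal G"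
    using mgrad_mass by metis
  define N where "N = (LBINT x. indicator (cball 0 (R + 1)) x * (f x)^4)"
  have N: "(NNINT x. indicator (cball 0 (R + 1)) x * (f x)^4) \<le> ennreal N" "N \<ge> 0"
    unfolding N_def using nn_integral_eq_integral[OF locint_truncate[OF f4, of "R + 1"]] by simp_all
  define V where "V = measure lborel (cball (0::real^3) R)"
  have V: "emeasure lborel (cball (0::real^3) R) \<le> ennreal V" "V \<ge> 0"
    unfolding V_def using emeasure_lborel_cball_finite[of "0::real^3" R] by (auto simp: emeasure_eq_ennreal_measure)
  \<comment> \<open>Makes the terms that stay bounded at most e/4; the summands 1 keep the
    denominator positive.\<close>
  define \<theta> where "\<theta> = e / (4 * (G + 1) * (M + N + 1))"
  have \<theta>: "\<theta> > 0" "G * (\<theta> * (M + N)) \<le> e / 4"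
  proof -
    show "\<theta> > 0" unfolding \<theta>_def using e G M(2) N(2) by simp
    have "G * (M + N) \<le> (G + 1) * (M + N + 1)" using G M(2) N(2) by (intro mult_mono) auto
    then have "\<theta> * (G * (M + N)) \<le> \<theta> * ((G + 1) * (M + N + 1))" using \<open>\<theta> > 0\<close> by (intro mult_left_mono) auto
    also have "\<dots> = e / 4"
    proof -
      have "e / (4 * a * b) * (a * b) = e / 4" if "a > 0" "b > 0" for a b using that by simp
      from this[of "G + 1" "M + N + 1"] show ?thesis unfolding \<theta>_def using G(1) M(2) N(2) by linarith
    qed
    finally show "G * (\<theta> * (M + N)) \<le> e / 4" by (simp add: mult_ac)
  qed
  \<comment> \<open>For this fixed \<theta> the remaining term of the estimate is also at most e/4.
    The admissible shifts, and thereby n, are determined afterwards from s.\<close>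
  define s where "s = e * \<theta>^3 / (4 * (G + 1))"
  have s: "s > 0" "G * (s / \<theta>^3) \<le> e / 4"
  proof -
    show "s > 0" unfolding s_def using e G \<theta> by simp
    have "G * (s / \<theta>^3) = e / 4 * (G / (G + 1))" unfolding s_def using \<theta> by simp
    also have "\<dots> \<le> e / 4 * 1" using e G by (intro mult_left_mono) auto
    finally show "G * (s / \<theta>^3) \<le> e / 4" by simp
  qed
  obtain d where d: "d > 0" "d \<le> 1"
    "\<And>c. norm c < d \<Longrightarrow> (NNINT x. indicator (cball 0 R) x * \<bar>(f (x + c))^4 - (f x)^4\<bar>) \<le> ennreal s"
    by (rule translation_local_uniform[OF f4 s(1), where R=R]) (rule that)
  define d' where "d' = min d (e / (4 * (M + N + V + 1)))"
  have d': "d' > 0" using d e M(2) N(2) V(2) by (simp add: d'_def)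
  have "(\<lambda>n. 1 / real (Suc n)) \<longlonglongrightarrow> 0" using LIMSEQ_inverse_real_of_nat by (simp add: inverse_eq_divide)
  from order_tendstoD(2)[OF this d']
  show "\<forall>\<^sub>F n in sequentially. (NNINT x. indicator (cball 0 R) x *
     (\<bar>conv (mollifier n) (\<lambda>x. f x * w x) x - conv (mollifier n) f x * w x\<bar> * (norm (conv (mgrad n) f x) + 1))) \<le> ennreal e"
  proof eventually_elim
    case (elim n)
    define \<epsilon> where "\<epsilon> = 1 / real (Suc n)"
    have \<epsilon>: "0 < \<epsilon>" "\<epsilon> \<le> 1" "\<epsilon> < d" "\<epsilon> * (M + N + V) \<le> e / 4"
    proof -
      show "0 < \<epsilon>" "\<epsilon> \<le> 1" by (auto simp: \<epsilon>_def)
      show "\<epsilon> < d" using elim by (simp add: \<epsilon>_def d'_def)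
      have "\<epsilon> \<le> e / (4 * (M + N + V + 1))" using elim by (simp add: \<epsilon>_def d'_def)
      then have "\<epsilon> * (M + N + V + 1) \<le> e / (4 * (M + N + V + 1)) * (M + N + V + 1)"
        using M(2) N(2) V(2) by (intro mult_right_mono) auto
      also have "\<dots> = e / 4"
      proof -
        have "e / (4 * a) * a = e / 4" if "a > 0" for a using that by simp
        from this[of "M + N + V + 1"] show ?thesis using M(2) N(2) V(2) by linarith
      qed
      finally show "\<epsilon> * (M + N + V) \<le> e / 4" using \<open>0 < \<epsilon>\<close> by (simp add: distrib_left)
    qed
    note mo = approx_idD[OF approx_id_mollifier]
    define Rr where "Rr x = \<bar>conv (mollifier n) (\<lambda>x. f x * w x) x - conv (mollifier n) f x * w x\<bar>" for x
    have z: "mollifier n h = 0" "mgrad n h = 0" if "norm h > \<epsilon>" for h :: "real^3"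
      using that mollifier_zero[of n h] mgrad_props(4)[of n h] by (simp_all add: \<epsilon>_def)
    have Gn: "(NNINT h. \<epsilon> * norm (mgrad n h)) \<le> ennreal G" unfolding \<epsilon>_def by (rule G(2))
    have sk: "(NNINT x. indicator (cball 0 R) x * \<bar>(f (x + k))^4 - (f x)^4\<bar>) \<le> ennreal s" if "norm k \<le> \<epsilon>" for k
      by (rule d(3)) (use that \<epsilon> in simp)
    note est = commutator_estimate[OF mo(1) mo(4) mo(2) mo(3) z(1) mgrad_props(1-3) z(2) Gn G(1) \<epsilon>(1,2) \<theta>(1) f fw w M N sk less_imp_le[OF s(1)] V]
    have [measurable]: "f \<in> borel_measurable borel" "w \<in> borel_measurable borel" using f w by (auto intro: locint_measurable)
    have [measurable]: "conv (mollifier n) f \<in> borel_measurable borel" "conv (mollifier n) (\<lambda>x. f x * w x) \<in> borel_measurable borel"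
      "conv (mgrad n) f \<in> borel_measurable borel"
      by (rule borel_measurable_continuous_onI[OF conv_continuous], rule mo, rule mo, rule f fw)+
        (rule borel_measurable_continuous_onI[OF conv_continuous[OF mgrad_props(1,2) f(1)]])
    have Rm: "Rr \<in> borel_measurable borel" unfolding Rr_def by measurable
    have "(NNINT x. indicator (cball 0 R) x * (Rr x * (norm (conv (mgrad n) f x) + 1)))
      = (\<integral>\<^sup>+x. ennreal (indicator (cball 0 R) x * (Rr x * norm (conv (mgrad n) f x))) + ennreal (indicator (cball 0 R) x * Rr x) \<partial>lborel)"
      by (intro nn_integral_cong, subst ennreal_plus[symmetric]) (auto simp: Rr_def distrib_left)
    also have "\<dots> = (NNINT x. indicator (cball 0 R) x * (Rr x * norm (conv (mgrad n) f x))) + (NNINT x. indicator (cball 0 R) x * Rr x)"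
      using Rm by (intro nn_integral_add) auto
    also have "\<dots> \<le> ennreal (G * (\<theta> * (M + N) + s / \<theta>^3)) + ennreal (\<epsilon> * (M + N + V))"
      unfolding Rr_def by (intro add_mono est)
    also have "\<dots> = ennreal (G * (\<theta> * (M + N) + s / \<theta>^3) + \<epsilon> * (M + N + V))"
      by (rule ennreal_plus[symmetric]) (use G \<theta> M(2) N(2) V(2) s \<epsilon> in auto)
    also have "\<dots> \<le> ennreal e"
    proof (rule ennreal_leI)
      have "G * (\<theta> * (M + N) + s / \<theta>^3) = G * (\<theta> * (M + N)) + G * (s / \<theta>^3)" by (rule distrib_left)
      then show "G * (\<theta> * (M + N) + s / \<theta>^3) + \<epsilon> * (M + N + V) \<le> e" using \<theta>(2) s(2) \<epsilon>(4) e by linarith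
    qed
    finally show ?case unfolding Rr_def .
  qed
qed


section \<open>Mollified divergence free fields and renormalization\<close>

lemma locint_vec_inner_bsupp:
  fixes u g :: "'a::euclidean_space \<Rightarrow> 'b::euclidean_space"
  assumes u: "locint u" and g: "continuous_on UNIV g" "bsupp g"
  shows "integrable lborel (\<lambda>x. u x \<bullet> g x)"
proof -
  have "integrable lborel (\<lambda>x. \<Sum>b\<in>Basis. (g x \<bullet> b) *\<^sub>R (u x \<bullet> b))"
  proof (rule Bochner_Integration.integrable_sum)
    fix b :: 'b
    have "continuous_on UNIV (\<lambda>x. g x \<bullet> b)" by (intro continuous_intros g(1))
    moreover have "bsupp (\<lambda>x. g x \<bullet> b)" by (rule bsupp_mono[OF g(2)]) simp
    ultimately show "integrable lborel (\<lambda>x. (g x \<bullet> b) *\<^sub>R (u x \<bullet> b))"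
      by (rule locint_mult_bsupp[OF locint_inner[OF u]])
  qed
  moreover have "u x \<bullet> g x = (\<Sum>b\<in>Basis. (g x \<bullet> b) *\<^sub>R (u x \<bullet> b))" for x
    by (subst euclidean_inner) (simp add: mult.commute)
  ultimately show ?thesis by simp
qed

text \<open>Testing with \<open>mollifier n (x - y)\<close> in y shows that the mollified field is
  divergence free at every x. Integration by parts then admits any C^1 function of bounded
  support.\<close>

lemma mollified_divergence_free:
  fixes m :: "real^3 \<Rightarrow> real^3"
  assumes m: "locint m" and div: "\<And>\<phi>. \<phi> \<in> Cc_inf \<Longrightarrow> (LBINT x. m x \<bullet> grad \<phi> x) = 0" and F: "C1c F dF"
  shows "(LBINT x. (\<Sum>i\<in>UNIV. conv (mollifier n) (\<lambda>y. m y $ i) x * dF x $ i)) = 0"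
proof -
  have mi: "locint (\<lambda>y. m y $ i)" for i using locint_inner[OF m, of "axis i 1"] by (simp add: inner_axis)
  have Fc: "continuous_on UNIV F" "continuous_on UNIV dF" using C1D[OF C1c_C1[OF F]] by simp_all
  have C: "C1 (conv (mollifier n) (\<lambda>y. m y $ i)) (conv (mgrad n) (\<lambda>y. m y $ i))" for i
    by (rule C1_conv[OF C1c_mollifier mi])
  have dc: "continuous_on UNIV (conv (mgrad n) (\<lambda>y. m y $ i))" for i by (rule C1D(2)[OF C])
  have iF: "integrable lborel (\<lambda>x. F x *\<^sub>R conv (mgrad n) (\<lambda>y. m y $ i) x)" for i
    by (rule integrable_bsupp[OF continuous_on_scaleR[OF Fc(1) dc]], rule bsupp_mono[OF bsupp_C1c(1)[OF F]], simp)
  have idF: "integrable lborel (\<lambda>x. conv (mollifier n) (\<lambda>y. m y $ i) x *\<^sub>R dF x)" for i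
    by (rule integrable_bsupp[OF continuous_on_scaleR[OF C1D(3)[OF C] Fc(2)]], rule bsupp_mono[OF bsupp_C1c(2)[OF F]], simp)
  have pt: "(\<Sum>i\<in>UNIV. conv (mgrad n) (\<lambda>y. m y $ i) x $ i) = 0" for x
  proof -
    have z: "(\<lambda>y. mollifier n (x - y)) \<in> Cc_inf" by (rule mollifier_Cc_inf)
    have "C1c (\<lambda>y. mollifier n (x + (-1) *\<^sub>R y)) (\<lambda>y. (-1) *\<^sub>R mgrad n (x + (-1) *\<^sub>R y))"
      by (rule C1c_affine[OF C1c_mollifier]) simp
    then have C': "C1c (\<lambda>y. mollifier n (x - y)) (\<lambda>y. - mgrad n (x - y))" by simp
    from div[OF z] have "(LBINT y. m y \<bullet> (- mgrad n (x - y))) = 0" unfolding C1c_Cc1(2)[OF C'] .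
    then have 0: "(LBINT y. (\<Sum>i\<in>UNIV. m y $ i * mgrad n (x - y) $ i)) = 0" by (simp add: inner_vec_def sum_negf)
    have ic: "integrable lborel (\<lambda>y. m y $ i *\<^sub>R mgrad n (x - y))" for i
      by (rule conv_integrable[OF mgrad_props(1,2) mi])
    have cc: "conv (mgrad n) (\<lambda>y. m y $ i) x $ i = (LBINT y. m y $ i * mgrad n (x - y) $ i)" for i
      using integral_inner_left[OF ic[of i], of "axis i 1"] unfolding conv_def by (simp add: inner_axis)
    have ii: "integrable lborel (\<lambda>y. m y $ i * mgrad n (x - y) $ i)" for i
      using integrable_inner_left[OF ic[of i], of "axis i 1"] by (simp add: inner_axis)
    show ?thesis unfolding cc using 0 ii by (simp add: integral_sum)
  qed
  have comp: "(LBINT x. conv (mollifier n) (\<lambda>y. m y $ i) x * dF x $ i) = - (LBINT x. F x * conv (mgrad n) (\<lambda>y. m y $ i) x $ i)" for i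
  proof -
    have "(LBINT x. F x *\<^sub>R conv (mgrad n) (\<lambda>y. m y $ i) x) \<bullet> axis i 1 = - (LBINT x. conv (mollifier n) (\<lambda>y. m y $ i) x *\<^sub>R dF x) \<bullet> axis i 1"
      using integral_by_parts[OF F C, of i] by simp
    then show ?thesis
      using integral_inner_left[OF iF[of i], of "axis i 1"] integral_inner_left[OF idF[of i], of "axis i 1"] by (simp add: inner_axis)
  qed
  have i1: "integrable lborel (\<lambda>x. conv (mollifier n) (\<lambda>y. m y $ i) x * dF x $ i)" for i
    using integrable_inner_left[OF idF[of i], of "axis i 1"] by (simp add: inner_axis)
  have i2: "integrable lborel (\<lambda>x. F x * conv (mgrad n) (\<lambda>y. m y $ i) x $ i)" for i
    using integrable_inner_left[OF iF[of i], of "axis i 1"] by (simp add: inner_axis)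
  have "(LBINT x. (\<Sum>i\<in>UNIV. conv (mollifier n) (\<lambda>y. m y $ i) x * dF x $ i))
     = (\<Sum>i\<in>UNIV. - (LBINT x. F x * conv (mgrad n) (\<lambda>y. m y $ i) x $ i))"
    using i1 by (simp add: integral_sum comp)
  also have "\<dots> = - (LBINT x. (\<Sum>i\<in>UNIV. F x * conv (mgrad n) (\<lambda>y. m y $ i) x $ i))"
    using i2 by (simp add: integral_sum sum_negf)
  also have "\<dots> = 0" unfolding sum_distrib_left[symmetric] pt by simp
  finally show ?thesis .
qed

text \<open>Widens the class of test functions from smooth to C^1, by letting the mollification
  scale tend to 0.\<close>

lemma divergence_free_C1c:
  fixes m :: "real^3 \<Rightarrow> real^3"
  assumes m: "locint m" and div: "\<And>\<phi>. \<phi> \<in> Cc_inf \<Longrightarrow> (LBINT x. m x \<bullet> grad \<phi> x) = 0" and F: "C1c F dF"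
  shows "(LBINT x. m x \<bullet> dF x) = 0"
proof -
  have mi: "locint (\<lambda>y. m y $ i)" for i using locint_inner[OF m, of "axis i 1"] by (simp add: inner_axis)
  have Fc: "continuous_on UNIV (\<lambda>x. dF x $ i)" for i using C1D(2)[OF C1c_C1[OF F]] by (intro continuous_intros)
  have Fb: "bsupp (\<lambda>x. dF x $ i)" for i by (rule bsupp_mono[OF bsupp_C1c(2)[OF F]]) simp
  have cm: "continuous_on UNIV (conv (mollifier n) (\<lambda>y. m y $ i))" for n i
    by (rule C1D(3)[OF C1_conv[OF C1c_mollifier mi]])
  have lc: "locint (conv (mollifier n) (\<lambda>y. m y $ i))" for n i
    unfolding locint_def using borel_integrable_compact[of "cball 0 R" "conv (mollifier n) (\<lambda>y. m y $ i)" for R] continuous_on_subset[OF cm]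
    by (auto intro: borel_measurable_continuous_onI[OF cm])
  have "(\<lambda>n. \<Sum>i\<in>UNIV. LBINT x. dF x $ i *\<^sub>R conv (mollifier n) (\<lambda>y. m y $ i) x) \<longlonglongrightarrow> (\<Sum>i\<in>UNIV. LBINT x. dF x $ i *\<^sub>R m x $ i)"
    by (intro tendsto_sum local_L1_limit_integral lc mi Fc Fb) (use mollify_local[OF approx_id_mollifier mi] in simp)
  moreover have "(\<Sum>i\<in>UNIV. LBINT x. dF x $ i *\<^sub>R conv (mollifier n) (\<lambda>y. m y $ i) x) = 0" for n
    using mollified_divergence_free[OF assms, of n] locint_mult_bsupp[OF lc Fc Fb]
    by (simp add: integral_sum mult.commute)
  ultimately have "(\<Sum>i\<in>UNIV. LBINT x. dF x $ i *\<^sub>R m x $ i) = 0" by (simp add: LIMSEQ_const_iff)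
  moreover have "(LBINT x. m x \<bullet> dF x) = (\<Sum>i\<in>UNIV. LBINT x. dF x $ i *\<^sub>R m x $ i)"
    using locint_mult_bsupp[OF mi Fc Fb] by (simp add: inner_vec_def integral_sum mult.commute)
  ultimately show ?thesis by simp
qed

text \<open>DiPerna--Lions renormalization, with \<open>B' = t \<beta>'\<close>.\<close>

lemma renormalized_continuity:
  fixes \<rho> d :: "real^3 \<Rightarrow> real" and u :: "real^3 \<Rightarrow> real^3"
  assumes \<rho>: "locint \<rho>" "\<And>x. 0 \<le> \<rho> x" "locint (\<lambda>x. (\<rho> x)^4)" and u: "locint u" and \<rho>u: "locint (\<lambda>x. \<rho> x *\<^sub>R u x)"
    and M: "\<And>i h. (NNINT x. (u (x + h) $ i - u x $ i)^2) \<le> ennreal ((norm h)^2 * M)" "M \<ge> 0"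
    and d: "locint d" "\<And>\<psi> d\<psi>. C1c \<psi> d\<psi> \<Longrightarrow> (LBINT x. u x \<bullet> d\<psi> x) = - (LBINT x. \<psi> x * d x)"
    and div: "\<And>\<phi>. \<phi> \<in> Cc_inf \<Longrightarrow> (LBINT x. (\<rho> x *\<^sub>R u x) \<bullet> grad \<phi> x) = 0"
    and \<beta>: "\<And>t. (\<beta> has_real_derivative \<beta>' t) (at t)" "\<And>t. (B has_real_derivative t * \<beta>' t) (at t)" "continuous_on UNIV \<beta>'"
    and K: "\<And>t. t \<ge> 0 \<Longrightarrow> \<bar>\<beta> t\<bar> \<le> K" "\<And>t. t \<ge> 0 \<Longrightarrow> \<bar>\<beta>' t\<bar> \<le> K" "\<And>t. t \<ge> 0 \<Longrightarrow> \<bar>B t\<bar> \<le> K" "\<And>t. t \<ge> 0 \<Longrightarrow> \<bar>t * \<beta> t - B t\<bar> \<le> K"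
    and \<xi>: "C1c \<xi> d\<xi>"
  shows "(LBINT x. \<xi> x * (B (\<rho> x) * d x)) = (LBINT x. (\<rho> x * \<beta> (\<rho> x) - B (\<rho> x)) * (u x \<bullet> d\<xi> x))"
proof -
  note mo = approx_idD[OF approx_id_mollifier]
  define r where "r n = conv (mollifier n) \<rho>" for n
  define dr where "dr n = conv (mgrad n) \<rho>" for n
  define m where "m n i = conv (mollifier n) (\<lambda>y. \<rho> y * u y $ i)" for n i
  define E where "E n i x = m n i x - r n x * u x $ i" for n i x
  have ui: "locint (\<lambda>x. u x $ i)" for i using locint_inner[OF u, of "axis i 1"] by (simp add: inner_axis)
  have \<rho>ui: "locint (\<lambda>x. \<rho> x * u x $ i)" for i using locint_inner[OF \<rho>u, of "axis i 1"] by (simp add: inner_axis)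
  have [measurable]: "\<rho> \<in> borel_measurable borel" "d \<in> borel_measurable borel" "u \<in> borel_measurable borel"
    using \<rho> d u by (auto intro: locint_measurable)
  have rC: "C1 (r n) (dr n)" for n unfolding r_def dr_def by (rule C1_conv[OF C1c_mollifier \<rho>(1)])
  have r0: "0 \<le> r n x" for n x
    unfolding r_def conv_def by (intro integral_nonneg_AE AE_I2) (simp add: \<rho>(2) mo(2))
  have mc: "continuous_on UNIV (m n i)" for n i unfolding m_def by (rule conv_continuous[OF mo(1) mo(4) \<rho>ui])
  have \<beta>c: "continuous_on UNIV \<beta>" "continuous_on UNIV B"
    using DERIV_isCont[OF \<beta>(1)] DERIV_isCont[OF \<beta>(2)] by (auto intro: continuous_at_imp_continuous_on)
  have [measurable]: "\<beta> \<in> borel_measurable borel" "B \<in> borel_measurable borel" "r n \<in> borel_measurable borel" "dr n \<in> borel_measurable borel" "m n i \<in> borel_measurable borel" for n i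
    using \<beta>c C1D(2,3)[OF rC] mc by (auto intro: borel_measurable_continuous_onI)
  have \<xi>c: "continuous_on UNIV \<xi>" "continuous_on UNIV d\<xi>" using C1D[OF C1c_C1[OF \<xi>]] by simp_all
  have [measurable]: "\<xi> \<in> borel_measurable borel" "d\<xi> \<in> borel_measurable borel" using \<xi>c by (auto intro: borel_measurable_continuous_onI)
  obtain X1 R1 where X1: "X1 > 0" "\<And>x. norm (\<xi> x) \<le> X1 * indicator (cball 0 R1) x"
    using bsupp_bound[OF \<xi>c(1) bsupp_C1c(1)[OF \<xi>]] by metis
  obtain X2 R2 where X2: "X2 > 0" "\<And>x. norm (d\<xi> x) \<le> X2 * indicator (cball 0 R2) x"
    using bsupp_bound[OF \<xi>c(2) bsupp_C1c(2)[OF \<xi>]] by metis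
  define R where "R = max R1 R2"
  define X where "X = X1 + X2"
  have X: "X > 0" "\<bar>\<xi> x\<bar> \<le> X * indicator (cball 0 R) x" "norm (d\<xi> x) \<le> X * indicator (cball 0 R) x" for x
  proof -
    show "X > 0" using X1 X2 by (simp add: X_def)
    have "X1 * indicator (cball 0 R1) x \<le> X * indicator (cball 0 R) x"
      unfolding X_def R_def using X1(1) X2(1) by (intro mult_mono) (auto simp: indicator_def)
    then show "\<bar>\<xi> x\<bar> \<le> X * indicator (cball 0 R) x" using X1(2)[of x] by simp
    have "X2 * indicator (cball 0 R2) x \<le> X * indicator (cball 0 R) x"
      unfolding X_def R_def using X1(1) X2(1) by (intro mult_mono) (auto simp: indicator_def)
    then show "norm (d\<xi> x) \<le> X * indicator (cball 0 R) x" using X2(2)[of x] by simp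
  qed
  have K0: "K \<ge> 0" using K(1)[of 0] by simp
  \<comment> \<open>The test function is \<xi> \<beta>(r), with r the mollified density: C^1, but in
    general not smooth.\<close>
  define dF where "dF n x = \<xi> x *\<^sub>R (\<beta>' (r n x) *\<^sub>R dr n x) + \<beta> (r n x) *\<^sub>R d\<xi> x" for n x
  have F: "C1c (\<lambda>x. \<xi> x * \<beta> (r n x)) (dF n)" for n
    unfolding dF_def by (rule C1c_mult_left[OF \<xi> C1_compose_real[OF rC \<beta>(1,3)]])
  define d\<Psi> where "d\<Psi> n x = \<xi> x *\<^sub>R ((r n x * \<beta>' (r n x)) *\<^sub>R dr n x) + B (r n x) *\<^sub>R d\<xi> x" for n x
  have \<Psi>: "C1c (\<lambda>x. \<xi> x * B (r n x)) (d\<Psi> n)" for n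
    unfolding d\<Psi>_def by (rule C1c_mult_left[OF \<xi> C1_compose_real[OF rC \<beta>(2)]]) (intro continuous_intros \<beta>(3))
  have dFc: "continuous_on UNIV (dF n)" for n by (rule C1D(2)[OF C1c_C1[OF F]])
  have dFb: "bsupp (dF n)" for n by (rule bsupp_C1c(2)[OF F])
  \<comment> \<open>This is where B' = t \<beta>' enters: r times the gradient of \<xi> \<beta>(r)
    is the gradient of \<xi> B(r) plus a term without derivatives of r. The weak divergence of u can
    then be inserted.\<close>
  have alg: "r n x *\<^sub>R dF n x = d\<Psi> n x + (r n x * \<beta> (r n x) - B (r n x)) *\<^sub>R d\<xi> x" for n x
    by (simp add: dF_def d\<Psi>_def algebra_simps)
  define Cn where "Cn n x = (r n x * \<beta> (r n x) - B (r n x)) * (u x \<bullet> d\<xi> x)" for n x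
  have iC: "integrable lborel (Cn n)" for n
  proof -
    have "continuous_on UNIV (\<lambda>x. (r n x * \<beta> (r n x) - B (r n x)) *\<^sub>R d\<xi> x)"
      by (intro continuous_intros \<xi>c C1D(3)[OF rC] continuous_on_compose2[OF \<beta>c(1)] continuous_on_compose2[OF \<beta>c(2)]) auto
    moreover have "bsupp (\<lambda>x. (r n x * \<beta> (r n x) - B (r n x)) *\<^sub>R d\<xi> x)"
      by (rule bsupp_mono[OF bsupp_C1c(2)[OF \<xi>]]) simp
    ultimately show ?thesis using locint_vec_inner_bsupp[OF u] unfolding Cn_def[abs_def] by fastforce
  qed
  have iPsi: "integrable lborel (\<lambda>x. u x \<bullet> d\<Psi> n x)" for n
    by (rule locint_vec_inner_bsupp[OF u C1D(2)[OF C1c_C1[OF \<Psi>]] bsupp_C1c(2)[OF \<Psi>]])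
  have im: "integrable lborel (\<lambda>x. \<Sum>i\<in>UNIV. m n i x * dF n x $ i)" for n
  proof (rule Bochner_Integration.integrable_sum)
    fix i
    have "continuous_on UNIV (\<lambda>x. dF n x $ i)" using dFc by (intro continuous_intros)
    moreover have "bsupp (\<lambda>x. dF n x $ i)" by (rule bsupp_mono[OF dFb[of n]]) simp
    ultimately show "integrable lborel (\<lambda>x. m n i x * dF n x $ i)"
      using integrable_product_bsupp[OF _ mc, of "\<lambda>x. dF n x $ i" n i] by (simp add: mult.commute)
  qed
  define Er where "Er n x = (\<Sum>i\<in>UNIV. E n i x * dF n x $ i)" for n x
  have Er_eq: "Er n x = (\<Sum>i\<in>UNIV. m n i x * dF n x $ i) - (u x \<bullet> d\<Psi> n x + Cn n x)" for n x
  proof -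
    have "Er n x = (\<Sum>i\<in>UNIV. m n i x * dF n x $ i) - (\<Sum>i\<in>UNIV. u x $ i * (r n x * dF n x $ i))"
      unfolding Er_def E_def by (simp add: sum_subtractf[symmetric] algebra_simps)
    also have "(\<Sum>i\<in>UNIV. u x $ i * (r n x * dF n x $ i)) = u x \<bullet> (r n x *\<^sub>R dF n x)" by (simp add: inner_vec_def)
    also have "\<dots> = u x \<bullet> d\<Psi> n x + Cn n x" unfolding alg by (simp add: inner_add_right Cn_def)
    finally show ?thesis .
  qed
  \<comment> \<open>The mollified flux m is r u plus the commutator E, and it integrates to zero
    against \<open>dF\<close>. \<open>Er\<close> collects the commutator contribution.\<close>
  have id: "(LBINT x. \<xi> x * (B (r n x) * d x)) = (LBINT x. Cn n x) + (LBINT x. Er n x)" for n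
  proof -
    have "(LBINT x. Er n x) = (LBINT x. (\<Sum>i\<in>UNIV. m n i x * dF n x $ i)) - ((LBINT x. u x \<bullet> d\<Psi> n x) + (LBINT x. Cn n x))"
      unfolding Er_eq using im iPsi iC by simp
    moreover have "(LBINT x. (\<Sum>i\<in>UNIV. m n i x * dF n x $ i)) = 0"
      using mollified_divergence_free[OF \<rho>u div F, of n n] by (simp add: m_def)
    moreover have "(LBINT x. u x \<bullet> d\<Psi> n x) = - (LBINT x. \<xi> x * (B (r n x) * d x))"
      using d(2)[OF \<Psi>, of n] by (simp add: mult.assoc)
    ultimately show ?thesis by simp
  qed
  have Er0: "(\<lambda>n. LBINT x. Er n x) \<longlonglongrightarrow> 0"
  proof (rule real_tendsto_0_from_ennreal, rule ennreal_squeeze_0)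
    fix n
    have iE: "integrable lborel (Er n)" unfolding Er_eq[abs_def] using im iPsi iC by simp
    have "ennreal (norm (LBINT x. Er n x)) \<le> (NNINT x. norm (Er n x))"
      by (rule integral_norm_bound_ennreal[OF iE])
    also have "\<dots> \<le> (\<integral>\<^sup>+x. (\<Sum>i\<in>UNIV. ennreal (K * X) * ennreal (indicator (cball 0 R) x * (\<bar>E n i x\<bar> * (norm (dr n x) + 1)))) \<partial>lborel)"
    proof (rule nn_integral_mono)
      fix x
      have dFn: "norm (dF n x) \<le> K * X * (indicator (cball 0 R) x * (norm (dr n x) + 1))"
      proof -
        have "norm (dF n x) \<le> \<bar>\<xi> x\<bar> * (\<bar>\<beta>' (r n x)\<bar> * norm (dr n x)) + \<bar>\<beta> (r n x)\<bar> * norm (d\<xi> x)"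
          unfolding dF_def by (rule order_trans[OF norm_triangle_ineq]) (simp add: abs_mult)
        also have "\<dots> \<le> (X * indicator (cball 0 R) x) * (K * norm (dr n x)) + K * (X * indicator (cball 0 R) x)"
          using X(1) K0 by (intro add_mono mult_mono X K r0) auto
        finally show ?thesis by (simp add: algebra_simps)
      qed
      have "norm (Er n x) \<le> (\<Sum>i\<in>UNIV. \<bar>E n i x * dF n x $ i\<bar>)" unfolding Er_def real_norm_def by (rule sum_abs)
      also have "\<dots> \<le> (\<Sum>i\<in>UNIV. (K * X) * (indicator (cball 0 R) x * (\<bar>E n i x\<bar> * (norm (dr n x) + 1))))"
      proof (rule sum_mono)
        fix i
        have "\<bar>dF n x $ i\<bar> \<le> K * X * (indicator (cball 0 R) x * (norm (dr n x) + 1))"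
          using dFn component_le_norm_cart[of "dF n x" i] by linarith
        then have "\<bar>E n i x\<bar> * \<bar>dF n x $ i\<bar> \<le> \<bar>E n i x\<bar> * (K * X * (indicator (cball 0 R) x * (norm (dr n x) + 1)))"
          by (intro mult_left_mono) auto
        then show "\<bar>E n i x * dF n x $ i\<bar> \<le> (K * X) * (indicator (cball 0 R) x * (\<bar>E n i x\<bar> * (norm (dr n x) + 1)))"
          by (simp add: abs_mult mult_ac)
      qed
      finally have "ennreal (norm (Er n x)) \<le> ennreal (\<Sum>i\<in>UNIV. (K * X) * (indicator (cball 0 R) x * (\<bar>E n i x\<bar> * (norm (dr n x) + 1))))"
        by (rule ennreal_leI)
      also have "\<dots> = (\<Sum>i\<in>UNIV. ennreal ((K * X) * (indicator (cball 0 R) x * (\<bar>E n i x\<bar> * (norm (dr n x) + 1)))))"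
        by (rule sum_ennreal[symmetric]) (use K0 X(1) in auto)
      also have "\<dots> = (\<Sum>i\<in>UNIV. ennreal (K * X) * ennreal (indicator (cball 0 R) x * (\<bar>E n i x\<bar> * (norm (dr n x) + 1))))"
        by (rule sum.cong) (use K0 X(1) in \<open>auto intro!: ennreal_mult\<close>)
      finally show "ennreal (norm (Er n x)) \<le> (\<Sum>i\<in>UNIV. ennreal (K * X) * ennreal (indicator (cball 0 R) x * (\<bar>E n i x\<bar> * (norm (dr n x) + 1))))" .
    qed
    also have "\<dots> = (\<Sum>i\<in>UNIV. ennreal (K * X) * (NNINT x. indicator (cball 0 R) x * (\<bar>E n i x\<bar> * (norm (dr n x) + 1))))"
      unfolding E_def by (subst nn_integral_sum) (auto simp: nn_integral_cmult)
    finally show "ennreal (norm (LBINT x. Er n x)) \<le> (\<Sum>i\<in>UNIV. ennreal (K * X) * (NNINT x. indicator (cball 0 R) x * (\<bar>E n i x\<bar> * (norm (dr n x) + 1))))" .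
  next
    have "(\<lambda>n. NNINT x. indicator (cball 0 R) x * (\<bar>E n i x\<bar> * (norm (dr n x) + 1))) \<longlonglongrightarrow> 0" for i
      unfolding E_def m_def r_def dr_def
      by (rule commutator_tendsto_0[OF \<rho>(1,2) \<rho>ui locint_measurable[OF ui] \<rho>(3) M])
    then have "(\<lambda>n. \<Sum>i\<in>(UNIV::3 set). ennreal (K * X) * (NNINT x. indicator (cball 0 R) x * (\<bar>E n i x\<bar> * (norm (dr n x) + 1)))) \<longlonglongrightarrow> (\<Sum>i\<in>(UNIV::3 set). ennreal (K * X) * 0)"
      by (intro tendsto_sum ennreal_tendsto_cmult) auto
    then show "(\<lambda>n. \<Sum>i\<in>UNIV. ennreal (K * X) * (NNINT x. indicator (cball 0 R) x * (\<bar>E n i x\<bar> * (norm (dr n x) + 1)))) \<longlonglongrightarrow> 0"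
      by simp
  qed
  \<comment> \<open>Pointwise convergence of the mollified density is used only on the ball
    containing the supports of \<xi> and \<open>d\<xi>\<close>; elsewhere the integrands
    vanish.\<close>
  have "(\<lambda>n. NNINT x. \<bar>indicator (cball 0 R) x * (r n x - \<rho> x)\<bar>) \<longlonglongrightarrow> 0"
    using mollify_local[OF approx_id_mollifier \<rho>(1), of R] by (simp add: r_def abs_mult)
  then obtain s :: "nat \<Rightarrow> nat" where s: "strict_mono s" "AE x in lborel. (\<lambda>n. indicator (cball 0 R) x * (r (s n) x - \<rho> x)) \<longlonglongrightarrow> 0"
    by (rule nn_integral_tendsto_0_AE_subseq[rotated]) auto
  have conv: "AE x in lborel. x \<in> cball 0 R \<longrightarrow> (\<lambda>n. r (s n) x) \<longlonglongrightarrow> \<rho> x"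
    using s(2) by eventually_elim (auto simp: Lim_null[of _ "\<rho> _"])
  have L1: "(\<lambda>n. LBINT x. \<xi> x * (B (r (s n) x) * d x)) \<longlonglongrightarrow> (LBINT x. \<xi> x * (B (\<rho> x) * d x))"
  proof (rule integral_dominated_convergence[where w="\<lambda>x. K * \<bar>\<xi> x *\<^sub>R d x\<bar>"])
    show "integrable lborel (\<lambda>x. K * \<bar>\<xi> x *\<^sub>R d x\<bar>)"
      by (intro integrable_mult_right integrable_abs locint_mult_bsupp[OF d(1) \<xi>c(1) bsupp_C1c(1)[OF \<xi>]])
    show "AE x in lborel. (\<lambda>n. \<xi> x * (B (r (s n) x) * d x)) \<longlonglongrightarrow> \<xi> x * (B (\<rho> x) * d x)"
      using conv
    proof eventually_elim
      case (elim x)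
      show ?case
      proof (cases "x \<in> cball 0 R")
        case True
        then have "(\<lambda>n. B (r (s n) x)) \<longlonglongrightarrow> B (\<rho> x)" using elim by (intro continuous_on_tendsto_compose[OF \<beta>c(2)]) auto
        then show ?thesis by (intro tendsto_intros)
      next
        case False
        then have "\<xi> x = 0" using X(2)[of x] by simp
        then show ?thesis by simp
      qed
    qed
    show "AE x in lborel. norm (\<xi> x * (B (r (s n) x) * d x)) \<le> K * \<bar>\<xi> x *\<^sub>R d x\<bar>" for n
    proof (rule AE_I2)
      fix x
      have "\<bar>B (r (s n) x)\<bar> * \<bar>\<xi> x *\<^sub>R d x\<bar> \<le> K * \<bar>\<xi> x *\<^sub>R d x\<bar>" by (intro mult_right_mono K(3) r0) simp
      then show "norm (\<xi> x * (B (r (s n) x) * d x)) \<le> K * \<bar>\<xi> x *\<^sub>R d x\<bar>" by (simp add: abs_mult mult_ac)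
    qed
  qed simp_all
  have L2: "(\<lambda>n. LBINT x. Cn (s n) x) \<longlonglongrightarrow> (LBINT x. (\<rho> x * \<beta> (\<rho> x) - B (\<rho> x)) * (u x \<bullet> d\<xi> x))"
    unfolding Cn_def
  proof (rule integral_dominated_convergence[where w="\<lambda>x. K * \<bar>u x \<bullet> d\<xi> x\<bar>"])
    show "integrable lborel (\<lambda>x. K * \<bar>u x \<bullet> d\<xi> x\<bar>)"
      by (intro integrable_mult_right integrable_abs locint_vec_inner_bsupp[OF u \<xi>c(2) bsupp_C1c(2)[OF \<xi>]])
    show "AE x in lborel. (\<lambda>n. (r (s n) x * \<beta> (r (s n) x) - B (r (s n) x)) * (u x \<bullet> d\<xi> x)) \<longlonglongrightarrow> (\<rho> x * \<beta> (\<rho> x) - B (\<rho> x)) * (u x \<bullet> d\<xi> x)"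
      using conv
    proof eventually_elim
      case (elim x)
      show ?case
      proof (cases "x \<in> cball 0 R")
        case True
        then have l: "(\<lambda>n. r (s n) x) \<longlonglongrightarrow> \<rho> x" using elim by simp
        have "(\<lambda>n. B (r (s n) x)) \<longlonglongrightarrow> B (\<rho> x)" "(\<lambda>n. \<beta> (r (s n) x)) \<longlonglongrightarrow> \<beta> (\<rho> x)"
          by (rule continuous_on_tendsto_compose[OF \<beta>c(2) l] continuous_on_tendsto_compose[OF \<beta>c(1) l]; simp)+
        then show ?thesis using l by (intro tendsto_intros)
      next
        case False
        then have "d\<xi> x = 0" using X(3)[of x] by simp
        then show ?thesis by simp
      qed
    qed
    show "AE x in lborel. norm ((r (s n) x * \<beta> (r (s n) x) - B (r (s n) x)) * (u x \<bullet> d\<xi> x)) \<le> K * \<bar>u x \<bullet> d\<xi> x\<bar>" for n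
      by (rule AE_I2) (simp only: real_norm_def abs_mult, intro mult_right_mono K(4) r0, simp)
  qed measurable
  have "(\<lambda>n. (LBINT x. Cn (s n) x) + (LBINT x. Er (s n) x)) \<longlonglongrightarrow> (LBINT x. (\<rho> x * \<beta> (\<rho> x) - B (\<rho> x)) * (u x \<bullet> d\<xi> x)) + 0"
    by (intro tendsto_add L2) (use LIMSEQ_subseq_LIMSEQ[OF Er0 s(1)] in \<open>simp add: o_def\<close>)
  then have "(\<lambda>n. LBINT x. \<xi> x * (B (r (s n) x) * d x)) \<longlonglongrightarrow> (LBINT x. (\<rho> x * \<beta> (\<rho> x) - B (\<rho> x)) * (u x \<bullet> d\<xi> x))"
    unfolding id by simp
  then show ?thesis using L1 by (rule LIMSEQ_unique[rotated])
qed

section \<open>Limits under duality and cut-offs\<close>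

lemma nn_integral_le_of_balls:
  fixes f :: "'a::euclidean_space \<Rightarrow> real"
  assumes [measurable]: "f \<in> borel_measurable borel" and b: "\<And>n::nat. (NNINT x. indicator (cball 0 (real n)) x * f x) \<le> C"
  shows "(NNINT x. f x) \<le> C"
proof -
  have "ennreal (f x) = liminf (\<lambda>n::nat. ennreal (indicator (cball 0 (real n)) x * f x))" for x
  proof -
    obtain N :: nat where N: "norm x \<le> N" using real_arch_simple by blast
    have "\<forall>\<^sub>F n in sequentially. ennreal (indicator (cball 0 (real n)) x * f x) = ennreal (f x)"
      using eventually_ge_at_top[of N] by eventually_elim (use N in auto)
    then have "(\<lambda>n. ennreal (indicator (cball 0 (real n)) x * f x)) \<longlonglongrightarrow> ennreal (f x)" by (rule tendsto_eventually)
    then show ?thesis by (intro lim_imp_Liminf[symmetric]) auto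
  qed
  then have "(NNINT x. f x) = (\<integral>\<^sup>+x. liminf (\<lambda>n::nat. ennreal (indicator (cball 0 (real n)) x * f x)) \<partial>lborel)" by simp
  also have "\<dots> \<le> liminf (\<lambda>n::nat. NNINT x. indicator (cball 0 (real n)) x * f x)"
    by (rule nn_integral_liminf) measurable
  also have "\<dots> \<le> C" by (rule Liminf_le) (use b in auto)
  finally show ?thesis .
qed

lemma nn_integral_norm_sq_diff:
  fixes a b :: "'a \<Rightarrow> 'b::euclidean_space"
  assumes [measurable]: "a \<in> borel_measurable M" "b \<in> borel_measurable M"
  shows "(\<integral>\<^sup>+x. ennreal (norm (a x - b x)^2) \<partial>M) \<le> 2 * (\<integral>\<^sup>+x. ennreal (norm (a x)^2) \<partial>M) + 2 * (\<integral>\<^sup>+x. ennreal (norm (b x)^2) \<partial>M)"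
proof -
  have "(\<integral>\<^sup>+x. ennreal (norm (a x - b x)^2) \<partial>M) \<le> (\<integral>\<^sup>+x. 2 * ennreal (norm (a x)^2) + 2 * ennreal (norm (b x)^2) \<partial>M)"
  proof (rule nn_integral_mono)
    fix x
    have "norm (a x - b x)^2 \<le> (norm (a x) + norm (b x))^2" by (intro power_mono norm_triangle_ineq4) simp
    also have "\<dots> \<le> 2 * norm (a x)^2 + 2 * norm (b x)^2"
      using sum_squares_bound[of "norm (a x)" "norm (b x)"] by (simp add: power2_sum)
    finally have "ennreal (norm (a x - b x)^2) \<le> ennreal (2 * norm (a x)^2 + 2 * norm (b x)^2)" by (rule ennreal_leI)
    then show "ennreal (norm (a x - b x)^2) \<le> 2 * ennreal (norm (a x)^2) + 2 * ennreal (norm (b x)^2)" by (simp add: ennreal_mult)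
  qed
  also have "\<dots> = 2 * (\<integral>\<^sup>+x. ennreal (norm (a x)^2) \<partial>M) + 2 * (\<integral>\<^sup>+x. ennreal (norm (b x)^2) \<partial>M)"
    by (simp add: nn_integral_add nn_integral_cmult)
  finally show ?thesis .
qed

text \<open>The Sobolev inequality for differences makes the sequence Cauchy in L^6. Local L^1
  convergence identifies the limit: on each ball an almost everywhere convergent subsequence and
  Fatou's lemma give the estimate with w, uniformly in the ball.\<close>

lemma Sobolev_limit:
  fixes \<phi> :: "nat \<Rightarrow> real^3 \<Rightarrow> real"
  assumes \<phi>: "\<And>n. C1c (\<phi> n) (d\<phi> n)" and V[measurable]: "V \<in> borel_measurable borel" and w[measurable]: "w \<in> borel_measurable borel"
    and lV: "(\<lambda>n. NNINT x. norm (d\<phi> n x - V x)^2) \<longlonglongrightarrow> 0"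
    and lw: "\<And>R. (\<lambda>n. NNINT x. indicator (cball 0 R) x * \<bar>\<phi> n x - w x\<bar>) \<longlonglongrightarrow> 0"
  shows "(\<lambda>n. NNINT x. \<bar>\<phi> n x - w x\<bar>^6) \<longlonglongrightarrow> 0"
proof (rule ennreal_tendsto_0I)
  fix e :: real assume e: "e > 0"
  have c: "continuous_on UNIV (\<phi> n)" "continuous_on UNIV (d\<phi> n)" for n using C1D[OF C1c_C1[OF \<phi>]] by simp_all
  have m[measurable]: "\<phi> n \<in> borel_measurable borel" "d\<phi> n \<in> borel_measurable borel" for n
    using c by (auto intro: borel_measurable_continuous_onI)
  \<comment> \<open>As \<delta> \<le> 1, its cube is at most \<delta>, so 4096 \<delta>^3 \<le> e.
    Two distances at most \<delta>/4 give \<delta> for the difference, since each enters with a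
    factor 2.\<close>
  define \<delta> where "\<delta> = min 1 (e / 4096)"
  have \<delta>: "\<delta> > 0" "4096 * \<delta>^3 \<le> e"
  proof -
    show "\<delta> > 0" using e by (simp add: \<delta>_def)
    have "\<delta>^3 \<le> \<delta>" using \<open>\<delta> > 0\<close> power_decreasing[of 1 3 \<delta>] by (simp add: \<delta>_def)
    also have "\<delta> \<le> e / 4096" by (simp add: \<delta>_def)
    finally show "4096 * \<delta>^3 \<le> e" by simp
  qed
  obtain N where N: "\<And>n. n \<ge> N \<Longrightarrow> (NNINT x. norm (d\<phi> n x - V x)^2) \<le> ennreal (\<delta> / 4)"
    using ennreal_tendsto_0D[OF lV, of "\<delta> / 4"] \<delta>(1) by (auto simp: eventually_sequentially)
  have cau: "(NNINT x. \<bar>\<phi> n x - \<phi> k x\<bar>^6) \<le> ennreal e" if "n \<ge> N" "k \<ge> N" for n k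
  proof -
    have C: "C1c (\<lambda>x. \<phi> n x - \<phi> k x) (\<lambda>x. d\<phi> n x - d\<phi> k x)"
      using C1c_add[OF \<phi>[of n] C1c_scale[OF \<phi>[of k], of "-1"]] by simp
    have "(NNINT x. norm (d\<phi> n x - d\<phi> k x)^2)
      = (NNINT x. norm ((d\<phi> n x - V x) - (d\<phi> k x - V x))^2)" by simp
    also have "\<dots> \<le> 2 * (NNINT x. norm (d\<phi> n x - V x)^2) + 2 * (NNINT x. norm (d\<phi> k x - V x)^2)"
      by (rule nn_integral_norm_sq_diff) measurable
    also have "\<dots> \<le> 2 * ennreal (\<delta> / 4) + 2 * ennreal (\<delta> / 4)"
      by (intro add_mono mult_left_mono N that) auto
    also have "\<dots> = ennreal \<delta>"
    proof -
      have "2 * ennreal (\<delta> / 4) = ennreal (2 * (\<delta> / 4))" using \<delta>(1) by (simp only: ennreal_mult ennreal_numeral)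
      then show ?thesis using \<delta>(1) by (simp add: ennreal_plus[symmetric] del: ennreal_plus)
    qed
    finally have "4096 * (NNINT x. norm (d\<phi> n x - d\<phi> k x)^2)^3 \<le> 4096 * (ennreal \<delta>)^3"
      by (intro mult_left_mono power_mono) auto
    also have "\<dots> = ennreal (4096 * \<delta>^3)" using \<delta>(1) by (simp add: ennreal_mult ennreal_power)
    also have "\<dots> \<le> ennreal e" by (rule ennreal_leI[OF \<delta>(2)])
    finally show ?thesis using Sobolev_6_2[OF C] by simp
  qed
  have "(NNINT x. \<bar>\<phi> n x - w x\<bar>^6) \<le> ennreal e" if n: "n \<ge> N" for n
  proof (rule nn_integral_le_of_balls)
    fix j :: nat
    have "(\<lambda>k. NNINT x. \<bar>indicator (cball 0 (real j)) x * (\<phi> k x - w x)\<bar>) \<longlonglongrightarrow> 0"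
      using lw[of "real j"] by (simp add: abs_mult)
    then obtain s :: "nat \<Rightarrow> nat" where s: "strict_mono s" "AE x in lborel. (\<lambda>k. indicator (cball 0 (real j)) x * (\<phi> (s k) x - w x)) \<longlonglongrightarrow> 0"
      by (rule nn_integral_tendsto_0_AE_subseq[rotated]) auto
    have "AE x in lborel. ennreal (indicator (cball 0 (real j)) x * \<bar>\<phi> n x - w x\<bar>^6)
        = liminf (\<lambda>k. ennreal (indicator (cball 0 (real j)) x * \<bar>\<phi> n x - \<phi> (s k) x\<bar>^6))"
      using s(2)
    proof eventually_elim
      case (elim x)
      have "(\<lambda>k. indicator (cball 0 (real j)) x * \<bar>\<phi> n x - \<phi> (s k) x\<bar>^6) \<longlonglongrightarrow> indicator (cball 0 (real j)) x * \<bar>\<phi> n x - w x\<bar>^6"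
      proof (cases "x \<in> cball 0 (real j)")
        case True
        then have "(\<lambda>k. \<phi> (s k) x) \<longlonglongrightarrow> w x" using elim by (simp add: Lim_null[of _ "w x"])
        then show ?thesis by (intro tendsto_intros)
      qed simp
      then have "(\<lambda>k. ennreal (indicator (cball 0 (real j)) x * \<bar>\<phi> n x - \<phi> (s k) x\<bar>^6)) \<longlonglongrightarrow> ennreal (indicator (cball 0 (real j)) x * \<bar>\<phi> n x - w x\<bar>^6)"
        by (rule tendsto_ennrealI)
      then show ?case by (intro lim_imp_Liminf[symmetric]) auto
    qed
    then have "(NNINT x. indicator (cball 0 (real j)) x * \<bar>\<phi> n x - w x\<bar>^6)
      = (\<integral>\<^sup>+x. liminf (\<lambda>k. ennreal (indicator (cball 0 (real j)) x * \<bar>\<phi> n x - \<phi> (s k) x\<bar>^6)) \<partial>lborel)"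
      by (rule nn_integral_cong_AE)
    also have "\<dots> \<le> liminf (\<lambda>k. NNINT x. indicator (cball 0 (real j)) x * \<bar>\<phi> n x - \<phi> (s k) x\<bar>^6)"
      by (rule nn_integral_liminf) measurable
    also have "\<dots> \<le> ennreal e"
    proof (rule Liminf_le)
      show "\<forall>\<^sub>F k in sequentially. (NNINT x. indicator (cball 0 (real j)) x * \<bar>\<phi> n x - \<phi> (s k) x\<bar>^6) \<le> ennreal e"
        using eventually_ge_at_top[of N]
      proof eventually_elim
        case (elim k)
        have "s k \<ge> N" using elim seq_suble[OF s(1), of k] by simp
        have "(NNINT x. indicator (cball 0 (real j)) x * \<bar>\<phi> n x - \<phi> (s k) x\<bar>^6) \<le> (NNINT x. \<bar>\<phi> n x - \<phi> (s k) x\<bar>^6)"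
          by (intro nn_integral_mono ennreal_leI) (auto simp: indicator_def)
        also have "\<dots> \<le> ennreal e" by (rule cau[OF n \<open>s k \<ge> N\<close>])
        finally show ?case .
      qed
    qed simp
    finally show "(NNINT x. indicator (cball 0 (real j)) x * \<bar>\<phi> n x - w x\<bar>^6) \<le> ennreal e" .
  qed measurable
  then show "\<forall>\<^sub>F n in sequentially. (NNINT x. \<bar>\<phi> n x - w x\<bar>^6) \<le> ennreal e"
    unfolding eventually_sequentially by blast
qed

text \<open>The increment is an integral of the gradient over the segment; Cauchy-Schwarz in the
  parameter, then Tonelli and translation invariance.\<close>

lemma increment_C1c:
  fixes \<phi> :: "'a::euclidean_space \<Rightarrow> real"
  assumes \<phi>: "C1c \<phi> d\<phi>"
  shows "(NNINT x. (\<phi> (x + h) - \<phi> x)^2) \<le> ennreal ((norm h)^2) * (NNINT x. norm (d\<phi> x)^2)"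
proof -
  have c: "continuous_on UNIV \<phi>" "continuous_on UNIV d\<phi>" using C1D[OF C1c_C1[OF \<phi>]] by simp_all
  have [measurable]: "\<phi> \<in> borel_measurable borel" "d\<phi> \<in> borel_measurable borel"
    using c by (auto intro: borel_measurable_continuous_onI)
  have pt: "ennreal ((\<phi> (x + h) - \<phi> x)^2) \<le> (\<integral>\<^sup>+t. indicator {0..1::real} t * ennreal ((norm h)^2 * norm (d\<phi> (x + t *\<^sub>R h))^2) \<partial>lborel)" for x
  proof -
    have b: "has_bochner_integral lborel (\<lambda>t. (d\<phi> (x + t *\<^sub>R h) \<bullet> h) * indicator {0..1} t) (\<phi> (x + 1 *\<^sub>R h) - \<phi> (x + 0 *\<^sub>R h))"
    proof (rule has_bochner_integral_FTC_Icc_real)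
      show "((\<lambda>t. \<phi> (x + t *\<^sub>R h)) has_real_derivative d\<phi> (x + t *\<^sub>R h) \<bullet> h) (at t)" for t
        by (rule C1_line[OF C1c_C1[OF \<phi>]])
      have "continuous_on UNIV (\<lambda>t. d\<phi> (x + t *\<^sub>R h) \<bullet> h)"
        by (intro continuous_intros continuous_on_compose2[OF c(2)]) auto
      then show "isCont (\<lambda>t. d\<phi> (x + t *\<^sub>R h) \<bullet> h) t" for t by (simp add: continuous_on_eq_continuous_at)
    qed simp
    then have i: "integrable lborel (\<lambda>t. (d\<phi> (x + t *\<^sub>R h) \<bullet> h) * indicator {0..1} t)"
      and e: "(LBINT t. (d\<phi> (x + t *\<^sub>R h) \<bullet> h) * indicator {0..1} t) = \<phi> (x + h) - \<phi> x"
      by (auto simp: has_bochner_integral_iff)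
    have "ennreal \<bar>\<phi> (x + h) - \<phi> x\<bar> \<le> (NNINT t. \<bar>(d\<phi> (x + t *\<^sub>R h) \<bullet> h) * indicator {0..1} t\<bar>)"
      using integral_norm_bound_ennreal[OF i] e by simp
    then have "(ennreal \<bar>\<phi> (x + h) - \<phi> x\<bar>)^2 \<le> (NNINT t. \<bar>(d\<phi> (x + t *\<^sub>R h) \<bullet> h) * indicator {0..1} t\<bar>)^2"
      by (rule power_mono) simp
    also have "\<dots> \<le> (\<integral>\<^sup>+t. indicator {0..1::real} t \<partial>lborel) * (\<integral>\<^sup>+t. indicator {0..1::real} t * ennreal ((norm h)^2 * norm (d\<phi> (x + t *\<^sub>R h))^2) \<partial>lborel)"
    proof (rule nn_integral_Cauchy_Schwarz)
      fix t :: real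
      have "\<bar>d\<phi> (x + t *\<^sub>R h) \<bullet> h\<bar> \<le> norm (d\<phi> (x + t *\<^sub>R h)) * norm h" by (rule Cauchy_Schwarz_ineq2)
      then have "\<bar>d\<phi> (x + t *\<^sub>R h) \<bullet> h\<bar>^2 \<le> (norm (d\<phi> (x + t *\<^sub>R h)) * norm h)^2" by (rule power_mono) simp
      then show "(ennreal \<bar>(d\<phi> (x + t *\<^sub>R h) \<bullet> h) * indicator {0..1} t\<bar>)^2
        \<le> indicator {0..1} t * (indicator {0..1} t * ennreal ((norm h)^2 * norm (d\<phi> (x + t *\<^sub>R h))^2))"
        by (auto simp: indicator_def ennreal_power power_mult_distrib mult.commute)
    qed measurable
    also have "(\<integral>\<^sup>+t. indicator {0..1::real} t \<partial>lborel) = 1" by simp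
    finally show ?thesis by (simp add: ennreal_power)
  qed
  have "(NNINT x. (\<phi> (x + h) - \<phi> x)^2)
    \<le> (\<integral>\<^sup>+x. (\<integral>\<^sup>+t. indicator {0..1::real} t * ennreal ((norm h)^2 * norm (d\<phi> (x + t *\<^sub>R h))^2) \<partial>lborel) \<partial>lborel)"
    by (intro nn_integral_mono pt)
  also have "\<dots> = (\<integral>\<^sup>+t. (\<integral>\<^sup>+x. indicator {0..1::real} t * ennreal ((norm h)^2 * norm (d\<phi> (x + t *\<^sub>R h))^2) \<partial>lborel) \<partial>lborel)"
    by (rule lborel_pair.Fubini') measurable
  also have "\<dots> = (\<integral>\<^sup>+t. indicator {0..1::real} t * (ennreal ((norm h)^2) * (NNINT x. norm (d\<phi> x)^2)) \<partial>lborel)"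
  proof (rule nn_integral_cong)
    fix t :: real
    have "(\<integral>\<^sup>+x. indicator {0..1::real} t * ennreal ((norm h)^2 * norm (d\<phi> (x + t *\<^sub>R h))^2) \<partial>lborel)
      = indicator {0..1::real} t * (ennreal ((norm h)^2) * (NNINT x. norm (d\<phi> (x + t *\<^sub>R h))^2))"
      by (simp add: ennreal_mult nn_integral_cmult)
    also have "(NNINT x. norm (d\<phi> (x + t *\<^sub>R h))^2) = (NNINT x. norm (d\<phi> x)^2)"
      by (rule lborel_nn_integral_translate[of "\<lambda>x. ennreal (norm (d\<phi> x)^2)"]) measurable
    finally show "(\<integral>\<^sup>+x. indicator {0..1::real} t * ennreal ((norm h)^2 * norm (d\<phi> (x + t *\<^sub>R h))^2) \<partial>lborel)
      = indicator {0..1::real} t * (ennreal ((norm h)^2) * (NNINT x. norm (d\<phi> x)^2))" .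
  qed
  also have "\<dots> = ennreal ((norm h)^2) * (NNINT x. norm (d\<phi> x)^2)"
    by (simp add: nn_integral_multc)
  finally show ?thesis .
qed

lemma increment_limit:
  fixes \<phi> :: "nat \<Rightarrow> 'a::euclidean_space \<Rightarrow> real"
  assumes \<phi>: "\<And>n. C1c (\<phi> n) (d\<phi> n)" and w[measurable]: "w \<in> borel_measurable borel"
    and b: "\<And>n. (NNINT x. norm (d\<phi> n x)^2) \<le> ennreal M" "M \<ge> 0"
    and l: "(\<lambda>n. NNINT x. \<bar>\<phi> n x - w x\<bar>^6) \<longlonglongrightarrow> 0"
  shows "(NNINT x. (w (x + h) - w x)^2) \<le> ennreal ((norm h)^2 * M)"
proof -
  have m[measurable]: "\<phi> n \<in> borel_measurable borel" for n
    using C1D(3)[OF C1c_C1[OF \<phi>]] by (rule borel_measurable_continuous_onI)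
  have "(\<integral>\<^sup>+x. ennreal \<bar>\<bar>\<phi> n x - w x\<bar>^6 + \<bar>\<phi> n (x + h) - w (x + h)\<bar>^6\<bar> \<partial>lborel) = 2 * (NNINT x. \<bar>\<phi> n x - w x\<bar>^6)" for n
  proof -
    have "(\<integral>\<^sup>+x. ennreal \<bar>\<bar>\<phi> n x - w x\<bar>^6 + \<bar>\<phi> n (x + h) - w (x + h)\<bar>^6\<bar> \<partial>lborel)
      = (\<integral>\<^sup>+x. ennreal (\<bar>\<phi> n x - w x\<bar>^6) + ennreal (\<bar>\<phi> n (x + h) - w (x + h)\<bar>^6) \<partial>lborel)"
      by (intro nn_integral_cong) (simp add: abs_of_nonneg)
    also have "\<dots> = (NNINT x. \<bar>\<phi> n x - w x\<bar>^6) + (NNINT x. \<bar>\<phi> n (x + h) - w (x + h)\<bar>^6)"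
      by (rule nn_integral_add) measurable
    also have "(NNINT x. \<bar>\<phi> n (x + h) - w (x + h)\<bar>^6) = (NNINT x. \<bar>\<phi> n x - w x\<bar>^6)"
      by (rule lborel_nn_integral_translate[of "\<lambda>x. ennreal (\<bar>\<phi> n x - w x\<bar>^6)"]) measurable
    finally show ?thesis by (simp add: mult_2)
  qed
  moreover have "(\<lambda>n. 2 * (NNINT x. \<bar>\<phi> n x - w x\<bar>^6)) \<longlonglongrightarrow> 2 * 0"
    by (intro ennreal_tendsto_cmult l) simp
  ultimately have "(\<lambda>n. \<integral>\<^sup>+x. ennreal \<bar>\<bar>\<phi> n x - w x\<bar>^6 + \<bar>\<phi> n (x + h) - w (x + h)\<bar>^6\<bar> \<partial>lborel) \<longlonglongrightarrow> 0" by simp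
  \<comment> \<open>Adding the errors at x and at x + h yields one subsequence that converges at
    both points.\<close>
  then obtain s :: "nat \<Rightarrow> nat" where s: "strict_mono s"
    "AE x in lborel. (\<lambda>n. \<bar>\<phi> (s n) x - w x\<bar>^6 + \<bar>\<phi> (s n) (x + h) - w (x + h)\<bar>^6) \<longlonglongrightarrow> 0"
    by (rule nn_integral_tendsto_0_AE_subseq[rotated]) auto
  have p6: "a \<longlonglongrightarrow> 0" if "(\<lambda>n. \<bar>a n\<bar>^6) \<longlonglongrightarrow> 0" for a :: "nat \<Rightarrow> real"
  proof -
    have "(\<lambda>n. root 6 (\<bar>a n\<bar>^6)) \<longlonglongrightarrow> root 6 0" by (intro tendsto_real_root that)
    moreover have "root 6 (\<bar>a n\<bar>^6) = \<bar>a n\<bar>" for n by (rule real_root_power_cancel) auto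
    ultimately have "(\<lambda>n. \<bar>a n\<bar>) \<longlonglongrightarrow> 0" by simp
    then show ?thesis by (rule tendsto_rabs_zero_cancel)
  qed
  have "AE x in lborel. ennreal ((w (x + h) - w x)^2) = liminf (\<lambda>n. ennreal ((\<phi> (s n) (x + h) - \<phi> (s n) x)^2))"
    using s(2)
  proof eventually_elim
    case (elim x)
    have "(\<lambda>n. \<bar>\<phi> (s n) x - w x\<bar>^6) \<longlonglongrightarrow> 0" "(\<lambda>n. \<bar>\<phi> (s n) (x + h) - w (x + h)\<bar>^6) \<longlonglongrightarrow> 0"
      by (rule tendsto_sandwich[OF _ _ tendsto_const elim]; simp)+
    then have "(\<lambda>n. \<phi> (s n) x) \<longlonglongrightarrow> w x" "(\<lambda>n. \<phi> (s n) (x + h)) \<longlonglongrightarrow> w (x + h)"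
      by (auto dest!: p6 simp: Lim_null[symmetric])
    then have "(\<lambda>n. ennreal ((\<phi> (s n) (x + h) - \<phi> (s n) x)^2)) \<longlonglongrightarrow> ennreal ((w (x + h) - w x)^2)"
      by (intro tendsto_ennrealI tendsto_intros)
    then show ?case by (intro lim_imp_Liminf[symmetric]) auto
  qed
  then have "(NNINT x. (w (x + h) - w x)^2) = (\<integral>\<^sup>+x. liminf (\<lambda>n. ennreal ((\<phi> (s n) (x + h) - \<phi> (s n) x)^2)) \<partial>lborel)"
    by (rule nn_integral_cong_AE)
  also have "\<dots> \<le> liminf (\<lambda>n. NNINT x. (\<phi> (s n) (x + h) - \<phi> (s n) x)^2)"
    by (rule nn_integral_liminf) measurable
  also have "\<dots> \<le> ennreal ((norm h)^2 * M)"
  proof (rule Liminf_le)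
    have "(NNINT x. (\<phi> (s n) (x + h) - \<phi> (s n) x)^2) \<le> ennreal ((norm h)^2 * M)" for n
    proof -
    have "(NNINT x. (\<phi> (s n) (x + h) - \<phi> (s n) x)^2) \<le> ennreal ((norm h)^2) * (NNINT x. norm (d\<phi> (s n) x)^2)"
      by (rule increment_C1c[OF \<phi>])
    also have "\<dots> \<le> ennreal ((norm h)^2) * ennreal M" by (intro mult_left_mono b) simp
    finally show ?thesis using b(2) by (simp add: ennreal_mult)
    qed
    then show "\<forall>\<^sub>F n in sequentially. (NNINT x. (\<phi> (s n) (x + h) - \<phi> (s n) x)^2) \<le> ennreal ((norm h)^2 * M)"
      by simp
  qed simp
  finally show ?thesis .
qed

text \<open>A weak form without the factors 1/p and 1/q: writing a and b as powers of a^p and b^q,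
  the product is at most the larger of the two. Constants are immaterial in the
  applications.\<close>

lemma young_product:
  fixes a b p q :: real
  assumes "a \<ge> 0" "b \<ge> 0" "p > 0" "q > 0" "1 / p + 1 / q = 1"
  shows "a * b \<le> a powr p + b powr q"
proof (cases "a = 0 \<or> b = 0")
  case False
  then have ab: "a > 0" "b > 0" using assms by auto
  show ?thesis
  proof (cases "a powr p \<le> b powr q")
    case True
    have "a = (a powr p) powr (1 / p)" using ab assms by (simp add: powr_powr)
    also have "\<dots> \<le> (b powr q) powr (1 / p)" using True assms by (intro powr_mono2) auto
    finally have "a * b \<le> (b powr q) powr (1 / p) * (b powr q) powr (1 / q)" using ab assms by (simp add: powr_powr)
    also have "\<dots> = (b powr q) powr 1" using assms(5) by (simp only: powr_add[symmetric])
    finally show ?thesis using ab by (simp add: add_increasing)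
  next
    case F: False
    have "b = (b powr q) powr (1 / q)" using ab assms by (simp add: powr_powr)
    also have "\<dots> \<le> (a powr p) powr (1 / q)" using F assms by (intro powr_mono2) auto
    finally have "a * b \<le> (a powr p) powr (1 / p) * (a powr p) powr (1 / q)" using ab assms by (simp add: powr_powr)
    also have "\<dots> = (a powr p) powr 1" using assms(5) by (simp only: powr_add[symmetric])
    finally show ?thesis using ab by (simp add: add_increasing2)
  qed
qed auto

lemma powr_product_le:
  fixes x y p q s :: real
  assumes "x \<ge> 0" "y \<ge> 0" "p > 0" "q > 0" "s > 0" "s / p + s / q = 1"
  shows "(x * y) powr s \<le> x powr p + y powr q"
proof -
  have "(x * y) powr s = x powr s * y powr s" using assms by (simp add: powr_mult)
  also have "\<dots> \<le> (x powr s) powr (p / s) + (y powr s) powr (q / s)"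
    by (rule young_product) (use assms in \<open>auto simp: field_simps\<close>)
  also have "\<dots> = x powr p + y powr q" using assms by (simp add: powr_powr)
  finally show ?thesis .
qed

text \<open>Convergence under \<open>L\<^sup>p\<close>--\<open>L\<^sup>q\<close> duality.  Splitting \<open>F d = (l F) (d / l)\<close> in Young's inequality
  replaces Hoelder's inequality.\<close>

lemma Hoelder_tendsto_0:
  fixes F :: "'a \<Rightarrow> real" and d :: "nat \<Rightarrow> 'a \<Rightarrow> real"
  assumes [measurable]: "F \<in> borel_measurable M" "\<And>n. d n \<in> borel_measurable M"
    and pq: "p > 0" "q > 0" "1 / p + 1 / q = 1"
    and F: "(\<integral>\<^sup>+x. ennreal (\<bar>F x\<bar> powr p) \<partial>M) < \<infinity>" and d: "(\<lambda>n. \<integral>\<^sup>+x. ennreal (\<bar>d n x\<bar> powr q) \<partial>M) \<longlonglongrightarrow> 0"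
  shows "(\<lambda>n. \<integral>\<^sup>+x. ennreal \<bar>F x * d n x\<bar> \<partial>M) \<longlonglongrightarrow> 0"
proof (rule ennreal_tendsto_0I)
  fix e :: real assume e: "e > 0"
  obtain A where A: "(\<integral>\<^sup>+x. ennreal (\<bar>F x\<bar> powr p) \<partial>M) = ennreal A" "A \<ge> 0"
    using F by (cases "\<integral>\<^sup>+x. ennreal (\<bar>F x\<bar> powr p) \<partial>M") auto
  \<comment> \<open>The weight makes the fixed part l^p A at most e/2; then n is taken so large that
    the other part is at most e/2.\<close>
  define l where "l = (e / (2 * (A + 1))) powr (1 / p)"
  have l: "l > 0" using e A(2) by (simp add: l_def)
  have lA: "l powr p * A \<le> e / 2"
  proof -
    have "l powr p = e / (2 * (A + 1))" unfolding l_def using e A(2) pq by (simp add: powr_powr)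
    then have "l powr p * (A + 1) = e / 2" using A(2) by (simp add: field_simps)
    moreover have "l powr p * A \<le> l powr p * (A + 1)" by (intro mult_left_mono) auto
    ultimately show ?thesis by simp
  qed
  have "l powr q * (e / 2) > 0" using l e by simp
  from ennreal_tendsto_0D[OF d this]
  show "\<forall>\<^sub>F n in sequentially. (\<integral>\<^sup>+x. ennreal \<bar>F x * d n x\<bar> \<partial>M) \<le> ennreal e"
  proof eventually_elim
    case (elim n)
    have "(\<integral>\<^sup>+x. ennreal \<bar>F x * d n x\<bar> \<partial>M) \<le> (\<integral>\<^sup>+x. ennreal (l powr p) * ennreal (\<bar>F x\<bar> powr p) + ennreal (1 / l powr q) * ennreal (\<bar>d n x\<bar> powr q) \<partial>M)"
    proof (rule nn_integral_mono)
      fix x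
      have "\<bar>F x * d n x\<bar> = (l * \<bar>F x\<bar>) * (\<bar>d n x\<bar> / l)" using l by (simp add: abs_mult)
      also have "\<dots> \<le> (l * \<bar>F x\<bar>) powr p + (\<bar>d n x\<bar> / l) powr q" by (rule young_product) (use l pq in auto)
      also have "\<dots> = l powr p * \<bar>F x\<bar> powr p + 1 / l powr q * \<bar>d n x\<bar> powr q" using l by (simp add: powr_mult powr_divide)
      finally show "ennreal \<bar>F x * d n x\<bar> \<le> ennreal (l powr p) * ennreal (\<bar>F x\<bar> powr p) + ennreal (1 / l powr q) * ennreal (\<bar>d n x\<bar> powr q)"
        by (simp add: ennreal_mult[symmetric] ennreal_plus[symmetric] ennreal_leI del: ennreal_plus)
    qed
    also have "\<dots> = ennreal (l powr p) * ennreal A + ennreal (1 / l powr q) * (\<integral>\<^sup>+x. ennreal (\<bar>d n x\<bar> powr q) \<partial>M)"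
      by (simp add: nn_integral_add nn_integral_cmult A(1))
    also have "\<dots> \<le> ennreal (l powr p) * ennreal A + ennreal (1 / l powr q) * ennreal (l powr q * (e / 2))"
      by (intro add_left_mono mult_left_mono elim) simp
    also have "\<dots> = ennreal (l powr p * A + 1 / l powr q * (l powr q * (e / 2)))"
      using e A(2) by (simp add: ennreal_mult[symmetric] ennreal_plus[symmetric] del: ennreal_plus)
    also have "\<dots> \<le> ennreal e" using lA l by (intro ennreal_leI) simp
    finally show ?case .
  qed
qed

lemma Hoelder_integrable:
  fixes F g :: "'a \<Rightarrow> real"
  assumes [measurable]: "F \<in> borel_measurable M" "g \<in> borel_measurable M"
    and pq: "p > 0" "q > 0" "1 / p + 1 / q = 1"
    and F: "(\<integral>\<^sup>+x. ennreal (\<bar>F x\<bar> powr p) \<partial>M) < \<infinity>" and g: "(\<integral>\<^sup>+x. ennreal (\<bar>g x\<bar> powr q) \<partial>M) < \<infinity>"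
  shows "integrable M (\<lambda>x. F x * g x)"
  unfolding integrable_iff_bounded
proof
  have "(\<integral>\<^sup>+x. ennreal (norm (F x * g x)) \<partial>M) \<le> (\<integral>\<^sup>+x. ennreal (\<bar>F x\<bar> powr p) + ennreal (\<bar>g x\<bar> powr q) \<partial>M)"
  proof (rule nn_integral_mono)
    fix x
    have "\<bar>F x\<bar> * \<bar>g x\<bar> \<le> \<bar>F x\<bar> powr p + \<bar>g x\<bar> powr q" by (rule young_product) (use pq in auto)
    then show "ennreal (norm (F x * g x)) \<le> ennreal (\<bar>F x\<bar> powr p) + ennreal (\<bar>g x\<bar> powr q)"
      by (simp add: abs_mult ennreal_plus[symmetric] ennreal_leI del: ennreal_plus)
  qed
  also have "\<dots> = (\<integral>\<^sup>+x. ennreal (\<bar>F x\<bar> powr p) \<partial>M) + (\<integral>\<^sup>+x. ennreal (\<bar>g x\<bar> powr q) \<partial>M)"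
    by (rule nn_integral_add) measurable
  also have "\<dots> < \<infinity>" using F g by simp
  finally show "(\<integral>\<^sup>+x. ennreal (norm (F x * g x)) \<partial>M) < \<infinity>" .
qed measurable

lemma integral_tendsto_of_L1:
  fixes f :: "nat \<Rightarrow> 'a \<Rightarrow> real"
  assumes "\<And>n. integrable M (f n)" "integrable M g" "(\<lambda>n. \<integral>\<^sup>+x. ennreal \<bar>f n x - g x\<bar> \<partial>M) \<longlonglongrightarrow> 0"
  shows "(\<lambda>n. \<integral>x. f n x \<partial>M) \<longlonglongrightarrow> (\<integral>x. g x \<partial>M)"
proof (rule Lim_null[THEN iffD2], rule real_tendsto_0_from_ennreal, rule ennreal_squeeze_0[OF _ assms(3)])
  fix n
  have "ennreal (norm ((\<integral>x. f n x \<partial>M) - (\<integral>x. g x \<partial>M))) = ennreal (norm (\<integral>x. f n x - g x \<partial>M))"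
    using assms(1,2) by simp
  also have "\<dots> \<le> (\<integral>\<^sup>+x. ennreal (norm (f n x - g x)) \<partial>M)"
    using assms(1,2) by (intro integral_norm_bound_ennreal) auto
  finally show "ennreal (norm ((\<integral>x. f n x \<partial>M) - (\<integral>x. g x \<partial>M))) \<le> (\<integral>\<^sup>+x. ennreal \<bar>f n x - g x\<bar> \<partial>M)" by simp
qed

lemma Hoelder_limit:
  fixes F g :: "'a \<Rightarrow> real" and f :: "nat \<Rightarrow> 'a \<Rightarrow> real"
  assumes [measurable]: "F \<in> borel_measurable M" "g \<in> borel_measurable M" "\<And>n. f n \<in> borel_measurable M"
    and pq: "p > 0" "q > 0" "1 / p + 1 / q = 1"
    and F: "(\<integral>\<^sup>+x. ennreal (\<bar>F x\<bar> powr p) \<partial>M) < \<infinity>"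
    and g: "(\<integral>\<^sup>+x. ennreal (\<bar>g x\<bar> powr q) \<partial>M) < \<infinity>" and f: "\<And>n. (\<integral>\<^sup>+x. ennreal (\<bar>f n x\<bar> powr q) \<partial>M) < \<infinity>"
    and l: "(\<lambda>n. \<integral>\<^sup>+x. ennreal (\<bar>f n x - g x\<bar> powr q) \<partial>M) \<longlonglongrightarrow> 0"
  shows "(\<lambda>n. \<integral>x. F x * f n x \<partial>M) \<longlonglongrightarrow> (\<integral>x. F x * g x \<partial>M)"
proof (rule integral_tendsto_of_L1)
  show "integrable M (\<lambda>x. F x * f n x)" for n by (rule Hoelder_integrable[OF _ _ pq F f]) measurable
  show "integrable M (\<lambda>x. F x * g x)" by (rule Hoelder_integrable[OF _ _ pq F g]) measurable
  show "(\<lambda>n. \<integral>\<^sup>+x. ennreal \<bar>F x * f n x - F x * g x\<bar> \<partial>M) \<longlonglongrightarrow> 0"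
    using Hoelder_tendsto_0[OF _ _ pq F l] by (simp add: right_diff_distrib)
qed

lemma L2_integrable:
  fixes a b :: "'a \<Rightarrow> real"
  assumes "a \<in> borel_measurable M" "b \<in> borel_measurable M"
    "(\<integral>\<^sup>+x. ennreal ((a x)^2) \<partial>M) < \<infinity>" "(\<integral>\<^sup>+x. ennreal ((b x)^2) \<partial>M) < \<infinity>"
  shows "integrable M (\<lambda>x. a x * b x)"
  by (rule Hoelder_integrable[where p=2 and q=2]) (use assms in \<open>auto simp: powr_numeral\<close>)

text \<open>Expanding around the limits leaves two terms with a fixed factor, treated by duality,
  and a product of two errors, bounded by the sum of their squares.\<close>

lemma L2_product_limit:
  fixes a b :: "nat \<Rightarrow> 'a \<Rightarrow> real"
  assumes m[measurable]: "\<And>n. a n \<in> borel_measurable M" "\<And>n. b n \<in> borel_measurable M" "a' \<in> borel_measurable M" "b' \<in> borel_measurable M"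
    and f: "\<And>n. (\<integral>\<^sup>+x. ennreal ((a n x)^2) \<partial>M) < \<infinity>" "\<And>n. (\<integral>\<^sup>+x. ennreal ((b n x)^2) \<partial>M) < \<infinity>"
      "(\<integral>\<^sup>+x. ennreal ((a' x)^2) \<partial>M) < \<infinity>" "(\<integral>\<^sup>+x. ennreal ((b' x)^2) \<partial>M) < \<infinity>"
    and l: "(\<lambda>n. \<integral>\<^sup>+x. ennreal ((a n x - a' x)^2) \<partial>M) \<longlonglongrightarrow> 0" "(\<lambda>n. \<integral>\<^sup>+x. ennreal ((b n x - b' x)^2) \<partial>M) \<longlonglongrightarrow> 0"
  shows "(\<lambda>n. \<integral>x. a n x * b n x \<partial>M) \<longlonglongrightarrow> (\<integral>x. a' x * b' x \<partial>M)"
proof (rule integral_tendsto_of_L1)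
  show "integrable M (\<lambda>x. a n x * b n x)" for n by (rule L2_integrable[OF m(1,2) f(1,2)])
  show "integrable M (\<lambda>x. a' x * b' x)" by (rule L2_integrable[OF m(3,4) f(3,4)])
  have 1: "(\<lambda>n. \<integral>\<^sup>+x. ennreal \<bar>a' x * (b n x - b' x)\<bar> \<partial>M) \<longlonglongrightarrow> 0"
    by (rule Hoelder_tendsto_0[where p=2 and q=2]) (use f(3) l(2) in \<open>auto simp: powr_numeral\<close>)
  have 2: "(\<lambda>n. \<integral>\<^sup>+x. ennreal \<bar>b' x * (a n x - a' x)\<bar> \<partial>M) \<longlonglongrightarrow> 0"
    by (rule Hoelder_tendsto_0[where p=2 and q=2]) (use f(4) l(1) in \<open>auto simp: powr_numeral\<close>)
  have 3: "(\<lambda>n. (\<integral>\<^sup>+x. ennreal ((a n x - a' x)^2) \<partial>M) + (\<integral>\<^sup>+x. ennreal ((b n x - b' x)^2) \<partial>M)) \<longlonglongrightarrow> 0 + 0"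
    by (intro tendsto_add l)
  have "(\<lambda>n. (\<integral>\<^sup>+x. ennreal \<bar>a' x * (b n x - b' x)\<bar> \<partial>M) + (\<integral>\<^sup>+x. ennreal \<bar>b' x * (a n x - a' x)\<bar> \<partial>M)
      + ((\<integral>\<^sup>+x. ennreal ((a n x - a' x)^2) \<partial>M) + (\<integral>\<^sup>+x. ennreal ((b n x - b' x)^2) \<partial>M))) \<longlonglongrightarrow> 0 + 0 + (0 + 0)"
    by (intro tendsto_add 1 2 l)
  then have lim: "(\<lambda>n. (\<integral>\<^sup>+x. ennreal \<bar>a' x * (b n x - b' x)\<bar> \<partial>M) + (\<integral>\<^sup>+x. ennreal \<bar>b' x * (a n x - a' x)\<bar> \<partial>M)
      + ((\<integral>\<^sup>+x. ennreal ((a n x - a' x)^2) \<partial>M) + (\<integral>\<^sup>+x. ennreal ((b n x - b' x)^2) \<partial>M))) \<longlonglongrightarrow> 0" by simp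
  show "(\<lambda>n. \<integral>\<^sup>+x. ennreal \<bar>a n x * b n x - a' x * b' x\<bar> \<partial>M) \<longlonglongrightarrow> 0"
  proof (rule ennreal_squeeze_0[OF _ lim])
    fix n
    have "(\<integral>\<^sup>+x. ennreal \<bar>a n x * b n x - a' x * b' x\<bar> \<partial>M) \<le> (\<integral>\<^sup>+x. ennreal \<bar>a' x * (b n x - b' x)\<bar> + ennreal \<bar>b' x * (a n x - a' x)\<bar>
      + (ennreal ((a n x - a' x)^2) + ennreal ((b n x - b' x)^2)) \<partial>M)"
    proof (rule nn_integral_mono)
      fix x
      have e: "a n x * b n x - a' x * b' x = a' x * (b n x - b' x) + b' x * (a n x - a' x) + (a n x - a' x) * (b n x - b' x)"
        by (simp add: algebra_simps)
      have p: "\<bar>(a n x - a' x) * (b n x - b' x)\<bar> \<le> (a n x - a' x)^2 + (b n x - b' x)^2"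
        using sum_squares_bound[of "\<bar>a n x - a' x\<bar>" "\<bar>b n x - b' x\<bar>"] abs_ge_zero[of "(a n x - a' x) * (b n x - b' x)"]
        unfolding abs_mult power2_abs by linarith
      have "\<bar>a n x * b n x - a' x * b' x\<bar> \<le> \<bar>a' x * (b n x - b' x)\<bar> + \<bar>b' x * (a n x - a' x)\<bar> + ((a n x - a' x)^2 + (b n x - b' x)^2)"
        unfolding e using p by linarith
      then have "ennreal \<bar>a n x * b n x - a' x * b' x\<bar> \<le> ennreal (\<bar>a' x * (b n x - b' x)\<bar> + \<bar>b' x * (a n x - a' x)\<bar> + ((a n x - a' x)^2 + (b n x - b' x)^2))"
        by (rule ennreal_leI)
      then show "ennreal \<bar>a n x * b n x - a' x * b' x\<bar> \<le> ennreal \<bar>a' x * (b n x - b' x)\<bar> + ennreal \<bar>b' x * (a n x - a' x)\<bar>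
        + (ennreal ((a n x - a' x)^2) + ennreal ((b n x - b' x)^2))" by simp
    qed
    also have "\<dots> = (\<integral>\<^sup>+x. ennreal \<bar>a' x * (b n x - b' x)\<bar> \<partial>M) + (\<integral>\<^sup>+x. ennreal \<bar>b' x * (a n x - a' x)\<bar> \<partial>M)
      + ((\<integral>\<^sup>+x. ennreal ((a n x - a' x)^2) \<partial>M) + (\<integral>\<^sup>+x. ennreal ((b n x - b' x)^2) \<partial>M))"
      by (simp add: nn_integral_add)
    finally show "(\<integral>\<^sup>+x. ennreal \<bar>a n x * b n x - a' x * b' x\<bar> \<partial>M) \<le> (\<integral>\<^sup>+x. ennreal \<bar>a' x * (b n x - b' x)\<bar> \<partial>M) + (\<integral>\<^sup>+x. ennreal \<bar>b' x * (a n x - a' x)\<bar> \<partial>M)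
      + ((\<integral>\<^sup>+x. ennreal ((a n x - a' x)^2) \<partial>M) + (\<integral>\<^sup>+x. ennreal ((b n x - b' x)^2) \<partial>M))" .
  qed
qed

text \<open>With r = \<rho> and U = |u| the right side is integrable. For r \<le> 1 the kinetic
  energy suffices if U \<le> 1, and U^6 otherwise. For r > 1 both products have degree 6, so they
  are at most r^6 + U^6, and r^6 \<le> r^\<gamma> by \<gamma> \<ge> 6. The first gives \<rho> u
  \<otimes> u in L^2, the second \<rho> u in L^3.\<close>

lemma interpolation_2_4:
  fixes r U \<gamma> :: real
  assumes "r \<ge> 0" "U \<ge> 0" "\<gamma> \<ge> 6"
  shows "r^2 * U^4 \<le> r * U^2 + U^6 + r powr \<gamma>" "r^3 * U^3 \<le> r * U^2 + U^6 + r powr \<gamma>"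
proof -
  have main: "r^2 * U^4 \<le> r * U^2 + U^6 + r powr \<gamma> \<and> r^3 * U^3 \<le> r * U^2 + U^6 + r powr \<gamma>"
  proof (cases "r \<le> 1")
    case r: True
    have r2: "r^2 \<le> r" "r^3 \<le> r" "r \<le> 1" using r assms power_decreasing[of 1 2 r] power_decreasing[of 1 3 r] by auto
    show ?thesis
    proof (cases "U \<le> 1")
      case True
      then have "U^4 \<le> U^2" "U^3 \<le> U^2" using assms by (auto intro: power_decreasing)
      then have "r^2 * U^4 \<le> r * U^2" "r^3 * U^3 \<le> r * U^2" using r2 assms by (auto intro!: mult_mono)
      moreover have "0 \<le> U^6" "0 \<le> r powr \<gamma>" using assms by simp_all
      ultimately show ?thesis by linarith
    next
      case False
      then have "U^4 \<le> U^6" "U^3 \<le> U^6" by (auto intro: power_increasing)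
      moreover have "r^2 \<le> 1" "r^3 \<le> 1" using r2 by linarith+
      ultimately have "r^2 * U^4 \<le> 1 * U^6" "r^3 * U^3 \<le> 1 * U^6" using assms by (intro mult_mono; simp)+
      moreover have "0 \<le> r * U^2" "0 \<le> r powr \<gamma>" using assms by simp_all
      ultimately show ?thesis by (intro conjI; linarith)
    qed
  next
    case False
    then have "r^6 = r powr 6" using powr_realpow[of r 6] by simp
    also have "\<dots> \<le> r powr \<gamma>" using False assms by (intro powr_mono) auto
    finally have r6: "r^6 \<le> r powr \<gamma>" .
    have "r^2 * U^4 \<le> r^6 + U^6 \<and> r^3 * U^3 \<le> r^6 + U^6"
    proof (cases "r \<le> U")
      case True
      then have "r^2 * U^4 \<le> U^2 * U^4" "r^3 * U^3 \<le> U^3 * U^3" using assms by (intro mult_right_mono power_mono; simp)+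
      then show ?thesis using assms by (simp add: power_add[symmetric] add_increasing)
    next
      case F: False
      then have "r^2 * U^4 \<le> r^2 * r^4" "r^3 * U^3 \<le> r^3 * r^3" using assms by (intro mult_left_mono power_mono; simp)+
      then show ?thesis using assms by (simp add: power_add[symmetric] add_increasing2)
    qed
    moreover have "0 \<le> r * U^2" using assms by simp
    ultimately show ?thesis using r6 by linarith
  qed
  then show "r^2 * U^4 \<le> r * U^2 + U^6 + r powr \<gamma>" "r^3 * U^3 \<le> r * U^2 + U^6 + r powr \<gamma>" by auto
qed


section \<open>Truncated renormalizing functions\<close>

lemma antiderivative_exists:
  fixes f :: "real \<Rightarrow> real"
  assumes "continuous_on UNIV f"
  obtains F where "\<And>t. (F has_real_derivative f t) (at t)"
proof -
  define F where "F t = interval_lebesgue_integral lborel (ereal 0) (ereal t) f" for t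
  have "(F has_real_derivative f t) (at t)" for t
  proof -
    define a b where "a = - \<bar>t\<bar> - 1" and "b = \<bar>t\<bar> + 1"
    have "((\<lambda>u. interval_lebesgue_integral lborel (ereal 0) (ereal u) f) has_vector_derivative f t) (at t within {a..b})"
    proof (rule interval_integral_FTC2)
      show "a \<le> 0" "0 \<le> b" "a \<le> t" "t \<le> b" by (simp_all add: a_def b_def)
      show "continuous_on {a..b} f" by (rule continuous_on_subset[OF assms]) simp
    qed
    moreover have "at t within {a..b} = at t" by (rule at_within_Icc_at) (simp_all add: a_def b_def)
    ultimately have "(F has_vector_derivative f t) (at t)"
      unfolding F_def[abs_def] by simp
    then show ?thesis by (simp add: has_real_derivative_iff_has_vector_derivative)
  qed
  then show ?thesis using that by blast
qed

text \<open>Differentiability is required only in the open interval, since the powers compared in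
  \<open>renormalization_cutoff\<close> are differentiated only for positive arguments.\<close>

lemma DERIV_le_imp_le:
  fixes f g :: "real \<Rightarrow> real"
  assumes "a \<le> b" "\<And>x. a < x \<Longrightarrow> x < b \<Longrightarrow> (f has_real_derivative f' x) (at x)" "\<And>x. a < x \<Longrightarrow> x < b \<Longrightarrow> (g has_real_derivative g' x) (at x)"
    and "continuous_on {a..b} f" "continuous_on {a..b} g" "\<And>x. a < x \<Longrightarrow> x < b \<Longrightarrow> f' x \<le> g' x" "f a \<le> g a"
  shows "f b \<le> g b"
proof -
  have "g a - f a \<le> g b - f b"
  proof (rule DERIV_nonneg_imp_increasing_open[OF assms(1)])
    show "\<exists>y. ((\<lambda>x. g x - f x) has_real_derivative y) (at x) \<and> 0 \<le> y" if "a < x" "x < b" for x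
      using DERIV_diff[OF assms(3)[OF that] assms(2)[OF that]] assms(6)[OF that] by (intro exI[of _ "g' x - f' x"]) simp
    show "continuous_on {a..b} (\<lambda>x. g x - f x)" by (intro continuous_on_diff assms)
  qed
  then show ?thesis using assms(7) by simp
qed

lemma powr_continuous_on_nonneg: "a > 0 \<Longrightarrow> continuous_on {0..b} (\<lambda>t::real. c * t powr a)"
  by (intro continuous_intros continuous_on_powr') auto

lemma eventually_constant_bounded:
  fixes f :: "real \<Rightarrow> real"
  assumes "continuous_on UNIV f" "\<And>t. t \<ge> k \<Longrightarrow> f t = f k" "k \<ge> 0"
  obtains K where "K \<ge> 0" "\<And>t. t \<ge> 0 \<Longrightarrow> \<bar>f t\<bar> \<le> K"
proof -
  have "compact (f ` {0..k})" by (intro compact_continuous_image continuous_on_subset[OF assms(1)]) auto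
  then have "bounded (f ` {0..k})" by (rule compact_imp_bounded)
  then obtain K where K: "K > 0" "\<And>t. t \<in> {0..k} \<Longrightarrow> \<bar>f t\<bar> \<le> K"
    unfolding bounded_pos by auto
  have "\<bar>f t\<bar> \<le> K" if "t \<ge> 0" for t
    using that K(2)[of t] K(2)[of k] assms(2)[of t] assms(3) by (cases "t \<le> k") auto
  then show ?thesis using K(1) by (intro that[of K]) auto
qed

text \<open>Cut-offs for renormalization: \<open>B\<close> is bounded and approximates \<open>t\<^sup>\<gamma>\<close> as \<open>k \<rightarrow> \<infinity>\<close>; \<open>\<beta>\<close> has compact
  support in \<open>[0, \<infinity>)\<close> and, up to the constant \<open>\<beta> 0\<close>, the size of \<open>t\<^sup>\<gamma>\<^sup>-\<^sup>1\<close> near \<open>0\<close>.\<close>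

lemma renormalization_cutoff:
  fixes \<gamma> k :: real
  assumes \<gamma>: "\<gamma> \<ge> 6" and k: "k > 0"
  obtains \<beta> \<beta>' B K where "\<And>t. (\<beta> has_real_derivative \<beta>' t) (at t)" "\<And>t. (B has_real_derivative t * \<beta>' t) (at t)" "continuous_on UNIV \<beta>'"
    "\<And>t. t \<ge> 0 \<Longrightarrow> \<bar>\<beta> t\<bar> \<le> K" "\<And>t. t \<ge> 0 \<Longrightarrow> \<bar>\<beta>' t\<bar> \<le> K" "\<And>t. t \<ge> 0 \<Longrightarrow> \<bar>B t\<bar> \<le> K" "\<And>t. t \<ge> 0 \<Longrightarrow> \<bar>t * \<beta> t - B t\<bar> \<le> K"
    "\<And>t. t \<ge> 0 \<Longrightarrow> 0 \<le> B t" "\<And>t. t \<ge> 0 \<Longrightarrow> B t \<le> t powr \<gamma>" "\<And>t. t \<ge> 0 \<Longrightarrow> t powr \<gamma> - B t \<le> \<gamma> * t powr (\<gamma> + 1) / k"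
    "\<And>t. t \<ge> 0 \<Longrightarrow> \<bar>t * (\<beta> t - \<beta> 0) - B t\<bar> \<le> 2 * K * t" "\<And>t. t \<ge> 0 \<Longrightarrow> \<bar>t * (\<beta> t - \<beta> 0) - B t\<bar> \<le> 2 * t powr \<gamma>" "K \<ge> 0"
proof -
  \<comment> \<open>The untruncated choice b = \<gamma> t^(\<gamma> - 2) would give B = t^\<gamma>,
    because B' = t b. The factor 1 - t/k, cut at 0, makes b continuous and zero from k on, and
    changes B by a relative error of order t/k.\<close>
  define b where "b t = \<gamma> * (max 0 t) powr (\<gamma> - 2) * max 0 (1 - t / k)" for t
  have bc: "continuous_on UNIV b"
    unfolding b_def using \<gamma> k by (intro continuous_intros continuous_on_powr') auto
  obtain \<beta>0 where \<beta>0: "\<And>t. (\<beta>0 has_real_derivative b t) (at t)" using antiderivative_exists[OF bc] by metis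
  have tbc: "continuous_on UNIV (\<lambda>t. t * b t)" by (intro continuous_intros bc)
  obtain B0 where B0: "\<And>t. (B0 has_real_derivative t * b t) (at t)" using antiderivative_exists[OF tbc] by metis
  \<comment> \<open>The constants of integration make \<beta> vanish from k on, so that t \<beta>(t)
    stays bounded, and B vanish at 0.\<close>
  define \<beta> where "\<beta> t = \<beta>0 t - \<beta>0 k" for t
  define B where "B t = B0 t - B0 0" for t
  have d\<beta>: "(\<beta> has_real_derivative b t) (at t)" for t unfolding \<beta>_def[abs_def] using DERIV_diff[OF \<beta>0 DERIV_const] by simp
  have dB: "(B has_real_derivative t * b t) (at t)" for t unfolding B_def[abs_def] using DERIV_diff[OF B0 DERIV_const] by simp
  have b0: "0 \<le> b t" for t using \<gamma> by (simp add: b_def)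
  have bk: "b t = 0" if "t \<ge> k" for t using that k by (simp add: b_def)
  have \<beta>c: "continuous_on S \<beta>" for S using DERIV_isCont[OF d\<beta>] by (intro continuous_at_imp_continuous_on) auto
  have Bc: "continuous_on S B" for S using DERIV_isCont[OF dB] by (intro continuous_at_imp_continuous_on) auto
  have \<beta>k: "\<beta> t = 0" if "t \<ge> k" for t
  proof -
    have "\<beta> t = \<beta> k"
    proof (rule antisym)
      show "\<beta> t \<le> \<beta> k" by (rule DERIV_le_imp_le[OF that d\<beta> DERIV_const \<beta>c continuous_on_const]) (use bk in auto)
      show "\<beta> k \<le> \<beta> t" by (rule DERIV_le_imp_le[OF that DERIV_const d\<beta> continuous_on_const \<beta>c]) (use b0 in auto)
    qed
    then show ?thesis by (simp add: \<beta>_def)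
  qed
  have Bk: "B t = B k" if "t \<ge> k" for t
  proof (rule antisym)
    show "B t \<le> B k" by (rule DERIV_le_imp_le[OF that dB DERIV_const Bc continuous_on_const]) (use bk in auto)
    show "B k \<le> B t" by (rule DERIV_le_imp_le[OF that DERIV_const dB continuous_on_const Bc]) (use b0 k in auto)
  qed
  note k0 = less_imp_le[OF k]
  have k1: "\<beta> t = \<beta> k" if "t \<ge> k" for t using \<beta>k[OF that] \<beta>k[of k] by simp
  have k2: "b t = b k" if "t \<ge> k" for t using bk[OF that] bk[of k] by simp
  have k4: "t * \<beta> t - B t = k * \<beta> k - B k" if "t \<ge> k" for t using \<beta>k[OF that] \<beta>k[of k] Bk[OF that] by simp
  have c4: "continuous_on UNIV (\<lambda>t. t * \<beta> t - B t)" by (intro continuous_intros \<beta>c Bc)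
  obtain K1 where K1: "K1 \<ge> 0" "\<And>t. t \<ge> 0 \<Longrightarrow> \<bar>\<beta> t\<bar> \<le> K1"
    by (rule eventually_constant_bounded[OF \<beta>c k1 k0]) (assumption, rule that)
  obtain K2 where K2: "K2 \<ge> 0" "\<And>t. t \<ge> 0 \<Longrightarrow> \<bar>b t\<bar> \<le> K2"
    by (rule eventually_constant_bounded[OF bc k2 k0]) (assumption, rule that)
  obtain K3 where K3: "K3 \<ge> 0" "\<And>t. t \<ge> 0 \<Longrightarrow> \<bar>B t\<bar> \<le> K3"
    by (rule eventually_constant_bounded[OF Bc Bk k0]) (assumption, rule that)
  obtain K4 where K4: "K4 \<ge> 0" "\<And>t. t \<ge> 0 \<Longrightarrow> \<bar>t * \<beta> t - B t\<bar> \<le> K4"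
    by (rule eventually_constant_bounded[OF c4 k4 k0]) (assumption, rule that)
  define K where "K = K1 + K2 + K3 + K4"
  have tp: "t * t powr (\<gamma> - 2) = t powr (\<gamma> - 1)" "t * t powr (\<gamma> - 1) = t powr \<gamma>" if "t \<ge> 0" for t
    using that powr_mult_base[of t "\<gamma> - 2"] powr_mult_base[of t "\<gamma> - 1"] by auto
  have B_nonneg: "0 \<le> B t" if "t \<ge> 0" for t
    by (rule DERIV_le_imp_le[OF that DERIV_const dB continuous_on_const Bc]) (use b0 in \<open>auto simp: B_def\<close>)
  have dp: "((\<lambda>t. c * t powr a) has_real_derivative c * a * t powr (a - 1)) (at t)" if "t > 0" for t a c :: real
    using that by (auto intro!: derivative_eq_intros)
  have B_le: "B t \<le> t powr \<gamma>" if "t \<ge> 0" for t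
  proof -
    have "B t \<le> 1 * t powr \<gamma>"
    proof (rule DERIV_le_imp_le[OF that])
      show "((\<lambda>t. 1 * t powr \<gamma>) has_real_derivative 1 * \<gamma> * x powr (\<gamma> - 1)) (at x)" if "0 < x" for x by (rule dp[OF that])
      show "(B has_real_derivative x * b x) (at x)" for x by (rule dB)
      show "x * b x \<le> 1 * \<gamma> * x powr (\<gamma> - 1)" if "0 < x" for x
      proof -
        have "x * b x = (\<gamma> * x powr (\<gamma> - 1)) * max 0 (1 - x / k)" using that tp(1)[of x] by (simp add: b_def mult_ac)
        also have "\<dots> \<le> (\<gamma> * x powr (\<gamma> - 1)) * 1" using that k \<gamma> by (intro mult_left_mono) auto
        finally show ?thesis by simp
      qed
      show "continuous_on {0..t} (\<lambda>t. 1 * t powr \<gamma>)" by (rule powr_continuous_on_nonneg) (use \<gamma> in simp)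
    qed (use Bc in \<open>auto simp: B_def\<close>)
    then show ?thesis by simp
  qed
  \<comment> \<open>The derivatives of t^\<gamma> and B differ by at most (\<gamma>/k) t^\<gamma>.
    The comparison function has the derivative (\<gamma>/k) (\<gamma> + 1) t^\<gamma>, which is
    larger.\<close>
  have B_ge: "t powr \<gamma> - B t \<le> \<gamma> * t powr (\<gamma> + 1) / k" if "t \<ge> 0" for t
  proof -
    have "1 * t powr \<gamma> - B t \<le> \<gamma> / k * t powr (\<gamma> + 1)"
    proof (rule DERIV_le_imp_le[OF that])
      show "((\<lambda>t. 1 * t powr \<gamma> - B t) has_real_derivative 1 * \<gamma> * x powr (\<gamma> - 1) - x * b x) (at x)" if "0 < x" for x
        by (intro DERIV_diff dp[OF that] dB)
      show "((\<lambda>t. \<gamma> / k * t powr (\<gamma> + 1)) has_real_derivative \<gamma> / k * (\<gamma> + 1) * x powr (\<gamma> + 1 - 1)) (at x)" if "0 < x" for x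
        by (rule dp[OF that])
      show "1 * \<gamma> * x powr (\<gamma> - 1) - x * b x \<le> \<gamma> / k * (\<gamma> + 1) * x powr (\<gamma> + 1 - 1)" if "0 < x" for x
      proof -
        have e: "x * b x = (\<gamma> * x powr (\<gamma> - 1)) * max 0 (1 - x / k)" using that tp(1)[of x] by (simp add: b_def mult_ac)
        have "(\<gamma> * x powr (\<gamma> - 1)) * (1 - x / k) \<le> x * b x" unfolding e using \<gamma> by (intro mult_left_mono) auto
        then have "1 * \<gamma> * x powr (\<gamma> - 1) - x * b x \<le> \<gamma> / k * (x * x powr (\<gamma> - 1))" by (simp add: algebra_simps)
        also have "\<dots> = \<gamma> / k * 1 * x powr \<gamma>" using tp(2)[of x] that by simp
        also have "\<dots> \<le> \<gamma> / k * (\<gamma> + 1) * x powr \<gamma>" using \<gamma> k by (intro mult_right_mono mult_left_mono) auto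
        finally show ?thesis by simp
      qed
      show "continuous_on {0..t} (\<lambda>t. 1 * t powr \<gamma> - B t)" by (intro continuous_on_diff powr_continuous_on_nonneg Bc) (use \<gamma> in simp)
      show "continuous_on {0..t} (\<lambda>t. \<gamma> / k * t powr (\<gamma> + 1))" by (rule powr_continuous_on_nonneg) (use \<gamma> in simp)
    qed (use \<gamma> in \<open>auto simp: B_def\<close>)
    then show ?thesis by simp
  qed
  have "\<beta> 0 \<le> \<beta> t" if "t \<ge> 0" for t
    by (rule DERIV_le_imp_le[OF that DERIV_const d\<beta> continuous_on_const \<beta>c]) (use b0 in auto)
  then have \<beta>mono: "0 \<le> \<beta> t - \<beta> 0" if "t \<ge> 0" for t using that by simp
  \<comment> \<open>The constant 2 absorbs the quotient of \<gamma> and \<gamma> - 1, as \<gamma>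
    \<le> 2 (\<gamma> - 1).\<close>
  have \<beta>le: "\<beta> t - \<beta> 0 \<le> 2 * t powr (\<gamma> - 1)" if "t \<ge> 0" for t
  proof (rule DERIV_le_imp_le[OF that])
    show "((\<lambda>t. \<beta> t - \<beta> 0) has_real_derivative b x - 0) (at x)" for x by (intro DERIV_diff d\<beta> DERIV_const)
    show "((\<lambda>t. 2 * t powr (\<gamma> - 1)) has_real_derivative 2 * (\<gamma> - 1) * x powr (\<gamma> - 1 - 1)) (at x)" if "0 < x" for x by (rule dp[OF that])
    show "b x - 0 \<le> 2 * (\<gamma> - 1) * x powr (\<gamma> - 1 - 1)" if "0 < x" for x
    proof -
      have "b x = (\<gamma> * x powr (\<gamma> - 2)) * max 0 (1 - x / k)" using that by (simp add: b_def)
      also have "\<dots> \<le> (\<gamma> * x powr (\<gamma> - 2)) * 1" using that k \<gamma> by (intro mult_left_mono) auto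
      also have "\<dots> \<le> 2 * (\<gamma> - 1) * x powr (\<gamma> - 2)" using \<gamma> by (simp add: mult_right_mono)
      finally show ?thesis by simp
    qed
    show "continuous_on {0..t} (\<lambda>t. \<beta> t - \<beta> 0)" by (intro continuous_intros \<beta>c)
    show "continuous_on {0..t} (\<lambda>t. 2 * t powr (\<gamma> - 1))" by (rule powr_continuous_on_nonneg) (use \<gamma> in simp)
  qed simp
  \<comment> \<open>The derivative of t (\<beta>(t) - \<beta>(0)) - B(t) is \<beta>(t) - \<beta>(0),
    since the two terms t b cancel. This gives the sign; B \<ge> 0 gives the upper bound.\<close>
  have C: "0 \<le> t * (\<beta> t - \<beta> 0) - B t" "t * (\<beta> t - \<beta> 0) - B t \<le> t * (\<beta> t - \<beta> 0)" if "t \<ge> 0" for t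
  proof -
    have "0 \<le> t * (\<beta> t - \<beta> 0) - B t"
    proof (rule DERIV_le_imp_le[OF that, of "\<lambda>_. 0" "\<lambda>_. 0" _ "\<lambda>t. \<beta> t - \<beta> 0"])
      show "((\<lambda>t. t * (\<beta> t - \<beta> 0) - B t) has_real_derivative \<beta> x - \<beta> 0) (at x)" for x
        by (auto intro!: derivative_eq_intros d\<beta> dB)
      show "continuous_on {0..t} (\<lambda>t. t * (\<beta> t - \<beta> 0) - B t)" by (intro continuous_intros \<beta>c Bc)
    qed (use \<beta>mono in \<open>auto simp: B_def\<close>)
    then show "0 \<le> t * (\<beta> t - \<beta> 0) - B t" .
    show "t * (\<beta> t - \<beta> 0) - B t \<le> t * (\<beta> t - \<beta> 0)" using B_nonneg[OF that] by simp
  qed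
  show ?thesis
  proof (rule that[of \<beta> b B K])
    fix t :: real assume t: "t \<ge> 0"
    show "\<bar>\<beta> t\<bar> \<le> K" "\<bar>b t\<bar> \<le> K" "\<bar>B t\<bar> \<le> K" "\<bar>t * \<beta> t - B t\<bar> \<le> K"
      using K1(2)[OF t] K2(2)[OF t] K3(2)[OF t] K4(2)[OF t] K1(1) K2(1) K3(1) K4(1) by (auto simp: K_def)
    show "0 \<le> B t" "B t \<le> t powr \<gamma>" "t powr \<gamma> - B t \<le> \<gamma> * t powr (\<gamma> + 1) / k" by (rule B_nonneg[OF t] B_le[OF t] B_ge[OF t])+
    have "\<beta> t - \<beta> 0 \<le> 2 * K" using K1(2)[OF t] K1(2)[of 0] K1(1) K2(1) K3(1) K4(1) by (simp add: K_def)
    then have "t * (\<beta> t - \<beta> 0) \<le> t * (2 * K)" using t by (rule mult_left_mono)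
    then show "\<bar>t * (\<beta> t - \<beta> 0) - B t\<bar> \<le> 2 * K * t" using C[OF t] by (simp add: mult_ac)
    have "t * (\<beta> t - \<beta> 0) \<le> t * (2 * t powr (\<gamma> - 1))" using \<beta>le[OF t] t by (rule mult_left_mono)
    also have "\<dots> = 2 * t powr \<gamma>" using tp(2)[OF t] by simp
    finally show "\<bar>t * (\<beta> t - \<beta> 0) - B t\<bar> \<le> 2 * t powr \<gamma>" using C[OF t] by simp
  qed (use d\<beta> dB bc K1(1) K2(1) K3(1) K4(1) in \<open>auto simp: K_def\<close>)
qed

section \<open>The pressure work vanishes\<close>

text \<open>\<open>mollifier 0\<close> stretched by n + 1 acts as a smooth cut-off; in the limit
  only its positive value at 0 remains as a factor.\<close>

lemma integral_cutoff_tendsto: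
  fixes f :: "real^3 \<Rightarrow> real"
  assumes f: "integrable lborel f"
  shows "(\<lambda>n. LBINT x. mollifier 0 ((1 / real (Suc n)) *\<^sub>R x) * f x) \<longlonglongrightarrow> mollifier 0 (0 :: real^3) * (LBINT x. f x)"
proof -
  note mo = approx_idD[OF approx_id_mollifier]
  obtain X R where X: "X > 0" "\<And>x :: real^3. norm (mollifier 0 x) \<le> X * indicator (cball 0 R) x"
    using bsupp_bound[OF mo(1) mo(4)] by metis
  have X': "\<bar>mollifier 0 x\<bar> \<le> X" for x :: "real^3"
    using X(2)[of x] X(1) by (cases "norm x \<le> R") auto
  have [measurable]: "(mollifier 0 :: real^3 \<Rightarrow> real) \<in> borel_measurable borel" by (rule mo(5))
  have "(\<lambda>n. LBINT x. mollifier 0 ((1 / real (Suc n)) *\<^sub>R x) * f x) \<longlonglongrightarrow> (LBINT x. mollifier 0 (0 :: real^3) * f x)"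
  proof (rule integral_dominated_convergence[where w="\<lambda>x. X * \<bar>f x\<bar>"])
    show "integrable lborel (\<lambda>x. X * \<bar>f x\<bar>)" using f by auto
    show "AE x in lborel. (\<lambda>n. mollifier 0 ((1 / real (Suc n)) *\<^sub>R x) * f x) \<longlonglongrightarrow> mollifier 0 (0 :: real^3) * f x"
    proof (rule AE_I2)
      fix x :: "real^3"
      have "(\<lambda>n. 1 / real (Suc n)) \<longlonglongrightarrow> 0" using LIMSEQ_inverse_real_of_nat by (simp add: inverse_eq_divide)
      then have "(\<lambda>n. (1 / real (Suc n)) *\<^sub>R x) \<longlonglongrightarrow> 0 *\<^sub>R x" by (intro tendsto_intros)
      then have "(\<lambda>n. (1 / real (Suc n)) *\<^sub>R x) \<longlonglongrightarrow> 0" by simp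
      then have "(\<lambda>n. mollifier 0 ((1 / real (Suc n)) *\<^sub>R x)) \<longlonglongrightarrow> mollifier 0 (0::real^3)"
        by (rule continuous_on_tendsto_compose[OF mo(1)]) auto
      then show "(\<lambda>n. mollifier 0 ((1 / real (Suc n)) *\<^sub>R x) * f x) \<longlonglongrightarrow> mollifier 0 (0 :: real^3) * f x" by (intro tendsto_intros)
    qed
    show "AE x in lborel. norm (mollifier 0 ((1 / real (Suc n)) *\<^sub>R x) * f x) \<le> X * \<bar>f x\<bar>" for n
      by (rule AE_I2) (simp only: real_norm_def abs_mult, intro mult_right_mono X', simp)
  qed (use f in measurable)
  then show ?thesis by simp
qed

text \<open>Formally \<rho>^\<gamma> div u is a multiple of the divergence of \<rho>^\<gamma> u. The
  renormalized equation is applied to bounded truncations B of the power with wide cut-offs \<xi>,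
  whose gradients are of order 1/n, and the truncation is removed afterwards. The work lies in
  bounding the flux through the cut-off region by the energy alone.\<close>

lemma pressure_divergence_zero:
  fixes \<rho> d :: "real^3 \<Rightarrow> real" and u :: "real^3 \<Rightarrow> real^3"
  assumes \<rho>: "locint \<rho>" "\<And>x. 0 \<le> \<rho> x" "locint (\<lambda>x. (\<rho> x)^4)" and u: "locint u" and \<rho>u: "locint (\<lambda>x. \<rho> x *\<^sub>R u x)"
    and M: "\<And>i h. (NNINT x. (u (x + h) $ i - u x $ i)^2) \<le> ennreal ((norm h)^2 * M)" "M \<ge> 0"
    and d: "locint d" "\<And>\<psi> d\<psi>. C1c \<psi> d\<psi> \<Longrightarrow> (LBINT x. u x \<bullet> d\<psi> x) = - (LBINT x. \<psi> x * d x)"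
    and div: "\<And>\<phi>. \<phi> \<in> Cc_inf \<Longrightarrow> (LBINT x. (\<rho> x *\<^sub>R u x) \<bullet> grad \<phi> x) = 0"
    and \<gamma>: "\<gamma> \<ge> 6" and E: "integrable lborel (\<lambda>x. \<rho> x powr \<gamma>)" "integrable lborel (\<lambda>x. \<rho> x * (norm (u x))^2)"
      "integrable lborel (\<lambda>x. \<rho> x powr \<gamma> * d x)"
  shows "(LBINT x. \<rho> x powr \<gamma> * d x) = 0"
proof -
  note mo = approx_idD[OF approx_id_mollifier]
  have [measurable]: "\<rho> \<in> borel_measurable borel" "d \<in> borel_measurable borel" "u \<in> borel_measurable borel"
    using \<rho> d u by (auto intro: locint_measurable)
  obtain L R where L: "L > 0" "\<And>x. norm (mgrad 0 x) \<le> L * indicator (cball 0 R) x"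
    using bsupp_bound[OF mgrad_props(1,2)] by metis
  have L': "norm (mgrad 0 x) \<le> L" for x
    using L(2)[of x] L(1) by (cases "norm x \<le> R") auto
  have step: "\<exists>B. B \<in> borel_measurable borel \<and> (\<forall>t\<ge>0. 0 \<le> B t \<and> B t \<le> t powr \<gamma> \<and> t powr \<gamma> - B t \<le> \<gamma> * t powr (\<gamma> + 1) / k) \<and> (LBINT x. B (\<rho> x) * d x) = 0"
    if k: "k > 0" for k :: real
  proof -
    obtain \<beta> \<beta>' B K where \<beta>: "\<And>t. (\<beta> has_real_derivative \<beta>' t) (at t)" "\<And>t. (B has_real_derivative t * \<beta>' t) (at t)" "continuous_on UNIV \<beta>'"
      and K: "\<And>t. t \<ge> 0 \<Longrightarrow> \<bar>\<beta> t\<bar> \<le> K" "\<And>t. t \<ge> 0 \<Longrightarrow> \<bar>\<beta>' t\<bar> \<le> K" "\<And>t. t \<ge> 0 \<Longrightarrow> \<bar>B t\<bar> \<le> K" "\<And>t. t \<ge> 0 \<Longrightarrow> \<bar>t * \<beta> t - B t\<bar> \<le> K"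
      and B: "\<And>t. t \<ge> 0 \<Longrightarrow> 0 \<le> B t" "\<And>t. t \<ge> 0 \<Longrightarrow> B t \<le> t powr \<gamma>" "\<And>t. t \<ge> 0 \<Longrightarrow> t powr \<gamma> - B t \<le> \<gamma> * t powr (\<gamma> + 1) / k"
      and C: "\<And>t. t \<ge> 0 \<Longrightarrow> \<bar>t * (\<beta> t - \<beta> 0) - B t\<bar> \<le> 2 * K * t" "\<And>t. t \<ge> 0 \<Longrightarrow> \<bar>t * (\<beta> t - \<beta> 0) - B t\<bar> \<le> 2 * t powr \<gamma>" and K0: "K \<ge> 0"
      by (rule renormalization_cutoff[OF \<gamma> k]) (rule that)
    have \<beta>c: "continuous_on UNIV \<beta>" "continuous_on UNIV B"
      using DERIV_isCont[OF \<beta>(1)] DERIV_isCont[OF \<beta>(2)] by (auto intro: continuous_at_imp_continuous_on)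
    have [measurable]: "\<beta> \<in> borel_measurable borel" and Bm[measurable]: "B \<in> borel_measurable borel"
      using \<beta>c by (auto intro: borel_measurable_continuous_onI)
    \<comment> \<open>Near \<rho> = 0 the flux factor \<rho> \<beta>(\<rho>) - B(\<rho>) behaves
      like \<beta>(0) \<rho>, and \<rho>|u| need not be integrable. Subtracting \<beta>(0) \<rho>
      leaves a factor of size \<rho>^\<gamma>.\<close>
    define C' where "C' x = \<rho> x * (\<beta> (\<rho> x) - \<beta> 0) - B (\<rho> x)" for x
    have Bd: "integrable lborel (\<lambda>x. B (\<rho> x) * d x)"
    proof (rule Bochner_Integration.integrable_bound[OF E(3)])
      show "AE x in lborel. norm (B (\<rho> x) * d x) \<le> norm (\<rho> x powr \<gamma> * d x)"
        using B(1,2)[OF \<rho>(2)] by (intro AE_I2) (auto simp: abs_mult intro!: mult_right_mono)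
    qed measurable
    define Q where "Q = (LBINT x. 2 * \<rho> x powr \<gamma> + 2 * K * (\<rho> x * (norm (u x))^2))"
    have iQ: "integrable lborel (\<lambda>x. 2 * \<rho> x powr \<gamma> + 2 * K * (\<rho> x * (norm (u x))^2))"
      using E(1,2) by auto
    have id: "\<bar>LBINT x. mollifier 0 ((1 / real (Suc n)) *\<^sub>R x) * (B (\<rho> x) * d x)\<bar> \<le> L / real (Suc n) * Q" for n
    proof -
      define r where "r = 1 / real (Suc n)"
      have r: "r > 0" by (simp add: r_def)
      have \<xi>: "C1c (\<lambda>x. mollifier 0 (r *\<^sub>R x)) (\<lambda>x. r *\<^sub>R mgrad 0 (r *\<^sub>R x))"
        using C1c_affine[OF C1c_mollifier[of 0], of r 0] r by simp
      note d\<xi> = C1D(2)[OF C1c_C1[OF \<xi>]] bsupp_C1c(2)[OF \<xi>]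
      have i0: "integrable lborel (\<lambda>x. u x \<bullet> (r *\<^sub>R mgrad 0 (r *\<^sub>R x)))" by (rule locint_vec_inner_bsupp[OF u d\<xi>])
      have i1: "integrable lborel (\<lambda>x. (\<rho> x *\<^sub>R u x) \<bullet> (r *\<^sub>R mgrad 0 (r *\<^sub>R x)))" by (rule locint_vec_inner_bsupp[OF \<rho>u d\<xi>])
      have mm: "mgrad 0 \<in> borel_measurable borel" by (rule borel_measurable_continuous_onI[OF mgrad_props(1)])
      have i2: "integrable lborel (\<lambda>x. (\<rho> x * \<beta> (\<rho> x) - B (\<rho> x)) * (u x \<bullet> (r *\<^sub>R mgrad 0 (r *\<^sub>R x))))"
      proof (rule Bochner_Integration.integrable_bound)
        show "integrable lborel (\<lambda>x. K * (u x \<bullet> (r *\<^sub>R mgrad 0 (r *\<^sub>R x))))" using i0 by (rule integrable_mult_right)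
        show "AE x in lborel. norm ((\<rho> x * \<beta> (\<rho> x) - B (\<rho> x)) * (u x \<bullet> (r *\<^sub>R mgrad 0 (r *\<^sub>R x)))) \<le> norm (K * (u x \<bullet> (r *\<^sub>R mgrad 0 (r *\<^sub>R x))))"
          using K(4)[OF \<rho>(2)] K0 by (intro AE_I2) (simp only: real_norm_def abs_mult abs_of_nonneg mult_right_mono abs_ge_zero)
      qed (use mm in measurable)
      have "(LBINT x. mollifier 0 (r *\<^sub>R x) * (B (\<rho> x) * d x)) = (LBINT x. (\<rho> x * \<beta> (\<rho> x) - B (\<rho> x)) * (u x \<bullet> (r *\<^sub>R mgrad 0 (r *\<^sub>R x))))"
        by (rule renormalized_continuity[OF \<rho> u \<rho>u M d div \<beta> K \<xi>])
      \<comment> \<open>The inserted term is zero by the continuity equation tested with the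
        cut-off.\<close>
      also have "\<dots> = (LBINT x. (\<rho> x * \<beta> (\<rho> x) - B (\<rho> x)) * (u x \<bullet> (r *\<^sub>R mgrad 0 (r *\<^sub>R x)))) - \<beta> 0 * (LBINT x. (\<rho> x *\<^sub>R u x) \<bullet> (r *\<^sub>R mgrad 0 (r *\<^sub>R x)))"
        using divergence_free_C1c[OF \<rho>u div \<xi>] by simp
      also have "\<dots> = (LBINT x. (\<rho> x * \<beta> (\<rho> x) - B (\<rho> x)) * (u x \<bullet> (r *\<^sub>R mgrad 0 (r *\<^sub>R x))) - \<beta> 0 * ((\<rho> x *\<^sub>R u x) \<bullet> (r *\<^sub>R mgrad 0 (r *\<^sub>R x))))"
        unfolding integral_mult_right_zero[symmetric] by (rule Bochner_Integration.integral_diff[symmetric, OF i2 integrable_mult_right[OF i1]])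
      also have "\<dots> = (LBINT x. C' x * (u x \<bullet> (r *\<^sub>R mgrad 0 (r *\<^sub>R x))))"
        by (rule Bochner_Integration.integral_cong) (simp_all add: C'_def algebra_simps)
      also have "\<bar>\<dots>\<bar> \<le> (LBINT x. L * r * (2 * \<rho> x powr \<gamma> + 2 * K * (\<rho> x * (norm (u x))^2)))"
      proof (rule integral_abs_le_integral)
        show "integrable lborel (\<lambda>x. L * r * (2 * \<rho> x powr \<gamma> + 2 * K * (\<rho> x * (norm (u x))^2)))" using iQ by (rule integrable_mult_right)
        fix x
        have "\<bar>u x \<bullet> (r *\<^sub>R mgrad 0 (r *\<^sub>R x))\<bar> \<le> norm (u x) * norm (r *\<^sub>R mgrad 0 (r *\<^sub>R x))" by (rule Cauchy_Schwarz_ineq2)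
        also have "\<dots> \<le> norm (u x) * (r * L)" using L'[of "r *\<^sub>R x"] r by (intro mult_left_mono) auto
        finally have 1: "\<bar>C' x * (u x \<bullet> (r *\<^sub>R mgrad 0 (r *\<^sub>R x)))\<bar> \<le> \<bar>C' x\<bar> * (norm (u x) * (r * L))"
          unfolding abs_mult by (intro mult_left_mono) auto
        \<comment> \<open>For |u| \<le> 1 the bound 2 \<rho>^\<gamma> suffices. For |u| > 1, |u| is
          at most |u|^2 and the linear bound 2 K \<rho> leads to the kinetic energy.\<close>
        have 2: "\<bar>C' x\<bar> * norm (u x) \<le> 2 * \<rho> x powr \<gamma> + 2 * K * (\<rho> x * (norm (u x))^2)"
        proof (cases "norm (u x) \<le> 1")
          case True
          then have "\<bar>C' x\<bar> * norm (u x) \<le> \<bar>C' x\<bar> * 1" by (intro mult_left_mono) auto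
          also have "\<dots> \<le> 2 * \<rho> x powr \<gamma>" using C(2)[OF \<rho>(2)[of x]] by (simp add: C'_def)
          finally show ?thesis using K0 \<rho>(2)[of x] by (simp add: add_increasing2)
        next
          case False
          then have "norm (u x) \<le> (norm (u x))^2" using power_increasing[of 1 2 "norm (u x)"] by simp
          then have "\<bar>C' x\<bar> * norm (u x) \<le> \<bar>C' x\<bar> * (norm (u x))^2" by (intro mult_left_mono) auto
          also have "\<dots> \<le> (2 * K * \<rho> x) * (norm (u x))^2" using C(1)[OF \<rho>(2)[of x]] by (intro mult_right_mono) (auto simp: C'_def)
          finally show ?thesis by (simp add: mult.assoc add_increasing)
        qed
        have "\<bar>C' x\<bar> * (norm (u x) * (r * L)) = L * r * (\<bar>C' x\<bar> * norm (u x))" by simp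
        also have "\<dots> \<le> L * r * (2 * \<rho> x powr \<gamma> + 2 * K * (\<rho> x * (norm (u x))^2))" by (intro mult_left_mono 2) (use L(1) r in auto)
        finally show "\<bar>C' x * (u x \<bullet> (r *\<^sub>R mgrad 0 (r *\<^sub>R x)))\<bar> \<le> L * r * (2 * \<rho> x powr \<gamma> + 2 * K * (\<rho> x * (norm (u x))^2))"
          using 1 by linarith
      qed
      also have "\<dots> = L / real (Suc n) * Q" unfolding Q_def integral_mult_right_zero by (simp add: r_def)
      finally show ?thesis unfolding r_def .
    qed
    have "(\<lambda>n. LBINT x. mollifier 0 ((1 / real (Suc n)) *\<^sub>R x) * (B (\<rho> x) * d x)) \<longlonglongrightarrow> 0"
    proof (rule Lim_null_comparison)
      show "\<forall>\<^sub>F n in sequentially. norm (LBINT x. mollifier 0 ((1 / real (Suc n)) *\<^sub>R x) * (B (\<rho> x) * d x)) \<le> L / real (Suc n) * Q"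
        using id by simp
      have "(\<lambda>n. L * (inverse (real (Suc n))) * Q) \<longlonglongrightarrow> L * 0 * Q" by (intro tendsto_intros LIMSEQ_inverse_real_of_nat)
      then show "(\<lambda>n. L / real (Suc n) * Q) \<longlonglongrightarrow> 0" by (simp add: divide_inverse)
    qed
    \<comment> \<open>The same sequence tends to 0 by the flux bound and to a positive multiple of
      the integral by \<open>integral_cutoff_tendsto\<close>.\<close>
    then have "mollifier 0 (0 :: real^3) * (LBINT x. B (\<rho> x) * d x) = 0"
      by (rule LIMSEQ_unique[OF integral_cutoff_tendsto[OF Bd]])
    moreover have "mollifier 0 (0 :: real^3) \<noteq> 0"
      using bump_mass_pos[where 'a="real^3"] bump_pos[of "0::real^3"] by (simp add: mollifier_def)
    ultimately show ?thesis using Bm B by (intro exI[of _ B]) auto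
  qed
  have "\<forall>n. \<exists>B. B \<in> borel_measurable borel \<and> (\<forall>t\<ge>0. 0 \<le> B t \<and> B t \<le> t powr \<gamma> \<and> t powr \<gamma> - B t \<le> \<gamma> * t powr (\<gamma> + 1) / real (Suc n)) \<and> (LBINT x. B (\<rho> x) * d x) = 0"
    by (intro allI step) simp
  then obtain B where B: "\<And>n. B n \<in> borel_measurable borel" "\<And>n t. t \<ge> 0 \<Longrightarrow> 0 \<le> B n t \<and> B n t \<le> t powr \<gamma> \<and> t powr \<gamma> - B n t \<le> \<gamma> * t powr (\<gamma> + 1) / real (Suc n)"
    "\<And>n. (LBINT x. B n (\<rho> x) * d x) = 0"
    unfolding choice_iff by blast
  have [measurable]: "B n \<in> borel_measurable borel" for n by (rule B(1))
  \<comment> \<open>Truncation levels k = n + 1. Since 0 \<le> B \<le> t^\<gamma>, the integrable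
    product of the pressure and the divergence dominates.\<close>
  have "(\<lambda>n. LBINT x. B n (\<rho> x) * d x) \<longlonglongrightarrow> (LBINT x. \<rho> x powr \<gamma> * d x)"
  proof (rule integral_dominated_convergence[where w="\<lambda>x. \<bar>\<rho> x powr \<gamma> * d x\<bar>"])
    show "AE x in lborel. (\<lambda>n. B n (\<rho> x) * d x) \<longlonglongrightarrow> \<rho> x powr \<gamma> * d x"
    proof (rule AE_I2)
      fix x
      have "(\<lambda>n. B n (\<rho> x)) \<longlonglongrightarrow> \<rho> x powr \<gamma>"
      proof (rule tendsto_sandwich[OF _ _ _ tendsto_const])
        show "\<forall>\<^sub>F n in sequentially. \<rho> x powr \<gamma> - \<gamma> * \<rho> x powr (\<gamma> + 1) * inverse (real (Suc n)) \<le> B n (\<rho> x)"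
          using B(2)[OF \<rho>(2)[of x]] by (intro always_eventually allI) (simp add: divide_inverse algebra_simps)
        show "\<forall>\<^sub>F n in sequentially. B n (\<rho> x) \<le> \<rho> x powr \<gamma>" using B(2)[OF \<rho>(2)[of x]] by simp
        have "(\<lambda>n. \<rho> x powr \<gamma> - \<gamma> * \<rho> x powr (\<gamma> + 1) * inverse (real (Suc n))) \<longlonglongrightarrow> \<rho> x powr \<gamma> - \<gamma> * \<rho> x powr (\<gamma> + 1) * 0"
          by (intro tendsto_intros LIMSEQ_inverse_real_of_nat)
        then show "(\<lambda>n. \<rho> x powr \<gamma> - \<gamma> * \<rho> x powr (\<gamma> + 1) * inverse (real (Suc n))) \<longlonglongrightarrow> \<rho> x powr \<gamma>" by simp
      qed
      then show "(\<lambda>n. B n (\<rho> x) * d x) \<longlonglongrightarrow> \<rho> x powr \<gamma> * d x" by (intro tendsto_intros)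
    qed
    show "AE x in lborel. norm (B n (\<rho> x) * d x) \<le> \<bar>\<rho> x powr \<gamma> * d x\<bar>" for n
      using B(2)[OF \<rho>(2)] by (intro AE_I2) (auto simp: abs_mult intro!: mult_right_mono)
  qed (use E(3) in \<open>auto intro!: integrable_abs\<close>)
  then show ?thesis unfolding B(3) by (simp add: LIMSEQ_const_iff)
qed

section \<open>Square integrable functions and duality bounds\<close>

definition sq_int :: "(real^3 \<Rightarrow> real) \<Rightarrow> bool" where
  "sq_int f \<longleftrightarrow> f \<in> borel_measurable borel \<and> (NNINT x. (f x)^2) < \<infinity>"

lemma sq_int_measurable: "sq_int f \<Longrightarrow> f \<in> borel_measurable borel"
  by (simp add: sq_int_def)

lemma sq_int_integrable: "sq_int f \<Longrightarrow> sq_int g \<Longrightarrow> integrable lborel (\<lambda>x. f x * g x)"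
  unfolding sq_int_def by (intro L2_integrable) auto

lemma sq_int_scale:
  assumes "sq_int f" shows "sq_int (\<lambda>x. c * f x)"
proof -
  have [measurable]: "f \<in> borel_measurable borel" by (rule sq_int_measurable[OF assms])
  have "(NNINT x. (c * f x)^2) = ennreal (c^2) * (NNINT x. (f x)^2)"
    by (subst nn_integral_cmult[symmetric]) (auto simp: power_mult_distrib ennreal_mult)
  then show ?thesis using assms by (simp add: sq_int_def ennreal_mult_less_top)
qed

lemma sq_int_add:
  assumes "sq_int f" "sq_int g" shows "sq_int (\<lambda>x. f x + g x)"
proof -
  have [measurable]: "f \<in> borel_measurable borel" "g \<in> borel_measurable borel" using assms by (auto intro: sq_int_measurable)
  have "(NNINT x. (f x - (- g x))^2) \<le> 2 * (NNINT x. (f x)^2) + 2 * (NNINT x. (- g x)^2)"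
    by (rule nn_integral_sq_diff) measurable
  also have "\<dots> < \<infinity>" using assms by (simp add: sq_int_def ennreal_mult_less_top)
  finally show ?thesis by (simp add: sq_int_def)
qed

lemma sq_int_sum: "finite I \<Longrightarrow> (\<And>i. i \<in> I \<Longrightarrow> sq_int (f i)) \<Longrightarrow> sq_int (\<lambda>x. \<Sum>i\<in>I. f i x)"
proof (induction I rule: finite_induct)
  case empty
  then show ?case by (simp add: sq_int_def)
next
  case (insert i I)
  then show ?case using sq_int_add[of "f i" "\<lambda>x. \<Sum>i\<in>I. f i x"] by simp
qed

lemma sq_int_bsupp:
  assumes "continuous_on UNIV f" "bsupp f" shows "sq_int f"
proof -
  have "integrable lborel (\<lambda>x. (f x)^2)"
    by (rule integrable_bsupp, intro continuous_intros assms, rule bsupp_mono[OF assms(2)], simp)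
  then show ?thesis using borel_measurable_continuous_onI[OF assms(1)]
    by (simp add: sq_int_def nn_integral_eq_integral)
qed

lemma sq_int_limit:
  assumes "\<And>n. sq_int (a n)" "\<And>n. sq_int (b n)" "sq_int a'" "sq_int b'"
    "(\<lambda>n. NNINT x. (a n x - a' x)^2) \<longlonglongrightarrow> 0" "(\<lambda>n. NNINT x. (b n x - b' x)^2) \<longlonglongrightarrow> 0"
  shows "(\<lambda>n. LBINT x. a n x * b n x) \<longlonglongrightarrow> (LBINT x. a' x * b' x)"
  by (rule L2_product_limit) (use assms in \<open>auto simp: sq_int_def\<close>)

text \<open>A sum in place of the product in Hoelder's inequality. It suffices to bound a linear
  functional on the unit ball of test fields.\<close>

lemma pair_bound:
  fixes a b :: "'a \<Rightarrow> real"
  assumes [measurable]: "a \<in> borel_measurable M" "b \<in> borel_measurable M" and pq: "p > 0" "q > 0" "1 / p + 1 / q = 1"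
    and A: "(\<integral>\<^sup>+x. ennreal (\<bar>a x\<bar> powr p) \<partial>M) \<le> ennreal A" "A \<ge> 0" and B: "(\<integral>\<^sup>+x. ennreal (\<bar>b x\<bar> powr q) \<partial>M) \<le> ennreal B" "B \<ge> 0"
  shows "\<bar>\<integral>x. a x * b x \<partial>M\<bar> \<le> A + B"
proof -
  have i: "integrable M (\<lambda>x. a x * b x)"
    by (rule Hoelder_integrable[OF _ _ pq]) (use A B in \<open>auto intro: order_le_less_trans\<close>)
  have "ennreal \<bar>\<integral>x. a x * b x \<partial>M\<bar> \<le> (\<integral>\<^sup>+x. ennreal (norm (a x * b x)) \<partial>M)"
    using integral_norm_bound_ennreal[OF i] by simp
  also have "\<dots> \<le> (\<integral>\<^sup>+x. ennreal (\<bar>a x\<bar> powr p) + ennreal (\<bar>b x\<bar> powr q) \<partial>M)"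
  proof (rule nn_integral_mono)
    fix x
    have "\<bar>a x\<bar> * \<bar>b x\<bar> \<le> \<bar>a x\<bar> powr p + \<bar>b x\<bar> powr q" by (rule young_product) (use pq in auto)
    then show "ennreal (norm (a x * b x)) \<le> ennreal (\<bar>a x\<bar> powr p) + ennreal (\<bar>b x\<bar> powr q)"
      by (simp add: abs_mult ennreal_plus[symmetric] ennreal_leI del: ennreal_plus)
  qed
  also have "\<dots> = (\<integral>\<^sup>+x. ennreal (\<bar>a x\<bar> powr p) \<partial>M) + (\<integral>\<^sup>+x. ennreal (\<bar>b x\<bar> powr q) \<partial>M)"
    by (rule nn_integral_add) measurable
  also have "\<dots> \<le> ennreal A + ennreal B" by (intro add_mono A B)
  also have "\<dots> = ennreal (A + B)" using A(2) B(2) by simp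
  finally show ?thesis using A(2) B(2) by (simp add: ennreal_le_iff ennreal_plus[symmetric] del: ennreal_plus)
qed

text \<open>The norm is at most the sum of the three absolute values, hence at most 3 times the
  largest; 729 is 3^6.\<close>

lemma norm_pow6_le:
  fixes x :: "real^3"
  shows "norm x ^ 6 \<le> 729 * (\<Sum>i\<in>UNIV. \<bar>x $ i\<bar>^6)"
proof -
  define m where "m = Max (range (\<lambda>j. \<bar>x $ j\<bar>))"
  have "m \<in> range (\<lambda>j. \<bar>x $ j\<bar>)" unfolding m_def by (rule Max_in) auto
  then obtain i where i: "m = \<bar>x $ i\<bar>" by auto
  have le: "\<bar>x $ j\<bar> \<le> m" for j unfolding m_def by (rule Max_ge) auto
  have "norm x \<le> (\<Sum>j\<in>UNIV. \<bar>x $ j\<bar>)" by (rule norm_le_l1_cart)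
  also have "\<dots> \<le> (\<Sum>j\<in>(UNIV::3 set). m)" by (intro sum_mono le)
  also have "\<dots> = 3 * m" by simp
  finally have "norm x ^ 6 \<le> (3 * m)^6" by (intro power_mono) auto
  also have "\<dots> = 729 * \<bar>x $ i\<bar>^6" by (simp add: power_mult_distrib i)
  also have "\<dots> \<le> 729 * (\<Sum>i\<in>UNIV. \<bar>x $ i\<bar>^6)"
    by (intro mult_left_mono member_le_sum) auto
  finally show ?thesis .
qed

text \<open>One member at finite distance from g suffices; the factor 2^q comes from |g| \<le> 2
  max(|f|, |f - g|).\<close>

lemma Lq_limit_finite:
  fixes f :: "nat \<Rightarrow> 'a \<Rightarrow> 'b::euclidean_space"
  assumes [measurable]: "\<And>n. f n \<in> borel_measurable M" "g \<in> borel_measurable M" and q: "q > 0"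
    and f: "\<And>n. (\<integral>\<^sup>+x. ennreal (norm (f n x) powr q) \<partial>M) < \<infinity>" and l: "(\<lambda>n. \<integral>\<^sup>+x. ennreal (norm (f n x - g x) powr q) \<partial>M) \<longlonglongrightarrow> 0"
  shows "(\<integral>\<^sup>+x. ennreal (norm (g x) powr q) \<partial>M) < \<infinity>"
proof -
  obtain n where n: "(\<integral>\<^sup>+x. ennreal (norm (f n x - g x) powr q) \<partial>M) \<le> ennreal 1"
    using eventually_happens[OF ennreal_tendsto_0D[OF l, of 1]] by auto
  have "(\<integral>\<^sup>+x. ennreal (norm (g x) powr q) \<partial>M) \<le> (\<integral>\<^sup>+x. ennreal (2 powr q) * (ennreal (norm (f n x) powr q) + ennreal (norm (f n x - g x) powr q)) \<partial>M)"
  proof (rule nn_integral_mono)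
    fix x
    define a b where "a = norm (f n x)" and "b = norm (f n x - g x)"
    have ab: "0 \<le> a" "0 \<le> b" by (auto simp: a_def b_def)
    have "norm (g x) \<le> a + b" unfolding a_def b_def by (metis norm_triangle_sub norm_minus_commute)
    also have "\<dots> \<le> 2 * max a b" by simp
    finally have "norm (g x) powr q \<le> (2 * max a b) powr q" using q by (intro powr_mono2) auto
    also have "\<dots> = 2 powr q * (max a b) powr q" using ab by (simp add: powr_mult)
    also have "\<dots> \<le> 2 powr q * (a powr q + b powr q)" by (intro mult_left_mono) (auto simp: max_def)
    finally show "ennreal (norm (g x) powr q) \<le> ennreal (2 powr q) * (ennreal (norm (f n x) powr q) + ennreal (norm (f n x - g x) powr q))"
      unfolding a_def b_def by (simp add: ennreal_mult[symmetric] ennreal_plus[symmetric] ennreal_leI del: ennreal_plus)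
  qed
  also have "\<dots> = ennreal (2 powr q) * ((\<integral>\<^sup>+x. ennreal (norm (f n x) powr q) \<partial>M) + (\<integral>\<^sup>+x. ennreal (norm (f n x - g x) powr q) \<partial>M))"
    by (simp add: nn_integral_cmult nn_integral_add)
  also have "\<dots> < \<infinity>" using f[of n] order_le_less_trans[OF n] by (simp add: ennreal_mult_less_top)
  finally show ?thesis .
qed

section \<open>Testing with the velocity\<close>

lemma nn_integral_bsupp_powr_finite:
  fixes f :: "'a::euclidean_space \<Rightarrow> 'b::euclidean_space"
  assumes "continuous_on UNIV f" "bsupp f" "q > 0"
  shows "(NNINT x. norm (f x) powr q) < \<infinity>"
proof -
  have "integrable lborel (\<lambda>x. norm (f x) powr q)"
  proof (rule integrable_bsupp)
    show "continuous_on UNIV (\<lambda>x. norm (f x) powr q)"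
      by (intro continuous_on_powr' continuous_intros assms(1)) (use assms(3) in auto)
    show "bsupp (\<lambda>x. norm (f x) powr q)" by (rule bsupp_mono[OF assms(2)]) simp
  qed
  then show ?thesis by (simp add: nn_integral_eq_integral)
qed

lemma nn_integral_powr_mono_finite:
  fixes f :: "'a \<Rightarrow> real"
  assumes "(\<integral>\<^sup>+x. ennreal (g x) \<partial>M) < \<infinity>" "\<And>x. f x \<le> g x"
  shows "(\<integral>\<^sup>+x. ennreal (f x) \<partial>M) < \<infinity>"
proof -
  have "(\<integral>\<^sup>+x. ennreal (f x) \<partial>M) \<le> (\<integral>\<^sup>+x. ennreal (g x) \<partial>M)" by (intro nn_integral_mono ennreal_leI assms(2))
  then show ?thesis using assms(1) by (rule order_le_less_trans)
qed

lemma locint_le_one_plus: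
  fixes f :: "'a::euclidean_space \<Rightarrow> real"
  assumes "f \<in> borel_measurable borel" "integrable lborel g" "\<And>x. \<bar>f x\<bar> \<le> 1 + g x"
  shows "locint f"
  unfolding locint_def
proof (intro conjI allI)
  fix R
  have [measurable]: "f \<in> borel_measurable borel" by (rule assms(1))
  show "integrable lborel (\<lambda>x. indicator (cball 0 R) x *\<^sub>R f x)"
  proof (rule Bochner_Integration.integrable_bound)
    show "integrable lborel (\<lambda>x. 1 * indicator (cball 0 R) x + \<bar>g x\<bar>)"
      using integrable_indicator_cball[of 1 0 R] assms(2) by (intro Bochner_Integration.integrable_add integrable_abs)
    show "AE x in lborel. norm (indicator (cball 0 R) x *\<^sub>R f x) \<le> norm (1 * indicator (cball 0 R) x + \<bar>g x\<bar>)"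
    proof (rule AE_I2)
      fix x
      show "norm (indicator (cball 0 R) x *\<^sub>R f x) \<le> norm (1 * indicator (cball 0 R) x + \<bar>g x\<bar>)"
        using assms(3)[of x] by (auto simp: indicator_def)
    qed
  qed measurable
qed (rule assms(1))

lemma double_sum_tendsto:
  fixes f :: "nat \<Rightarrow> 3 \<Rightarrow> 3 \<Rightarrow> real"
  assumes "\<And>i j. (\<lambda>n. f n i j) \<longlonglongrightarrow> l i j"
  shows "(\<lambda>n. \<Sum>i\<in>UNIV. \<Sum>j\<in>UNIV. f n i j) \<longlonglongrightarrow> (\<Sum>i\<in>UNIV. \<Sum>j\<in>UNIV. l i j)"
  by (intro tendsto_sum assms)

text \<open>\<open>V i\<close> is the gradient of \<open>u\<^sub>i\<close>, approximated by \<open>d\<phi> i n\<close>,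
  and \<open>H\<close> is the gradient of the potential, approximated by \<open>d\<psi> n\<close>.\<close>

lemma velocity_zero:
  fixes \<mu> \<eta> \<gamma> :: real and \<rho> :: "real^3 \<Rightarrow> real" and u H :: "real^3 \<Rightarrow> real^3" and V :: "3 \<Rightarrow> real^3 \<Rightarrow> real^3"
    and \<phi> :: "3 \<Rightarrow> nat \<Rightarrow> real^3 \<Rightarrow> real" and \<psi> :: "nat \<Rightarrow> real^3 \<Rightarrow> real"
  assumes \<mu>: "\<mu> > 0" and \<eta>: "\<eta> \<ge> 0" and \<gamma>: "\<gamma> \<ge> 6" and q: "q = 6 * \<gamma> / (5 * \<gamma> - 6)"
    and \<rho>: "\<rho> \<in> borel_measurable borel" "\<And>x. 0 \<le> \<rho> x" and u: "locint u" and \<rho>u: "locint (\<lambda>x. \<rho> x *\<^sub>R u x)"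
    and V: "\<And>i. locint (V i)" and H: "H \<in> borel_measurable borel"
    and E1: "(NNINT x. \<rho> x powr \<gamma>) < \<infinity>" and E2: "(NNINT x. \<rho> x * (norm (u x))^2) < \<infinity>"
    and \<phi>: "\<And>i n. C1c (\<phi> i n) (d\<phi> i n)"
    and \<phi>V: "\<And>i. (\<lambda>n. NNINT x. norm (d\<phi> i n x - V i x) powr 2) \<longlonglongrightarrow> 0"
    and \<phi>u: "\<And>i R. (\<lambda>n. NNINT x. indicator (cball 0 R) x * \<bar>\<phi> i n x - u x $ i\<bar>) \<longlonglongrightarrow> 0"
    and \<psi>: "\<And>n. C1c (\<psi> n) (d\<psi> n)"
    and \<psi>H: "(\<lambda>n. NNINT x. norm (d\<psi> n x - H x) powr q) \<longlonglongrightarrow> 0"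
    and div: "\<And>\<xi>. \<xi> \<in> Cc_inf \<Longrightarrow> (LBINT x. (\<rho> x *\<^sub>R u x) \<bullet> grad \<xi> x) = 0"
    and S: "\<And>i j x. S i j x = \<mu> * (V i x $ j + V j x $ i) + (if i = j then (\<eta> - 2/3 * \<mu>) * (\<Sum>k\<in>UNIV. V k x $ k) else 0)"
    and mom: "\<And>\<Xi> D. (\<And>i. C1c (\<Xi> i) (D i)) \<Longrightarrow>
      (LBINT x. (\<Sum>i\<in>UNIV. \<Sum>j\<in>UNIV. (\<rho> x * u x $ i * u x $ j) * D i x $ j) + \<rho> x powr \<gamma> * (\<Sum>i\<in>UNIV. D i x $ i))
      = (LBINT x. (\<Sum>i\<in>UNIV. \<Sum>j\<in>UNIV. S i j x * D i x $ j)) - (LBINT x. (\<Sum>i\<in>UNIV. (\<rho> x * H x $ i) * \<Xi> i x))"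
  shows "AE x in lborel. u x = 0"
proof -
  have [measurable]: "\<rho> \<in> borel_measurable borel" "u \<in> borel_measurable borel" "H \<in> borel_measurable borel" "V i \<in> borel_measurable borel" for i
    using \<rho> u V H by (auto intro: locint_measurable)
  have \<phi>c: "continuous_on UNIV (\<phi> i n)" "continuous_on UNIV (d\<phi> i n)" "bsupp (\<phi> i n)" "bsupp (d\<phi> i n)" for i n
    using C1D[OF C1c_C1[OF \<phi>]] bsupp_C1c[OF \<phi>] by simp_all
  have \<psi>c: "continuous_on UNIV (d\<psi> n)" "bsupp (d\<psi> n)" for n
    using C1D[OF C1c_C1[OF \<psi>]] bsupp_C1c[OF \<psi>] by simp_all
  have [measurable]: "\<phi> i n \<in> borel_measurable borel" "d\<phi> i n \<in> borel_measurable borel" "d\<psi> n \<in> borel_measurable borel" for i n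
    by (rule borel_measurable_continuous_onI; rule \<phi>c \<psi>c)+
  \<comment> \<open>The relation 1/\<gamma> + 1/q = 5/6 puts \<rho> grad G into the dual space of
    L^6.\<close>
  have q0: "q > 0" "1 / q = 5/6 - 1/\<gamma>"
    using \<gamma> by (auto simp: q field_simps)
  have \<phi>V2: "(\<lambda>n. NNINT x. norm (d\<phi> i n x - V i x)^2) \<longlonglongrightarrow> 0" for i
    using \<phi>V[of i] by (simp add: powr_numeral)
  have V2: "(NNINT x. norm (V i x)^2) < \<infinity>" for i
    using Lq_limit_finite[OF _ _ _ nn_integral_bsupp_powr_finite[OF \<phi>c(2,4)] \<phi>V, of i] by (simp add: powr_numeral)
  have Hq: "(NNINT x. norm (H x) powr q) < \<infinity>"
    by (rule Lq_limit_finite[OF _ _ q0(1) nn_integral_bsupp_powr_finite[OF \<psi>c q0(1)] \<psi>H]) measurable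
  have \<phi>6: "(\<lambda>n. NNINT x. \<bar>\<phi> i n x - u x $ i\<bar>^6) \<longlonglongrightarrow> 0" for i
    by (rule Sobolev_limit[OF \<phi> _ _ \<phi>V2 \<phi>u]) measurable
  have \<phi>6': "(\<lambda>n. NNINT x. norm (\<phi> i n x - u x $ i) powr 6) \<longlonglongrightarrow> 0" for i
    using \<phi>6[of i] by (simp add: powr_numeral)
  have \<phi>f6: "(NNINT x. norm (\<phi> i n x) powr 6) < \<infinity>" for i n
    by (rule nn_integral_bsupp_powr_finite[OF \<phi>c(1,3)]) simp
  have ui6': "(NNINT x. norm (u x $ i) powr 6) < \<infinity>" for i
    by (rule Lq_limit_finite[OF _ _ _ \<phi>f6 \<phi>6']) auto
  then have ui6: "(NNINT x. \<bar>u x $ i\<bar>^6) < \<infinity>" for i by (simp add: powr_numeral)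
  have u6: "(NNINT x. norm (u x)^6) < \<infinity>"
  proof -
    have "(NNINT x. norm (u x)^6) \<le> (\<integral>\<^sup>+x. ennreal 729 * (\<Sum>i\<in>UNIV. ennreal (\<bar>u x $ i\<bar>^6)) \<partial>lborel)"
    proof (rule nn_integral_mono)
      fix x
      have "ennreal (norm (u x)^6) \<le> ennreal (729 * (\<Sum>i\<in>UNIV. \<bar>u x $ i\<bar>^6))" by (rule ennreal_leI[OF norm_pow6_le])
      then show "ennreal (norm (u x)^6) \<le> ennreal 729 * (\<Sum>i\<in>UNIV. ennreal (\<bar>u x $ i\<bar>^6))"
        by (simp add: ennreal_mult sum_nonneg)
    qed
    also have "\<dots> = ennreal 729 * (\<Sum>i\<in>UNIV. (NNINT x. \<bar>u x $ i\<bar>^6))"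
      by (subst nn_integral_cmult, measurable, subst nn_integral_sum, measurable)
    also have "\<dots> < \<infinity>" using ui6 by (simp add: ennreal_mult_less_top)
    finally show ?thesis .
  qed
  have u6': "(NNINT x. norm (u x) powr 6) < \<infinity>" using u6 by (simp add: powr_numeral)
  have i\<rho>: "integrable lborel (\<lambda>x. \<rho> x powr \<gamma>)"
    unfolding integrable_iff_bounded using E1 by simp
  have i\<rho>u: "integrable lborel (\<lambda>x. \<rho> x * (norm (u x))^2)"
    unfolding integrable_iff_bounded using E2 \<rho>(2) by (simp add: abs_mult)
  \<comment> \<open>Only local integrability of \<rho> and \<rho>^4 follows, because the constant 1
    is integrable on balls but not globally.\<close>
  have \<rho>pow: "\<bar>\<rho> x\<bar> \<le> 1 + \<rho> x powr \<gamma>" "\<bar>\<rho> x ^ 4\<bar> \<le> 1 + \<rho> x powr \<gamma>" for x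
  proof -
    have "\<rho> x \<le> 1 + \<rho> x powr \<gamma> \<and> \<rho> x ^ 4 \<le> 1 + \<rho> x powr \<gamma>"
    proof (cases "\<rho> x \<le> 1")
      case True
      then have "\<rho> x ^ 4 \<le> 1" using \<rho>(2)[of x] by (intro power_le_one) auto
      moreover have "0 \<le> \<rho> x powr \<gamma>" by simp
      ultimately show ?thesis using True by linarith
    next
      case False
      then have "\<rho> x powr 1 \<le> \<rho> x powr \<gamma>" "\<rho> x powr 4 \<le> \<rho> x powr \<gamma>" using \<gamma> by (intro powr_mono; simp)+
      then show ?thesis using False by (simp add: powr_numeral)
    qed
    then show "\<bar>\<rho> x\<bar> \<le> 1 + \<rho> x powr \<gamma>" "\<bar>\<rho> x ^ 4\<bar> \<le> 1 + \<rho> x powr \<gamma>" using \<rho>(2)[of x] by simp_all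
  qed
  have l\<rho>: "locint \<rho>" "locint (\<lambda>x. (\<rho> x)^4)"
    by (rule locint_le_one_plus[OF _ i\<rho>]; use \<rho>pow in simp)+
  \<comment> \<open>The common integrable majorant of both interpolation inequalities.\<close>
  have sum3: "(NNINT x. \<rho> x * (norm (u x))^2 + norm (u x)^6 + \<rho> x powr \<gamma>) < \<infinity>"
  proof -
    have "(NNINT x. \<rho> x * (norm (u x))^2 + norm (u x)^6 + \<rho> x powr \<gamma>)
      = (\<integral>\<^sup>+x. ennreal (\<rho> x * (norm (u x))^2) + ennreal (norm (u x)^6) + ennreal (\<rho> x powr \<gamma>) \<partial>lborel)"
      using \<rho>(2) by (intro nn_integral_cong) simp
    also have "\<dots> = (NNINT x. \<rho> x * (norm (u x))^2) + (NNINT x. norm (u x)^6) + (NNINT x. \<rho> x powr \<gamma>)"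
      by (simp add: nn_integral_add)
    also have "\<dots> < \<infinity>" using E1 E2 u6 by simp
    finally show ?thesis .
  qed
  \<comment> \<open>The four densities: convective flux F in L^2, pressure p in L^1 for the moment,
    force G in L^(6/5), mass flux J.\<close>
  define F where "F i j x = \<rho> x * u x $ i * u x $ j" for i j x
  define p where "p x = \<rho> x powr \<gamma>" for x
  define G where "G i x = \<rho> x * H x $ i" for i x
  define J where "J i x = \<rho> x * u x $ i" for i x
  have [measurable]: "F i j \<in> borel_measurable borel" "p \<in> borel_measurable borel" "G i \<in> borel_measurable borel" "J i \<in> borel_measurable borel" for i j
    unfolding F_def p_def G_def J_def by measurable
  have comp_le: "\<bar>u x $ i\<bar> \<le> norm (u x)" "\<bar>H x $ i\<bar> \<le> norm (H x)" for x i by (rule component_le_norm_cart)+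
  have sF: "sq_int (F i j)" for i j
    unfolding sq_int_def
  proof
    show "(NNINT x. (F i j x)^2) < \<infinity>"
    proof (rule nn_integral_powr_mono_finite[OF sum3])
      fix x
      have "\<bar>F i j x\<bar> \<le> \<rho> x * norm (u x) * norm (u x)"
        unfolding F_def abs_mult using \<rho>(2)[of x] by (intro mult_mono comp_le) auto
      then have "\<bar>F i j x\<bar>^2 \<le> (\<rho> x * norm (u x) * norm (u x))^2" by (rule power_mono) simp
      then have "(F i j x)^2 \<le> (\<rho> x * norm (u x) * norm (u x))^2" unfolding power2_abs .
      also have "\<dots> = (\<rho> x)^2 * (norm (u x))^4" by (simp add: power_mult_distrib power2_eq_square power4_eq_xxxx)
      finally show "(F i j x)^2 \<le> \<rho> x * (norm (u x))^2 + norm (u x)^6 + \<rho> x powr \<gamma>"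
        using interpolation_2_4(1)[OF \<rho>(2)[of x] norm_ge_zero[of "u x"] \<gamma>] by linarith
    qed
  qed measurable
  have sV: "sq_int (\<lambda>x. V i x $ j)" for i j
    unfolding sq_int_def
  proof
    show "(NNINT x. (V i x $ j)^2) < \<infinity>"
    proof (rule nn_integral_powr_mono_finite[OF V2[of i]])
      show "(V i x $ j)^2 \<le> norm (V i x)^2" for x
        using component_le_norm_cart[of "V i x" j] abs_le_square_iff[of "V i x $ j" "norm (V i x)"] by simp
    qed
  qed measurable
  have sD: "sq_int (\<lambda>x. d\<phi> i n x $ j)" for i j n
    by (rule sq_int_bsupp, intro continuous_intros \<phi>c, rule bsupp_mono[OF \<phi>c(4)[of i n]], simp)
  have str: "sq_int (\<lambda>x. \<Sum>k\<in>UNIV. V k x $ k)" by (rule sq_int_sum) (auto intro: sV)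
  have sS: "sq_int (S i j)" for i j
  proof -
    have "sq_int (\<lambda>x. \<mu> * (V i x $ j + V j x $ i) + (if i = j then \<eta> - 2/3 * \<mu> else 0) * (\<Sum>k\<in>UNIV. V k x $ k))"
      by (intro sq_int_add sq_int_scale sV str)
    moreover have "S i j = (\<lambda>x. \<mu> * (V i x $ j + V j x $ i) + (if i = j then \<eta> - 2/3 * \<mu> else 0) * (\<Sum>k\<in>UNIV. V k x $ k))"
      by (rule ext) (simp add: S)
    ultimately show ?thesis by simp
  qed
  have dl: "(\<lambda>n. NNINT x. (d\<phi> i n x $ j - V i x $ j)^2) \<longlonglongrightarrow> 0" for i j
  proof (rule ennreal_squeeze_0[OF _ \<phi>V2[of i]])
    show "(NNINT x. (d\<phi> i n x $ j - V i x $ j)^2) \<le> (NNINT x. norm (d\<phi> i n x - V i x)^2)" for n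
    proof (intro nn_integral_mono ennreal_leI)
      fix x
      show "(d\<phi> i n x $ j - V i x $ j)^2 \<le> norm (d\<phi> i n x - V i x)^2"
        using component_le_norm_cart[of "d\<phi> i n x - V i x" j] abs_le_square_iff[of "d\<phi> i n x $ j - V i x $ j" "norm (d\<phi> i n x - V i x)"] by simp
    qed
  qed
  have Gf: "(NNINT x. \<bar>G i x\<bar> powr (6/5)) < \<infinity>" for i
  proof -
    have "(NNINT x. \<rho> x powr \<gamma> + norm (H x) powr q) = (NNINT x. \<rho> x powr \<gamma>) + (NNINT x. norm (H x) powr q)"
      by (simp add: nn_integral_add)
    then have f: "(NNINT x. \<rho> x powr \<gamma> + norm (H x) powr q) < \<infinity>" using E1 Hq by simp
    show ?thesis
    proof (rule nn_integral_powr_mono_finite[OF f])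
      fix x
      have "\<bar>G i x\<bar> \<le> \<rho> x * norm (H x)" unfolding G_def abs_mult using \<rho>(2)[of x] by (intro mult_mono comp_le) auto
      then have "\<bar>G i x\<bar> powr (6/5) \<le> (\<rho> x * norm (H x)) powr (6/5)" by (intro powr_mono2) auto
      also have "\<dots> \<le> \<rho> x powr \<gamma> + norm (H x) powr q"
      proof (rule powr_product_le)
        have "6/5 / \<gamma> + 6/5 / q = 6/5 * (1/\<gamma> + 1/q)" by (simp add: algebra_simps)
        then show "6/5 / \<gamma> + 6/5 / q = 1" unfolding q0(2) by simp
      qed (use \<rho>(2) \<gamma> q0 in auto)
      finally show "\<bar>G i x\<bar> powr (6/5) \<le> \<rho> x powr \<gamma> + norm (H x) powr q" .
    qed
  qed
  \<comment> \<open>The exponent of the mass flux, from \<rho> in L^\<gamma> and u in L^6. It is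
    conjugate to q, as 1/s + 1/q = 1/6 + 1/\<gamma> + 5/6 - 1/\<gamma> = 1.\<close>
  define s where "s = 6 * \<gamma> / (\<gamma> + 6)"
  have s0: "s > 0" "1 / s = 1/6 + 1/\<gamma>" using \<gamma> by (auto simp: s_def field_simps)
  have Jf: "(NNINT x. \<bar>J i x\<bar> powr s) < \<infinity>" for i
  proof -
    have "(NNINT x. \<rho> x powr \<gamma> + norm (u x) powr 6) = (NNINT x. \<rho> x powr \<gamma>) + (NNINT x. norm (u x) powr 6)"
      by (simp add: nn_integral_add)
    then have f: "(NNINT x. \<rho> x powr \<gamma> + norm (u x) powr 6) < \<infinity>" using E1 u6' by simp
    show ?thesis
    proof (rule nn_integral_powr_mono_finite[OF f])
      fix x
      have "\<bar>J i x\<bar> \<le> \<rho> x * norm (u x)" unfolding J_def abs_mult using \<rho>(2)[of x] by (intro mult_mono comp_le) auto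
      then have "\<bar>J i x\<bar> powr s \<le> (\<rho> x * norm (u x)) powr s" using s0 by (intro powr_mono2) auto
      also have "\<dots> \<le> \<rho> x powr \<gamma> + norm (u x) powr 6"
      proof (rule powr_product_le)
        have "s / \<gamma> + s / 6 = s * (1 / s)" unfolding s0(2) by (simp add: algebra_simps)
        then show "s / \<gamma> + s / 6 = 1" using s0(1) by simp
      qed (use \<rho>(2) \<gamma> s0 in auto)
      finally show "\<bar>J i x\<bar> powr s \<le> \<rho> x powr \<gamma> + norm (u x) powr 6" .
    qed
  qed
  have ip: "integrable lborel p" unfolding p_def by (rule i\<rho>)
  have lp: "locint p" by (rule integrable_imp_locint[OF ip])
  have mom': "(\<Sum>i\<in>UNIV. \<Sum>j\<in>UNIV. LBINT x. F i j x * D i x $ j) + (LBINT x. p x * (\<Sum>i\<in>UNIV. D i x $ i))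
      = (\<Sum>i\<in>UNIV. \<Sum>j\<in>UNIV. LBINT x. S i j x * D i x $ j) - (\<Sum>i\<in>UNIV. LBINT x. G i x * \<Xi> i x)"
    if C: "\<And>i. C1c (\<Xi> i) (D i)" for \<Xi> D
  proof -
    have Dc: "continuous_on UNIV (\<lambda>x. D i x $ j)" for i j using C1D(2)[OF C1c_C1[OF C]] by (intro continuous_intros)
    have Db: "bsupp (\<lambda>x. D i x $ j)" for i j by (rule bsupp_mono[OF bsupp_C1c(2)[OF C[of i]]]) simp
    have sqD: "sq_int (\<lambda>x. D i x $ j)" for i j by (rule sq_int_bsupp[OF Dc Db])
    have iF: "integrable lborel (\<lambda>x. F i j x * D i x $ j)" for i j by (rule sq_int_integrable[OF sF sqD])
    have iS: "integrable lborel (\<lambda>x. S i j x * D i x $ j)" for i j by (rule sq_int_integrable[OF sS sqD])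
    have ipD: "integrable lborel (\<lambda>x. p x * D i x $ i)" for i
      using locint_mult_bsupp[OF lp Dc Db] by (simp add: mult.commute)
    have ipD': "integrable lborel (\<lambda>x. p x * (\<Sum>i\<in>UNIV. D i x $ i))"
      unfolding sum_distrib_left by (rule Bochner_Integration.integrable_sum) (rule ipD)
    have iG: "integrable lborel (\<lambda>x. G i x * \<Xi> i x)" for i
    proof (rule Hoelder_integrable[where p="6/5" and q=6])
      show "(NNINT x. \<bar>\<Xi> i x\<bar> powr 6) < \<infinity>"
        using nn_integral_bsupp_powr_finite[OF C1D(3)[OF C1c_C1[OF C]] bsupp_C1c(1)[OF C], of 6 i] by simp
      show "\<Xi> i \<in> borel_measurable lborel" using borel_measurable_continuous_onI[OF C1D(3)[OF C1c_C1[OF C]]] by simp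
    qed (use Gf in auto)
    have "(LBINT x. (\<Sum>i\<in>UNIV. \<Sum>j\<in>UNIV. F i j x * D i x $ j) + p x * (\<Sum>i\<in>UNIV. D i x $ i))
      = (LBINT x. (\<Sum>i\<in>UNIV. \<Sum>j\<in>UNIV. F i j x * D i x $ j)) + (LBINT x. p x * (\<Sum>i\<in>UNIV. D i x $ i))"
      by (intro Bochner_Integration.integral_add Bochner_Integration.integrable_sum iF ipD')
    moreover have "(LBINT x. (\<Sum>i\<in>UNIV. \<Sum>j\<in>UNIV. F i j x * D i x $ j)) = (\<Sum>i\<in>UNIV. \<Sum>j\<in>UNIV. LBINT x. F i j x * D i x $ j)"
      using iF by (simp add: integral_sum Bochner_Integration.integrable_sum)
    moreover have "(LBINT x. (\<Sum>i\<in>UNIV. \<Sum>j\<in>UNIV. S i j x * D i x $ j)) = (\<Sum>i\<in>UNIV. \<Sum>j\<in>UNIV. LBINT x. S i j x * D i x $ j)"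
      using iS by (simp add: integral_sum Bochner_Integration.integrable_sum)
    moreover have "(LBINT x. (\<Sum>i\<in>UNIV. G i x * \<Xi> i x)) = (\<Sum>i\<in>UNIV. LBINT x. G i x * \<Xi> i x)"
      using iG by (simp add: integral_sum)
    ultimately show ?thesis using mom[OF C] unfolding F_def p_def G_def by simp
  qed
  have fin: "\<exists>A\<ge>0. X \<le> ennreal A" if "X < \<infinity>" for X :: ennreal
    using that by (cases X) auto
  obtain fF where fF: "\<And>i j. fF i j \<ge> 0" "\<And>i j. (NNINT x. \<bar>F i j x\<bar> powr 2) \<le> ennreal (fF i j)"
  proof -
    have "\<exists>A\<ge>0. (NNINT x. \<bar>F i j x\<bar> powr 2) \<le> ennreal A" for i j
      by (rule fin) (use sF[of i j] in \<open>simp add: sq_int_def powr_numeral\<close>)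
    then show ?thesis using that by metis
  qed
  obtain fS where fS: "\<And>i j. fS i j \<ge> 0" "\<And>i j. (NNINT x. \<bar>S i j x\<bar> powr 2) \<le> ennreal (fS i j)"
  proof -
    have "\<exists>A\<ge>0. (NNINT x. \<bar>S i j x\<bar> powr 2) \<le> ennreal A" for i j
      by (rule fin) (use sS[of i j] in \<open>simp add: sq_int_def powr_numeral\<close>)
    then show ?thesis using that by metis
  qed
  obtain fG where fG: "\<And>i. fG i \<ge> 0" "\<And>i. (NNINT x. \<bar>G i x\<bar> powr (6/5)) \<le> ennreal (fG i)"
  proof -
    have "\<exists>A\<ge>0. (NNINT x. \<bar>G i x\<bar> powr (6/5)) \<le> ennreal A" for i
      by (rule fin[OF Gf])
    then show ?thesis using that by metis
  qed
  \<comment> \<open>The momentum equation expresses the pressure term by three others, each bounded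
    by \<open>pair_bound\<close> on test fields whose gradient has L^2 norm at most 1. The number
    4096 is the Sobolev constant.\<close>
  define C where "C = (\<Sum>i\<in>UNIV. \<Sum>j\<in>UNIV. fS i j + 1) + (\<Sum>i\<in>UNIV. fG i + 4096) + (\<Sum>i\<in>UNIV. \<Sum>j\<in>UNIV. fF i j + 1)"
  have bound: "\<bar>LBINT x. p x * (\<Sum>i\<in>UNIV. D i x $ i)\<bar> \<le> C"
    if C: "\<And>i. C1c (\<Xi> i) (D i)" and D1: "(\<Sum>i\<in>UNIV. NNINT x. norm (D i x)^2) \<le> 1" for \<Xi> D
  proof -
    have Dm: "D i \<in> borel_measurable borel" for i by (rule borel_measurable_continuous_onI[OF C1D(2)[OF C1c_C1[OF C]]])
    have \<Xi>m: "\<Xi> i \<in> borel_measurable borel" for i by (rule borel_measurable_continuous_onI[OF C1D(3)[OF C1c_C1[OF C]]])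
    have Di1: "(NNINT x. norm (D i x)^2) \<le> 1" for i
      using member_le_sum[of i UNIV "\<lambda>i. NNINT x. norm (D i x)^2"] D1 by (auto intro: order_trans)
    have Dij: "(NNINT x. \<bar>D i x $ j\<bar> powr 2) \<le> ennreal 1" for i j
    proof -
      have "(NNINT x. \<bar>D i x $ j\<bar> powr 2) \<le> (NNINT x. norm (D i x)^2)"
        by (intro nn_integral_mono ennreal_leI) (simp add: powr_numeral power_mono[OF component_le_norm_cart, of _ _ 2, simplified])
      then show ?thesis using Di1[of i] by simp
    qed
    have \<Xi>6: "(NNINT x. \<bar>\<Xi> i x\<bar> powr 6) \<le> ennreal 4096" for i
    proof -
      have "(NNINT x. \<bar>\<Xi> i x\<bar>^6) \<le> 4096 * (NNINT x. norm (D i x)^2)^3" by (rule Sobolev_6_2[OF C])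
      also have "\<dots> \<le> 4096 * 1^3" by (intro mult_left_mono power_mono Di1) auto
      finally show ?thesis by (simp add: powr_numeral)
    qed
    have bF: "\<bar>LBINT x. F i j x * D i x $ j\<bar> \<le> fF i j + 1" for i j
      by (rule pair_bound[where p=2 and q=2]) (use fF Dij Dm in auto)
    have bS: "\<bar>LBINT x. S i j x * D i x $ j\<bar> \<le> fS i j + 1" for i j
      by (rule pair_bound[where p=2 and q=2]) (use fS Dij Dm sq_int_measurable[OF sS] in auto)
    have bG: "\<bar>LBINT x. G i x * \<Xi> i x\<bar> \<le> fG i + 4096" for i
      by (rule pair_bound[where p="6/5" and q=6]) (use fG \<Xi>6 \<Xi>m in auto)
    have s1: "\<bar>\<Sum>i\<in>UNIV. \<Sum>j\<in>UNIV. LBINT x. F i j x * D i x $ j\<bar> \<le> (\<Sum>i\<in>UNIV. \<Sum>j\<in>UNIV. fF i j + 1)"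
      by (intro order_trans[OF sum_abs] sum_mono bF)
    have s2: "\<bar>\<Sum>i\<in>UNIV. \<Sum>j\<in>UNIV. LBINT x. S i j x * D i x $ j\<bar> \<le> (\<Sum>i\<in>UNIV. \<Sum>j\<in>UNIV. fS i j + 1)"
      by (intro order_trans[OF sum_abs] sum_mono bS)
    have s3: "\<bar>\<Sum>i\<in>UNIV. LBINT x. G i x * \<Xi> i x\<bar> \<le> (\<Sum>i\<in>UNIV. fG i + 4096)"
      by (intro order_trans[OF sum_abs] sum_mono bG)
    show ?thesis using mom'[of \<Xi> D, OF C] s1 s2 s3 unfolding C_def by linarith
  qed
  \<comment> \<open>From here on every term of the momentum equation is continuous along the
    approximations of u.\<close>
  have sp: "sq_int p"
  proof -
    have "(NNINT x. (p x)^2) < \<infinity>"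
    proof (rule L2_from_div_bound[OF ip])
      fix \<Xi> :: "3 \<Rightarrow> real^3 \<Rightarrow> real" and D
      assume "\<And>i. C1c (\<Xi> i) (D i)" "(\<Sum>i\<in>UNIV. NNINT x. norm (D i x)^2) \<le> 1"
      then show "\<bar>LBINT x. p x * (\<Sum>i\<in>UNIV. D i x $ i)\<bar> \<le> C" by (rule bound)
    qed
    then show ?thesis by (simp add: sq_int_def)
  qed
  have div': "(LBINT x. (\<rho> x *\<^sub>R u x) \<bullet> d\<xi> x) = 0" if "C1c \<xi> d\<xi>" for \<xi> d\<xi>
    by (rule divergence_free_C1c[OF \<rho>u _ that]) (rule div)
  have z0: "(\<lambda>n::nat. NNINT x. (f x - f x)^2) \<longlonglongrightarrow> 0" for f :: "real^3 \<Rightarrow> real" by simp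
  \<comment> \<open>The renormalized equation requires increments of u of order |h| in L^2, obtained
    from the approximations, and the trace of V as the weak divergence of u.\<close>
  have Z1: "(\<Sum>i\<in>UNIV. LBINT x. p x * V i x $ i) = 0"
  proof -
    define d where "d x = (\<Sum>k\<in>UNIV. V k x $ k)" for x
    have lVi: "locint (\<lambda>x. V i x $ j)" for i j using locint_inner[OF V[of i], of "axis j 1"] by (simp add: inner_axis)
    have ld: "locint d"
      unfolding locint_def d_def scaleR_sum_right
    proof (intro conjI allI)
      show "(\<lambda>x. \<Sum>k\<in>UNIV. V k x $ k) \<in> borel_measurable borel" by measurable
      show "integrable lborel (\<lambda>x. \<Sum>k\<in>UNIV. indicat_real (cball 0 R) x *\<^sub>R V k x $ k)" for R
        by (rule Bochner_Integration.integrable_sum) (rule locint_truncate[OF lVi])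
    qed
    \<comment> \<open>Convergence bounds the gradient norms only from some index N on; the sequence
      is shifted accordingly for \<open>increment_limit\<close>.\<close>
    have "\<exists>N A. A \<ge> 0 \<and> (\<forall>n\<ge>N. (NNINT x. norm (d\<phi> i n x)^2) \<le> ennreal A)" for i
    proof -
      obtain N where N: "\<And>n. n \<ge> N \<Longrightarrow> (NNINT x. norm (d\<phi> i n x - V i x)^2) \<le> ennreal 1"
        using ennreal_tendsto_0D[OF \<phi>V2[of i], of 1] by (auto simp: eventually_sequentially)
      obtain A where A: "A \<ge> 0" "(NNINT x. norm (V i x)^2) \<le> ennreal A" using fin[OF V2[of i]] by auto
      have "(NNINT x. norm (d\<phi> i n x)^2) \<le> ennreal (2 + 2 * A)" if "n \<ge> N" for n
      proof -
        have "(NNINT x. norm (d\<phi> i n x)^2) = (NNINT x. norm ((d\<phi> i n x - V i x) - (- V i x))^2)" by simp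
        also have "\<dots> \<le> 2 * (NNINT x. norm (d\<phi> i n x - V i x)^2) + 2 * (NNINT x. norm (- V i x)^2)"
          by (rule nn_integral_norm_sq_diff) measurable
        also have "\<dots> \<le> 2 * ennreal 1 + 2 * ennreal A" using A(2) by (intro add_mono mult_left_mono N[OF that]) auto
        also have "\<dots> = ennreal (2 + 2 * A)" using A(1) by (simp add: ennreal_mult)
        finally show ?thesis .
      qed
      then show ?thesis using A(1) by (intro exI[of _ N] exI[of _ "2 + 2 * A"]) auto
    qed
    then obtain N A where NA: "\<And>i. A i \<ge> 0" "\<And>i n. n \<ge> N i \<Longrightarrow> (NNINT x. norm (d\<phi> i n x)^2) \<le> ennreal (A i)" by metis
    define M where "M = (\<Sum>i\<in>UNIV. A i)"
    have M: "M \<ge> 0" "A i \<le> M" for i unfolding M_def using NA(1) by (auto intro: sum_nonneg member_le_sum)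
    have incr: "(NNINT x. (u (x + h) $ i - u x $ i)^2) \<le> ennreal ((norm h)^2 * M)" for i h
    proof (rule increment_limit[where \<phi>="\<lambda>n. \<phi> i (n + N i)" and d\<phi>="\<lambda>n. d\<phi> i (n + N i)"])
      show "(NNINT x. norm (d\<phi> i (n + N i) x)^2) \<le> ennreal M" for n
        using NA(2)[of i "n + N i"] ennreal_leI[OF M(2)[of i]] by (auto intro: order_trans)
      show "(\<lambda>n. NNINT x. \<bar>\<phi> i (n + N i) x - u x $ i\<bar>^6) \<longlonglongrightarrow> 0"
        using LIMSEQ_ignore_initial_segment[OF \<phi>6[of i], of "N i"] .
    qed (use \<phi> M in auto)
    have lui: "locint (\<lambda>x. u x $ i)" for i using locint_inner[OF u, of "axis i 1"] by (simp add: inner_axis)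
    have l\<phi>: "locint (\<phi> i n)" "locint (\<lambda>x. d\<phi> i n x $ j)" for i j n
      by (rule integrable_imp_locint, rule integrable_bsupp[OF \<phi>c(1,3)])
        (rule integrable_imp_locint, rule integrable_bsupp, intro continuous_intros \<phi>c, rule bsupp_mono[OF \<phi>c(4)[of i n]], simp)
    have wk: "(LBINT x. u x \<bullet> d\<xi> x) = - (LBINT x. \<xi> x * d x)" if \<xi>: "C1c \<xi> d\<xi>" for \<xi> d\<xi>
    proof -
      have \<xi>c: "continuous_on UNIV \<xi>" "continuous_on UNIV (\<lambda>x. d\<xi> x $ i)" "bsupp \<xi>" "bsupp (\<lambda>x. d\<xi> x $ i)" for i
        using C1D(2,3)[OF C1c_C1[OF \<xi>]] bsupp_C1c[OF \<xi>] by (auto intro!: continuous_intros elim: bsupp_mono)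
      have VL1: "(\<lambda>n. NNINT x. indicator (cball 0 R) x * norm (d\<phi> i n x $ i - V i x $ i)) \<longlonglongrightarrow> 0" for R i
      proof -
        have "(\<lambda>n. NNINT x. indicator (cball 0 R) x * norm (d\<phi> i n x $ i - V i x $ i)) \<longlonglongrightarrow> 0"
          by (rule Lq_imp_L1_local[where q=2]) (use dl[of i i] in \<open>auto simp: powr_numeral\<close>)
        then show ?thesis .
      qed
      have 1: "(\<lambda>n. LBINT x. d\<xi> x $ i *\<^sub>R \<phi> i n x) \<longlonglongrightarrow> (LBINT x. d\<xi> x $ i *\<^sub>R u x $ i)" for i
        by (rule local_L1_limit_integral[OF l\<phi>(1) lui _ \<xi>c(2,4)]) (use \<phi>u in simp)
      have 2: "(\<lambda>n. LBINT x. \<xi> x *\<^sub>R d\<phi> i n x $ i) \<longlonglongrightarrow> (LBINT x. \<xi> x *\<^sub>R V i x $ i)" for i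
        by (rule local_L1_limit_integral[OF l\<phi>(2) lVi VL1 \<xi>c(1,3)])
      have ibp: "(LBINT x. d\<xi> x $ i *\<^sub>R \<phi> i n x) = - (LBINT x. \<xi> x *\<^sub>R d\<phi> i n x $ i)" for i n
      proof -
        have a: "integrable lborel (\<lambda>x. \<xi> x *\<^sub>R d\<phi> i n x)"
          by (rule integrable_bsupp[OF continuous_on_scaleR[OF \<xi>c(1) \<phi>c(2)]], rule bsupp_mono[OF \<xi>c(3)], simp)
        have b: "integrable lborel (\<lambda>x. \<phi> i n x *\<^sub>R d\<xi> x)"
          by (rule integrable_bsupp[OF continuous_on_scaleR[OF \<phi>c(1) C1D(2)[OF C1c_C1[OF \<xi>]]]], rule bsupp_mono[OF \<phi>c(3)[of i n]], simp)
        show ?thesis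
          using arg_cong[OF integral_by_parts[OF \<xi> C1c_C1[OF \<phi>], of i n], of "\<lambda>v. v \<bullet> axis i 1"]
            integral_inner_left[OF a, of "axis i 1"] integral_inner_left[OF b, of "axis i 1"]
          by (simp add: inner_axis mult.commute)
      qed
      have "(\<lambda>n. - (LBINT x. \<xi> x *\<^sub>R d\<phi> i n x $ i)) \<longlonglongrightarrow> - (LBINT x. \<xi> x *\<^sub>R V i x $ i)" for i
        by (rule tendsto_minus[OF 2])
      then have e: "(LBINT x. d\<xi> x $ i *\<^sub>R u x $ i) = - (LBINT x. \<xi> x *\<^sub>R V i x $ i)" for i
        using 1[of i] unfolding ibp by (rule LIMSEQ_unique[rotated])
      have "(LBINT x. u x \<bullet> d\<xi> x) = (\<Sum>i\<in>UNIV. LBINT x. d\<xi> x $ i *\<^sub>R u x $ i)"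
        using locint_mult_bsupp[OF lui \<xi>c(2,4)] by (simp add: inner_vec_def integral_sum mult.commute)
      also have "\<dots> = - (\<Sum>i\<in>UNIV. LBINT x. \<xi> x *\<^sub>R V i x $ i)" unfolding e by (simp add: sum_negf)
      also have "(\<Sum>i\<in>UNIV. LBINT x. \<xi> x *\<^sub>R V i x $ i) = (LBINT x. \<xi> x * d x)"
        using locint_mult_bsupp[OF lVi \<xi>c(1,3)] by (simp add: d_def sum_distrib_left integral_sum)
      finally show ?thesis .
    qed
    have ipd: "integrable lborel (\<lambda>x. \<rho> x powr \<gamma> * d x)" using sq_int_integrable[OF sp str] by (simp add: p_def d_def)
    have "(LBINT x. \<rho> x powr \<gamma> * d x) = 0"
      by (rule pressure_divergence_zero[OF l\<rho>(1) \<rho>(2) l\<rho>(2) u \<rho>u incr M(1) ld wk div \<gamma> i\<rho> i\<rho>u ipd])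
    moreover have "(LBINT x. \<rho> x powr \<gamma> * d x) = (\<Sum>i\<in>UNIV. LBINT x. p x * V i x $ i)"
      using sq_int_integrable[OF sp sV] by (simp add: d_def p_def sum_distrib_left integral_sum)
    ultimately show ?thesis by simp
  qed
  have Ji: "integrable lborel (\<lambda>x. J i x * d\<psi> n x $ i)" for i n
  proof (rule Hoelder_integrable[where p=s and q=q])
    have "(NNINT x. norm (d\<psi> n x $ i) powr q) < \<infinity>"
      by (rule nn_integral_bsupp_powr_finite[OF _ _ q0(1)], intro continuous_intros \<psi>c, rule bsupp_mono[OF \<psi>c(2)[of n]], simp)
    then show "(NNINT x. \<bar>d\<psi> n x $ i\<bar> powr q) < \<infinity>" by simp
  qed (use Jf s0 q0 in auto)
  \<comment> \<open>The work of the force is the mass flux paired with the gradient of the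
    potential, the limit of continuity equations tested with the approximations of the
    potential.\<close>
  have Z2: "(\<Sum>i\<in>UNIV. LBINT x. G i x * u x $ i) = 0"
  proof -
    have "(\<lambda>n. LBINT x. J i x * d\<psi> n x $ i) \<longlonglongrightarrow> (LBINT x. J i x * H x $ i)" for i
    proof (rule Hoelder_limit[where p=s and q=q])
      show "(NNINT x. \<bar>H x $ i\<bar> powr q) < \<infinity>"
        by (rule nn_integral_powr_mono_finite[OF Hq]) (use q0 comp_le in \<open>auto intro: powr_mono2\<close>)
      have "(NNINT x. norm (d\<psi> n x $ i) powr q) < \<infinity>" for n
        by (rule nn_integral_bsupp_powr_finite[OF _ _ q0(1)], intro continuous_intros \<psi>c, rule bsupp_mono[OF \<psi>c(2)[of n]], simp)
      then show "(NNINT x. \<bar>d\<psi> n x $ i\<bar> powr q) < \<infinity>" for n by simp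
      show "(\<lambda>n. NNINT x. \<bar>d\<psi> n x $ i - H x $ i\<bar> powr q) \<longlonglongrightarrow> 0"
      proof (rule ennreal_squeeze_0[OF _ \<psi>H])
        show "(NNINT x. \<bar>d\<psi> n x $ i - H x $ i\<bar> powr q) \<le> (NNINT x. norm (d\<psi> n x - H x) powr q)" for n
        proof (intro nn_integral_mono ennreal_leI powr_mono2)
          show "\<bar>d\<psi> n x $ i - H x $ i\<bar> \<le> norm (d\<psi> n x - H x)" for x using component_le_norm_cart[of "d\<psi> n x - H x" i] by simp
        qed (use q0 in auto)
      qed
    qed (use Jf s0 q0 in auto)
    then have "(\<lambda>n. \<Sum>i\<in>UNIV. LBINT x. J i x * d\<psi> n x $ i) \<longlonglongrightarrow> (\<Sum>i\<in>UNIV. LBINT x. J i x * H x $ i)" by (intro tendsto_sum)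
    moreover have "(\<Sum>i\<in>UNIV. LBINT x. J i x * d\<psi> n x $ i) = 0" for n
    proof -
      have "(LBINT x. (\<rho> x *\<^sub>R u x) \<bullet> d\<psi> n x) = (\<Sum>i\<in>UNIV. LBINT x. J i x * d\<psi> n x $ i)"
        using Ji by (simp add: inner_vec_def J_def integral_sum)
      then show ?thesis using div'[OF \<psi>, of n] by simp
    qed
    ultimately have "(\<Sum>i\<in>UNIV. LBINT x. J i x * H x $ i) = 0" by (simp add: LIMSEQ_const_iff)
    moreover have "J i x * H x $ i = G i x * u x $ i" for i x by (simp add: J_def G_def)
    ultimately show ?thesis by simp
  qed
  \<comment> \<open>Only one of the two velocity factors is replaced by its approximation; \<rho>
    u_j has to stay exact for the continuity equation to apply.\<close>
  define a where "a i j n x = J j x * \<phi> i n x" for i j n x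
  \<comment> \<open>The mass flux lies in L^3, so its product with an L^6 function lies in L^2,
    where it pairs with the gradients. The exponents 3/2 and 3 are those for the squares.\<close>
  have J3: "(NNINT x. \<bar>(J j x)^2\<bar> powr (3/2)) < \<infinity>" for j
  proof (rule nn_integral_powr_mono_finite[OF sum3])
    fix x
    have j: "\<bar>J j x\<bar> \<le> \<rho> x * norm (u x)" unfolding J_def abs_mult using \<rho>(2)[of x] by (intro mult_mono comp_le) auto
    have "\<bar>(J j x)^2\<bar> powr (3/2) = \<bar>J j x\<bar>^3"
    proof (cases "J j x = 0")
      case False
      have "\<bar>(J j x)^2\<bar> = \<bar>J j x\<bar> powr 2" using powr_realpow[of "\<bar>J j x\<bar>" 2] False by simp
      then have "\<bar>(J j x)^2\<bar> powr (3/2) = (\<bar>J j x\<bar> powr 2) powr (3/2)" by (simp only:)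
      also have "\<dots> = \<bar>J j x\<bar> powr 3" unfolding powr_powr by simp
      also have "\<dots> = \<bar>J j x\<bar>^3" using powr_realpow[of "\<bar>J j x\<bar>" 3] False by simp
      finally show ?thesis .
    qed simp
    also have "\<dots> \<le> (\<rho> x * norm (u x))^3" by (rule power_mono[OF j]) simp
    also have "\<dots> = (\<rho> x)^3 * (norm (u x))^3" by (rule power_mult_distrib)
    also have "\<dots> \<le> \<rho> x * (norm (u x))^2 + norm (u x)^6 + \<rho> x powr \<gamma>" by (rule interpolation_2_4(2)[OF \<rho>(2) norm_ge_zero \<gamma>])
    finally show "\<bar>(J j x)^2\<bar> powr (3/2) \<le> \<rho> x * (norm (u x))^2 + norm (u x)^6 + \<rho> x powr \<gamma>" .
  qed
  have p3: "\<bar>t^2\<bar> powr 3 = \<bar>t\<bar>^6" for t :: real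
    using powr_realpow'[of "t^2" 3] by (cases "t = 0") (auto simp: powr_numeral power_mult[symmetric] power_even_abs)
  have sa: "sq_int (a i j n)" for i j n
  proof -
    have "integrable lborel (\<lambda>x. (J j x)^2 * (\<phi> i n x)^2)"
      by (rule Hoelder_integrable[where p="3/2" and q=3]) (use J3 \<phi>f6[of i n] in \<open>auto simp: p3 powr_numeral\<close>)
    then have "(NNINT x. (a i j n x)^2) < \<infinity>"
      unfolding a_def power_mult_distrib by (simp add: nn_integral_eq_integral)
    then show ?thesis unfolding sq_int_def a_def by simp
  qed
  have la: "(\<lambda>n. NNINT x. (a i j n x - F j i x)^2) \<longlonglongrightarrow> 0" for i j
  proof -
    have "(\<lambda>n. NNINT x. \<bar>(J j x)^2 * (\<phi> i n x - u x $ i)^2\<bar>) \<longlonglongrightarrow> 0"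
      by (rule Hoelder_tendsto_0[where p="3/2" and q=3]) (use J3 \<phi>6[of i] in \<open>auto simp: p3\<close>)
    moreover have "(a i j n x - F j i x)^2 = \<bar>(J j x)^2 * (\<phi> i n x - u x $ i)^2\<bar>" for n x
    proof -
      have "a i j n x - F j i x = J j x * (\<phi> i n x - u x $ i)" unfolding a_def F_def J_def by (simp add: algebra_simps)
      then show ?thesis by (simp add: power_mult_distrib abs_mult)
    qed
    ultimately show ?thesis by simp
  qed
  have Z3: "(\<Sum>i\<in>UNIV. \<Sum>j\<in>UNIV. LBINT x. F i j x * V i x $ j) = 0"
  proof -
    have "(\<lambda>n. LBINT x. a i j n x * d\<phi> i n x $ j) \<longlonglongrightarrow> (LBINT x. F j i x * V i x $ j)" for i j
      by (rule sq_int_limit[OF sa sD sF sV la dl])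
    then have l: "(\<lambda>n. \<Sum>i\<in>UNIV. \<Sum>j\<in>UNIV. LBINT x. a i j n x * d\<phi> i n x $ j) \<longlonglongrightarrow> (\<Sum>i\<in>UNIV. \<Sum>j\<in>UNIV. LBINT x. F j i x * V i x $ j)"
      by (rule double_sum_tendsto)
    have "(\<Sum>i\<in>UNIV. \<Sum>j\<in>UNIV. LBINT x. a i j n x * d\<phi> i n x $ j) = 0" for n
    proof -
      have ia: "integrable lborel (\<lambda>x. a i j n x * d\<phi> i n x $ j)" for i j by (rule sq_int_integrable[OF sa sD])
      \<comment> \<open>The convective term is half of \<rho> u tested with the gradient of
        |\<phi>|^2, which the continuity equation makes zero.\<close>
      have "C1c (\<lambda>x. \<Sum>i\<in>UNIV. \<phi> i n x * \<phi> i n x) (\<lambda>x. \<Sum>i\<in>UNIV. \<phi> i n x *\<^sub>R d\<phi> i n x + \<phi> i n x *\<^sub>R d\<phi> i n x)"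
        by (intro C1c_sum C1c_mult_left \<phi> C1c_C1) auto
      then have "(LBINT x. (\<rho> x *\<^sub>R u x) \<bullet> (\<Sum>i\<in>UNIV. \<phi> i n x *\<^sub>R d\<phi> i n x + \<phi> i n x *\<^sub>R d\<phi> i n x)) = 0"
        by (rule div')
      moreover have "(\<rho> x *\<^sub>R u x) \<bullet> (\<Sum>i\<in>UNIV. \<phi> i n x *\<^sub>R d\<phi> i n x + \<phi> i n x *\<^sub>R d\<phi> i n x)
        = 2 * (\<Sum>i\<in>UNIV. \<Sum>j\<in>UNIV. a i j n x * d\<phi> i n x $ j)" for x
      proof -
        have "(\<rho> x *\<^sub>R u x) \<bullet> (\<phi> i n x *\<^sub>R d\<phi> i n x) = (\<Sum>j\<in>UNIV. a i j n x * d\<phi> i n x $ j)" for i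
          by (simp add: inner_vec_def a_def J_def sum_distrib_left mult_ac)
        then show ?thesis
          unfolding inner_sum_right inner_add_right sum.distrib by (simp only: mult_2)
      qed
      ultimately have "(LBINT x. (\<Sum>i\<in>UNIV. \<Sum>j\<in>UNIV. a i j n x * d\<phi> i n x $ j)) = 0" by simp
      then show ?thesis using ia by (simp add: integral_sum Bochner_Integration.integrable_sum)
    qed
    then have "(\<Sum>i\<in>UNIV. \<Sum>j\<in>UNIV. LBINT x. F j i x * V i x $ j) = 0" using l by (simp add: LIMSEQ_const_iff)
    moreover have "F j i = F i j" for i j unfolding F_def by (rule ext) simp
    ultimately show ?thesis by simp
  qed
  \<comment> \<open>The momentum equation is tested with the approximations and passed to the limit;
    this is the equation tested with u.\<close>
  have energy: "(\<Sum>i\<in>UNIV. \<Sum>j\<in>UNIV. LBINT x. S i j x * V i x $ j) = 0"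
  proof -
    have T1: "(\<lambda>n. \<Sum>i\<in>UNIV. \<Sum>j\<in>UNIV. LBINT x. F i j x * d\<phi> i n x $ j) \<longlonglongrightarrow> (\<Sum>i\<in>UNIV. \<Sum>j\<in>UNIV. LBINT x. F i j x * V i x $ j)"
      by (intro double_sum_tendsto sq_int_limit sF sD sV dl z0)
    have T2: "(\<lambda>n. \<Sum>i\<in>UNIV. LBINT x. p x * d\<phi> i n x $ i) \<longlonglongrightarrow> (\<Sum>i\<in>UNIV. LBINT x. p x * V i x $ i)"
      by (intro tendsto_sum sq_int_limit sp sD sV dl z0)
    have T3: "(\<lambda>n. \<Sum>i\<in>UNIV. \<Sum>j\<in>UNIV. LBINT x. S i j x * d\<phi> i n x $ j) \<longlonglongrightarrow> (\<Sum>i\<in>UNIV. \<Sum>j\<in>UNIV. LBINT x. S i j x * V i x $ j)"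
      by (intro double_sum_tendsto sq_int_limit sS sD sV dl z0)
    have T4: "(\<lambda>n. \<Sum>i\<in>UNIV. LBINT x. G i x * \<phi> i n x) \<longlonglongrightarrow> (\<Sum>i\<in>UNIV. LBINT x. G i x * u x $ i)"
    proof (intro tendsto_sum Hoelder_limit[where p="6/5" and q=6])
      show "(NNINT x. \<bar>u x $ i\<bar> powr 6) < \<infinity>" for i using ui6'[of i] by simp
      show "(NNINT x. \<bar>\<phi> i n x\<bar> powr 6) < \<infinity>" for i n using \<phi>f6[of i n] by simp
      show "(\<lambda>n. NNINT x. \<bar>\<phi> i n x - u x $ i\<bar> powr 6) \<longlonglongrightarrow> 0" for i using \<phi>6'[of i] by simp
    qed (use Gf in auto)
    have ip\<phi>: "(LBINT x. p x * (\<Sum>i\<in>UNIV. d\<phi> i n x $ i)) = (\<Sum>i\<in>UNIV. LBINT x. p x * d\<phi> i n x $ i)" for n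
      using sq_int_integrable[OF sp sD] by (simp add: sum_distrib_left integral_sum)
    have m: "(\<Sum>i\<in>UNIV. \<Sum>j\<in>UNIV. LBINT x. F i j x * d\<phi> i n x $ j) + (\<Sum>i\<in>UNIV. LBINT x. p x * d\<phi> i n x $ i)
      = (\<Sum>i\<in>UNIV. \<Sum>j\<in>UNIV. LBINT x. S i j x * d\<phi> i n x $ j) - (\<Sum>i\<in>UNIV. LBINT x. G i x * \<phi> i n x)" for n
      using mom'[of "\<lambda>i. \<phi> i n" "\<lambda>i. d\<phi> i n", OF \<phi>] ip\<phi>[of n] by simp
    have "(\<Sum>i\<in>UNIV. \<Sum>j\<in>UNIV. LBINT x. F i j x * V i x $ j) + (\<Sum>i\<in>UNIV. LBINT x. p x * V i x $ i)
      = (\<Sum>i\<in>UNIV. \<Sum>j\<in>UNIV. LBINT x. S i j x * V i x $ j) - (\<Sum>i\<in>UNIV. LBINT x. G i x * u x $ i)"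
      using tendsto_add[OF T1 T2] tendsto_diff[OF T3 T4] unfolding m by (rule LIMSEQ_unique)
    then show ?thesis using Z1 Z2 Z3 by simp
  qed
  define P where "P i j k l = (LBINT x. V i x $ j * V k x $ l)" for i j k l
  have iV: "integrable lborel (\<lambda>x. V i x $ j * V k x $ l)" for i j k l by (rule sq_int_integrable[OF sV sV])
  \<comment> \<open>Swapping the two derivatives turns the mixed products into products of diagonal
    entries, for the approximations by \<open>integral_grad_swap\<close> and then in the
    limit.\<close>
  have transp: "(\<Sum>i\<in>UNIV. \<Sum>j\<in>UNIV. P j i i j) = (\<Sum>i\<in>UNIV. \<Sum>j\<in>UNIV. P j j i i)"
  proof -
    have A: "(\<lambda>n. \<Sum>i\<in>UNIV. \<Sum>j\<in>UNIV. LBINT x. d\<phi> j n x $ i * d\<phi> i n x $ j) \<longlonglongrightarrow> (\<Sum>i\<in>UNIV. \<Sum>j\<in>UNIV. P j i i j)"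
      unfolding P_def by (intro double_sum_tendsto sq_int_limit sD sV dl)
    have B: "(\<lambda>n. \<Sum>i\<in>UNIV. \<Sum>j\<in>UNIV. LBINT x. d\<phi> j n x $ j * d\<phi> i n x $ i) \<longlonglongrightarrow> (\<Sum>i\<in>UNIV. \<Sum>j\<in>UNIV. P j j i i)"
      unfolding P_def by (intro double_sum_tendsto sq_int_limit sD sV dl)
    have c: "(LBINT x. d\<phi> j n x $ i * d\<phi> i n x $ j) = (LBINT x. d\<phi> j n x $ j * d\<phi> i n x $ i)" for i j n
      using integral_grad_swap[OF \<phi>[of j n] \<phi>[of i n], of "axis i 1" "axis j 1"] by (simp add: inner_axis)
    have "(\<Sum>i\<in>UNIV. \<Sum>j\<in>UNIV. LBINT x. d\<phi> j n x $ i * d\<phi> i n x $ j)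
      = (\<Sum>i\<in>UNIV. \<Sum>j\<in>UNIV. LBINT x. d\<phi> j n x $ j * d\<phi> i n x $ i)" for n
      by (intro sum.cong refl c)
    then show ?thesis using LIMSEQ_unique[OF A] B by simp
  qed
  have tr2: "(\<Sum>i\<in>UNIV. \<Sum>j\<in>UNIV. P j j i i) = (LBINT x. (\<Sum>k\<in>UNIV. V k x $ k)^2)"
  proof -
    have "(LBINT x. (\<Sum>k\<in>UNIV. V k x $ k)^2) = (LBINT x. (\<Sum>i\<in>UNIV. \<Sum>j\<in>UNIV. V j x $ j * V i x $ i))"
      by (simp add: power2_eq_square sum_product mult.commute)
    then show ?thesis unfolding P_def using iV by (simp add: integral_sum Bochner_Integration.integrable_sum)
  qed
  have SV: "(LBINT x. S i j x * V i x $ j) = \<mu> * P i j i j + \<mu> * P j i i j + (if i = j then (\<eta> - 2/3 * \<mu>) * (\<Sum>k\<in>UNIV. P k k i i) else 0)" for i j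
  proof -
    define c where "c = (if i = j then \<eta> - 2/3 * \<mu> else 0)"
    have "S i j x = \<mu> * (V i x $ j + V j x $ i) + c * (\<Sum>k\<in>UNIV. V k x $ k)" for x
      by (simp add: S c_def)
    then have "S i j x * V i x $ j = \<mu> * (V i x $ j * V i x $ j) + \<mu> * (V j x $ i * V i x $ j) + (\<Sum>k\<in>UNIV. c * (V k x $ k * V i x $ j))" for x
      by (simp add: algebra_simps sum_distrib_left sum_distrib_right)
    then have "(LBINT x. S i j x * V i x $ j) = \<mu> * P i j i j + \<mu> * P j i i j + (\<Sum>k\<in>UNIV. c * P k k i j)"
      unfolding P_def using iV by (simp add: integral_sum Bochner_Integration.integrable_sum)
    then show ?thesis by (simp add: sum_distrib_left c_def)
  qed
  have "(\<Sum>i\<in>UNIV. \<Sum>j\<in>UNIV. LBINT x. S i j x * V i x $ j)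
    = \<mu> * (\<Sum>i\<in>UNIV. \<Sum>j\<in>UNIV. P i j i j) + \<mu> * (\<Sum>i\<in>UNIV. \<Sum>j\<in>UNIV. P j i i j) + (\<eta> - 2/3 * \<mu>) * (\<Sum>i\<in>UNIV. \<Sum>j\<in>UNIV. P j j i i)"
    unfolding SV by (simp add: sum.distrib sum_distrib_left)
  \<comment> \<open>The transposed part of the stress contributes \<mu> times the squared
    divergence, so its total coefficient is \<mu> + \<eta> - 2/3 \<mu> = \<mu>/3 + \<eta>, which is
    nonnegative.\<close>
  then have en: "\<mu> * (\<Sum>i\<in>UNIV. \<Sum>j\<in>UNIV. P i j i j) + (\<mu> + (\<eta> - 2/3 * \<mu>)) * (LBINT x. (\<Sum>k\<in>UNIV. V k x $ k)^2) = 0"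
    unfolding energy transp tr2 by (simp add: algebra_simps)
  have Pn: "0 \<le> P i j i j" for i j unfolding P_def by simp
  have "0 \<le> (\<mu> + (\<eta> - 2/3 * \<mu>)) * (LBINT x. (\<Sum>k\<in>UNIV. V k x $ k)^2)" using \<mu> \<eta> by (intro mult_nonneg_nonneg) auto
  then have "\<mu> * (\<Sum>i\<in>UNIV. \<Sum>j\<in>UNIV. P i j i j) \<le> 0" using en by linarith
  then have "(\<Sum>i\<in>UNIV. \<Sum>j\<in>UNIV. P i j i j) \<le> 0" using \<mu> by (simp add: mult_le_0_iff)
  then have "(\<Sum>i\<in>UNIV. \<Sum>j\<in>UNIV. P i j i j) = 0" using Pn by (intro antisym sum_nonneg) auto
  then have P0: "P i j i j = 0" for i j
    using Pn by (simp add: sum_nonneg_eq_0_iff sum_nonneg)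
  have V0: "AE x in lborel. V i x = 0" for i
  proof -
    have "AE x in lborel. V i x $ j = 0" for j
    proof -
      have "AE x in lborel. V i x $ j * V i x $ j = 0"
        using P0[of i j] unfolding P_def by (subst (asm) integral_nonneg_eq_0_iff_AE[OF iV]) auto
      then show ?thesis by eventually_elim simp
    qed
    then have "AE x in lborel. \<forall>j\<in>UNIV. V i x $ j = 0" by (intro AE_finite_allI) auto
    then show ?thesis by eventually_elim (simp add: vec_eq_iff)
  qed
  \<comment> \<open>With V = 0 the gradients of the approximations tend to 0 in L^2. By the Sobolev
    inequality the approximations tend to 0 in L^6, where they also tend to u. The factor 64 is
    2^6.\<close>
  have "AE x in lborel. u x $ i = 0" for i
  proof -
    have D0: "(\<lambda>n. NNINT x. norm (d\<phi> i n x)^2) \<longlonglongrightarrow> 0"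
    proof -
      have "(NNINT x. norm (d\<phi> i n x - V i x)^2) = (NNINT x. norm (d\<phi> i n x)^2)" for n
        by (rule nn_integral_cong_AE) (use V0[of i] in \<open>eventually_elim, simp\<close>)
      then show ?thesis using \<phi>V2[of i] by simp
    qed
    have "(\<lambda>n. (NNINT x. norm (d\<phi> i n x)^2)^3) \<longlonglongrightarrow> 0"
    proof (rule ennreal_tendsto_0I)
      fix e :: real assume e: "e > 0"
      define e' where "e' = min 1 e"
      have e': "e' > 0" "e'^3 \<le> e"
      proof -
        show "e' > 0" using e by (simp add: e'_def)
        then have "e'^3 \<le> e'" using power_decreasing[of 1 3 e'] by (simp add: e'_def)
        then show "e'^3 \<le> e" by (simp add: e'_def)
      qed
      from ennreal_tendsto_0D[OF D0 e'(1)]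
      show "\<forall>\<^sub>F n in sequentially. (NNINT x. norm (d\<phi> i n x)^2)^3 \<le> ennreal e"
      proof eventually_elim
        case (elim n)
        then have "(NNINT x. norm (d\<phi> i n x)^2)^3 \<le> (ennreal e')^3" by (rule power_mono) simp
        also have "\<dots> \<le> ennreal e" using e' by (simp add: ennreal_power ennreal_leI)
        finally show ?case .
      qed
    qed
    then have "(\<lambda>n. 4096 * (NNINT x. norm (d\<phi> i n x)^2)^3) \<longlonglongrightarrow> 4096 * 0" by (intro ennreal_tendsto_cmult) auto
    then have f0: "(\<lambda>n. NNINT x. \<bar>\<phi> i n x\<bar>^6) \<longlonglongrightarrow> 0"
      by (intro ennreal_squeeze_0[OF Sobolev_6_2[OF \<phi>]]) simp
    have "(\<lambda>n. 64 * ((NNINT x. \<bar>\<phi> i n x\<bar>^6) + (NNINT x. \<bar>\<phi> i n x - u x $ i\<bar>^6))) \<longlonglongrightarrow> 64 * (0 + 0)"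
      by (intro ennreal_tendsto_cmult tendsto_add f0 \<phi>6) auto
    then have l64: "(\<lambda>n. 64 * ((NNINT x. \<bar>\<phi> i n x\<bar>^6) + (NNINT x. \<bar>\<phi> i n x - u x $ i\<bar>^6))) \<longlonglongrightarrow> 0" by simp
    have "(\<lambda>n::nat. NNINT x. \<bar>u x $ i\<bar>^6) \<longlonglongrightarrow> 0"
    proof (rule ennreal_squeeze_0[OF _ l64])
      fix n
      have "(NNINT x. \<bar>u x $ i\<bar>^6) \<le> (\<integral>\<^sup>+x. 64 * (ennreal (\<bar>\<phi> i n x\<bar>^6) + ennreal (\<bar>\<phi> i n x - u x $ i\<bar>^6)) \<partial>lborel)"
      proof (rule nn_integral_mono)
        fix x
        define b c where "b = \<bar>\<phi> i n x\<bar>" and "c = \<bar>\<phi> i n x - u x $ i\<bar>"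
        have "\<bar>u x $ i\<bar> \<le> b + c" unfolding b_def c_def by linarith
        then have "\<bar>u x $ i\<bar> \<le> 2 * max b c" by linarith
        then have "\<bar>u x $ i\<bar>^6 \<le> (2 * max b c)^6" by (rule power_mono) simp
        also have "\<dots> = 64 * (max b c)^6" by (simp add: power_mult_distrib)
        also have "\<dots> \<le> 64 * (b^6 + c^6)" by (auto simp: max_def b_def c_def)
        finally show "ennreal (\<bar>u x $ i\<bar>^6) \<le> 64 * (ennreal (\<bar>\<phi> i n x\<bar>^6) + ennreal (\<bar>\<phi> i n x - u x $ i\<bar>^6))"
          unfolding b_def c_def using ennreal_leI[of "\<bar>u x $ i\<bar>^6" "64 * (\<bar>\<phi> i n x\<bar>^6 + \<bar>\<phi> i n x - u x $ i\<bar>^6)"] by (simp add: ennreal_mult)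
      qed
      also have "\<dots> = 64 * ((NNINT x. \<bar>\<phi> i n x\<bar>^6) + (NNINT x. \<bar>\<phi> i n x - u x $ i\<bar>^6))"
        by (simp add: nn_integral_cmult nn_integral_add)
      finally show "(NNINT x. \<bar>u x $ i\<bar>^6) \<le> 64 * ((NNINT x. \<bar>\<phi> i n x\<bar>^6) + (NNINT x. \<bar>\<phi> i n x - u x $ i\<bar>^6))" .
    qed
    then have "(NNINT x. \<bar>u x $ i\<bar>^6) = 0" by (simp add: LIMSEQ_const_iff)
    then have "AE x in lborel. ennreal (\<bar>u x $ i\<bar>^6) = 0" by (subst (asm) nn_integral_0_iff_AE) auto
    then show ?thesis by eventually_elim simp
  qed
  then have "AE x in lborel. \<forall>i\<in>UNIV. u x $ i = 0" by (intro AE_finite_allI) auto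
  then show ?thesis by eventually_elim (simp add: vec_eq_iff)
qed

section \<open>Passage between the weak formulation and Borel representatives\<close>

text \<open>Lebesgue measure is complete, so preimages that differ by a null set are measurable
  together.\<close>

lemma lebesgue_measurable_AE:
  assumes g: "g \<in> borel_measurable borel" and fg: "AE x in lebesgue. f x = g x"
  shows "f \<in> borel_measurable lebesgue"
proof (rule measurableI)
  fix A :: "'b set" assume A: "A \<in> sets borel"
  have "g \<in> borel_measurable lebesgue" using g by (simp add: measurable_completion)
  then have gA: "g -` A \<inter> space lebesgue \<in> sets lebesgue" using A by (rule measurable_sets)
  show "f -` A \<inter> space lebesgue \<in> sets lebesgue"
    by (rule completion.in_sets_AE[OF _ gA]) (use fg in \<open>auto elim: eventually_mono\<close>)
qed simp

text \<open>The transfer rule for the integrals of the weak formulation, whose integrands contain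
  the functions only up to null sets.\<close>

lemma lebesgue_integral_eq_lborel:
  fixes f g :: "'a::euclidean_space \<Rightarrow> real"
  assumes g: "g \<in> borel_measurable borel" and fg: "AE x in lebesgue. f x = g x"
  shows "(\<integral>x. f x \<partial>lebesgue) = (LBINT x. g x)"
proof -
  have "(\<integral>x. f x \<partial>lebesgue) = (\<integral>x. g x \<partial>lebesgue)"
    by (intro integral_cong_AE lebesgue_measurable_AE[OF g fg] fg) (use g in \<open>simp add: measurable_completion\<close>)
  then show ?thesis using g by (simp add: integral_completion)
qed

lemma inner_matrix: "A \<bullet> B = (\<Sum>i\<in>UNIV. \<Sum>j\<in>UNIV. A $ i $ j * B $ i $ j)" for A B :: "real^3^3"
  by (simp add: inner_vec_def)

lemma stress_component:
  "stress \<mu> \<eta> A $ i $ j = \<mu> * (A $ i $ j + A $ j $ i) + (if i = j then (\<eta> - 2/3 * \<mu>) * trace A else 0)"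
  by (simp add: stress_def transpose_def mat_def algebra_simps)

text \<open>Assembles three scalar functions into one test field of the momentum equation; the rows
  of its Jacobian are their gradients. The sum of the absolute values of the three radii bounds the
  support.\<close>

lemma vector_C1c:
  fixes \<Xi> :: "3 \<Rightarrow> real^3 \<Rightarrow> real"
  assumes C: "\<And>i. C1c (\<Xi> i) (D i)"
  defines "\<xi> \<equiv> \<lambda>x. \<chi> i. \<Xi> i x"
  shows "\<xi> \<in> Cc 1" "jacobian \<xi> (at x) $ i $ j = D i x $ j"
proof -
  have d: "(\<xi> has_derivative (\<lambda>h. \<chi> i. D i x \<bullet> h)) (at x)" for x
    unfolding has_derivative_componentwise_within[of \<xi>]
  proof
    fix b :: "real^3" assume "b \<in> Basis"
    then obtain k where b: "b = axis k 1" by (auto simp: Basis_vec_def)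
    show "((\<lambda>x. \<xi> x \<bullet> b) has_derivative (\<lambda>h. (\<chi> i. D i x \<bullet> h) \<bullet> b)) (at x)"
      using C1D(1)[OF C1c_C1[OF C[of k]], of x] by (simp add: b inner_axis \<xi>_def)
  qed
  have "Ck_fun (Suc 0) \<xi>"
    by (rule Ck_SucI[OF d]) (use C1D(2)[OF C1c_C1[OF C]] in \<open>auto intro!: continuous_intros continuous_on_vec_lambda\<close>)
  moreover have "bsupp \<xi>"
  proof -
    have "\<exists>R. \<forall>x. norm x > R \<longrightarrow> \<Xi> i x = 0" for i using bsupp_C1c(1)[OF C[of i]] by (simp add: bsupp_def)
    then obtain R where R: "\<And>i x. norm x > R i \<Longrightarrow> \<Xi> i x = 0" by metis
    have "R i \<le> (\<Sum>i\<in>UNIV. \<bar>R i\<bar>)" for i using member_le_sum[of i UNIV "\<lambda>i. \<bar>R i\<bar>"] by simp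
    then have "\<xi> x = 0" if "norm x > (\<Sum>i\<in>UNIV. \<bar>R i\<bar>)" for x
      unfolding \<xi>_def vec_eq_iff using that by (auto intro!: R intro: le_less_trans)
    then show ?thesis unfolding bsupp_def by blast
  qed
  ultimately show "\<xi> \<in> Cc 1" by (simp add: Cc_def compactly_supported_iff)
  have "frechet_derivative \<xi> (at x) = (\<lambda>h. \<chi> i. D i x \<bullet> h)" using frechet_derivative_at[OF d] by simp
  then show "jacobian \<xi> (at x) $ i $ j = D i x $ j" by (simp add: jacobian_def matrix_def inner_axis)
qed

theorem theorem6:
  fixes \<mu> \<eta> \<gamma> :: real
    and G \<rho> :: "real^3 \<Rightarrow> real"
    and u :: "real^3 \<Rightarrow> real^3"
  assumes "\<mu> > 0" and "\<eta> \<ge> 0" and "\<gamma> \<ge> 6"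
    and "G \<in> D0 (6 * \<gamma> / (5 * \<gamma> - 6))"
    and "weak_solution \<mu> \<eta> (\<lambda>s. s powr \<gamma>) G \<rho> u"
    and "(\<integral>\<^sup>+x. ennreal (1 / 2 * \<rho> x * (norm (u x))\<^sup>2 + 1 / (\<gamma> - 1) * \<rho> x powr \<gamma>) \<partial>lebesgue) < \<infinity>"
  shows "AE x in lebesgue. u x = 0"
proof -
  note \<mu> = assms(1) and \<eta> = assms(2) and \<gamma> = assms(3)
  define q where "q = 6 * \<gamma> / (5 * \<gamma> - 6)"
  have q1: "q \<ge> 1" using \<gamma> by (simp add: q_def field_simps)
  have \<rho>m: "\<rho> \<in> borel_measurable lebesgue" and \<rho>0: "AE x in lebesgue. 0 \<le> \<rho> x"
    and \<rho>u: "(\<lambda>x. \<rho> x *\<^sub>R u x) \<in> L1_loc"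
    and div: "\<And>\<phi>. \<phi> \<in> Cc_inf \<Longrightarrow> (\<integral>x. (\<rho> x *\<^sub>R u x) \<bullet> grad \<phi> x \<partial>lebesgue) = 0"
    and uD: "u \<in> D0_vec 2"
    and mom: "\<And>\<phi>. \<phi> \<in> Cc 1 \<Longrightarrow> (\<integral>x. (\<rho> x *\<^sub>R tensor (u x) (u x)) \<bullet> jacobian \<phi> (at x) + \<rho> x powr \<gamma> * divg \<phi> x \<partial>lebesgue)
        = (\<integral>x. stress \<mu> \<eta> (weak_jacobian u x) \<bullet> jacobian \<phi> (at x) \<partial>lebesgue)
          - (\<integral>x. (\<rho> x *\<^sub>R weak_grad G x) \<bullet> \<phi> x \<partial>lebesgue)"
    using assms(5) unfolding weak_solution_def by blast+
  \<comment> \<open>Names the data of \<open>D0_gradient\<close> as one predicate, so that they can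
    be chosen simultaneously for the three components of u.\<close>
  define P where "P v q' \<phi> V v' \<longleftrightarrow> (\<forall>n. \<phi> n \<in> Cc_inf) \<and> locint V \<and> locint v' \<and> (AE x in lebesgue. v x = v' x) \<and> (AE x in lebesgue. weak_grad v x = V x) \<and>
    (\<lambda>n. NNINT x. norm (grad (\<phi> n) x - V x) powr q') \<longlonglongrightarrow> 0 \<and>
    (\<forall>R. (\<lambda>n. NNINT x. indicator (cball 0 R) x * \<bar>\<phi> n x - v' x\<bar>) \<longlonglongrightarrow> 0)"
    for v v' :: "real^3 \<Rightarrow> real" and q' and \<phi> :: "nat \<Rightarrow> real^3 \<Rightarrow> real" and V
  have P: "\<exists>\<phi> V v'. P v q' \<phi> V v'" if v: "v \<in> D0 q'" "q' \<ge> 1" for v q'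
  proof (rule D0_gradient[OF v])
    fix \<phi> V v'
    assume "\<And>n. \<phi> n \<in> Cc_inf" "locint V" "locint v'" "AE x in lebesgue. v x = v' x" "AE x in lebesgue. weak_grad v x = V x"
      "(\<lambda>n. NNINT x. norm (grad (\<phi> n) x - V x) powr q') \<longlonglongrightarrow> 0"
      "\<And>R. (\<lambda>n. NNINT x. indicator (cball 0 R) x * \<bar>\<phi> n x - v' x\<bar>) \<longlonglongrightarrow> 0"
    then have "P v q' \<phi> V v'" unfolding P_def by simp
    then show ?thesis by (intro exI)
  qed
  have "\<exists>\<phi> V v'. P (\<lambda>x. u x $ i) 2 \<phi> V v'" for i
    using P[of "\<lambda>x. u x $ i" 2] uD by (simp add: D0_vec_def)
  then obtain \<phi> V v' where Pi: "\<And>i. P (\<lambda>x. u x $ i) 2 (\<phi> i) (V i) (v' i)" by metis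
  have \<phi>: "\<phi> i n \<in> Cc_inf" and V: "locint (V i)" and v': "locint (v' i)" and uv: "AE x in lebesgue. u x $ i = v' i x"
    and wV: "AE x in lebesgue. weak_grad (\<lambda>x. u x $ i) x = V i x"
    and \<phi>V: "(\<lambda>n. NNINT x. norm (grad (\<phi> i n) x - V i x) powr 2) \<longlonglongrightarrow> 0"
    and \<phi>v: "(\<lambda>n. NNINT x. indicator (cball 0 R) x * \<bar>\<phi> i n x - v' i x\<bar>) \<longlonglongrightarrow> 0" for i n R
    using Pi[of i] unfolding P_def by simp_all
  obtain \<psi> H g' where PG: "P G q \<psi> H g'" using P[OF assms(4)[folded q_def] q1] by metis
  have \<psi>: "\<psi> n \<in> Cc_inf" and H: "locint H" and wH: "AE x in lebesgue. weak_grad G x = H x"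
    and \<psi>H: "(\<lambda>n. NNINT x. norm (grad (\<psi> n) x - H x) powr q) \<longlonglongrightarrow> 0" for n
    using PG unfolding P_def by simp_all
  obtain r where r[measurable]: "r \<in> borel_measurable borel" and \<rho>r: "AE x in lebesgue. \<rho> x = r x"
    using \<rho>m by (rule lebesgue_ex_borel) (rule that)
  \<comment> \<open>The representative r is nonnegative only almost everywhere. Truncation makes it
    nonnegative at every point, as \<open>velocity_zero\<close> assumes.\<close>
  define \<rho>1 where "\<rho>1 x = max 0 (r x)" for x
  define u1 where "u1 x = (\<chi> i. v' i x)" for x
  have [measurable]: "\<rho>1 \<in> borel_measurable borel" unfolding \<rho>1_def by measurable
  have [measurable]: "V i \<in> borel_measurable borel" "v' i \<in> borel_measurable borel" "H \<in> borel_measurable borel" for i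
    using V v' H by (auto intro: locint_measurable)
  have u1i: "u1 x $ i = v' i x" for x i by (simp add: u1_def)
  have [measurable]: "u1 \<in> borel_measurable borel"
  proof (rule borel_measurable_euclidean_space[THEN iffD2, rule_format])
    fix b :: "real^3" assume "b \<in> Basis"
    then obtain k where "b = axis k 1" by (auto simp: Basis_vec_def)
    then show "(\<lambda>x. u1 x \<bullet> b) \<in> borel_measurable borel" by (simp add: inner_axis u1i)
  qed
  have \<rho>1: "0 \<le> \<rho>1 x" for x by (simp add: \<rho>1_def)
  have e: "AE x in lebesgue. \<rho> x = \<rho>1 x \<and> u x = u1 x \<and> (\<forall>i. weak_grad (\<lambda>x. u x $ i) x = V i x) \<and> weak_grad G x = H x"
  proof -
    have "AE x in lebesgue. \<forall>i\<in>UNIV. u x $ i = v' i x" "AE x in lebesgue. \<forall>i\<in>UNIV. weak_grad (\<lambda>x. u x $ i) x = V i x"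
      by (intro AE_finite_allI uv wV; simp)+
    then show ?thesis using \<rho>r \<rho>0 wH
      by eventually_elim (simp add: \<rho>1_def vec_eq_iff u1i)
  qed
  have lu: "locint u1"
    unfolding locint_def
  proof (intro conjI allI)
    fix R
    have "integrable lborel (\<lambda>x. \<Sum>i\<in>UNIV. (indicator (cball 0 R) x *\<^sub>R v' i x) *\<^sub>R (axis i 1 :: real^3))"
      by (intro Bochner_Integration.integrable_sum integrable_scaleR_left locint_truncate[OF v'])
    moreover have "indicat_real (cball 0 R) x *\<^sub>R u1 x = (\<Sum>i\<in>UNIV. (indicator (cball 0 R) x *\<^sub>R v' i x) *\<^sub>R (axis i 1 :: real^3))" for x
      using basis_expansion[of "indicat_real (cball 0 R) x *\<^sub>R u1 x"] by (simp add: scalar_mult_eq_scaleR u1i)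
    ultimately show "integrable lborel (\<lambda>x. indicat_real (cball 0 R) x *\<^sub>R u1 x)" by simp
  qed measurable
  have l\<rho>u: "locint (\<lambda>x. \<rho>1 x *\<^sub>R u1 x)"
    by (rule L1_loc_locint[OF \<rho>u]) (measurable, use e in \<open>eventually_elim, simp\<close>)
  have E: "(NNINT x. 1 / 2 * \<rho>1 x * (norm (u1 x))\<^sup>2 + 1 / (\<gamma> - 1) * \<rho>1 x powr \<gamma>) < \<infinity>"
  proof -
    have "(\<integral>\<^sup>+x. ennreal (1 / 2 * \<rho>1 x * (norm (u1 x))\<^sup>2 + 1 / (\<gamma> - 1) * \<rho>1 x powr \<gamma>) \<partial>lebesgue)
      = (\<integral>\<^sup>+x. ennreal (1 / 2 * \<rho> x * (norm (u x))\<^sup>2 + 1 / (\<gamma> - 1) * \<rho> x powr \<gamma>) \<partial>lebesgue)"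
      by (rule nn_integral_cong_AE) (use e in \<open>eventually_elim, simp\<close>)
    then show ?thesis using assms(6) by (simp add: nn_integral_completion)
  qed
  \<comment> \<open>Both summands of the energy density are nonnegative, so each is at most the
    density, and multiplying by \<gamma> - 1 or by 2 removes its coefficient.\<close>
  have E1: "(NNINT x. \<rho>1 x powr \<gamma>) < \<infinity>"
  proof -
    have "(NNINT x. \<rho>1 x powr \<gamma>) \<le> (\<integral>\<^sup>+x. ennreal (\<gamma> - 1) * ennreal (1 / 2 * \<rho>1 x * (norm (u1 x))\<^sup>2 + 1 / (\<gamma> - 1) * \<rho>1 x powr \<gamma>) \<partial>lborel)"
    proof (rule nn_integral_mono)
      fix x
      have "0 \<le> (\<gamma> - 1) * (1 / 2 * \<rho>1 x * (norm (u1 x))\<^sup>2)" using \<gamma> \<rho>1[of x] by simp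
      then have "\<rho>1 x powr \<gamma> \<le> (\<gamma> - 1) * (1 / 2 * \<rho>1 x * (norm (u1 x))\<^sup>2 + 1 / (\<gamma> - 1) * \<rho>1 x powr \<gamma>)" using \<gamma> by (simp add: distrib_left)
      then show "ennreal (\<rho>1 x powr \<gamma>) \<le> ennreal (\<gamma> - 1) * ennreal (1 / 2 * \<rho>1 x * (norm (u1 x))\<^sup>2 + 1 / (\<gamma> - 1) * \<rho>1 x powr \<gamma>)"
        using \<gamma> \<rho>1[of x] by (subst ennreal_mult[symmetric]) (auto intro: ennreal_leI)
    qed
    also have "\<dots> = ennreal (\<gamma> - 1) * (NNINT x. 1 / 2 * \<rho>1 x * (norm (u1 x))\<^sup>2 + 1 / (\<gamma> - 1) * \<rho>1 x powr \<gamma>)"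
      by (rule nn_integral_cmult) measurable
    also have "\<dots> < \<infinity>" using E by (simp add: ennreal_mult_less_top)
    finally show ?thesis .
  qed
  have E2: "(NNINT x. \<rho>1 x * (norm (u1 x))^2) < \<infinity>"
  proof -
    have "(NNINT x. \<rho>1 x * (norm (u1 x))^2) \<le> (\<integral>\<^sup>+x. ennreal 2 * ennreal (1 / 2 * \<rho>1 x * (norm (u1 x))\<^sup>2 + 1 / (\<gamma> - 1) * \<rho>1 x powr \<gamma>) \<partial>lborel)"
    proof (rule nn_integral_mono)
      fix x
      have "0 \<le> 1 / (\<gamma> - 1) * \<rho>1 x powr \<gamma>" using \<gamma> by simp
      then have "\<rho>1 x * (norm (u1 x))^2 \<le> 2 * (1 / 2 * \<rho>1 x * (norm (u1 x))\<^sup>2 + 1 / (\<gamma> - 1) * \<rho>1 x powr \<gamma>)" unfolding distrib_left by simp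
      then show "ennreal (\<rho>1 x * (norm (u1 x))^2) \<le> ennreal 2 * ennreal (1 / 2 * \<rho>1 x * (norm (u1 x))\<^sup>2 + 1 / (\<gamma> - 1) * \<rho>1 x powr \<gamma>)"
        using \<gamma> \<rho>1[of x] by (subst ennreal_mult[symmetric]) (auto intro: ennreal_leI)
    qed
    also have "\<dots> = ennreal 2 * (NNINT x. 1 / 2 * \<rho>1 x * (norm (u1 x))\<^sup>2 + 1 / (\<gamma> - 1) * \<rho>1 x powr \<gamma>)"
      by (rule nn_integral_cmult) measurable
    also have "\<dots> < \<infinity>" using E by (simp add: ennreal_mult_less_top)
    finally show ?thesis .
  qed
  define S where "S i j x = \<mu> * (V i x $ j + V j x $ i) + (if i = j then (\<eta> - 2/3 * \<mu>) * (\<Sum>k\<in>UNIV. V k x $ k) else 0)" for i j x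
  have Sm[measurable]: "S i j \<in> borel_measurable borel" for i j unfolding S_def by measurable
  \<comment> \<open>It remains to rewrite the continuity and momentum equations for the
    representatives, with contractions of matrices written as double sums over components.\<close>
  have "AE x in lborel. u1 x = 0"
  proof (rule velocity_zero[OF \<mu> \<eta> \<gamma> q_def _ \<rho>1 lu l\<rho>u V _ E1 E2 Cc_inf_C1c[OF \<phi>] \<phi>V _ Cc_inf_C1c[OF \<psi>] \<psi>H _ S_def])
    show "(\<lambda>n. NNINT x. indicator (cball 0 R) x * \<bar>\<phi> i n x - u1 x $ i\<bar>) \<longlonglongrightarrow> 0" for i R
      using \<phi>v by (simp add: u1i)
    show "(LBINT x. (\<rho>1 x *\<^sub>R u1 x) \<bullet> grad \<xi> x) = 0" if \<xi>: "\<xi> \<in> Cc_inf" for \<xi>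
    proof -
      have [measurable]: "grad \<xi> \<in> borel_measurable borel"
        by (rule borel_measurable_continuous_onI[OF C1D(2)[OF C1c_C1[OF Cc_inf_C1c[OF \<xi>]]]])
      have "(\<integral>x. (\<rho> x *\<^sub>R u x) \<bullet> grad \<xi> x \<partial>lebesgue) = (LBINT x. (\<rho>1 x *\<^sub>R u1 x) \<bullet> grad \<xi> x)"
        by (rule lebesgue_integral_eq_lborel, measurable) (use e in \<open>eventually_elim, simp\<close>)
      then show ?thesis using div[OF \<xi>] by simp
    qed
    fix \<Xi> :: "3 \<Rightarrow> real^3 \<Rightarrow> real" and D :: "3 \<Rightarrow> real^3 \<Rightarrow> real^3"
    assume C: "\<And>i. C1c (\<Xi> i) (D i)"
    define \<xi> where "\<xi> = (\<lambda>x. \<chi> i. \<Xi> i x)"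
    have j: "jacobian \<xi> (at x) $ i $ k = D i x $ k" for x i k unfolding \<xi>_def by (rule vector_C1c(2)[OF C])
    have [measurable]: "D i \<in> borel_measurable borel" "\<Xi> i \<in> borel_measurable borel" for i
      using C1D(2,3)[OF C1c_C1[OF C]] by (auto intro: borel_measurable_continuous_onI)
    have Dm: "(\<lambda>x. D i x $ k) \<in> borel_measurable borel" for i k by measurable
    have "(\<integral>x. (\<rho> x *\<^sub>R tensor (u x) (u x)) \<bullet> jacobian \<xi> (at x) + \<rho> x powr \<gamma> * divg \<xi> x \<partial>lebesgue)
      = (LBINT x. (\<Sum>i\<in>UNIV. \<Sum>j\<in>UNIV. (\<rho>1 x * u1 x $ i * u1 x $ j) * D i x $ j) + \<rho>1 x powr \<gamma> * (\<Sum>i\<in>UNIV. D i x $ i))"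
      by (rule lebesgue_integral_eq_lborel, measurable)
        (use e in \<open>eventually_elim, simp add: inner_matrix tensor_def divg_def trace_def j mult_ac\<close>)
    moreover have "(\<integral>x. stress \<mu> \<eta> (weak_jacobian u x) \<bullet> jacobian \<xi> (at x) \<partial>lebesgue) = (LBINT x. (\<Sum>i\<in>UNIV. \<Sum>j\<in>UNIV. S i j x * D i x $ j))"
      by (rule lebesgue_integral_eq_lborel, intro borel_measurable_sum borel_measurable_times Sm Dm)
        (use e in \<open>eventually_elim, simp add: inner_matrix stress_component weak_jacobian_def trace_def j S_def cong: if_cong\<close>)
    moreover have "(\<integral>x. (\<rho> x *\<^sub>R weak_grad G x) \<bullet> \<xi> x \<partial>lebesgue) = (LBINT x. (\<Sum>i\<in>UNIV. (\<rho>1 x * H x $ i) * \<Xi> i x))"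
      by (rule lebesgue_integral_eq_lborel, measurable)
        (use e in \<open>eventually_elim, simp add: inner_vec_def \<xi>_def\<close>)
    moreover have "\<xi> \<in> Cc 1" unfolding \<xi>_def by (rule vector_C1c(1)[OF C])
    ultimately show "(LBINT x. (\<Sum>i\<in>UNIV. \<Sum>j\<in>UNIV. (\<rho>1 x * u1 x $ i * u1 x $ j) * D i x $ j) + \<rho>1 x powr \<gamma> * (\<Sum>i\<in>UNIV. D i x $ i))
      = (LBINT x. (\<Sum>i\<in>UNIV. \<Sum>j\<in>UNIV. S i j x * D i x $ j)) - (LBINT x. (\<Sum>i\<in>UNIV. (\<rho>1 x * H x $ i) * \<Xi> i x))"
      using mom[of \<xi>] by simp
  qed measurable
  then have "AE x in lebesgue. u1 x = 0" by (simp add: AE_completion_iff)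
  then show ?thesis using e by eventually_elim simp
qed

end
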